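(* A stratified submanifold (germ at $0$) $N\in(U_9)$ of the symplectic space $(\mathbb R^{2n},\omega_0=\sum_{i=1}^n dp_i\wedge dq_i)$ with canonical coordinates $(p_1,q_1,\dots,p_n,q_n)$ is symplectically equivalent to one and only one of the following curves $B_1\cup B_2$ (branches written in the coordinates $(p_1,q_1,p_2,q_2,\dots)$; omitted coordinates are $0$). The parameters $c,c_1,c_2,c_3$ are moduli. The Lagrangian tangency orders $Lt$ and $L_2$ are as stated. - $(U_9)^0$ ($2n\ge4$): $B_1:(0,0,t,0,0,\dots)$, $B_2:(\pm t^5,t^3,-t^7,c_1t^3-c_2t^5,0,\dots)$. $L_2=5$; $Lt=3$ if $c_1\ne0$, $Lt=5$ if $c_1=0$. - $(U_9)^1$ ($2n\ge4$): $B_1:(t,0,0,c_1t,0,\dots)$, $B_2:(-t^7,\pm t^3,t^5,-c_1t^7+\frac{c_2}{2}t^6\pm\frac{c_3}{3}t^9,0,\dots)$. $Lt=3$, $L_2=7$. - $(U_9)^2$ ($2n\ge4$), $c_1\ne0$: $B_1:(0,\pm t,0,0,0,\dots)$, $B_2:(t^5,\mp t^7,c_1t^8+\frac{c_2}{2}t^{10},t^3,0,\dots)$. $Lt=5$, $L_2=7$. - $(U_9)^{3,0}$ ($2n\ge4$), $c_1\ne0$: $B_1:(0,\pm t,0,0,0,\dots)$, $B_2:(t^5,\mp t^7,\frac{c_1}{2}t^{10}+c_2t^{11},t^3,0,\dots)$. $Lt=5$, $L_2=7$. - $(U_9)^{4,0}$ ($2n\ge4$): $B_1:(0,\pm t,0,0,0,\dots)$,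 $B_2:(t^5,\mp t^7,c_1t^{11}+\frac{c_2}{2}t^{13},t^3,0,\dots)$. $Lt=5$, $L_2=7$. For the remaining classes ($2n\ge6$): $B_1:(0,0,t,0,0,0,\dots)$ and - $(U_9)^{3,1}$: $B_2:(t^5,0,-t^7,0,t^3,-t^8-\frac c2t^{10},0,\dots)$. $Lt=L_2=8$. - $(U_9)^{4,1}$: $B_2:(t^5,0,-t^7,0,t^3,-\frac12t^{10}-c_1t^{11}-c_2t^{14},0,\dots)$. $Lt=L_2=10$. - $(U_9)^5$: $B_2:(t^5,0,-t^7,0,t^3,\mp t^{11}-\frac c2t^{13},0,\dots)$. $Lt=L_2=11$. - $(U_9)^6$: $B_2:(t^5,0,-t^7,0,t^3,\mp\frac12t^{13}-ct^{14},0,\dots)$. $Lt=L_2=13$. - $(U_9)^7$: $B_2:(t^5,0,-t^7,0,t^3,-t^{14}-\frac c2t^{16},0,\dots)$. $Lt=14$, $L_2=\infty$. - $(U_9)^8$: $B_2:(t^5,0,-t^7,0,t^3,-\frac12t^{16},0,\dots)$. $Lt=16$, $L_2=\infty$. - $(U_9)^9$: $B_2:(t^5,0,-t^7,0,t^3,0,0,\dots)$. $Lt=L_2=\infty$.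
   Context: $U_9=\{x\in\mathbb R^{2n}: x_1^2+x_2x_3=x_1x_2+x_3^4=x_{\ge4}=0\}$, $2n\ge4$; $(U_9)$ is the class of germs at $0$ of subsets of the symplectic space $\mathbb R^{2n}$ that are images of $U_9$ under a germ of a diffeomorphism. Such $N$ is a union of a nonsingular branch $B_1$ and a singular branch $B_2$. Two germs are symplectically equivalent if a germ of a symplectomorphism maps one onto the other. Here $c,c_1,c_2,c_3\in\mathbb R$; "one and only one" refers to the listed families (classes). Parameters are moduli in the usual sense of singularity theory: they are independent continuous invariants, i.e. no nonconstant smooth path of parameter values (within one family) consists of mutually equivalent members. Lagrangian tangency orders: if $H_1=\dots=H_n=0$ are regular equations of a smooth Lagrangian submanifold germ $L$, then $t(f,L)$ is the minimum of the orders of vanishing at $0$ of $H_1\circ f,\dots,H_n\circ f$. $Lt=\max_L\min\{t(B_1,L),t(B_2,L)\}$ and $L_2=\max_Lt(B_2,L)$, maxima over all smooth Lagrangian submanifold germs $L$. *)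

theory Defs
  imports "HOL-Analysis.Analysis" "HOL-Library.Extended_Nat"
begin

section \<open>Smooth maps and germs at the origin\<close>

text \<open>Class C-k on an open set, by iterating directional derivatives in fixed directions.\<close>

primrec Ck_on ::
  "nat \<Rightarrow> 'a::real_normed_vector set \<Rightarrow> ('a \<Rightarrow> 'b::real_normed_vector) \<Rightarrow> bool" where
  "Ck_on 0 S = (\<lambda>f. continuous_on S f)"
| "Ck_on (Suc k) S =
     (\<lambda>f. (\<forall>x\<in>S. f differentiable (at x)) \<and>
          (\<forall>v. Ck_on k S (\<lambda>x. frechet_derivative f (at x) v)))"

definition smooth_on ::
  "'a::real_normed_vector set \<Rightarrow> ('a \<Rightarrow> 'b::real_normed_vector) \<Rightarrow> bool" where
  "smooth_on S f \<longleftrightarrow> (\<forall>k. Ck_on k S f)"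

text \<open>A diffeomorphism germ at the origin is represented by a map \<open>g\<close> together with a domain
  \<open>U\<close> on which it is a diffeomorphism onto an open set. Images of set germs are always taken
  of the part inside \<open>U\<close>; their germ at \<open>0\<close> does not change when \<open>U\<close> is shrunk.\<close>

definition diffeo_at0 ::
  "('a::real_normed_vector \<Rightarrow> 'a) \<Rightarrow> 'a set \<Rightarrow> bool" where
  "diffeo_at0 g U \<longleftrightarrow>
     open U \<and> 0 \<in> U \<and> g 0 = 0 \<and> smooth_on U g \<and> inj_on g U \<and>
     open (g ` U) \<and> smooth_on (g ` U) (inv_into U g)"

definition germ_eq :: "'a::real_normed_vector set \<Rightarrow> 'a set \<Rightarrow> bool" where
  "germ_eq M N \<longleftrightarrow> (\<forall>\<^sub>F x in nhds 0. x \<in> M \<longleftrightarrow> x \<in> N)"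


section \<open>Symplectic space\<close>

text \<open>A point of the space of dimension \<open>2n\<close>, where \<open>n = CARD('n)\<close>, is a pair \<open>(p, q)\<close>.\<close>

type_synonym 'n symp = "(real ^ 'n) \<times> (real ^ 'n)"

definition omega0 :: "'n::finite symp \<Rightarrow> 'n symp \<Rightarrow> real" where
  "omega0 u v = (\<Sum>i\<in>UNIV. fst u $ i * snd v $ i - snd u $ i * fst v $ i)"

definition symplectic_on :: "'n::finite symp set \<Rightarrow> ('n symp \<Rightarrow> 'n symp) \<Rightarrow> bool" where
  "symplectic_on U g \<longleftrightarrow>
     (\<forall>x\<in>U. \<forall>u v. omega0 (frechet_derivative g (at x) u) (frechet_derivative g (at x) v)
                   = omega0 u v)"

definition symp_equiv :: "'n::finite symp set \<Rightarrow> 'n symp set \<Rightarrow> bool" where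
  "symp_equiv N M \<longleftrightarrow>
     (\<exists>g U. diffeo_at0 g U \<and> symplectic_on U g \<and> germ_eq M (g ` (N \<inter> U)))"

text \<open>The index type \<open>'n\<close> carries no order, so the numbering of the coordinate pairs is an
  enumeration \<open>e\<close> of \<open>'n\<close> by \<open>1, \<dots>, n\<close>, giving the ordered coordinates
  \<open>(x\<^sub>1, x\<^sub>2, x\<^sub>3, x\<^sub>4, \<dots>) = (p\<^sub>1, q\<^sub>1, p\<^sub>2, q\<^sub>2, \<dots>)\<close>.\<close>

definition coord :: "(nat \<Rightarrow> 'n::finite) \<Rightarrow> nat \<Rightarrow> 'n symp \<Rightarrow> real" where
  "coord e j x = (if odd j then fst x $ e ((j + 1) div 2) else snd x $ e (j div 2))"

text \<open>The point with the listed leading coordinates \<open>p\<^sub>1, q\<^sub>1, p\<^sub>2, q\<^sub>2, \<dots>\<close>;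
  the omitted ones are \<open>0\<close>.\<close>

definition pt :: "(nat \<Rightarrow> 'n::finite) \<Rightarrow> real list \<Rightarrow> 'n symp" where
  "pt e xs =
     (let entry = (\<lambda>j. if j < length xs then xs ! j else 0);
          index = inv_into {1..CARD('n)} e
      in (\<chi> i. entry (2 * index i - 2), \<chi> i. entry (2 * index i - 1)))"

lemma coord_pt:
  fixes e :: "nat \<Rightarrow> 'n::finite"
  assumes e: "bij_betw e {1..CARD('n)} UNIV" and j: "1 \<le> j" "j \<le> 2 * CARD('n)"
  shows "coord e j (pt e xs) = (if j \<le> length xs then xs ! (j - 1) else 0)"
proof -
  have inv: "inv_into {1..CARD('n)} e (e k) = k" if "1 \<le> k" "k \<le> CARD('n)" for k
    using e that by (simp add: bij_betw_def inv_into_f_f)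
  show ?thesis
  proof (cases "odd j")
    case True
    then obtain m where m: "j = 2 * m + 1" by (elim oddE)
    show ?thesis using j inv[of "m + 1"] m by (auto simp: coord_def pt_def Let_def)
  next
    case False
    then obtain m where m: "j = 2 * m" by (auto elim: evenE)
    show ?thesis using j inv[of m] m by (auto simp: coord_def pt_def Let_def)
  qed
qed


section \<open>Lagrangian tangency orders\<close>

text \<open>\<open>lagrangian_equations H\<close>: the \<open>n\<close> components of \<open>H\<close> are regular equations of a Lagrangian
  submanifold germ \<open>L = {H = 0}\<close> through \<open>0\<close>. The tangent space of \<open>L\<close> at \<open>x\<close> is the kernel of the
  differential of \<open>H\<close>, which has dimension \<open>n\<close> by surjectivity, so that isotropic means Lagrangian.
  Every Lagrangian germ arises in this way, and the tangency order below depends only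
  on \<open>L\<close>, so a maximum over all \<open>L\<close> is a maximum over all such \<open>H\<close>.\<close>

definition lagrangian_equations :: "('n::finite symp \<Rightarrow> real ^ 'n) \<Rightarrow> bool" where
  "lagrangian_equations H \<longleftrightarrow>
     (\<exists>U. open U \<and> 0 \<in> U \<and> smooth_on U H \<and> H 0 = 0 \<and>
        (\<forall>x\<in>U. H x = 0 \<longrightarrow>
           surj (frechet_derivative H (at x)) \<and>
           (\<forall>u v. frechet_derivative H (at x) u = 0 \<longrightarrow> frechet_derivative H (at x) v = 0
                  \<longrightarrow> omega0 u v = 0)))"

text \<open>Order of vanishing at \<open>0\<close> of a smooth function germ; it is \<open>\<infinity>\<close> (infimum of the empty set)
  for a flat function.\<close>

definition vanishing_order :: "(real \<Rightarrow> real) \<Rightarrow> enat" where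
  "vanishing_order h = (INF k\<in>{k. (deriv ^^ k) h 0 \<noteq> 0}. enat k)"

definition tangency_order :: "(real \<Rightarrow> 'n::finite symp) \<Rightarrow> ('n symp \<Rightarrow> real ^ 'n) \<Rightarrow> enat" where
  "tangency_order f H = Min (range (\<lambda>i. vanishing_order (\<lambda>t. H (f t) $ i)))"

definition is_maximum :: "enat set \<Rightarrow> enat \<Rightarrow> bool" where
  "is_maximum A m \<longleftrightarrow> m \<in> A \<and> (\<forall>a\<in>A. a \<le> m)"

definition is_Lt :: "(real \<Rightarrow> 'n::finite symp) \<Rightarrow> (real \<Rightarrow> 'n symp) \<Rightarrow> enat \<Rightarrow> bool" where
  "is_Lt f1 f2 m \<longleftrightarrow>
     is_maximum {min (tangency_order f1 H) (tangency_order f2 H) | H. lagrangian_equations H} m"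

definition is_L2 :: "(real \<Rightarrow> 'n::finite symp) \<Rightarrow> enat \<Rightarrow> bool" where
  "is_L2 f2 m \<longleftrightarrow> is_maximum {tangency_order f2 H | H. lagrangian_equations H} m"


section \<open>The class of \<open>U\<^sub>9\<close>\<close>

definition U9 :: "(nat \<Rightarrow> 'n::finite) \<Rightarrow> 'n symp set" where
  "U9 e = {x. (coord e 1 x)\<^sup>2 + coord e 2 x * coord e 3 x = 0 \<and>
              coord e 1 x * coord e 2 x + (coord e 3 x) ^ 4 = 0 \<and>
              (\<forall>j\<in>{4..2 * CARD('n)}. coord e j x = 0)}"

definition in_U9_class :: "(nat \<Rightarrow> 'n::finite) \<Rightarrow> 'n symp set \<Rightarrow> bool" where
  "in_U9_class e N \<longleftrightarrow> (\<exists>g U. diffeo_at0 g U \<and> germ_eq N (g ` (U9 e \<inter> U)))"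

text \<open>\<open>U\<^sub>9\<close> is the union of the \<open>x\<^sub>2\<close>-axis and the curve \<open>(t\<^sup>5, -t\<^sup>7, t\<^sup>3, 0, \<dots>)\<close>:
  if \<open>x\<^sub>1 \<noteq> 0\<close>, eliminating \<open>x\<^sub>2\<close> gives \<open>x\<^sub>1\<^sup>3 = x\<^sub>3\<^sup>5\<close>. The branches \<open>B\<^sub>1, B\<^sub>2\<close> of a germ \<open>N\<close>
  in the class are parametrized by the images of these two parametrizations under
  a diffeomorphism germ taking \<open>U\<^sub>9\<close> to \<open>N\<close>.\<close>

definition branches :: "(nat \<Rightarrow> 'n::finite) \<Rightarrow>
    'n symp set \<Rightarrow> (real \<Rightarrow> 'n symp) \<Rightarrow> (real \<Rightarrow> 'n symp) \<Rightarrow> bool" where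
  "branches e N f1 f2 \<longleftrightarrow>
     (\<exists>g U. diffeo_at0 g U \<and> germ_eq N (g ` (U9 e \<inter> U)) \<and>
        (\<forall>\<^sub>F t in nhds 0. f1 t = g (pt e [0, t, 0])) \<and>
        (\<forall>\<^sub>F t in nhds 0. f2 t = g (pt e [t^5, - (t^7), t^3])))"


section \<open>The normal forms\<close>

datatype U9_family =
  U9_0 | U9_1 | U9_2 | U9_30 | U9_40 | U9_31 | U9_41 | U9_5 | U9_6 | U9_7 | U9_8 | U9_9

text \<open>\<open>families n\<close>: the families present in dimension \<open>2n \<ge> 4\<close>.\<close>

definition families :: "nat \<Rightarrow> U9_family set" where
  "families n = {U9_0, U9_1, U9_2, U9_30, U9_40} \<union>
     (if 2 * n \<ge> 6 then {U9_31, U9_41, U9_5, U9_6, U9_7, U9_8, U9_9} else {})"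

text \<open>Values of the sign \<open>s\<close>: \<open>\<plusminus>\<close> is \<open>s\<close> and \<open>\<mp>\<close> is \<open>-s\<close>, with one common \<open>s\<close> throughout a pair of
  branches. Families without a free sign use \<open>s = 1\<close>.\<close>

fun signs :: "U9_family \<Rightarrow> real set" where
  "signs U9_0 = {1, -1}"
| "signs U9_1 = {1, -1}"
| "signs U9_2 = {1, -1}"
| "signs U9_30 = {1, -1}"
| "signs U9_40 = {1, -1}"
| "signs U9_31 = {1}"
| "signs U9_41 = {1}"
| "signs U9_5 = {1, -1}"
| "signs U9_6 = {1, -1}"
| "signs U9_7 = {1}"
| "signs U9_8 = {1}"
| "signs U9_9 = {1}"

text \<open>Parameter spaces inside the space of triples \<open>(c\<^sub>1, c\<^sub>2, c\<^sub>3)\<close>. A single parameter \<open>c\<close> is stored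
  as \<open>c\<^sub>1\<close>; parameters absent from a family are pinned to \<open>0\<close>, so that a nonconstant path in the
  parameter space is nonconstant in the actual parameters.\<close>

fun params :: "U9_family \<Rightarrow> (real \<times> real \<times> real) set" where
  "params U9_0 = {(c1, c2, c3). c3 = 0}"
| "params U9_1 = UNIV"
| "params U9_2 = {(c1, c2, c3). c1 \<noteq> 0 \<and> c3 = 0}"
| "params U9_30 = {(c1, c2, c3). c1 \<noteq> 0 \<and> c3 = 0}"
| "params U9_40 = {(c1, c2, c3). c3 = 0}"
| "params U9_31 = {(c1, c2, c3). c2 = 0 \<and> c3 = 0}"
| "params U9_41 = {(c1, c2, c3). c3 = 0}"
| "params U9_5 = {(c1, c2, c3). c2 = 0 \<and> c3 = 0}"
| "params U9_6 = {(c1, c2, c3). c2 = 0 \<and> c3 = 0}"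
| "params U9_7 = {(c1, c2, c3). c2 = 0 \<and> c3 = 0}"
| "params U9_8 = {(0, 0, 0)}"
| "params U9_9 = {(0, 0, 0)}"

fun B1 :: "(nat \<Rightarrow> 'n::finite) \<Rightarrow> U9_family \<Rightarrow> real \<Rightarrow> real \<times> real \<times> real \<Rightarrow> real \<Rightarrow> 'n symp" where
  "B1 e U9_0 s (c1, c2, c3) t = pt e [0, 0, t, 0]"
| "B1 e U9_1 s (c1, c2, c3) t = pt e [t, 0, 0, c1 * t]"
| "B1 e U9_2 s (c1, c2, c3) t = pt e [0, s * t, 0, 0]"
| "B1 e U9_30 s (c1, c2, c3) t = pt e [0, s * t, 0, 0]"
| "B1 e U9_40 s (c1, c2, c3) t = pt e [0, s * t, 0, 0]"
| "B1 e U9_31 s (c1, c2, c3) t = pt e [0, 0, t, 0, 0, 0]"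
| "B1 e U9_41 s (c1, c2, c3) t = pt e [0, 0, t, 0, 0, 0]"
| "B1 e U9_5 s (c1, c2, c3) t = pt e [0, 0, t, 0, 0, 0]"
| "B1 e U9_6 s (c1, c2, c3) t = pt e [0, 0, t, 0, 0, 0]"
| "B1 e U9_7 s (c1, c2, c3) t = pt e [0, 0, t, 0, 0, 0]"
| "B1 e U9_8 s (c1, c2, c3) t = pt e [0, 0, t, 0, 0, 0]"
| "B1 e U9_9 s (c1, c2, c3) t = pt e [0, 0, t, 0, 0, 0]"

fun B2 :: "(nat \<Rightarrow> 'n::finite) \<Rightarrow> U9_family \<Rightarrow> real \<Rightarrow> real \<times> real \<times> real \<Rightarrow> real \<Rightarrow> 'n symp" where
  "B2 e U9_0 s (c1, c2, c3) t = pt e [s * t^5, t^3, - (t^7), c1 * t^3 - c2 * t^5]"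
| "B2 e U9_1 s (c1, c2, c3) t =
     pt e [- (t^7), s * t^3, t^5, - c1 * t^7 + c2 / 2 * t^6 + s * (c3 / 3) * t^9]"
| "B2 e U9_2 s (c1, c2, c3) t = pt e [t^5, - s * t^7, c1 * t^8 + c2 / 2 * t^10, t^3]"
| "B2 e U9_30 s (c1, c2, c3) t = pt e [t^5, - s * t^7, c1 / 2 * t^10 + c2 * t^11, t^3]"
| "B2 e U9_40 s (c1, c2, c3) t = pt e [t^5, - s * t^7, c1 * t^11 + c2 / 2 * t^13, t^3]"
| "B2 e U9_31 s (c, c2, c3) t = pt e [t^5, 0, - (t^7), 0, t^3, - (t^8) - c / 2 * t^10]"
| "B2 e U9_41 s (c1, c2, c3) t =
     pt e [t^5, 0, - (t^7), 0, t^3, - (1/2) * t^10 - c1 * t^11 - c2 * t^14]"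
| "B2 e U9_5 s (c, c2, c3) t = pt e [t^5, 0, - (t^7), 0, t^3, - s * t^11 - c / 2 * t^13]"
| "B2 e U9_6 s (c, c2, c3) t = pt e [t^5, 0, - (t^7), 0, t^3, - s * (1/2) * t^13 - c * t^14]"
| "B2 e U9_7 s (c, c2, c3) t = pt e [t^5, 0, - (t^7), 0, t^3, - (t^14) - c / 2 * t^16]"
| "B2 e U9_8 s (c1, c2, c3) t = pt e [t^5, 0, - (t^7), 0, t^3, - (1/2) * t^16]"
| "B2 e U9_9 s (c1, c2, c3) t = pt e [t^5, 0, - (t^7), 0, t^3, 0]"

text \<open>Some coordinate of \<open>B2\<close> is \<open>\<plusminus>t\<^sup>3\<close>, so its points near \<open>0\<close> have parameters near \<open>0\<close>, and the
  full range represents the right germ.\<close>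

definition curve ::
  "(nat \<Rightarrow> 'n::finite) \<Rightarrow> U9_family \<Rightarrow> real \<Rightarrow> real \<times> real \<times> real \<Rightarrow> 'n symp set" where
  "curve e k s c = range (B1 e k s c) \<union> range (B2 e k s c)"

fun Lt_value :: "U9_family \<Rightarrow> real \<times> real \<times> real \<Rightarrow> enat" where
  "Lt_value U9_0 (c1, c2, c3) = (if c1 \<noteq> 0 then 3 else 5)"
| "Lt_value U9_1 c = 3"
| "Lt_value U9_2 c = 5"
| "Lt_value U9_30 c = 5"
| "Lt_value U9_40 c = 5"
| "Lt_value U9_31 c = 8"
| "Lt_value U9_41 c = 10"
| "Lt_value U9_5 c = 11"
| "Lt_value U9_6 c = 13"
| "Lt_value U9_7 c = 14"
| "Lt_value U9_8 c = 16"
| "Lt_value U9_9 c = \<infinity>"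

fun L2_value :: "U9_family \<Rightarrow> enat" where
  "L2_value U9_0 = 5"
| "L2_value U9_1 = 7"
| "L2_value U9_2 = 7"
| "L2_value U9_30 = 7"
| "L2_value U9_40 = 7"
| "L2_value U9_31 = 8"
| "L2_value U9_41 = 10"
| "L2_value U9_5 = 11"
| "L2_value U9_6 = 13"
| "L2_value U9_7 = \<infinity>"
| "L2_value U9_8 = \<infinity>"
| "L2_value U9_9 = \<infinity>"

text \<open>Paths on the open unit interval: restricting a nonconstant smooth path on the closed
  interval to the open one loses nothing, by continuity.\<close>

definition params_are_moduli :: "(nat \<Rightarrow> 'n::finite) \<Rightarrow> U9_family \<Rightarrow> real \<Rightarrow> bool" where
  "params_are_moduli e k s \<longleftrightarrow>
     \<not> (\<exists>\<gamma>. smooth_on {0<..<1} \<gamma> \<and> \<gamma> ` {0<..<1::real} \<subseteq> params k \<and>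
           \<not> \<gamma> constant_on {0<..<1} \<and>
           (\<forall>a\<in>{0<..<1}. \<forall>b\<in>{0<..<1}.
              symp_equiv (curve e k s (\<gamma> a)) (curve e k s (\<gamma> b))))"

end

(* The germ N is the image of U9 under an embedding E of 3-space, and U9 is the union of the cusp (t^5, -t^7, t^3)
   and the line (0, t, 0). By a relative Darboux theorem, N is determined up to symplectomorphisms by the restriction
   to U9 of the pulled-back Liouville form p dq modulo differentials of functions: if two such forms agree, a linear
   symplectic map (Witt) makes the 1-jets of the embeddings equal, and a generating function with prescribed
   first derivatives along U9 gives a symplectomorphism that carries one embedding to the other on U9. No flow is used.

   The quotient of the 1-forms by the forms that are exact on U9 has dimension 9, with one linear coordinate in each
   of the weights 8, 10, 11, 12, 13, 14, 16, 17, 19, where x, y, z have the weights 5, 7, 3. Every symmetry of U9 acts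
   on U9 as (x, y, z) -> (x u^5, y u^7 + m k, z u^3) with k = y^2 - x z^3, so the classification becomes an
   explicit triangular normal form problem for a vector of nine numbers. The normal forms of this problem are the
   curves of the theorem, and the finite group u(0) = 1 or -1 that is left explains why the parameters are moduli.

   Along a Lagrangian submanifold H = 0 the Liouville form is exact up to terms of the size of H. A tangency order K of
   the branches therefore forces the invariants that only involve Taylor coefficients below K to vanish, which bounds
   Lt and L_2 from above; explicit graphs of gradients attain the bounds. *)

theory Submission
  imports Defs "HOL-Computational_Algebra.Formal_Power_Series"
begin

section \<open>Smooth germs\<close>

text \<open>Functions restricted to the cusp have orders in the semigroup generated by 3, 5 and 7,
  whose gaps are 1, 2 and 4. This explains most constants: the cusp parameter can only be multiplied
  by a series u with u_1 = u_2 = u_4 = 0, and the coefficients of t^3, t^5, t^7 read off the first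
  derivatives by z, x, y at the origin. A form is exact along the germ as soon as its coefficients
  of dx, dy, dz have orders 15, 13, 17 on the cusp and 3, 2, 3 on the line, so only finitely many
  Taylor coefficients matter. Exactness along the germ concerns whole covectors at the points of U9,
  not only their tangential parts; this is what allows a primitive to be extended to a generating
  function with prescribed full differential. The germs are smooth, not analytic. Where a power
  series would be sorted by exponents modulo 3 to become a combination of functions of z = t^3,
  Borel's theorem realizes two of the residue classes, and a lemma on smooth functions with a Taylor
  series in t^3 absorbs the flat remainder. The line contributes coefficients of its own only in
  weights 17 and 19, through y^2 dz and y^2 dx.\<close>

abbreviation D :: "('a::real_normed_vector \<Rightarrow> 'b::real_normed_vector) \<Rightarrow> 'a \<Rightarrow> 'a \<Rightarrow> 'b" where
  "D f x \<equiv> frechet_derivative f (at x)"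

lemma D_eq: "(f has_derivative f') (at x) \<Longrightarrow> D f x = f'"
  using frechet_derivative_at by metis

lemma D_works: "f differentiable (at x) \<Longrightarrow> (f has_derivative D f x) (at x)"
  using frechet_derivative_works by blast

text \<open>Congruence is a premise because \<open>Ck_on_cong\<close> is itself proved with this
  rule, by induction on \<open>k\<close>; \<open>Ck_SucI\<close> discharges the premise
  afterwards.\<close>

lemma Ck_on_SucI:
  assumes "open S" "\<And>x. x \<in> S \<Longrightarrow> (f has_derivative f' x) (at x)"
    "\<And>v. Ck_on k S (\<lambda>x. f' x v)"
    and cong: "\<And>f g :: 'a \<Rightarrow> 'b. (\<And>x. x \<in> S \<Longrightarrow> f x = g x) \<Longrightarrow> Ck_on k S f \<Longrightarrow> Ck_on k S g"
  shows "Ck_on (Suc k) S (f :: 'a::real_normed_vector \<Rightarrow> 'b::real_normed_vector)"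
proof -
  have "D f x = f' x" if "x \<in> S" for x using assms(2)[OF that] D_eq by blast
  then have "Ck_on k S (\<lambda>x. D f x v)" for v
    using cong[of "\<lambda>x. f' x v" "\<lambda>x. D f x v"] assms(3) by auto
  then show ?thesis using assms(2) by (auto simp: differentiable_def)
qed

lemma Ck_on_cong:
  assumes "open S" "\<And>x. x \<in> S \<Longrightarrow> f x = g x" "Ck_on k S f"
  shows "Ck_on k S g"
  using assms(2,3)
proof (induction k arbitrary: f g)
  case 0 then show ?case using continuous_on_cong by (metis Ck_on.simps(1))
next
  case (Suc k)
  have d: "(g has_derivative D f x) (at x)" if "x \<in> S" for x
  proof -
    have "f differentiable (at x)" using Suc.prems that by auto
    then have "(f has_derivative D f x) (at x)" by (rule D_works)
    then show ?thesis
      using has_derivative_transform_within_open[OF _ \<open>open S\<close> that] Suc.prems(1) by blast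
  qed
  show ?case
    using Suc.prems by (intro Ck_on_SucI[OF assms(1) d]) (auto intro: Suc.IH)
qed

lemma Ck_SucI:
  assumes "open S" "\<And>x. x \<in> S \<Longrightarrow> (f has_derivative f' x) (at x)"
    "\<And>v. Ck_on k S (\<lambda>x. f' x v)"
  shows "Ck_on (Suc k) S f"
  by (rule Ck_on_SucI[OF assms]) (auto intro: Ck_on_cong[OF assms(1)])

lemma Ck_SucD:
  assumes "Ck_on (Suc k) S f"
  shows "\<And>x. x \<in> S \<Longrightarrow> (f has_derivative D f x) (at x)" "\<And>v. Ck_on k S (\<lambda>x. D f x v)"
  using assms D_works by auto

lemma Ck_on_lower: "Ck_on (Suc k) S f \<Longrightarrow> Ck_on k S f"
proof (induction k arbitrary: f)
  case 0
  then have "f differentiable_on S"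
    unfolding differentiable_on_def by (auto intro: differentiable_at_withinI)
  then show ?case by (simp add: differentiable_imp_continuous_on)
next
  case (Suc k) then show ?case by (metis Ck_on.simps(2))
qed

lemma Ck_on_subset: "Ck_on k S f \<Longrightarrow> T \<subseteq> S \<Longrightarrow> Ck_on k T f"
proof (induction k arbitrary: f)
  case 0 then show ?case by (auto intro: continuous_on_subset)
next
  case (Suc k) then show ?case by (metis Ck_on.simps(2) subsetD)
qed

lemma Ck_on_imp_continuous_on: "Ck_on k S f \<Longrightarrow> continuous_on S f"
  by (induction k) (use Ck_on_lower in auto)

lemma Ck_on_const: "open S \<Longrightarrow> Ck_on k S (\<lambda>x. c)"
proof (induction k arbitrary: c)
  case (Suc k) then show ?case by (intro Ck_SucI[where f'="\<lambda>x v. 0"]) auto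
qed auto

lemma Ck_on_add:
  assumes "open S" shows "Ck_on k S f \<Longrightarrow> Ck_on k S g \<Longrightarrow> Ck_on k S (\<lambda>x. f x + g x)"
proof (induction k arbitrary: f g)
  case 0 then show ?case by (auto intro: continuous_intros)
next
  case (Suc k)
  note f = Ck_SucD[OF Suc.prems(1)] and g = Ck_SucD[OF Suc.prems(2)]
  show ?case
    by (rule Ck_SucI[where f'="\<lambda>x v. D f x v + D g x v"])
       (auto intro!: assms has_derivative_add f g Suc.IH)
qed

lemma Ck_on_sum:
  assumes "open S" shows "(\<And>i. i \<in> I \<Longrightarrow> Ck_on k S (f i)) \<Longrightarrow> Ck_on k S (\<lambda>x. \<Sum>i\<in>I. f i x)"
  by (induction I rule: infinite_finite_induct) (auto intro!: assms Ck_on_const Ck_on_add)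

lemma Ck_on_bounded_linear:
  assumes "open S" "bounded_linear L" shows "Ck_on k S f \<Longrightarrow> Ck_on k S (\<lambda>x. L (f x))"
proof (induction k arbitrary: f)
  case 0 then show ?case using assms by (auto intro: bounded_linear.continuous_on)
next
  case (Suc k)
  note f = Ck_SucD[OF Suc.prems(1)]
  show ?case
    by (rule Ck_SucI[where f'="\<lambda>x v. L (D f x v)"])
       (auto intro!: assms bounded_linear.has_derivative[OF assms(2)] f Suc.IH)
qed

lemma Ck_on_bilinear:
  assumes "open S" "bounded_bilinear B"
  shows "Ck_on k S f \<Longrightarrow> Ck_on k S g \<Longrightarrow> Ck_on k S (\<lambda>x. B (f x) (g x))"
proof (induction k arbitrary: f g)
  case 0 then show ?case using assms(2) by (auto intro: bounded_bilinear.continuous_on)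
next
  case (Suc k)
  note f = Ck_SucD[OF Suc.prems(1)] and g = Ck_SucD[OF Suc.prems(2)]
  show ?case
    by (rule Ck_SucI[where f'="\<lambda>x v. B (f x) (D g x v) + B (D f x v) (g x)"])
       (auto intro!: assms bounded_bilinear.FDERIV[OF assms(2)] f g Suc.IH Ck_on_add
         Ck_on_lower[OF Suc.prems(1)] Ck_on_lower[OF Suc.prems(2)])
qed

lemma Ck_on_id: "open S \<Longrightarrow> Ck_on k S (\<lambda>x. x)"
  by (cases k) (auto intro!: Ck_SucI[where f'="\<lambda>x v. v"] Ck_on_const)

text \<open>\<open>Ck_on\<close> differentiates in fixed directions, whereas the chain rule produces
  \<open>D f (g x)\<close> in the direction \<open>D g x v\<close>, which varies with
  \<open>x\<close>. Expanding that direction in the finite basis of the middle space reduces to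
  fixed ones.\<close>

lemma Ck_on_compose:
  fixes g :: "'a::real_normed_vector \<Rightarrow> 'b::euclidean_space"
  assumes "open S" "open T" "\<And>x. x \<in> S \<Longrightarrow> g x \<in> T"
  shows "Ck_on k T f \<Longrightarrow> Ck_on k S g \<Longrightarrow> Ck_on k S (\<lambda>x. f (g x))"
proof (induction k arbitrary: f)
  case 0 then show ?case using assms(3)
    by (auto intro: continuous_on_compose2)
next
  case (Suc k)
  note f = Ck_SucD[OF Suc.prems(1)] and g = Ck_SucD[OF Suc.prems(2)]
  have "D f (g x) (D g x v) = (\<Sum>b\<in>Basis. (D g x v \<bullet> b) *\<^sub>R D f (g x) b)" if "x \<in> S" for x v
  proof -
    have "linear (D f (g x))" using f(1)[OF assms(3)[OF that]] has_derivative_linear by blast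
    then show ?thesis
      by (subst euclidean_representation[symmetric, of "D g x v"]) (simp add: linear_sum linear_scale del: euclidean_representation)
  qed
  moreover have "Ck_on k S (\<lambda>x. \<Sum>b\<in>Basis. (D g x v \<bullet> b) *\<^sub>R D f (g x) b)" for v
  proof (intro Ck_on_sum[OF assms(1)] Ck_on_bilinear[OF assms(1) bounded_bilinear_scaleR])
    fix b :: 'b assume "b \<in> Basis"
    show "Ck_on k S (\<lambda>x. D g x v \<bullet> b)"
      by (rule Ck_on_bounded_linear[OF assms(1) bounded_linear_inner_left g(2)])
    show "Ck_on k S (\<lambda>x. D f (g x) b)"
      using Suc.IH[OF f(2)] Ck_on_lower[OF Suc.prems(2)] by blast
  qed
  ultimately have "Ck_on k S (\<lambda>x. D f (g x) (D g x v))" for v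
    by (intro Ck_on_cong[OF assms(1) _ \<open>Ck_on k S (\<lambda>x. \<Sum>b\<in>Basis. (D g x v \<bullet> b) *\<^sub>R D f (g x) b)\<close>]) auto
  moreover have "((\<lambda>x. f (g x)) has_derivative (\<lambda>v. D f (g x) (D g x v))) (at x)" if "x \<in> S" for x
    using has_derivative_compose[OF g(1)[OF that] f(1)[OF assms(3)[OF that]]] by simp
  ultimately show ?case by (intro Ck_SucI[OF assms(1)])
qed

lemma smooth_on_D: "smooth_on S f \<Longrightarrow> smooth_on S (\<lambda>x. D f x v)"
  unfolding smooth_on_def by (metis Ck_on.simps(2))

lemma smooth_on_has_derivative: "smooth_on S f \<Longrightarrow> x \<in> S \<Longrightarrow> (f has_derivative D f x) (at x)"
  unfolding smooth_on_def using Ck_SucD(1) by blast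

lemma smooth_on_differentiable: "smooth_on S f \<Longrightarrow> x \<in> S \<Longrightarrow> f differentiable (at x)"
  using smooth_on_has_derivative differentiable_def by blast

lemma smooth_on_continuous_on: "smooth_on S f \<Longrightarrow> continuous_on S f"
  unfolding smooth_on_def using Ck_on_imp_continuous_on by blast

lemma smooth_on_subset: "smooth_on S f \<Longrightarrow> T \<subseteq> S \<Longrightarrow> smooth_on T f"
  unfolding smooth_on_def using Ck_on_subset by blast

lemma smooth_on_cong: "open S \<Longrightarrow> (\<And>x. x \<in> S \<Longrightarrow> f x = g x) \<Longrightarrow> smooth_on S f \<Longrightarrow> smooth_on S g"
  unfolding smooth_on_def using Ck_on_cong by blast

lemma smooth_on_derivI:
  assumes "open S" "\<And>x. x \<in> S \<Longrightarrow> (f has_derivative f' x) (at x)" "\<And>v. smooth_on S (\<lambda>x. f' x v)"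
  shows "smooth_on S f"
proof -
  have "Ck_on (Suc k) S f" for k
    by (rule Ck_SucI[OF assms(1,2)]) (use assms(3) smooth_on_def in auto)
  then show ?thesis unfolding smooth_on_def using Ck_on_lower by blast
qed

lemma smooth_on_const: "open S \<Longrightarrow> smooth_on S (\<lambda>x. c)"
  and smooth_on_id: "open S \<Longrightarrow> smooth_on S (\<lambda>x. x)"
  by (auto simp: smooth_on_def intro: Ck_on_const Ck_on_id)

lemma smooth_on_add: "open S \<Longrightarrow> smooth_on S f \<Longrightarrow> smooth_on S g \<Longrightarrow> smooth_on S (\<lambda>x. f x + g x)"
  by (auto simp: smooth_on_def intro: Ck_on_add)

lemma smooth_on_sum: "open S \<Longrightarrow> (\<And>i. i \<in> I \<Longrightarrow> smooth_on S (f i)) \<Longrightarrow> smooth_on S (\<lambda>x. \<Sum>i\<in>I. f i x)"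
  by (auto simp: smooth_on_def intro: Ck_on_sum)

lemma smooth_on_bounded_linear: "open S \<Longrightarrow> bounded_linear L \<Longrightarrow> smooth_on S f \<Longrightarrow> smooth_on S (\<lambda>x. L (f x))"
  by (auto simp: smooth_on_def intro: Ck_on_bounded_linear)

lemma smooth_on_bilinear:
  "open S \<Longrightarrow> bounded_bilinear B \<Longrightarrow> smooth_on S f \<Longrightarrow> smooth_on S g \<Longrightarrow> smooth_on S (\<lambda>x. B (f x) (g x))"
  by (auto simp: smooth_on_def intro: Ck_on_bilinear)

lemma smooth_on_compose:
  fixes g :: "'a::real_normed_vector \<Rightarrow> 'b::euclidean_space"
  assumes "open S" "open T" "\<And>x. x \<in> S \<Longrightarrow> g x \<in> T" "smooth_on T f" "smooth_on S g"
  shows "smooth_on S (\<lambda>x. f (g x))"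
  using assms unfolding smooth_on_def by (auto intro: Ck_on_compose[OF assms(1-3)])

lemma smooth_on_inverse: "smooth_on (- {0}) (inverse :: real \<Rightarrow> real)"
proof -
  have "Ck_on k (- {0}) (inverse :: real \<Rightarrow> real)" for k
  proof (induction k)
    case 0 then show ?case by (auto intro!: continuous_intros)
  next
    case (Suc k)
    show ?case
    proof (rule Ck_SucI[where f'="\<lambda>x v. - (inverse x * v * inverse x)"])
      show "(inverse has_derivative (\<lambda>v. - (inverse x * v * inverse x))) (at x)"
        if "x \<in> - {0}" for x :: real
        using that by (auto intro!: derivative_eq_intros)
      show "Ck_on k (- {0}) (\<lambda>x::real. - (inverse x * v * inverse x))" for v
        by (intro Ck_on_bounded_linear[OF _ bounded_linear_minus[OF bounded_linear_ident]] Ck_on_bilinear[OF _ bounded_bilinear_mult] Ck_on_const Suc) auto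
    qed auto
  qed
  then show ?thesis by (simp add: smooth_on_def)
qed

section \<open>Germs at the origin and their closure rules\<close>

definition smooth_germ :: "('a::real_normed_vector \<Rightarrow> 'b::real_normed_vector) \<Rightarrow> bool" where
  "smooth_germ f \<longleftrightarrow> (\<exists>U. open U \<and> 0 \<in> U \<and> smooth_on U f)"

lemma smooth_germI: "open U \<Longrightarrow> 0 \<in> U \<Longrightarrow> smooth_on U f \<Longrightarrow> smooth_germ f"
  by (auto simp: smooth_germ_def)

lemma smooth_germ2:
  assumes "smooth_germ f" "smooth_germ g"
  obtains U where "open U" "0 \<in> U" "smooth_on U f" "smooth_on U g"
proof -
  obtain U V where "open U" "0 \<in> U" "smooth_on U f" "open V" "0 \<in> V" "smooth_on V g"
    using assms by (auto simp: smooth_germ_def)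
  then show thesis
    by (intro that[of "U \<inter> V"]) (auto intro: smooth_on_subset)
qed

lemma smooth_germ_cong:
  assumes "\<forall>\<^sub>F x in nhds 0. f x = g x" "smooth_germ f" shows "smooth_germ g"
proof -
  obtain V where V: "open V" "0 \<in> V" "\<And>x. x \<in> V \<Longrightarrow> f x = g x"
    using assms(1) by (auto simp: eventually_nhds)
  obtain U where U: "open U" "0 \<in> U" "smooth_on U f" using assms by (auto simp: smooth_germ_def)
  show ?thesis
    using V U by (intro smooth_germI[of "U \<inter> V"]) (auto intro: smooth_on_cong[of _ f] smooth_on_subset)
qed

named_theorems sg

lemma smooth_germ_const [sg]: "smooth_germ (\<lambda>x. c)"
  by (rule smooth_germI[of UNIV]) (auto intro: smooth_on_const)

lemma smooth_germ_id [sg]: "smooth_germ (\<lambda>x. x)"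
  by (rule smooth_germI[of UNIV]) (auto intro: smooth_on_id)

lemma smooth_germ_linear: "bounded_linear L \<Longrightarrow> smooth_germ f \<Longrightarrow> smooth_germ (\<lambda>x. L (f x))"
  unfolding smooth_germ_def by (auto intro: smooth_on_bounded_linear)

lemma smooth_germ_bilinear:
  assumes "bounded_bilinear B" "smooth_germ f" "smooth_germ g" shows "smooth_germ (\<lambda>x. B (f x) (g x))"
proof -
  obtain U where "open U" "0 \<in> U" "smooth_on U f" "smooth_on U g"
    by (rule smooth_germ2[OF assms(2,3)])
  then show ?thesis using smooth_germI[of U] smooth_on_bilinear[OF _ assms(1)] by blast
qed

lemma smooth_germ_add [sg]: assumes "smooth_germ f" "smooth_germ g" shows "smooth_germ (\<lambda>x. f x + g x)"
proof -
  obtain U where "open U" "0 \<in> U" "smooth_on U f" "smooth_on U g"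
    by (rule smooth_germ2[OF assms])
  then show ?thesis using smooth_germI[of U] smooth_on_add by blast
qed

lemma smooth_germ_uminus [sg]: "smooth_germ f \<Longrightarrow> smooth_germ (\<lambda>x. - f x)"
  by (rule smooth_germ_linear[OF bounded_linear_minus[OF bounded_linear_ident]])

lemma smooth_germ_diff [sg]: "smooth_germ f \<Longrightarrow> smooth_germ g \<Longrightarrow> smooth_germ (\<lambda>x. f x - g x)"
  using smooth_germ_add[OF _ smooth_germ_uminus, of f g] by simp

lemma smooth_germ_mult [sg]: "smooth_germ f \<Longrightarrow> smooth_germ g \<Longrightarrow> smooth_germ (\<lambda>x. f x * g x :: real)"
  by (rule smooth_germ_bilinear[OF bounded_bilinear_mult])

lemma smooth_germ_divide_const [sg]: "smooth_germ f \<Longrightarrow> smooth_germ (\<lambda>x. f x / c :: real)"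
  using smooth_germ_mult[OF _ smooth_germ_const] by (simp add: divide_inverse)

lemma smooth_germ_power [sg]: "smooth_germ f \<Longrightarrow> smooth_germ (\<lambda>x. (f x :: real) ^ n)"
  by (induction n) (auto intro!: sg)

lemma smooth_germ_scaleR [sg]: "smooth_germ f \<Longrightarrow> smooth_germ g \<Longrightarrow> smooth_germ (\<lambda>x. f x *\<^sub>R g x)"
  by (rule smooth_germ_bilinear[OF bounded_bilinear_scaleR])

lemma smooth_germ_inner [sg]: "smooth_germ f \<Longrightarrow> smooth_germ g \<Longrightarrow> smooth_germ (\<lambda>x. f x \<bullet> g x)"
  by (rule smooth_germ_bilinear[OF bounded_bilinear_inner])

lemma smooth_germ_fst [sg]: "smooth_germ f \<Longrightarrow> smooth_germ (\<lambda>x. fst (f x))"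
  and smooth_germ_snd [sg]: "smooth_germ f \<Longrightarrow> smooth_germ (\<lambda>x. snd (f x))"
  by (auto intro!: smooth_germ_linear[OF bounded_linear_fst] smooth_germ_linear[OF bounded_linear_snd])

lemma smooth_germ_Pair [sg]:
  assumes "smooth_germ f" "smooth_germ g" shows "smooth_germ (\<lambda>x. (f x, g x))"
proof -
  have 1: "bounded_linear (\<lambda>x. (x, 0))" "bounded_linear (\<lambda>x. (0, x))"
    by (intro bounded_linear_Pair bounded_linear_zero bounded_linear_ident)+
  have "smooth_germ (\<lambda>x. (f x, 0) + (0, g x))"
    by (intro sg smooth_germ_linear[OF 1(1)] smooth_germ_linear[OF 1(2)] assms)
  then show ?thesis by simp
qed

lemma smooth_germ_sum [sg]: "(\<And>i. i \<in> I \<Longrightarrow> smooth_germ (f i)) \<Longrightarrow> smooth_germ (\<lambda>x. \<Sum>i\<in>I. f i x)"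
  by (induction I rule: infinite_finite_induct) (auto intro!: sg)

lemma smooth_germ_imp_isCont: "smooth_germ f \<Longrightarrow> isCont f 0"
  unfolding smooth_germ_def
  using continuous_on_eq_continuous_at smooth_on_continuous_on by blast

lemma smooth_germ_tendsto: "smooth_germ f \<Longrightarrow> (f \<longlongrightarrow> f 0) (nhds 0)"
  using smooth_germ_imp_isCont
  by (metis isCont_def tendsto_at_iff_tendsto_nhds)

lemma smooth_germ_eventually:
  "smooth_germ f \<Longrightarrow> f 0 = a \<Longrightarrow> \<forall>\<^sub>F x in nhds a. P x \<Longrightarrow> \<forall>\<^sub>F x in nhds 0. P (f x)"
  using smooth_germ_tendsto[of f] unfolding filterlim_iff by blast

lemma smooth_germ_compose_on:
  fixes g :: "'a::real_normed_vector \<Rightarrow> 'b::euclidean_space"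
  assumes "smooth_on T f" "open T" "g 0 \<in> T" "smooth_germ g"
  shows "smooth_germ (\<lambda>x. f (g x))"
proof -
  obtain U where U: "open U" "0 \<in> U" "smooth_on U g" using assms by (auto simp: smooth_germ_def)
  have o: "open (U \<inter> g -` T)"
    by (rule continuous_open_preimage[OF smooth_on_continuous_on[OF U(3)] U(1) assms(2)])
  have "smooth_on (U \<inter> g -` T) (\<lambda>x. f (g x))"
    by (rule smooth_on_compose[OF o assms(2) _ assms(1) smooth_on_subset[OF U(3)]]) auto
  then show ?thesis using smooth_germI[OF o] U assms(3) by auto
qed

lemma smooth_germ_compose:
  fixes g :: "'a::real_normed_vector \<Rightarrow> 'b::euclidean_space"
  assumes "smooth_germ f" "smooth_germ g" "g 0 = 0"
  shows "smooth_germ (\<lambda>x. f (g x))"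
  using assms smooth_germ_compose_on unfolding smooth_germ_def[of f] by metis

lemma smooth_germ_D [sg]: "smooth_germ f \<Longrightarrow> smooth_germ (\<lambda>x. D f x v)"
  unfolding smooth_germ_def using smooth_on_D by blast

lemma smooth_germ_has_derivative: "smooth_germ f \<Longrightarrow> \<forall>\<^sub>F x in nhds 0. (f has_derivative D f x) (at x)"
  unfolding smooth_germ_def eventually_nhds using smooth_on_has_derivative by blast

lemma smooth_germ_has_derivative0: "smooth_germ f \<Longrightarrow> (f has_derivative D f 0) (at 0)"
  by (rule eventually_nhds_x_imp_x[OF smooth_germ_has_derivative])

lemma smooth_germ_linear_D: "smooth_germ f \<Longrightarrow> \<forall>\<^sub>F x in nhds 0. linear (D f x)"
  by (rule eventually_mono[OF smooth_germ_has_derivative]) (auto intro: has_derivative_linear)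

lemma has_derivative_cong_nhds:
  assumes "\<forall>\<^sub>F y in nhds x. f y = g y" "(f has_derivative f') (at x)"
  shows "(g has_derivative f') (at x)"
  using has_derivative_transform_eventually[OF assms(2), of g] assms(1) eventually_nhds_x_imp_x[OF assms(1)]
  by (simp add: eventually_at_filter eventually_mono)

lemma D_cong:
  assumes "\<forall>\<^sub>F y in nhds x. f y = g y"
  shows "D f x = D g x"
proof -
  have "\<forall>\<^sub>F y in nhds x. g y = f y" using assms by (simp add: eq_commute)
  then have "(f has_derivative f') (at x) \<longleftrightarrow> (g has_derivative f') (at x)" for f'
    using has_derivative_cong_nhds assms by blast
  then show ?thesis unfolding frechet_derivative_def by simp
qed

lemma D_cong_germ:
  assumes "\<forall>\<^sub>F y in nhds x. f y = g y"
  shows "\<forall>\<^sub>F y in nhds x. D f y = D g y"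
  using assms by (subst (asm) eventually_eventually[symmetric]) (auto elim!: eventually_mono intro: D_cong)

section \<open>Inverse functions and second derivatives\<close>

text \<open>Near a zero of \<open>f\<close>, the factor \<open>g\<close> multiplies the remainder of
  \<open>f\<close>, and its own increment is multiplied by the small quantity \<open>f' h\<close>;
  so continuity of \<open>g\<close> suffices. This serves to differentiate a family of inverses of
  which only continuity is known so far.\<close>

lemma has_derivative_scaleR_zero:
  fixes f :: "'a::real_normed_vector \<Rightarrow> real" and g :: "'a \<Rightarrow> 'b::real_normed_vector"
  assumes f: "(f has_derivative f') (at y)" "f y = 0" and g: "isCont g y"
  shows "((\<lambda>x. f x *\<^sub>R g x) has_derivative (\<lambda>h. f' h *\<^sub>R g y)) (at y)"
proof -
  have bl: "bounded_linear f'" using f(1) has_derivative_bounded_linear by blast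
  have bl2: "bounded_linear (\<lambda>h. f' h *\<^sub>R g y)"
    by (rule bounded_linear_scaleR_left[THEN bounded_linear_compose, OF bl])
  obtain K where K: "\<And>h. norm (f' h) \<le> norm h * K" using bounded_linear.bounded[OF bl] by blast
  have lim: "((\<lambda>h. norm (f (y + h) - f y - f' h) / norm h) \<longlongrightarrow> 0) (at 0)"
    using f(1) by (simp add: has_derivative_at)
  have limg: "((\<lambda>h. norm (g (y + h) - g y)) \<longlongrightarrow> 0) (at 0)"
    using g unfolding isCont_iff by (simp add: LIM_zero tendsto_norm_zero)
  have "((\<lambda>h. (norm (f (y + h) - f y - f' h) / norm h) * norm (g (y + h)) + K * norm (g (y + h) - g y)) \<longlongrightarrow> 0 * norm (g y) + K * 0) (at 0)"
    using g unfolding isCont_iff by (intro tendsto_intros lim limg)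
  then have lim2: "((\<lambda>h. (norm (f (y + h) - f y - f' h) / norm h) * norm (g (y + h)) + K * norm (g (y + h) - g y)) \<longlongrightarrow> 0) (at 0)"
    by simp
  have "((\<lambda>h. norm (f (y + h) *\<^sub>R g (y + h) - f y *\<^sub>R g y - f' h *\<^sub>R g y) / norm h) \<longlongrightarrow> 0) (at 0)"
  proof (rule tendsto_sandwich[OF _ _ tendsto_const lim2])
    show "\<forall>\<^sub>F h in at 0. 0 \<le> norm (f (y + h) *\<^sub>R g (y + h) - f y *\<^sub>R g y - f' h *\<^sub>R g y) / norm h"
      by simp
    have "norm (f (y + h) *\<^sub>R g (y + h) - f y *\<^sub>R g y - f' h *\<^sub>R g y) / norm h
      \<le> (norm (f (y + h) - f y - f' h) / norm h) * norm (g (y + h)) + K * norm (g (y + h) - g y)"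
      if "h \<noteq> 0" for h
    proof -
      have "f (y + h) *\<^sub>R g (y + h) - f y *\<^sub>R g y - f' h *\<^sub>R g y
        = (f (y + h) - f y - f' h) *\<^sub>R g (y + h) + f' h *\<^sub>R (g (y + h) - g y)"
        using f(2) by (simp add: algebra_simps)
      then have "norm (f (y + h) *\<^sub>R g (y + h) - f y *\<^sub>R g y - f' h *\<^sub>R g y)
        \<le> norm (f (y + h) - f y - f' h) * norm (g (y + h)) + norm (f' h) * norm (g (y + h) - g y)"
        by (metis norm_scaleR norm_triangle_ineq real_norm_def)
      also have "\<dots> \<le> norm (f (y + h) - f y - f' h) * norm (g (y + h)) + (norm h * K) * norm (g (y + h) - g y)"
        by (intro add_left_mono mult_right_mono K) auto
      finally show ?thesis using that by (simp add: field_simps)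
    qed
    then show "\<forall>\<^sub>F h in at 0. norm (f (y + h) *\<^sub>R g (y + h) - f y *\<^sub>R g y - f' h *\<^sub>R g y) / norm h
      \<le> (norm (f (y + h) - f y - f' h) / norm h) * norm (g (y + h)) + K * norm (g (y + h) - g y)"
      by (simp add: eventually_at_filter)
  qed
  then show ?thesis using bl2 by (simp add: has_derivative_at)
qed

lemma linear_basis_sum:
  assumes "linear L" shows "L (x::'a::euclidean_space) = (\<Sum>b\<in>Basis. (x \<bullet> b) *\<^sub>R L b)"
proof -
  have "L x = L (\<Sum>b\<in>Basis. (x \<bullet> b) *\<^sub>R b)" by (simp add: euclidean_representation)
  also have "\<dots> = (\<Sum>b\<in>Basis. (x \<bullet> b) *\<^sub>R L b)"
    using assms by (simp add: linear_sum linear_scale del: euclidean_representation)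
  finally show ?thesis .
qed

text \<open>From \<open>W y' v - W y v = - W y' (A y' (W y v) - v)\<close> the uniform bound
  \<open>K\<close> gives continuity first; then the product rule at a zero gives the derivative
  \<open>- W A' W\<close>. It involves only \<open>W\<close> and derivatives of \<open>A\<close>, so
  regularity climbs from \<open>k\<close> to \<open>Suc k\<close>.\<close>

lemma Ck_on_inverse_family:
  fixes A :: "'c::real_normed_vector \<Rightarrow> 'a::euclidean_space \<Rightarrow> 'a"
  assumes V: "open V" and lin: "\<And>y. y \<in> V \<Longrightarrow> linear (A y)" "\<And>y. y \<in> V \<Longrightarrow> linear (W y)"
    and inv: "\<And>y v. y \<in> V \<Longrightarrow> W y (A y v) = v" "\<And>y v. y \<in> V \<Longrightarrow> A y (W y v) = v"
    and K: "\<And>y v. y \<in> V \<Longrightarrow> norm (W y v) \<le> K * norm v"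
  shows "(\<And>w. Ck_on k V (\<lambda>y. A y w)) \<Longrightarrow> Ck_on k V (\<lambda>y. W y v)"
proof (induction k arbitrary: v)
  have diff: "W y' v - W y v = - W y' (A y' (W y v) - v)" if "y \<in> V" "y' \<in> V" for y y' v
    using that by (simp add: linear_diff[OF lin(2)[OF that(2)]] inv)
  case 0
  then have cA: "continuous_on V (\<lambda>y. A y w)" for w by auto
  have "isCont (\<lambda>y. W y v) y" if "y \<in> V" for y
  proof -
    have "((\<lambda>y'. A y' (W y v)) \<longlongrightarrow> A y (W y v)) (at y)"
      using cA[of "W y v"] that V continuous_on_eq_continuous_at isCont_def by blast
    then have "((\<lambda>y'. K * norm (A y' (W y v) - v)) \<longlongrightarrow> K * norm (A y (W y v) - v)) (at y)"
      by (intro tendsto_intros)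
    then have l: "((\<lambda>y'. K * norm (A y' (W y v) - v)) \<longlongrightarrow> 0) (at y)"
      using inv(2)[OF that] by simp
    have "((\<lambda>y'. W y' v - W y v) \<longlongrightarrow> 0) (at y)"
    proof (rule Lim_null_comparison[OF _ l])
      have "\<forall>\<^sub>F y' in at y. y' \<in> V" using V that eventually_at_topological by blast
      then show "\<forall>\<^sub>F y' in at y. norm (W y' v - W y v) \<le> K * norm (A y' (W y v) - v)"
      proof eventually_elim
        case (elim y') then show ?case using diff[OF that elim] K[OF elim] by simp
      qed
    qed
    then show ?thesis by (simp add: isCont_def LIM_zero_iff)
  qed
  then show ?case using continuous_on_eq_continuous_at[OF V] by (metis Ck_on.simps(1))
next
  have diff: "W y' v - W y v = - W y' (A y' (W y v) - v)" if "y \<in> V" "y' \<in> V" for y y' v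
    using that by (simp add: linear_diff[OF lin(2)[OF that(2)]] inv)
  case (Suc k)
  note A = Ck_SucD[OF Suc.prems]
  have W: "Ck_on k V (\<lambda>y. W y v)" for v using Suc.IH Ck_on_lower[OF Suc.prems] by blast
  have cW: "isCont (\<lambda>y. W y v) y" if "y \<in> V" for y v
    using Ck_on_imp_continuous_on[OF W] that V continuous_on_eq_continuous_at by blast
  let ?d = "\<lambda>y h. \<Sum>b\<in>Basis. (D (\<lambda>y. A y b) y h)"
  define A' where "A' y h w = (\<Sum>b\<in>Basis. (w \<bullet> b) *\<^sub>R D (\<lambda>y. A y b) y h)" for y h w
  have A': "((\<lambda>y. A y w) has_derivative (\<lambda>h. A' y h w)) (at y)" if "y \<in> V" for y w
  proof -
    have "((\<lambda>y. \<Sum>b\<in>Basis. (w \<bullet> b) *\<^sub>R A y b) has_derivative (\<lambda>h. A' y h w)) (at y)"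
      unfolding A'_def by (intro has_derivative_sum has_derivative_scaleR_right A(1)[OF that])
    then show ?thesis
      by (rule has_derivative_transform_within_open[OF _ V that])
        (metis linear_basis_sum[OF lin(1)])
  qed
  show ?case
  proof (rule Ck_SucI[OF V, where f'="\<lambda>y h. - (\<Sum>b\<in>Basis. (A' y h (W y v) \<bullet> b) *\<^sub>R W y b)"])
    fix y assume y: "y \<in> V"
    let ?a = "\<lambda>y'. A y' (W y v) - v"
    have "((\<lambda>y'. \<Sum>b\<in>Basis. (?a y' \<bullet> b) *\<^sub>R W y' b) has_derivative
        (\<lambda>h. \<Sum>b\<in>Basis. (A' y h (W y v) \<bullet> b) *\<^sub>R W y b)) (at y)"
    proof (intro has_derivative_sum has_derivative_scaleR_zero cW[OF y])
      fix b
      show "((\<lambda>y'. ?a y' \<bullet> b) has_derivative (\<lambda>h. A' y h (W y v) \<bullet> b)) (at y)"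
        by (auto intro!: derivative_eq_intros A' y)
    qed (simp add: inv(2)[OF y])
    then have "((\<lambda>y'. W y v - (\<Sum>b\<in>Basis. (?a y' \<bullet> b) *\<^sub>R W y' b)) has_derivative
        (\<lambda>h. - (\<Sum>b\<in>Basis. (A' y h (W y v) \<bullet> b) *\<^sub>R W y b))) (at y)"
      by (rule has_derivative_diff[OF has_derivative_const[of "W y v"], simplified])
    then show "((\<lambda>y'. W y' v) has_derivative (\<lambda>h. - (\<Sum>b\<in>Basis. (A' y h (W y v) \<bullet> b) *\<^sub>R W y b))) (at y)"
    proof (rule has_derivative_transform_within_open[OF _ V y])
      fix y' assume y': "y' \<in> V"
      show "W y v - (\<Sum>b\<in>Basis. (?a y' \<bullet> b) *\<^sub>R W y' b) = W y' v"
        using diff[OF y y', of v] linear_basis_sum[OF lin(2)[OF y'], of "?a y'", symmetric]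
        by (simp only: eq_diff_eq diff_eq_eq) simp
    qed
  next
    show "Ck_on k V (\<lambda>y. - (\<Sum>b\<in>Basis. (A' y h (W y v) \<bullet> b) *\<^sub>R W y b))" for h
      unfolding A'_def
      by (intro Ck_on_bounded_linear[OF V bounded_linear_minus[OF bounded_linear_ident]] Ck_on_sum V
         Ck_on_bilinear[OF V bounded_bilinear_scaleR] W
         Ck_on_bounded_linear[OF V bounded_linear_inner_left] A(2))
  qed
qed

lemma smooth_on_continuous_Blinfun:
  fixes f :: "'a::euclidean_space \<Rightarrow> 'b::euclidean_space"
  assumes "smooth_on U f"
  shows "continuous_on U (\<lambda>x. Blinfun (D f x))"
proof (rule continuous_on_blinfun_componentwise)
  fix i :: 'a
  have "continuous_on U (\<lambda>x. D f x i)" using assms smooth_on_D smooth_on_continuous_on by blast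
  moreover have "blinfun_apply (Blinfun (D f x)) i = D f x i" if "x \<in> U" for x
    using has_derivative_bounded_linear[OF smooth_on_has_derivative[OF assms that]]
    by (simp add: bounded_linear_Blinfun_apply)
  ultimately show "continuous_on U (\<lambda>x. blinfun_apply (Blinfun (D f x)) i)"
    by (simp cong: continuous_on_cong)
qed

text \<open>A continuously differentiable local inverse \<open>g\<close> has derivative
  \<open>inv (D f (g y))\<close>. If \<open>g\<close> is of class \<open>k\<close>, so is this
  family of inverse maps by \<open>Ck_on_inverse_family\<close>, and \<open>g\<close> gains one
  order.\<close>

theorem smooth_inverse_function:
  fixes f :: "'a::euclidean_space \<Rightarrow> 'a"
  assumes "smooth_germ f" "f 0 = 0" "inj (D f 0)" "open X" "0 \<in> X"
  obtains U where "diffeo_at0 f U" "U \<subseteq> X"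
proof -
  obtain U0 where U0: "open U0" "0 \<in> U0" "smooth_on U0 f" using assms(1) by (auto simp: smooth_germ_def)
  define f' where "f' x = Blinfun (D f x)" for x
  have bl: "bounded_linear (D f x)" if "x \<in> U0" for x
    using smooth_on_has_derivative[OF U0(3) that] has_derivative_bounded_linear by blast
  then have f': "blinfun_apply (f' x) = D f x" if "x \<in> U0" for x
    using that by (simp add: f'_def bounded_linear_Blinfun_apply)
  have cont: "continuous_on U0 f'" unfolding f'_def by (rule smooth_on_continuous_Blinfun[OF U0(3)])
  obtain B where B: "linear B" "B \<circ> D f 0 = id"
    using linear_injective_left_inverse[of "D f 0"] bl[OF U0(2)] assms(3) bounded_linear.linear by blast
  obtain K where K: "K > 0" "\<And>x. norm (B x) \<le> norm x * K"
    using bounded_linear.pos_bounded[of B] B(1) linear_conv_bounded_linear by blast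
  \<comment> \<open>Here \<open>D f x\<close> differs from \<open>D f 0\<close> by less than half
    the lower bound \<open>1 / K\<close> of \<open>D f 0\<close>. So \<open>D f x\<close> is bounded
    below by \<open>1 / (2 * K)\<close>, which is the uniform bound on the inverses needed
    later.\<close>
  define U1 where "U1 = (U0 \<inter> f' -` ball (f' 0) (1 / (2 * K))) \<inter> X"
  have U1: "open U1" "0 \<in> U1" "U1 \<subseteq> U0" "U1 \<subseteq> X"
    using continuous_open_preimage[OF cont U0(1)] K U0 assms unfolding U1_def by auto
  have low: "norm w \<le> 2 * K * norm (D f x w)" if "x \<in> U1" for x w
  proof -
    have x0: "x \<in> U0" using that U1 by blast
    have "norm (D f 0 w - D f x w) \<le> norm (f' 0 - f' x) * norm w"
      using norm_blinfun[of "f' 0 - f' x" w] f'[OF x0] f'[OF U0(2)] by (simp add: blinfun.diff_left)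
    also have "\<dots> \<le> (1 / (2 * K)) * norm w"
      using that by (intro mult_right_mono) (auto simp: U1_def dist_norm)
    finally have "norm (D f 0 w) \<le> norm (D f x w) + (1 / (2 * K)) * norm w"
      by (smt (verit) norm_triangle_ineq2)
    moreover have "norm w \<le> norm (D f 0 w) * K"
      using K(2)[of "D f 0 w"] B(2) by (metis comp_apply id_apply)
    ultimately have "norm w \<le> (norm (D f x w) + (1 / (2 * K)) * norm w) * K"
      using K(1) by (smt (verit) mult_right_mono)
    then show ?thesis using K(1) by (simp add: field_simps)
  qed
  have inv0: "Blinfun B o\<^sub>L f' 0 = id_blinfun"
    by (rule blinfun_eqI) (use B f'[OF U0(2)] in \<open>simp add: bounded_linear_Blinfun_apply linear_conv_bounded_linear comp_def id_def fun_eq_iff\<close>)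
  obtain U' V g g' where g: "open U'" "U' \<subseteq> U1" "0 \<in> U'" "open V" "f 0 \<in> V" "homeomorphism U' V f g"
     "\<And>y. y \<in> V \<Longrightarrow> (g has_derivative (g' y)) (at y)"
     "\<And>y. y \<in> V \<Longrightarrow> g' y = inv (blinfun_apply (f'(g y)))"
     "\<And>y. y \<in> V \<Longrightarrow> bij (blinfun_apply (f'(g y)))"
  proof (rule inverse_function_theorem[of U1 f f' 0 "Blinfun B"])
    show "(f has_derivative blinfun_apply (f' x)) (at x)" if "x \<in> U1" for x
      using smooth_on_has_derivative[OF U0(3)] f' that U1 by (metis subsetD)
    show "continuous_on U1 f'" using cont U1 continuous_on_subset by blast
  qed (use U1 inv0 that in auto)
  have gU: "g y \<in> U1" "g y \<in> U0" "g y \<in> U'" if "y \<in> V" for y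
    using g(2,6) that U1 unfolding homeomorphism_def by blast+
  have A: "linear (D f (g y))" if "y \<in> V" for y using bl[OF gU(2)[OF that]] bounded_linear.linear by blast
  have W: "linear (g' y)" if "y \<in> V" for y using g(7)[OF that] has_derivative_linear by blast
  have i1: "g' y (D f (g y) v) = v" "D f (g y) (g' y v) = v" if "y \<in> V" for y v
    using g(8,9)[OF that] f'[OF gU(2)[OF that]] by (simp_all add: bij_is_inj bij_is_surj surj_f_inv_f)
  have "Ck_on k V g" for k
  proof (induction k)
    case 0 then show ?case using g(6) by (simp add: homeomorphism_def)
  next
    case (Suc k)
    have "Ck_on k V (\<lambda>y. D f (g y) w)" for w
      using Suc gU(2) smooth_on_D[OF U0(3)] U0(1) g(4)
      by (intro Ck_on_compose[where f="\<lambda>x. D f x w", OF g(4) U0(1)]) (auto simp: smooth_on_def)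
    then have "Ck_on k V (\<lambda>y. g' y v)" for v
      by (intro Ck_on_inverse_family[of V "\<lambda>y. D f (g y)" g' "2 * K"])
        (use g(4) A W i1 low[OF gU(1)] in \<open>auto, metis\<close>)
    then show ?case using Ck_SucI[OF g(4) g(7)] by blast
  qed
  then have sg: "smooth_on V g" by (simp add: smooth_on_def)
  have img: "f ` U' = V" using g(6) by (simp add: homeomorphism_def)
  have inj: "inj_on f U'" using g(6) by (metis homeomorphism_apply1 inj_onI)
  have "inv_into U' f y = g y" if "y \<in> V" for y
    using g(6) that inj by (metis gU(3) homeomorphism_apply2 inv_into_f_eq)
  then have "smooth_on V (inv_into U' f)" using smooth_on_cong[OF g(4) _ sg] by metis
  then have "diffeo_at0 f U'"
    unfolding diffeo_at0_def using g U1 img inj assms(2) smooth_on_subset[OF U0(3)] by auto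
  then show thesis using that g(2) U1 by blast
qed

text \<open>The mean value theorem in direction \<open>u\<close>, applied to the difference
  \<open>\<phi>\<close> of \<open>f\<close> along two parallel segments, leaves two values of
  \<open>D f _ u\<close>; differentiability at the single point \<open>x\<close> replaces their
  difference by \<open>h * L v\<close>. The second difference is symmetric in \<open>u\<close> and
  \<open>v\<close>, so comparing both limits yields the symmetry of second derivatives.\<close>

lemma second_difference_bound:
  fixes f :: "'a::real_normed_vector \<Rightarrow> real"
  assumes U: "open U" "x \<in> U" and f: "\<And>y. y \<in> U \<Longrightarrow> (f has_derivative D f y) (at y)"
    and L: "((\<lambda>y. D f y u) has_derivative L) (at x)" and e: "e > 0"
  shows "\<exists>d>0. \<forall>h. 0 < h \<and> h < d \<longrightarrow>
    \<bar>f (x + h *\<^sub>R u + h *\<^sub>R v) - f (x + h *\<^sub>R u) - f (x + h *\<^sub>R v) + f x - h\<^sup>2 * L v\<bar> \<le> e * h\<^sup>2"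
proof -
  \<comment> \<open>The estimate is used at two points whose distances from \<open>x\<close> add up
    to at most \<open>h * (2 * norm u + norm v)\<close>; the summand 1 keeps \<open>C\<close>
    positive.\<close>
  define C where "C = 2 * norm u + norm v + 1"
  have C: "C > 0" by (simp add: C_def add_nonneg_pos)
  obtain d0 where d0: "d0 > 0" "\<And>y. norm (y - x) < d0 \<Longrightarrow>
      \<bar>D f y u - D f x u - L (y - x)\<bar> \<le> (e / C) * norm (y - x)"
    using L e C unfolding has_derivative_at_alt by (metis divide_pos_pos real_norm_def)
  obtain d1 where d1: "d1 > 0" "ball x d1 \<subseteq> U" using U openE by blast
  have lin: "linear L" using L has_derivative_linear by blast
  define d where "d = min d0 d1 / C"
  have "d > 0" using d0 d1 C by (simp add: d_def)
  moreover have "\<bar>f (x + h *\<^sub>R u + h *\<^sub>R v) - f (x + h *\<^sub>R u) - f (x + h *\<^sub>R v) + f x - h\<^sup>2 * L v\<bar> \<le> e * h\<^sup>2"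
    if h: "0 < h" "h < d" for h
  proof -
    have hC: "h * C < min d0 d1" using h C by (simp add: d_def field_simps)
    have nb: "norm (s *\<^sub>R u + r *\<^sub>R v) \<le> h * (norm u + norm v)" if "0 \<le> s" "s \<le> h" "0 \<le> r" "r \<le> h" for s r
      using that norm_triangle_ineq[of "s *\<^sub>R u" "r *\<^sub>R v"]
        mult_right_mono[of s h "norm u"] mult_right_mono[of r h "norm v"] by (simp add: algebra_simps)
    have nb2: "h * (norm u + norm v) < min d0 d1"
    proof -
      have "h * (norm u + norm v) \<le> h * C" using h(1) by (intro mult_left_mono) (auto simp: C_def)
      then show ?thesis using hC by linarith
    qed
    have inU: "x + (s *\<^sub>R u + r *\<^sub>R v) \<in> U" if "0 \<le> s" "s \<le> h" "0 \<le> r" "r \<le> h" for s r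
      using nb[OF that] nb2 d1(2) norm_minus_cancel[of "s *\<^sub>R u + r *\<^sub>R v"]
      by (intro subsetD[OF d1(2)]) (simp add: dist_norm)
    define \<phi> where "\<phi> s = f (x + (s *\<^sub>R u + h *\<^sub>R v)) - f (x + (s *\<^sub>R u + 0 *\<^sub>R v))" for s
    have der: "((\<lambda>s. f (x + (s *\<^sub>R u + r *\<^sub>R v))) has_real_derivative D f (x + (s *\<^sub>R u + r *\<^sub>R v)) u) (at s)"
      if "0 \<le> s" "s \<le> h" "0 \<le> r" "r \<le> h" for s r
    proof -
      have i: "((\<lambda>s. x + (s *\<^sub>R u + r *\<^sub>R v)) has_derivative (\<lambda>t. t *\<^sub>R u)) (at s)"
        by (auto intro!: derivative_eq_intros)
      have "((\<lambda>s. f (x + (s *\<^sub>R u + r *\<^sub>R v))) has_derivative (\<lambda>t. D f (x + (s *\<^sub>R u + r *\<^sub>R v)) (t *\<^sub>R u))) (at s)"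
        by (rule has_derivative_compose[OF i f[OF inU[OF that]]])
      moreover have "linear (D f (x + (s *\<^sub>R u + r *\<^sub>R v)))" using f[OF inU[OF that]] has_derivative_linear by blast
      ultimately show ?thesis
        by (simp add: has_field_derivative_def linear_scale mult.commute[of _ "D f _ u"] mult_commute_abs)
    qed
    obtain \<xi> where \<xi>: "0 < \<xi>" "\<xi> < h" and mv: "\<phi> h - \<phi> 0 = (h - 0) *
        (D f (x + (\<xi> *\<^sub>R u + h *\<^sub>R v)) u - D f (x + (\<xi> *\<^sub>R u + 0 *\<^sub>R v)) u)"
      using MVT2[of 0 h \<phi> "\<lambda>s. D f (x + (s *\<^sub>R u + h *\<^sub>R v)) u - D f (x + (s *\<^sub>R u + 0 *\<^sub>R v)) u"] h
        DERIV_diff[OF der[of _ h] der[of _ 0]] unfolding \<phi>_def by auto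
    have b1: "\<bar>D f (x + (\<xi> *\<^sub>R u + r *\<^sub>R v)) u - D f x u - L (\<xi> *\<^sub>R u + r *\<^sub>R v)\<bar> \<le> (e / C) * norm (\<xi> *\<^sub>R u + r *\<^sub>R v)"
      if "0 \<le> r" "r \<le> h" for r
      using d0(2)[of "x + (\<xi> *\<^sub>R u + r *\<^sub>R v)"] nb[of \<xi> r] nb2 \<xi> that by auto
    have "norm (\<xi> *\<^sub>R u + h *\<^sub>R v) + norm (\<xi> *\<^sub>R u + 0 *\<^sub>R v) \<le> h * C"
      using nb[of \<xi> h] mult_right_mono[of \<xi> h "norm u"] \<xi> h by (simp add: C_def algebra_simps)
    then have "(e / C) * (norm (\<xi> *\<^sub>R u + h *\<^sub>R v) + norm (\<xi> *\<^sub>R u + 0 *\<^sub>R v)) \<le> (e / C) * (h * C)"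
      using e C by (intro mult_left_mono) auto
    moreover have "(e / C) * (h * C) = e * h" using C by simp
    moreover have "L (\<xi> *\<^sub>R u + h *\<^sub>R v) - L (\<xi> *\<^sub>R u + 0 *\<^sub>R v) = h * L v"
      using lin by (simp add: linear_add linear_scale)
    ultimately have "\<bar>D f (x + (\<xi> *\<^sub>R u + h *\<^sub>R v)) u - D f (x + (\<xi> *\<^sub>R u + 0 *\<^sub>R v)) u - h * L v\<bar> \<le> e * h"
      using b1[of h] b1[of 0] h unfolding ring_distribs by linarith
    then have "h * \<bar>D f (x + (\<xi> *\<^sub>R u + h *\<^sub>R v)) u - D f (x + (\<xi> *\<^sub>R u + 0 *\<^sub>R v)) u - h * L v\<bar> \<le> h * (e * h)"
      using h by (intro mult_left_mono) auto
    moreover have "f (x + h *\<^sub>R u + h *\<^sub>R v) - f (x + h *\<^sub>R u) - f (x + h *\<^sub>R v) + f x - h\<^sup>2 * L v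
      = h * (D f (x + (\<xi> *\<^sub>R u + h *\<^sub>R v)) u - D f (x + (\<xi> *\<^sub>R u + 0 *\<^sub>R v)) u - h * L v)"
      using mv unfolding \<phi>_def by (simp add: algebra_simps power2_eq_square)
    ultimately show ?thesis using h by (simp add: abs_mult power2_eq_square mult_ac)
  qed
  ultimately show ?thesis by blast
qed

lemma symmetric_second_derivative_real:
  fixes f :: "'a::real_normed_vector \<Rightarrow> real"
  assumes U: "open U" "x \<in> U" and f: "smooth_on U f"
  shows "D (\<lambda>y. D f y u) x v = D (\<lambda>y. D f y v) x u"
proof (rule ccontr)
  let ?a = "D (\<lambda>y. D f y u) x v" and ?b = "D (\<lambda>y. D f y v) x u"
  assume "?a \<noteq> ?b"
  define e where "e = \<bar>?a - ?b\<bar> / 4"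
  have e: "e > 0" using \<open>?a \<noteq> ?b\<close> by (simp add: e_def)
  note df = smooth_on_has_derivative[OF f] and d2 = smooth_on_has_derivative[OF smooth_on_D[OF f] U(2)]
  obtain d1 where d1: "d1 > 0" "\<And>h. 0 < h \<Longrightarrow> h < d1 \<Longrightarrow>
    \<bar>f (x + h *\<^sub>R u + h *\<^sub>R v) - f (x + h *\<^sub>R u) - f (x + h *\<^sub>R v) + f x - h\<^sup>2 * ?a\<bar> \<le> e * h\<^sup>2"
    using second_difference_bound[OF U df d2 e, of u v] by blast
  obtain d2 where d2: "d2 > 0" "\<And>h. 0 < h \<Longrightarrow> h < d2 \<Longrightarrow>
    \<bar>f (x + h *\<^sub>R v + h *\<^sub>R u) - f (x + h *\<^sub>R v) - f (x + h *\<^sub>R u) + f x - h\<^sup>2 * ?b\<bar> \<le> e * h\<^sup>2"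
    using second_difference_bound[OF U df d2 e, of v u] by blast
  define h where "h = min d1 d2 / 2"
  have h: "0 < h" "h < d1" "h < d2" using d1(1) d2(1) by (auto simp: h_def min_def)
  have eq: "x + h *\<^sub>R v + h *\<^sub>R u = x + h *\<^sub>R u + h *\<^sub>R v" by (simp add: algebra_simps)
  have "\<bar>h\<^sup>2 * ?a - h\<^sup>2 * ?b\<bar> \<le> 2 * (e * h\<^sup>2)"
    using d1(2)[OF h(1,2)] d2(2)[OF h(1,3)] unfolding eq by linarith
  moreover have "h\<^sup>2 * \<bar>?a - ?b\<bar> = \<bar>h\<^sup>2 * ?a - h\<^sup>2 * ?b\<bar>"
    by (simp add: abs_mult flip: right_diff_distrib)
  ultimately have "h\<^sup>2 * \<bar>?a - ?b\<bar> \<le> h\<^sup>2 * (2 * e)" by (simp add: mult_ac)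
  then have "\<bar>?a - ?b\<bar> \<le> 2 * e" using h(1) by simp
  then show False using e by (simp add: e_def)
qed

lemma symmetric_second_derivative:
  fixes f :: "'a::real_normed_vector \<Rightarrow> 'b::euclidean_space"
  assumes U: "open U" "x \<in> U" and f: "smooth_on U f"
  shows "D (\<lambda>y. D f y u) x v = D (\<lambda>y. D f y v) x u"
proof (rule euclidean_eqI)
  fix b :: 'b assume "b \<in> Basis"
  have sb: "smooth_on U (\<lambda>y. f y \<bullet> b)"
    by (rule smooth_on_bounded_linear[OF U(1) bounded_linear_inner_left f])
  have 1: "D (\<lambda>y. f y \<bullet> b) y w = D f y w \<bullet> b" if "y \<in> U" for y w
    using D_eq[OF has_derivative_inner_left[OF smooth_on_has_derivative[OF f that]], of b] by simp
  have 2: "D (\<lambda>y. D (\<lambda>y. f y \<bullet> b) y w) x z = D (\<lambda>y. D f y w) x z \<bullet> b" for w z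
  proof -
    have "D (\<lambda>y. D (\<lambda>y. f y \<bullet> b) y w) x = D (\<lambda>y. D f y w \<bullet> b) x"
      by (rule D_cong) (use U 1 in \<open>auto simp: eventually_nhds\<close>)
    also have "\<dots> = (\<lambda>z. D (\<lambda>y. D f y w) x z \<bullet> b)"
      using D_eq[OF has_derivative_inner_left[OF smooth_on_has_derivative[OF smooth_on_D[OF f] U(2)]], of w b] by simp
    finally show ?thesis by metis
  qed
  show "D (\<lambda>y. D f y u) x v \<bullet> b = D (\<lambda>y. D f y v) x u \<bullet> b"
    using symmetric_second_derivative_real[OF U sb, of u v] unfolding 2 .
qed

section \<open>Hadamard's lemma and the Poincare lemma\<close>

lemma continuous_on_linear_family:
  assumes "bounded_linear P" "bounded_linear Q"
  shows "continuous_on X (\<lambda>p. P (fst p) + snd p *\<^sub>R Q (fst p) :: 'b::real_normed_vector)"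
  by (intro continuous_on_add continuous_on_scaleR bounded_linear.continuous_on[OF assms(1)]
    bounded_linear.continuous_on[OF assms(2)] continuous_on_fst continuous_on_snd continuous_on_id)

lemma continuous_on_family_product:
  fixes P Q :: "'a::real_normed_vector \<Rightarrow> 'b::real_normed_vector" and f :: "'b \<Rightarrow> 'c::real_normed_vector"
  assumes "bounded_linear P" "bounded_linear Q"
    "\<And>x s. x \<in> X \<Longrightarrow> s \<in> {0..1} \<Longrightarrow> P x + s *\<^sub>R Q x \<in> U"
    "continuous_on {0..1} c" "continuous_on U f"
  shows "continuous_on (X \<times> {0..1}) (\<lambda>p. c (snd p) *\<^sub>R f (P (fst p) + snd p *\<^sub>R Q (fst p)))"
proof (rule continuous_on_scaleR)
  show "continuous_on (X \<times> {0..1}) (\<lambda>p. c (snd p))"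
    by (rule continuous_on_compose2[OF assms(4) continuous_on_snd[OF continuous_on_id]]) auto
  show "continuous_on (X \<times> {0..1}) (\<lambda>p. f (P (fst p) + snd p *\<^sub>R Q (fst p)))"
    by (rule continuous_on_compose2[OF assms(5) continuous_on_linear_family[OF assms(1,2)]]) (use assms(3) in force)
qed

lemma has_derivative_integral_family:
  fixes f :: "'a::euclidean_space \<Rightarrow> 'b::euclidean_space" and P Q :: "'a \<Rightarrow> 'a"
  assumes P: "bounded_linear P" and Q: "bounded_linear Q"
    and dom: "\<And>x s. x \<in> ball 0 \<delta> \<Longrightarrow> s \<in> {0..1} \<Longrightarrow> P x + s *\<^sub>R Q x \<in> U"
    and C1: "Ck_on (Suc 0) U f" and c: "continuous_on {0..1} c" and x0: "x0 \<in> ball 0 \<delta>"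
  shows "((\<lambda>x. integral {0..1} (\<lambda>s. c s *\<^sub>R f (P x + s *\<^sub>R Q x))) has_derivative
     (\<lambda>v. integral {0..1} (\<lambda>s. c s *\<^sub>R D f (P x0 + s *\<^sub>R Q x0) (P v))
     + integral {0..1} (\<lambda>s. (s * c s) *\<^sub>R D f (P x0 + s *\<^sub>R Q x0) (Q v)))) (at x0)"
proof -
  note f = Ck_SucD[OF C1]
  define fx where "fx x s = Blinfun (\<lambda>v. c s *\<^sub>R D f (P x + s *\<^sub>R Q x) (P v + s *\<^sub>R Q v))" for x s
  have der: "((\<lambda>x. c s *\<^sub>R f (P x + s *\<^sub>R Q x)) has_derivative
      (\<lambda>v. c s *\<^sub>R D f (P x + s *\<^sub>R Q x) (P v + s *\<^sub>R Q v))) (at x)"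
    if "x \<in> ball 0 \<delta>" "s \<in> {0..1}" for x s
  proof -
    have PQ: "((\<lambda>x. P x + s *\<^sub>R Q x) has_derivative (\<lambda>v. P v + s *\<^sub>R Q v)) (at x)"
      by (intro derivative_intros bounded_linear_imp_has_derivative P Q)
    show ?thesis
      by (intro has_derivative_scaleR_right has_derivative_compose[OF PQ f(1)[OF dom[OF that]]])
  qed
  have fx: "blinfun_apply (fx x s) = (\<lambda>v. c s *\<^sub>R D f (P x + s *\<^sub>R Q x) (P v + s *\<^sub>R Q v))"
    if "x \<in> ball 0 \<delta>" "s \<in> {0..1}" for x s
    unfolding fx_def using has_derivative_bounded_linear[OF der[OF that]] by (rule bounded_linear_Blinfun_apply)
  have lin: "linear (D f (P x + s *\<^sub>R Q x))" if "x \<in> ball 0 \<delta>" "s \<in> {0..1}" for x s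
    using f(1)[OF dom[OF that]] has_derivative_linear by blast
  have cf: "continuous_on U (\<lambda>x. D f x b)" for b by (rule Ck_on_imp_continuous_on[OF f(2)])
  have contf: "continuous_on (ball 0 \<delta> \<times> {0..1}) (\<lambda>p. c (snd p) *\<^sub>R D f (P (fst p) + snd p *\<^sub>R Q (fst p)) b)" for b
    using continuous_on_family_product[where X="ball 0 \<delta>", OF P Q dom c cf] by simp
  have cont: "continuous_on (ball 0 \<delta> \<times> cbox 0 1) (\<lambda>(x, s). fx x s)"
  proof (rule continuous_on_blinfun_componentwise)
    fix i :: 'a
    have "continuous_on (ball 0 \<delta> \<times> cbox 0 1) (\<lambda>p. c (snd p) *\<^sub>R D f (P (fst p) + snd p *\<^sub>R Q (fst p)) (P i)
       + snd p *\<^sub>R (c (snd p) *\<^sub>R D f (P (fst p) + snd p *\<^sub>R Q (fst p)) (Q i)))"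
      by (simp only: cbox_interval)
        (rule continuous_on_add[OF contf continuous_on_scaleR[OF continuous_on_snd[OF continuous_on_id] contf]])
    moreover have "c (snd p) *\<^sub>R D f (P (fst p) + snd p *\<^sub>R Q (fst p)) (P i)
       + snd p *\<^sub>R (c (snd p) *\<^sub>R D f (P (fst p) + snd p *\<^sub>R Q (fst p)) (Q i)) = blinfun_apply (case p of (x, s) \<Rightarrow> fx x s) i"
      if "p \<in> ball 0 \<delta> \<times> cbox 0 1" for p
      using that lin[of "fst p" "snd p"] fx[of "fst p" "snd p"]
      by (auto simp: linear_add linear_scale algebra_simps split_beta)
    ultimately show "continuous_on (ball 0 \<delta> \<times> cbox 0 1) (\<lambda>p. blinfun_apply (case p of (x, s) \<Rightarrow> fx x s) i)"
      by (simp cong: continuous_on_cong)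
  qed
  let ?I = "\<lambda>x. integral {0..1} (\<lambda>s. c s *\<^sub>R f (P x + s *\<^sub>R Q x))"
  have intble: "(\<lambda>s. c s *\<^sub>R f (P x + s *\<^sub>R Q x)) integrable_on {0..1}" if "x \<in> ball 0 \<delta>" for x
    using c dom[OF that]
    by (intro integrable_continuous_real continuous_intros continuous_on_compose2[OF Ck_on_imp_continuous_on[OF C1]]) auto
  have intc: "(\<lambda>s. c s *\<^sub>R D f (P x + s *\<^sub>R Q x) b) integrable_on {0..1}" 
    "(\<lambda>s. (s * c s) *\<^sub>R D f (P x + s *\<^sub>R Q x) b) integrable_on {0..1}" if "x \<in> ball 0 \<delta>" for x b
    using c dom[OF that]
    by (intro integrable_continuous_real continuous_intros continuous_on_compose2[OF cf]; auto)+
  have "(?I has_derivative blinfun_apply (integral (cbox 0 1) (fx x))) (at x)" if "x \<in> ball 0 \<delta>" for x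
  proof -
    have "((\<lambda>x. integral (cbox 0 1) (\<lambda>s. c s *\<^sub>R f (P x + s *\<^sub>R Q x))) has_derivative
        blinfun_apply (integral (cbox 0 1) (fx x))) (at x within ball 0 \<delta>)"
    proof (rule leibniz_rule[OF _ _ cont that convex_ball])
      show "((\<lambda>x. c t *\<^sub>R f (P x + t *\<^sub>R Q x)) has_derivative blinfun_apply (fx x t)) (at x within ball 0 \<delta>)"
        if "x \<in> ball 0 \<delta>" "t \<in> cbox 0 1" for x t
        using that der[OF that(1), of t] fx[OF that(1), of t] by (simp add: has_derivative_at_withinI)
      show "(\<lambda>s. c s *\<^sub>R f (P x + s *\<^sub>R Q x)) integrable_on cbox 0 1" if "x \<in> ball 0 \<delta>" for x
        using intble[OF that] by simp
    qed
    then show ?thesis unfolding at_within_open[OF that open_ball] by (simp only: cbox_interval)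
  qed
  moreover have "blinfun_apply (integral (cbox 0 1) (fx x)) v
     = integral {0..1} (\<lambda>s. c s *\<^sub>R D f (P x + s *\<^sub>R Q x) (P v))
     + integral {0..1} (\<lambda>s. (s * c s) *\<^sub>R D f (P x + s *\<^sub>R Q x) (Q v))" if "x \<in> ball 0 \<delta>" for x v
  proof -
    have "continuous_on (cbox 0 1) (\<lambda>s. (\<lambda>(x, s). fx x s) (x, s))"
      by (rule continuous_on_compose2[OF cont continuous_on_Pair[OF continuous_on_const continuous_on_id]])
        (use that in auto)
    then have "continuous_on (cbox 0 1) (fx x)" by simp
    then have "fx x integrable_on cbox 0 1" by (rule integrable_continuous)
    then have "blinfun_apply (integral (cbox 0 1) (fx x)) v = integral (cbox 0 1) (\<lambda>s. blinfun_apply (fx x s) v)"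
      using integral_linear[OF _ blinfun.bounded_linear_left, of "fx x" "cbox 0 1" v]
      by (simp add: o_def)
    also have "\<dots> = integral {0..1} (\<lambda>s. c s *\<^sub>R D f (P x + s *\<^sub>R Q x) (P v) + (s * c s) *\<^sub>R D f (P x + s *\<^sub>R Q x) (Q v))"
      unfolding cbox_interval using fx[OF that] lin[OF that]
      by (intro integral_cong) (auto simp: linear_add linear_scale algebra_simps)
    also have "\<dots> = integral {0..1} (\<lambda>s. c s *\<^sub>R D f (P x + s *\<^sub>R Q x) (P v))
     + integral {0..1} (\<lambda>s. (s * c s) *\<^sub>R D f (P x + s *\<^sub>R Q x) (Q v))"
      by (intro integral_add intc that)
    finally show ?thesis .
  qed
  ultimately have "(?I has_derivative (\<lambda>v. integral {0..1} (\<lambda>s. c s *\<^sub>R D f (P x + s *\<^sub>R Q x) (P v))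
     + integral {0..1} (\<lambda>s. (s * c s) *\<^sub>R D f (P x + s *\<^sub>R Q x) (Q v)))) (at x)" if "x \<in> ball 0 \<delta>" for x
    using that by (metis (no_types, lifting) ext)
  then show ?thesis using x0 .
qed

text \<open>Differentiation under the integral in the direction \<open>Q v\<close> multiplies the
  weight by \<open>s\<close>, so the induction has to run over all continuous weights
  \<open>c\<close>.\<close>

lemma Ck_on_integral:
  fixes f :: "'a::euclidean_space \<Rightarrow> 'b::euclidean_space" and P Q :: "'a \<Rightarrow> 'a"
  assumes P: "bounded_linear P" and Q: "bounded_linear Q"
    and dom: "\<And>x s. x \<in> ball 0 \<delta> \<Longrightarrow> s \<in> {0..1} \<Longrightarrow> P x + s *\<^sub>R Q x \<in> U"
  shows "Ck_on k U f \<Longrightarrow> continuous_on {0..1} c \<Longrightarrow>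
    Ck_on k (ball 0 \<delta>) (\<lambda>x. integral {0..1} (\<lambda>s. c s *\<^sub>R f (P x + s *\<^sub>R Q x)))"
proof (induction k arbitrary: f c)
  case 0
  have "continuous_on (ball 0 \<delta>) (\<lambda>x. integral (cbox 0 1) (\<lambda>s. c s *\<^sub>R f (P x + s *\<^sub>R Q x)))"
  proof (rule integral_continuous_on_param)
    have "continuous_on (ball 0 \<delta> \<times> cbox 0 1) (\<lambda>p. c (snd p) *\<^sub>R f (P (fst p) + snd p *\<^sub>R Q (fst p)))"
      using continuous_on_family_product[where X="ball 0 \<delta>", OF P Q dom 0(2) 0(1)[unfolded Ck_on.simps]] by simp
    then show "continuous_on (ball 0 \<delta> \<times> cbox 0 1) (\<lambda>(x, s). c s *\<^sub>R f (P x + s *\<^sub>R Q x))"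
      by (simp add: split_beta)
  qed
  then show ?case by simp
next
  case (Suc k)
  note f = Ck_SucD[OF Suc.prems(1)]
  show ?case
    by (rule Ck_SucI[OF open_ball has_derivative_integral_family[OF P Q dom]])
       (use Suc.prems in \<open>auto intro!: Ck_on_add Suc.IH f(2) continuous_intros dest: Ck_on_imp_continuous_on\<close>)
qed

lemma linear_family_domain:
  fixes P Q :: "'a::real_normed_vector \<Rightarrow> 'b::real_normed_vector"
  assumes "bounded_linear P" "bounded_linear Q" "open U" "0 \<in> U"
  obtains \<delta> where "\<delta> > 0" "\<And>x s. x \<in> ball 0 \<delta> \<Longrightarrow> s \<in> {0..1} \<Longrightarrow> P x + s *\<^sub>R Q x \<in> U"
proof -
  obtain K1 K2 where K: "K1 > 0" "\<And>x. norm (P x) \<le> norm x * K1" "K2 > 0" "\<And>x. norm (Q x) \<le> norm x * K2"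
    using assms(1,2) bounded_linear.pos_bounded by metis
  obtain r where r: "r > 0" "ball 0 r \<subseteq> U" using assms openE by blast
  show thesis
  proof (rule that[of "r / (K1 + K2)"])
    show "r / (K1 + K2) > 0" using r K by simp
    fix x :: 'a and s :: real assume x: "x \<in> ball 0 (r / (K1 + K2))" and s: "s \<in> {0..1}"
    have "norm (P x + s *\<^sub>R Q x) \<le> norm (P x) + norm (s *\<^sub>R Q x)" by (rule norm_triangle_ineq)
    also have "norm (s *\<^sub>R Q x) \<le> norm (Q x)" using s by (simp add: mult_left_le_one_le)
    also have "norm (P x) + norm (Q x) \<le> norm x * (K1 + K2)" using K(2,4)[of x] by (simp add: distrib_left)
    also have "\<dots> < r" using x K by (simp add: field_simps)
    finally show "P x + s *\<^sub>R Q x \<in> U" using r by auto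
  qed
qed

lemma smooth_germ_integral:
  fixes f :: "'a::euclidean_space \<Rightarrow> 'b::euclidean_space" and P Q :: "'a \<Rightarrow> 'a"
  assumes "bounded_linear P" "bounded_linear Q" "smooth_germ f"
  shows "smooth_germ (\<lambda>x. integral {0..1} (\<lambda>s. f (P x + s *\<^sub>R Q x)))"
proof -
  obtain U where U: "open U" "0 \<in> U" "smooth_on U f" using assms by (auto simp: smooth_germ_def)
  obtain \<delta> where \<delta>: "\<delta> > 0" "\<And>x s. x \<in> ball 0 \<delta> \<Longrightarrow> s \<in> {0..1} \<Longrightarrow> P x + s *\<^sub>R Q x \<in> U"
    using linear_family_domain[OF assms(1,2) U(1,2)] by metis
  have "Ck_on k (ball 0 \<delta>) (\<lambda>x. integral {0..1} (\<lambda>s. 1 *\<^sub>R f (P x + s *\<^sub>R Q x)))" for k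
    using U(3) by (intro Ck_on_integral[OF assms(1,2) \<delta>(2)]) (auto simp: smooth_on_def)
  then show ?thesis using \<delta>(1) by (intro smooth_germI[of "ball 0 \<delta>"]) (auto simp: smooth_on_def)
qed

lemma integral_along_segment:
  fixes f :: "'a::euclidean_space \<Rightarrow> 'b::euclidean_space"
  assumes f: "smooth_on U f" and U: "\<And>s. s \<in> {0..1} \<Longrightarrow> a + s *\<^sub>R b \<in> U"
  shows "f (a + b) - f a = integral {0..1} (\<lambda>s. D f (a + s *\<^sub>R b) b)"
proof -
  have "((\<lambda>s. f (a + s *\<^sub>R b)) has_vector_derivative D f (a + s *\<^sub>R b) b) (at s within {0..1})"
    if "s \<in> {0..1}" for s
  proof -
    note df = smooth_on_has_derivative[OF f U[OF that]]
    have "((\<lambda>s. a + s *\<^sub>R b) has_derivative (\<lambda>t. t *\<^sub>R b)) (at s)"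
      by (auto intro!: derivative_eq_intros)
    from has_derivative_compose[OF this df]
    have "((\<lambda>s. f (a + s *\<^sub>R b)) has_derivative (\<lambda>t. t *\<^sub>R D f (a + s *\<^sub>R b) b)) (at s)"
      using has_derivative_linear[OF df] by (simp add: linear_scale)
    then show ?thesis by (simp add: has_vector_derivative_def has_derivative_at_withinI)
  qed
  then have "((\<lambda>s. D f (a + s *\<^sub>R b) b) has_integral f (a + 1 *\<^sub>R b) - f (a + 0 *\<^sub>R b)) {0..1}"
    by (intro fundamental_theorem_of_calculus) auto
  then show ?thesis by (simp add: integral_unique)
qed

text \<open>Hadamard's quotient is the integral of the derivative of \<open>f\<close> at
  \<open>s * t\<close> over \<open>s\<close> between 0 and 1.\<close>

lemma smooth_on_divide:
  fixes f :: "real \<Rightarrow> real"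
  assumes f: "smooth_on (ball 0 r) f" "f 0 = 0"
  obtains g where "smooth_on (ball 0 r) g" "\<And>t. t \<in> ball 0 r \<Longrightarrow> f t = t * g t"
proof -
  define g where "g t = integral {0..1} (\<lambda>s. 1 *\<^sub>R D f (0 + s *\<^sub>R t) 1)" for t :: real
  have dom: "0 + s *\<^sub>R t \<in> ball 0 r" if "t \<in> ball 0 r" "s \<in> {0..1}" for s t :: real
  proof -
    have "\<bar>s\<bar> * \<bar>t\<bar> \<le> \<bar>t\<bar>" using that by (auto intro: mult_left_le_one_le)
    then show ?thesis using that by (simp add: abs_mult)
  qed
  have "smooth_on (ball 0 r) g"
    unfolding smooth_on_def g_def
    by (intro allI Ck_on_integral[OF bounded_linear_zero bounded_linear_ident dom])
       (use smooth_on_D[OF f(1), of 1] in \<open>auto simp: smooth_on_def\<close>)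
  moreover have "f t = t * g t" if t: "t \<in> ball 0 r" for t
  proof -
    have "f t = integral {0..1} (\<lambda>s. D f (0 + s *\<^sub>R t) t)"
      using integral_along_segment[OF f(1) dom[OF t]] f(2) by simp
    also have "\<dots> = integral {0..1} (\<lambda>s. t * D f (0 + s *\<^sub>R t) 1)"
    proof (rule integral_cong)
      fix s :: real assume "s \<in> {0..1}"
      then show "D f (0 + s *\<^sub>R t) t = t * D f (0 + s *\<^sub>R t) 1"
        using linear_scale[OF has_derivative_linear[OF smooth_on_has_derivative[OF f(1) dom[OF t]]], of s t 1] by simp
    qed
    finally show ?thesis by (simp add: g_def)
  qed
  ultimately show thesis using that by blast
qed

lemma smooth_germ_ball:
  assumes "smooth_germ f"
  obtains r where "r > 0" "smooth_on (ball 0 r) f"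
  using assms unfolding smooth_germ_def by (metis openE smooth_on_subset)

lemma eventually_ball: "r > 0 \<Longrightarrow> (\<And>x. x \<in> ball a r \<Longrightarrow> P x) \<Longrightarrow> eventually P (nhds a)"
  unfolding eventually_nhds by (intro exI[of _ "ball a r"]) auto

lemma smooth_germ_divide:
  fixes f :: "real \<Rightarrow> real"
  assumes "smooth_germ f" "f 0 = 0"
  obtains g where "smooth_germ g" "\<forall>\<^sub>F t in nhds 0. f t = t * g t"
proof -
  obtain r where r: "r > 0" "smooth_on (ball 0 r) f" by (rule smooth_germ_ball[OF assms(1)])
  obtain g where "smooth_on (ball 0 r) g" "\<And>t. t \<in> ball 0 r \<Longrightarrow> f t = t * g t"
    using smooth_on_divide[OF r(2) assms(2)] by blast
  then show thesis using r(1) by (intro that[of g] smooth_germI[of "ball 0 r"] eventually_ball[OF r(1)]) auto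
qed

lemma smooth_germ_antiderivative:
  fixes f :: "real \<Rightarrow> real"
  assumes "smooth_germ f"
  obtains F where "smooth_germ F" "F 0 = 0" "\<forall>\<^sub>F t in nhds 0. (F has_real_derivative f t) (at t)"
proof -
  obtain U where U: "open U" "0 \<in> U" "smooth_on U f" using assms by (auto simp: smooth_germ_def)
  obtain r where r: "r > 0" "cball 0 r \<subseteq> U" using U open_contains_cball by blast
  have cf: "continuous_on {-r..r} f"
    using r(2) by (intro continuous_on_subset[OF smooth_on_continuous_on[OF U(3)]]) (simp add: cball_eq_atLeastAtMost)
  define F where "F t = integral {-r..t} f - integral {-r..0} f" for t
  have der: "(F has_real_derivative f t) (at t)" if "t \<in> {-r<..<r}" for t
  proof -
    have "((\<lambda>t. integral {-r..t} f) has_real_derivative f t) (at t within {-r..r})"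
      using integral_has_real_derivative[OF cf, of t] that by auto
    then have "((\<lambda>t. integral {-r..t} f) has_real_derivative f t) (at t)"
      using that by (simp add: at_within_Icc_at)
    then show ?thesis unfolding F_def by (auto intro!: derivative_eq_intros)
  qed
  have "smooth_on {-r<..<r} F"
  proof (rule smooth_on_derivI[where f'="\<lambda>x v. f x * v"])
    show "(F has_derivative (*) (f x)) (at x)" if "x \<in> {-r<..<r}" for x
      using der[OF that] by (simp add: has_field_derivative_def)
    have "smooth_on {-r<..<r} f" 
      using r(2) by (intro smooth_on_subset[OF U(3)]) (auto simp: cball_eq_atLeastAtMost subset_eq)
    then show "smooth_on {-r<..<r} (\<lambda>x. f x * v)" for v
      by (intro smooth_on_bilinear[OF _ bounded_bilinear_mult] smooth_on_const) auto
  qed auto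
  then have "smooth_germ F" using r(1) by (intro smooth_germI[of "{-r<..<r}"]) auto
  moreover have "\<forall>\<^sub>F t in nhds 0. (F has_real_derivative f t) (at t)"
    using der r(1) by (auto simp: eventually_nhds intro!: exI[of _ "{-r<..<r}"])
  ultimately show thesis using that[of F] by (simp add: F_def)
qed

definition smooth_form :: "('a::euclidean_space \<Rightarrow> 'a \<Rightarrow> real) \<Rightarrow> bool" where
  "smooth_form \<alpha> \<longleftrightarrow> (\<forall>v. smooth_germ (\<lambda>x. \<alpha> x v)) \<and> (\<forall>\<^sub>F x in nhds 0. linear (\<alpha> x))"

text \<open>The primitive is the integral of \<open>\<alpha> (s x) x\<close>. Closedness turns its
  derivative in direction \<open>v\<close> into the integral of the \<open>s\<close>-derivative of
  \<open>s * \<alpha> (s x) v\<close>, which is \<open>\<alpha> x v\<close>.\<close>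

lemma poincare:
  fixes \<alpha> :: "'a::euclidean_space \<Rightarrow> 'a \<Rightarrow> real"
  assumes "smooth_form \<alpha>"
    and closed: "\<forall>\<^sub>F x in nhds 0. \<forall>u v. D (\<lambda>x. \<alpha> x v) x u = D (\<lambda>x. \<alpha> x u) x v"
  obtains F where "smooth_germ F" "F 0 = 0" "\<forall>\<^sub>F x in nhds 0. (F has_derivative \<alpha> x) (at x)"
proof -
  have "\<exists>U. open U \<and> 0 \<in> U \<and> (\<forall>b\<in>Basis. smooth_on U (\<lambda>x. \<alpha> x b))"
  proof -
    have "\<forall>b. \<exists>U. open U \<and> 0 \<in> U \<and> smooth_on U (\<lambda>x. \<alpha> x b)"
      using assms(1) by (auto simp: smooth_form_def smooth_germ_def)
    then obtain U where U: "\<And>b. open (U b)" "\<And>b. 0 \<in> U b" "\<And>b. smooth_on (U b) (\<lambda>x. \<alpha> x b)" by metis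
    show ?thesis
      by (rule exI[of _ "\<Inter>b\<in>Basis. U b"]) (auto intro: U smooth_on_subset[OF U(3)])
  qed
  then obtain U where U: "open U" "0 \<in> U" "\<And>b. b \<in> Basis \<Longrightarrow> smooth_on U (\<lambda>x. \<alpha> x b)" by auto
  obtain U' where U': "open U'" "0 \<in> U'" "\<And>x. x \<in> U' \<Longrightarrow> linear (\<alpha> x)"
      "\<And>x u v. x \<in> U' \<Longrightarrow> D (\<lambda>x. \<alpha> x v) x u = D (\<lambda>x. \<alpha> x u) x v"
  proof -
    have "\<forall>\<^sub>F x in nhds 0. linear (\<alpha> x) \<and> (\<forall>u v. D (\<lambda>x. \<alpha> x v) x u = D (\<lambda>x. \<alpha> x u) x v)"
      using assms(1) closed by (auto simp: smooth_form_def intro: eventually_conj)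
    then show thesis using that by (auto simp: eventually_nhds)
  qed
  obtain r where r: "r > 0" "ball 0 r \<subseteq> U \<inter> U'" using U U' by (metis IntI openE open_Int)
  define B where "B = ball (0::'a) r"
  have B: "open B" "B \<subseteq> U" "B \<subseteq> U'" using r by (auto simp: B_def)
  have lin: "linear (\<alpha> x)" if "x \<in> B" for x using U' B that by blast
  have sm: "smooth_on B (\<lambda>x. \<alpha> x v)" for v
  proof -
    have "smooth_on B (\<lambda>x. \<Sum>b\<in>Basis. (v \<bullet> b) *\<^sub>R \<alpha> x b)"
      using U(3) B by (intro smooth_on_sum smooth_on_bilinear[OF _ bounded_bilinear_scaleR] smooth_on_const)
        (auto intro: smooth_on_subset)
    then show ?thesis
      by (rule smooth_on_cong[OF B(1), rotated]) (metis linear_basis_sum[OF lin])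
  qed
  define h where "h b = (\<lambda>x. integral {0..1} (\<lambda>s. 1 *\<^sub>R \<alpha> (0 + s *\<^sub>R x) b))" for b
  have dom: "0 + s *\<^sub>R x \<in> B" if "x \<in> ball 0 r" "s \<in> {0..1}" for x s
  proof -
    have "\<bar>s\<bar> * norm x \<le> norm x" using that by (auto intro: mult_left_le_one_le)
    then show ?thesis using that unfolding B_def by auto
  qed
  have smh: "smooth_on B (h b)" for b
    unfolding smooth_on_def h_def B_def
    by (intro allI Ck_on_integral[OF bounded_linear_zero bounded_linear_ident dom])
       (use sm in \<open>auto simp: smooth_on_def\<close>)
  \<comment> \<open>Written through the components \<open>h b\<close>, in which the direction
    \<open>b\<close> is fixed, so that the lemma on parameter integrals gives smoothness.\<close>
  define F where "F x = (\<Sum>b\<in>Basis. (x \<bullet> b) * h b x)" for x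
  have F_eq: "F x = integral {0..1} (\<lambda>s. \<alpha> (s *\<^sub>R x) x)" if x: "x \<in> B" for x
  proof -
    have "integral {0..1} (\<lambda>s. \<alpha> (s *\<^sub>R x) x) = integral {0..1} (\<lambda>s. \<Sum>b\<in>Basis. (x \<bullet> b) *\<^sub>R \<alpha> (s *\<^sub>R x) b)"
      using dom[of x] x linear_basis_sum[OF lin] by (intro integral_cong) (simp add: B_def)
    also have "\<dots> = (\<Sum>b\<in>Basis. integral {0..1} (\<lambda>s. (x \<bullet> b) *\<^sub>R \<alpha> (s *\<^sub>R x) b))"
    proof (intro integral_sum integrable_continuous_real continuous_on_scaleR continuous_on_const)
      fix b
      show "continuous_on {0..1} (\<lambda>s. \<alpha> (s *\<^sub>R x) b)"
        by (rule continuous_on_compose2[OF smooth_on_continuous_on[OF sm]])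
          (use dom[of x] x in \<open>auto intro!: continuous_intros simp: B_def\<close>)
    qed auto
    finally show ?thesis by (simp add: F_def h_def)
  qed
  have der: "(F has_derivative \<alpha> x) (at x)" if x: "x \<in> B" for x
  proof -
    have smF: "smooth_on B F" unfolding F_def
      by (intro smooth_on_sum smooth_on_bilinear[OF _ bounded_bilinear_mult] smh B smooth_on_bounded_linear[OF _ bounded_linear_inner_left] smooth_on_id)
    have "D F x v = \<alpha> x v" for v
    proof -
      have cx: "continuous_on {0..1} (\<lambda>s. s *\<^sub>R x)" and sx: "(\<lambda>s. s *\<^sub>R x) ` {0..1} \<subseteq> B"
        using dom[of x] x by (auto intro!: continuous_intros simp: B_def)
      have c2: "continuous_on {0..1} (\<lambda>s. \<alpha> (s *\<^sub>R x) w)" for w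
        by (rule continuous_on_compose2[OF smooth_on_continuous_on[OF sm] cx sx])
      have c1: "continuous_on {0..1} (\<lambda>s. s *\<^sub>R D (\<lambda>y. \<alpha> y w) (s *\<^sub>R x) z)" for w z
        by (intro continuous_on_scaleR continuous_on_id
            continuous_on_compose2[OF smooth_on_continuous_on[OF smooth_on_D[OF sm, of w z]] cx sx])
      have hd: "D (h b) x v = integral {0..1} (\<lambda>s. s *\<^sub>R D (\<lambda>y. \<alpha> y b) (s *\<^sub>R x) v)" for b
      proof -
        have "(h b has_derivative (\<lambda>v. integral {0..1} (\<lambda>s. 1 *\<^sub>R D (\<lambda>y. \<alpha> y b) (0 + s *\<^sub>R x) 0)
           + integral {0..1} (\<lambda>s. (s * 1) *\<^sub>R D (\<lambda>y. \<alpha> y b) (0 + s *\<^sub>R x) v))) (at x)"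
          unfolding h_def using x
          by (intro has_derivative_integral_family[OF bounded_linear_zero bounded_linear_ident dom])
            (use sm in \<open>auto simp: smooth_on_def B_def simp del: Ck_on.simps\<close>)
        moreover have "integral {0..1} (\<lambda>s. 1 *\<^sub>R D (\<lambda>y. \<alpha> y b) (0 + s *\<^sub>R x) 0) = integral {0..1::real} (\<lambda>s. 0)"
        proof (rule integral_cong)
          fix s :: real assume "s \<in> {0..1}"
          then have "0 + s *\<^sub>R x \<in> B" using dom[of x] x by (simp add: B_def)
          from linear_0[OF has_derivative_linear[OF smooth_on_has_derivative[OF sm this]]]
          show "1 *\<^sub>R D (\<lambda>y. \<alpha> y b) (0 + s *\<^sub>R x) 0 = 0" by simp
        qed
        ultimately show ?thesis by (simp add: D_eq)
      qed
      have dF: "D F x v = (\<Sum>b\<in>Basis. (v \<bullet> b) * h b x + (x \<bullet> b) * D (h b) x v)"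
      proof -
        have "(F has_derivative (\<lambda>v. \<Sum>b\<in>Basis. (x \<bullet> b) * D (h b) x v + (v \<bullet> b) * h b x)) (at x)"
          unfolding F_def
          by (intro has_derivative_sum has_derivative_mult has_derivative_inner_left has_derivative_ident
              smooth_on_has_derivative[OF smh x])
        then show ?thesis by (simp add: D_eq add.commute)
      qed
      also have "\<dots> = (\<Sum>b\<in>Basis. integral {0..1} (\<lambda>s. (v \<bullet> b) * \<alpha> (s *\<^sub>R x) b + (x \<bullet> b) * (s *\<^sub>R D (\<lambda>y. \<alpha> y b) (s *\<^sub>R x) v)))"
        unfolding hd unfolding h_def
        by (intro sum.cong refl) (subst integral_add; auto intro!: integrable_continuous_real continuous_intros c1[unfolded real_scaleR_def] c2)
      also have "\<dots> = integral {0..1} (\<lambda>s. \<Sum>b\<in>Basis. (v \<bullet> b) * \<alpha> (s *\<^sub>R x) b + (x \<bullet> b) * (s *\<^sub>R D (\<lambda>y. \<alpha> y b) (s *\<^sub>R x) v))"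
        by (intro integral_sum[symmetric] integrable_continuous_real continuous_intros c1 c2) auto
      also have "\<dots> = integral {0..1} (\<lambda>s. \<alpha> (s *\<^sub>R x) v + s * D (\<lambda>y. \<alpha> y v) (s *\<^sub>R x) x)"
      proof (intro integral_cong)
        fix s :: real assume s: "s \<in> {0..1}"
        have sx: "s *\<^sub>R x \<in> B" using dom[of x s] x s by (auto simp: B_def)
        have "((\<lambda>y. \<Sum>b\<in>Basis. (x \<bullet> b) *\<^sub>R \<alpha> y b) has_derivative
            (\<lambda>v. \<Sum>b\<in>Basis. (x \<bullet> b) *\<^sub>R D (\<lambda>y. \<alpha> y b) (s *\<^sub>R x) v)) (at (s *\<^sub>R x))"
          by (intro has_derivative_sum has_derivative_scaleR_right smooth_on_has_derivative[OF sm sx])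
        then have "((\<lambda>y. \<alpha> y x) has_derivative
            (\<lambda>v. \<Sum>b\<in>Basis. (x \<bullet> b) *\<^sub>R D (\<lambda>y. \<alpha> y b) (s *\<^sub>R x) v)) (at (s *\<^sub>R x))"
          by (rule has_derivative_transform_within_open[OF _ B(1) sx]) (metis linear_basis_sum[OF lin])
        then have "(\<Sum>b\<in>Basis. (x \<bullet> b) * D (\<lambda>y. \<alpha> y b) (s *\<^sub>R x) v) = D (\<lambda>y. \<alpha> y x) (s *\<^sub>R x) v"
          by (simp add: D_eq)
        also have "\<dots> = D (\<lambda>y. \<alpha> y v) (s *\<^sub>R x) x" using U'(4) sx B(3) by blast
        finally show "(\<Sum>b\<in>Basis. (v \<bullet> b) * \<alpha> (s *\<^sub>R x) b + (x \<bullet> b) * (s *\<^sub>R D (\<lambda>y. \<alpha> y b) (s *\<^sub>R x) v))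
            = \<alpha> (s *\<^sub>R x) v + s * D (\<lambda>y. \<alpha> y v) (s *\<^sub>R x) x"
          using linear_basis_sum[OF lin[OF sx], of v]
          by (simp add: sum.distrib sum_distrib_left mult.left_commute flip: sum_distrib_left)
      qed
      also have "\<dots> = 1 * \<alpha> (1 *\<^sub>R x) v - 0 * \<alpha> (0 *\<^sub>R x) v"
      proof (rule integral_unique[OF fundamental_theorem_of_calculus])
        fix s :: real assume s: "s \<in> {0..1}"
        have sx: "s *\<^sub>R x \<in> B" using dom[of x s] x s by (auto simp: B_def)
        have "((\<lambda>s. s *\<^sub>R x) has_derivative (\<lambda>t. t *\<^sub>R x)) (at s)" by (auto intro!: derivative_eq_intros)
        note * = has_derivative_compose[OF this smooth_on_has_derivative[OF sm sx]]
        have "((\<lambda>s. \<alpha> (s *\<^sub>R x) v) has_real_derivative D (\<lambda>y. \<alpha> y v) (s *\<^sub>R x) x) (at s)"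
          unfolding has_field_derivative_def
          by (rule has_derivative_eq_rhs[OF *])
            (simp add: fun_eq_iff linear_scale[OF has_derivative_linear[OF smooth_on_has_derivative[OF sm sx]]])
        then have "((\<lambda>s. s * \<alpha> (s *\<^sub>R x) v) has_real_derivative \<alpha> (s *\<^sub>R x) v + s * D (\<lambda>y. \<alpha> y v) (s *\<^sub>R x) x) (at s)"
          by (auto intro!: derivative_eq_intros)
        then show "((\<lambda>s. s * \<alpha> (s *\<^sub>R x) v) has_vector_derivative \<alpha> (s *\<^sub>R x) v + s * D (\<lambda>y. \<alpha> y v) (s *\<^sub>R x) x) (at s within {0..1})"
          by (simp add: has_real_derivative_iff_has_vector_derivative has_vector_derivative_at_within)
      qed simp
      also have "\<dots> = \<alpha> x v" by simp
      finally show ?thesis .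
    qed
    then show ?thesis using smooth_on_has_derivative[OF smF x] by presburger
  qed
  show thesis
  proof (rule that)
    show "smooth_germ F" using r(1) unfolding F_def
      by (intro smooth_germI[OF B(1)] smooth_on_sum smooth_on_bilinear[OF _ bounded_bilinear_mult] smh B smooth_on_bounded_linear[OF _ bounded_linear_inner_left] smooth_on_id)
        (simp add: B_def)
    show "\<forall>\<^sub>F x in nhds 0. (F has_derivative \<alpha> x) (at x)"
      using der B(1) r(1) unfolding eventually_nhds by (intro exI[of _ B]) (simp add: B_def)
  qed (simp add: F_def)
qed

section \<open>Taylor series and Borel's theorem\<close>

notation fps_nth (infixl "$$" 75)

definition jet :: "(real \<Rightarrow> real) \<Rightarrow> real fps" where
  "jet f = Abs_fps (\<lambda>n. (deriv ^^ n) f 0 / fact n)"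

lemma deriv_eq_D: "f differentiable (at x) \<Longrightarrow> deriv f x = D f x 1" for f :: "real \<Rightarrow> real"
proof -
  assume f: "f differentiable (at x)"
  have "(f has_real_derivative D f x 1) (at x)"
  proof (rule has_derivative_imp_has_field_derivative[OF D_works[OF f]])
    show "y * D f x 1 = D f x y" for y
      using linear_scale[OF has_derivative_linear[OF D_works[OF f]], of y 1] by simp
  qed
  then show ?thesis by (rule DERIV_imp_deriv)
qed

lemma has_real_derivative_deriv: "f differentiable (at x) \<Longrightarrow> (f has_real_derivative deriv f x) (at x)" for f :: "real \<Rightarrow> real"
  by (simp add: DERIV_deriv_iff_real_differentiable)

lemma smooth_germ_differentiable: "smooth_germ f \<Longrightarrow> \<forall>\<^sub>F x in nhds 0. f differentiable (at x)"
  by (rule eventually_mono[OF smooth_germ_has_derivative]) (auto simp: differentiable_def)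

lemma smooth_germ_deriv [sg]: "smooth_germ f \<Longrightarrow> smooth_germ (deriv f)" for f :: "real \<Rightarrow> real"
  by (rule smooth_germ_cong[OF _ smooth_germ_D[of f 1]])
    (auto elim: eventually_mono[OF smooth_germ_differentiable] simp: deriv_eq_D)

lemma smooth_on_deriv: "open S \<Longrightarrow> smooth_on S f \<Longrightarrow> smooth_on S (deriv f)" for f :: "real \<Rightarrow> real"
  by (rule smooth_on_cong[OF _ _ smooth_on_D[of S f 1]]) (auto simp: deriv_eq_D smooth_on_differentiable)

lemma jet_nth_0 [simp]: "jet f $$ 0 = f 0" by (simp add: jet_def)

lemma jet_nth_Suc: "jet f $$ Suc n = jet (deriv f) $$ n / real (Suc n)"
  by (simp add: jet_def funpow_Suc_right del: funpow.simps)

lemma fps_deriv_jet: "fps_deriv (jet f) = jet (deriv f)"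
  by (simp add: fps_eq_iff jet_nth_Suc flip: Suc_eq_plus1)

lemma deriv_cong_germ:
  assumes "\<forall>\<^sub>F x in nhds a. f x = g x" shows "\<forall>\<^sub>F x in nhds a. deriv f x = deriv g x"
  using assms by (subst (asm) eventually_eventually[symmetric])
    (auto elim!: eventually_mono intro!: deriv_cong_ev)

lemma jet_cong: assumes "\<forall>\<^sub>F x in nhds 0. f x = g x" shows "jet f = jet g"
proof -
  have "jet f $$ n = jet g $$ n" for n
    using assms
  proof (induction n arbitrary: f g)
    case 0 then show ?case using eventually_nhds_x_imp_x[OF 0] by simp
  next
    case (Suc n) then show ?case by (simp add: jet_nth_Suc deriv_cong_germ)
  qed
  then show ?thesis by (simp add: fps_eq_iff)
qed

lemma jet_const [simp]: "jet (\<lambda>x. c) = fps_const c"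
proof -
  have z: "jet (\<lambda>x. 0) $$ n = 0" for n
    by (induction n) (simp_all add: jet_nth_Suc)
  have "jet (\<lambda>x. c) $$ n = fps_const c $$ n" for n
    by (cases n) (simp_all add: jet_nth_Suc z)
  then show ?thesis by (simp add: fps_eq_iff)
qed

lemma jet_id [simp]: "jet (\<lambda>x. x) = fps_X"
proof -
  have "jet (\<lambda>x. x) $$ n = fps_X $$ n" for n
    by (cases n) (auto simp add: jet_nth_Suc fps_X_def)
  then show ?thesis by (simp add: fps_eq_iff)
qed

lemma jet_add [simp]:
  assumes "smooth_germ f" "smooth_germ g" shows "jet (\<lambda>x. f x + g x) = jet f + jet g"
proof -
  have "jet (\<lambda>x. f x + g x) $$ n = jet f $$ n + jet g $$ n" for n
    using assms
  proof (induction n arbitrary: f g)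
    case (Suc n)
    have "\<forall>\<^sub>F x in nhds 0. deriv (\<lambda>x. f x + g x) x = deriv f x + deriv g x"
      using smooth_germ_differentiable[OF Suc.prems(1)] smooth_germ_differentiable[OF Suc.prems(2)]
      by eventually_elim (auto intro!: DERIV_imp_deriv derivative_eq_intros has_real_derivative_deriv)
    then have "jet (deriv (\<lambda>x. f x + g x)) = jet (\<lambda>x. deriv f x + deriv g x)" by (rule jet_cong)
    then show ?case using Suc by (simp add: jet_nth_Suc Suc.IH sg add_divide_distrib)
  qed simp
  then show ?thesis by (simp add: fps_eq_iff)
qed

lemma jet_mult [simp]:
  assumes "smooth_germ f" "smooth_germ g" shows "jet (\<lambda>x. f x * g x) = jet f * jet g"
proof -
  have "jet (\<lambda>x. f x * g x) $$ n = (jet f * jet g) $$ n" for n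
    using assms
  proof (induction n arbitrary: f g)
    case (Suc n)
    have "\<forall>\<^sub>F x in nhds 0. deriv (\<lambda>x. f x * g x) x = deriv f x * g x + f x * deriv g x"
      using smooth_germ_differentiable[OF Suc.prems(1)] smooth_germ_differentiable[OF Suc.prems(2)]
      by eventually_elim (auto intro!: DERIV_imp_deriv derivative_eq_intros has_real_derivative_deriv)
    then have "jet (deriv (\<lambda>x. f x * g x)) = jet (\<lambda>x. deriv f x * g x + f x * deriv g x)" by (rule jet_cong)
    also have "\<dots> = jet (\<lambda>x. deriv f x * g x) + jet (\<lambda>x. f x * deriv g x)"
      by (intro jet_add sg Suc.prems)
    finally have "jet (deriv (\<lambda>x. f x * g x)) $$ n = (fps_deriv (jet f) * jet g + jet f * fps_deriv (jet g)) $$ n"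
      by (simp add: Suc sg fps_deriv_jet)
    also have "\<dots> = fps_deriv (jet f * jet g) $$ n" by (simp only: fps_deriv_mult add.commute)
    also have "\<dots> = real (Suc n) * (jet f * jet g) $$ Suc n" by (simp only: fps_deriv_nth Suc_eq_plus1)
    finally show ?case by (simp only: jet_nth_Suc) simp
  qed simp
  then show ?thesis by (simp add: fps_eq_iff)
qed

lemma jet_cmult [simp]: "smooth_germ f \<Longrightarrow> jet (\<lambda>x. c * f x) = fps_const c * jet f"
  by (simp add: sg)

lemma jet_divide_const [simp]: "smooth_germ f \<Longrightarrow> jet (\<lambda>x. f x / c) = fps_const (1 / c) * jet f"
  using jet_cmult[of f "1 / c"] by simp

lemma jet_uminus [simp]: "smooth_germ f \<Longrightarrow> jet (\<lambda>x. - f x) = - jet f"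
  using jet_cmult[of f "-1"] by (simp add: fps_const_neg[symmetric] del: fps_const_neg)

lemma jet_diff [simp]: "smooth_germ f \<Longrightarrow> smooth_germ g \<Longrightarrow> jet (\<lambda>x. f x - g x) = jet f - jet g"
  using jet_add[of f "\<lambda>x. - g x"] by (simp add: sg)

lemma jet_power [simp]: "smooth_germ f \<Longrightarrow> jet (\<lambda>x. f x ^ n) = jet f ^ n"
  by (induction n) (simp_all add: sg)

text \<open>Differentiating both sides expresses the coefficient of index \<open>n\<close> through
  smaller coefficients of the same identity for \<open>deriv f\<close>; hence the induction over all
  smaller indices with \<open>f\<close> arbitrary.\<close>

lemma jet_compose:
  assumes "smooth_germ f" "smooth_germ g" "g 0 = 0" shows "jet (\<lambda>x. f (g x)) = jet f oo jet g"
proof -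
  have "jet (\<lambda>x. f (g x)) $$ n = (jet f oo jet g) $$ n" for n
    using assms(1)
  proof (induction n arbitrary: f rule: less_induct)
    case (less n)
    show ?case
    proof (cases n)
      case 0 then show ?thesis using assms(3) by simp
    next
      case (Suc m)
      have "\<forall>\<^sub>F x in nhds 0. f differentiable (at (g x))"
        using smooth_germ_eventually[OF assms(2,3) smooth_germ_differentiable[OF less.prems]] .
      then have "\<forall>\<^sub>F x in nhds 0. deriv (\<lambda>x. f (g x)) x = deriv f (g x) * deriv g x"
        using smooth_germ_differentiable[OF assms(2)]
        by eventually_elim (auto intro!: DERIV_imp_deriv DERIV_chain2[where f=f] has_real_derivative_deriv)
      then have "jet (deriv (\<lambda>x. f (g x))) = jet (\<lambda>x. deriv f (g x) * deriv g x)" by (rule jet_cong)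
      also have "\<dots> = jet (\<lambda>x. deriv f (g x)) * jet (deriv g)"
        by (rule jet_mult[OF smooth_germ_compose[OF smooth_germ_deriv[OF less.prems] assms(2,3)] smooth_germ_deriv[OF assms(2)]])
      finally have "jet (deriv (\<lambda>x. f (g x))) $$ m = (\<Sum>i=0..m. jet (\<lambda>x. deriv f (g x)) $$ i * jet (deriv g) $$ (m - i))"
        by (simp add: fps_mult_nth)
      also have "\<dots> = (\<Sum>i=0..m. (jet (deriv f) oo jet g) $$ i * jet (deriv g) $$ (m - i))"
        using Suc less.prems by (intro sum.cong refl) (simp add: less.IH sg)
      also have "\<dots> = ((jet (deriv f) oo jet g) * jet (deriv g)) $$ m" by (simp add: fps_mult_nth)
      also have "\<dots> = fps_deriv (jet f oo jet g) $$ m"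
        by (subst fps_compose_deriv) (simp_all add: assms(3) fps_deriv_jet)
      also have "\<dots> = real (Suc m) * (jet f oo jet g) $$ Suc m" by simp
      finally show ?thesis unfolding Suc by (simp only: jet_nth_Suc) simp
    qed
  qed
  then show ?thesis by (simp add: fps_eq_iff)
qed

lemma jet_zero_divide:
  assumes "smooth_germ f" "\<And>j. j < k \<Longrightarrow> jet f $$ j = 0"
  shows "\<exists>g. smooth_germ g \<and> (\<forall>\<^sub>F t in nhds 0. f t = t ^ k * g t)"
  using assms
proof (induction k arbitrary: f)
  case 0 then show ?case by auto
next
  case (Suc k)
  have "f 0 = 0" using Suc.prems(2)[of 0] by simp
  then obtain g where g: "smooth_germ g" "\<forall>\<^sub>F t in nhds 0. f t = t * g t"
    using smooth_germ_divide[OF Suc.prems(1)] by blast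
  have jf: "jet f = fps_X * jet g" using jet_cong[OF g(2)] g(1) by (simp add: sg)
  have "jet g $$ j = 0" if "j < k" for j
    using Suc.prems(2)[of "Suc j"] that jf by simp
  then obtain h where h: "smooth_germ h" "\<forall>\<^sub>F t in nhds 0. g t = t ^ k * h t"
    using Suc.IH[OF g(1)] by blast
  have "\<forall>\<^sub>F t in nhds 0. f t = t ^ Suc k * h t"
    using g(2) h(2) by eventually_elim simp
  then show ?case using h(1) by blast
qed

text \<open>If the first nonzero coefficient had index \<open>j < k\<close>, division by
  \<open>t ^ j\<close> would give a function tending both to that coefficient and to 0. It serves to
  turn estimates along a branch into vanishing Taylor coefficients.\<close>

lemma jet_zero_of_bound:
  assumes f: "smooth_germ f" and b: "\<forall>\<^sub>F t in nhds 0. \<bar>f t\<bar> \<le> C * \<bar>t\<bar> ^ k" and j: "j < k"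
  shows "jet f $$ j = 0"
  using j
proof (induction j rule: less_induct)
  case (less j)
  then have "\<And>i. i < j \<Longrightarrow> jet f $$ i = 0" by simp
  then obtain g where g: "smooth_germ g" "\<forall>\<^sub>F t in nhds 0. f t = t ^ j * g t"
    using jet_zero_divide[OF f] by blast
  have "jet f = fps_X ^ j * jet g" using jet_cong[OF g(2)] g(1) by (simp add: sg)
  then have jf: "jet f $$ j = g 0" by (simp add: fps_X_power_mult_nth)
  have "\<forall>\<^sub>F t in at 0. \<bar>g t\<bar> \<le> C * \<bar>t\<bar> ^ (k - j)"
    unfolding eventually_at_filter using b g(2)
  proof eventually_elim
    case (elim t)
    show ?case
    proof (intro impI)
      assume t: "t \<noteq> 0"
      have "\<bar>t\<bar> ^ k = \<bar>t\<bar> ^ j * \<bar>t\<bar> ^ (k - j)" using less.prems by (simp flip: power_add)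
      then have "\<bar>t\<bar> ^ j * \<bar>g t\<bar> \<le> \<bar>t\<bar> ^ j * (C * \<bar>t\<bar> ^ (k - j))"
        using elim by (simp add: abs_mult power_abs mult_ac)
      then show "\<bar>g t\<bar> \<le> C * \<bar>t\<bar> ^ (k - j)" using t by simp
    qed
  qed
  moreover have "((\<lambda>t. C * \<bar>t\<bar> ^ (k - j)) \<longlongrightarrow> C * \<bar>0\<bar> ^ (k - j)) (at (0::real))"
    by (intro tendsto_intros)
  then have "((\<lambda>t. C * \<bar>t\<bar> ^ (k - j)) \<longlongrightarrow> 0) (at (0::real))"
    using less.prems by (simp add: zero_power)
  ultimately have "(g \<longlongrightarrow> 0) (at 0)" using Lim_null_comparison[of g "\<lambda>t. C * \<bar>t\<bar> ^ (k - j)"] by simp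
  moreover have "(g \<longlongrightarrow> g 0) (at 0)" using smooth_germ_imp_isCont[OF g(1)] by (simp add: isCont_def)
  ultimately have "g 0 = 0" using tendsto_unique trivial_limit_at by blast
  then show ?case using jf by simp
qed

lemma fps_compose_X_power_nth:
  fixes a :: "real fps"
  assumes "d > 0"
  shows "(a oo fps_X ^ d) $$ n = (if d dvd n then a $$ (n div d) else 0)"
proof -
  have "(a oo fps_X ^ d) $$ n = (\<Sum>i=0..n. if i * d = n then a $$ i else 0)"
    unfolding fps_compose_nth
    by (intro sum.cong refl) (auto simp: fps_X_power_nth power_mult[symmetric] mult.commute)
  also have "\<dots> = (\<Sum>i\<in>(if d dvd n then {n div d} else {}). a $$ i)"
    using assms by (intro sum.mono_neutral_cong_right) (auto split: if_splits)
  finally show ?thesis by simp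
qed

section \<open>Borel's theorem, with powers of sines in place of cutoff functions\<close>

lemma smooth_UNIV_deriv:
  assumes "smooth_on UNIV (f :: real \<Rightarrow> real)"
  shows "(f has_real_derivative deriv f x) (at x)" "smooth_on UNIV (deriv f)"
  using smooth_on_deriv[OF open_UNIV assms] has_real_derivative_deriv[OF smooth_on_differentiable[OF assms UNIV_I]]
  by blast+

lemma smooth_UNIV_higher_deriv:
  "smooth_on UNIV (f :: real \<Rightarrow> real) \<Longrightarrow> smooth_on UNIV ((deriv ^^ k) f)"
  by (induction k) (auto intro: smooth_UNIV_deriv)

lemma deriv_UNIV_eq: "(\<And>x. (f has_real_derivative f' x) (at x)) \<Longrightarrow> deriv f = f'"
  by (auto intro!: DERIV_imp_deriv)

text \<open>For the derivative of order \<open>j\<close> the bound is asked only for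
  \<open>n > j\<close>. The finitely many other terms do not affect uniform convergence, so
  Weierstrass' test applies to every termwise derivative.\<close>

lemma smooth_series:
  fixes u :: "nat \<Rightarrow> real \<Rightarrow> real"
  assumes sm: "\<And>n. smooth_on UNIV (u n)"
    and bd: "\<And>j n t. j < n \<Longrightarrow> \<bar>(deriv ^^ j) (u n) t\<bar> \<le> (1/2) ^ n"
  shows "smooth_on UNIV (\<lambda>t. \<Sum>n. u n t)" "(deriv ^^ j) (\<lambda>t. \<Sum>n. u n t) = (\<lambda>t. \<Sum>n. (deriv ^^ j) (u n) t)"
proof -
  define W where "W j t = (\<Sum>n. (deriv ^^ j) (u n) t)" for j t
  have smb: "summable (\<lambda>n. (deriv ^^ j) (u n) t)" for j t
    by (rule summable_comparison_test_ev[where g="\<lambda>n. (1/2) ^ n"])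
      (use bd in \<open>auto simp: eventually_sequentially intro!: exI[of _ "Suc j"]\<close>)
  have dW: "(W j has_real_derivative W (Suc j) t) (at t)" for j t
    unfolding W_def
  proof (rule has_field_derivative_series'[of UNIV])
    show "((\<lambda>t. (deriv ^^ j) (u n) t) has_real_derivative (deriv ^^ Suc j) (u n) x) (at x within UNIV)" for n x
      using smooth_UNIV_deriv(1)[OF smooth_UNIV_higher_deriv[OF sm]] by simp
    have "uniform_limit UNIV (\<lambda>n x. \<Sum>i<n. (deriv ^^ Suc j) (u i) x) (\<lambda>x. \<Sum>i. (deriv ^^ Suc j) (u i) x) sequentially"
      by (rule Weierstrass_m_test_ev[where M="\<lambda>n. (1/2) ^ n"])
        (use bd in \<open>auto simp: eventually_sequentially simp del: funpow.simps intro!: exI[of _ "Suc (Suc j)"]\<close>)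
    then show "uniformly_convergent_on UNIV (\<lambda>n x. \<Sum>i<n. (deriv ^^ Suc j) (u i) x)"
      by (auto simp: uniformly_convergent_on_def)
  qed (use smb in auto)
  have smW: "\<forall>j. Ck_on k UNIV (W j)" for k
  proof (induction k)
    case 0 then show ?case
      using dW by (auto intro!: continuous_at_imp_continuous_on DERIV_isCont)
  next
    case (Suc k)
    show ?case
    proof
      fix j
      show "Ck_on (Suc k) UNIV (W j)"
        using dW Suc
        by (intro Ck_SucI[where f'="\<lambda>x v. W (Suc j) x * v"] Ck_on_bilinear[OF _ bounded_bilinear_mult] Ck_on_const)
          (auto simp: has_field_derivative_def)
    qed
  qed
  have W0: "W 0 = (\<lambda>t. \<Sum>n. u n t)" by (simp add: W_def fun_eq_iff)
  then show "smooth_on UNIV (\<lambda>t. \<Sum>n. u n t)" using smW by (metis smooth_on_def)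
  have "(deriv ^^ j) (W 0) = W j" for j
    by (induction j) (auto simp: deriv_UNIV_eq[OF dW])
  then show "(deriv ^^ j) (\<lambda>t. \<Sum>n. u n t) = (\<lambda>t. \<Sum>n. (deriv ^^ j) (u n) t)"
    unfolding W0 by (simp add: W_def fun_eq_iff)
qed

lemma higher_deriv_linear:
  assumes "smooth_on UNIV f" "smooth_on UNIV g"
  shows "(deriv ^^ j) (\<lambda>t::real. a * f t + b * g t) = (\<lambda>t::real. a * (deriv ^^ j) f t + b * (deriv ^^ j) g t :: real)"
  using assms
proof (induction j arbitrary: f g)
  case (Suc j)
  have "deriv (\<lambda>t. a * f t + b * g t) = (\<lambda>t. a * deriv f t + b * deriv g t)"
    by (intro deriv_UNIV_eq) (auto intro!: derivative_eq_intros smooth_UNIV_deriv(1) Suc.prems)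
  then show ?case
    by (simp add: funpow_Suc_right Suc.IH smooth_UNIV_deriv(2) Suc.prems del: funpow.simps)
qed simp

lemma sin_cos_smooth: "smooth_on UNIV (\<lambda>t::real. sin (r * t))" "smooth_on UNIV (\<lambda>t::real. cos (r * t))"
proof -
  have "Ck_on k UNIV (\<lambda>t::real. sin (r * t)) \<and> Ck_on k UNIV (\<lambda>t::real. cos (r * t))" for k
  proof (induction k)
    case 0 then show ?case by (auto intro!: continuous_intros)
  next
    case (Suc k)
    have "Ck_on k UNIV (\<lambda>t. cos (r * t) * (r * v))" "Ck_on k UNIV (\<lambda>t. sin (r * t) * (- r * v))" for v
      by (rule Ck_on_bilinear[OF open_UNIV bounded_bilinear_mult Suc[THEN conjunct2] Ck_on_const[OF open_UNIV]],
          rule Ck_on_bilinear[OF open_UNIV bounded_bilinear_mult Suc[THEN conjunct1] Ck_on_const[OF open_UNIV]])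
    then show ?case
      by (intro conjI Ck_SucI[where f'="\<lambda>t v. cos (r * t) * (r * v)"] Ck_SucI[where f'="\<lambda>t v. sin (r * t) * (- r * v)"])
        (auto intro!: derivative_eq_intros)
  qed
  then show "smooth_on UNIV (\<lambda>t::real. sin (r * t))" "smooth_on UNIV (\<lambda>t::real. cos (r * t))"
    by (auto simp: smooth_on_def)
qed

lemma smooth_on_power: "open S \<Longrightarrow> smooth_on S f \<Longrightarrow> smooth_on S (\<lambda>x. f x ^ n :: real)"
  by (induction n) (auto intro!: smooth_on_const smooth_on_bilinear[OF _ bounded_bilinear_mult])

text \<open>Each derivative replaces a product of \<open>n\<close> sines and cosines by two such
  products with factors \<open>r * p\<close> and \<open>r * q\<close>, whose sum is
  \<open>r * n\<close>.\<close>

lemma sin_cos_power_deriv_bound: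
  assumes "r \<ge> 0"
  shows "p + q = n \<Longrightarrow> \<bar>(deriv ^^ j) (\<lambda>t. sin (r * t) ^ p * cos (r * t) ^ q) t\<bar> \<le> (r * real n) ^ j"
proof (induction j arbitrary: p q t)
  case 0
  have "\<bar>sin (r * t)\<bar> ^ p * \<bar>cos (r * t)\<bar> ^ q \<le> 1 * 1"
    by (intro mult_mono power_le_one) auto
  then show ?case by (simp add: abs_mult power_abs)
next
  case (Suc j)
  let ?G = "\<lambda>p q t. sin (r * t) ^ p * cos (r * t) ^ q"
  have sm: "smooth_on UNIV (?G p q)" for p q
    by (intro smooth_on_bilinear[OF _ bounded_bilinear_mult] smooth_on_power sin_cos_smooth) auto
  have d: "deriv (?G p q) = (\<lambda>t. (r * real p) * ?G (p - 1) (q + 1) t + (- r * real q) * ?G (p + 1) (q - 1) t)"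
  proof (rule deriv_UNIV_eq)
    show "(?G p q has_real_derivative (r * real p) * ?G (p - 1) (q + 1) t + (- r * real q) * ?G (p + 1) (q - 1) t) (at t)" for t
      by (auto intro!: derivative_eq_intros simp: algebra_simps)
  qed
  have b1: "\<bar>(r * real p) * (deriv ^^ j) (?G (p - 1) (q + 1)) t\<bar> \<le> (r * real p) * (r * real n) ^ j"
  proof (cases "p = 0")
    case False
    then show ?thesis using Suc.IH[of "p - 1" "q + 1" t] Suc.prems assms
      by (simp only: abs_mult) (auto intro!: mult_left_mono)
  qed simp
  have b2: "\<bar>(- r * real q) * (deriv ^^ j) (?G (p + 1) (q - 1)) t\<bar> \<le> (r * real q) * (r * real n) ^ j"
  proof (cases "q = 0")
    case False
    then show ?thesis using Suc.IH[of "p + 1" "q - 1" t] Suc.prems assms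
      by (simp only: abs_mult) (auto intro!: mult_left_mono)
  qed simp
  have "(deriv ^^ Suc j) (?G p q) t = (r * real p) * (deriv ^^ j) (?G (p - 1) (q + 1)) t + (- r * real q) * (deriv ^^ j) (?G (p + 1) (q - 1)) t"
    by (simp only: funpow_Suc_right comp_apply d higher_deriv_linear[OF sm sm])
  then have "\<bar>(deriv ^^ Suc j) (?G p q) t\<bar> \<le> (r * real p) * (r * real n) ^ j + (r * real q) * (r * real n) ^ j"
    using b1 b2 by linarith
  also have "\<dots> = (r * real n) ^ Suc j" using Suc.prems by (simp add: algebra_simps flip: of_nat_add distrib_left distrib_right)
  finally show ?case .
qed

text \<open>For \<open>j < n\<close> the derivative of order \<open>j\<close> of the term is at most
  \<open>\<bar>c\<bar> / r ^ n * (r * n) ^ j\<close>, hence at most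
  \<open>\<bar>c\<bar> * n ^ n / r\<close> when \<open>r \<ge> 1\<close>. The rate makes this at
  most \<open>(1/2) ^ n\<close>; the summand 1 ensures \<open>r \<ge> 1\<close>.\<close>

definition borel_rate :: "nat \<Rightarrow> real \<Rightarrow> real" where
  "borel_rate n c = 1 + \<bar>c\<bar> * real n ^ n * 2 ^ n"

definition borel_term :: "nat \<Rightarrow> real \<Rightarrow> real \<Rightarrow> real" where
  "borel_term n c t = (c / borel_rate n c ^ n) * sin (borel_rate n c * t) ^ n"

text \<open>The \<open>n\<close>-th term has a zero of order \<open>n\<close> at the origin, so the coefficients of the series
  realizing a given formal power series are found recursively.\<close>

fun borel_coeff :: "real fps \<Rightarrow> nat \<Rightarrow> real" where
  "borel_coeff A m = A $$ m - (\<Sum>n\<in>{..<m}. jet (borel_term n (borel_coeff A n)) $$ m)"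

declare borel_coeff.simps [simp del]

lemma borel_rate_ge: "borel_rate n c \<ge> 1" by (simp add: borel_rate_def)

lemma borel_term_smooth: "smooth_on UNIV (borel_term n c)"
  unfolding borel_term_def
  by (intro smooth_on_bilinear[OF _ bounded_bilinear_mult] smooth_on_power sin_cos_smooth smooth_on_const) auto

lemma borel_term_bound:
  assumes "j < n" shows "\<bar>(deriv ^^ j) (borel_term n c) t\<bar> \<le> (1/2) ^ n"
proof -
  define r where "r = borel_rate n c"
  have r: "r \<ge> 1" "r \<ge> \<bar>c\<bar> * real n ^ n * 2 ^ n" by (auto simp: r_def borel_rate_def)
  have sm: "smooth_on UNIV (\<lambda>t. sin (r * t) ^ n)" by (intro smooth_on_power sin_cos_smooth) auto
  have "borel_term n c = (\<lambda>t. (c / r ^ n) * sin (r * t) ^ n + 0 * sin (r * t) ^ n)"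
    by (auto simp: borel_term_def r_def)
  then have "(deriv ^^ j) (borel_term n c) t = (c / r ^ n) * (deriv ^^ j) (\<lambda>t. sin (r * t) ^ n) t"
    using higher_deriv_linear[OF sm sm, of j "c / r ^ n" 0] by simp
  then have "\<bar>(deriv ^^ j) (borel_term n c) t\<bar> = \<bar>c\<bar> / r ^ n * \<bar>(deriv ^^ j) (\<lambda>t. sin (r * t) ^ n) t\<bar>"
    using r by (simp add: abs_mult)
  also have "\<dots> \<le> \<bar>c\<bar> / r ^ n * (r * real n) ^ j"
    using sin_cos_power_deriv_bound[of r n 0 n j t] r by (intro mult_left_mono) auto
  also have "\<dots> \<le> \<bar>c\<bar> / r ^ n * (r ^ (n - 1) * real n ^ n)"
  proof (intro mult_left_mono)
    have "r ^ j \<le> r ^ (n - 1)" using r assms by (intro power_increasing) auto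
    moreover have "real n ^ j \<le> real n ^ n" using assms by (intro power_increasing) auto
    ultimately show "(r * real n) ^ j \<le> r ^ (n - 1) * real n ^ n"
      using r by (auto simp: power_mult_distrib intro!: mult_mono)
  qed (use r in auto)
  also have "\<dots> = \<bar>c\<bar> * real n ^ n / r" using assms r by (cases n) auto
  also have "\<dots> \<le> (1/2) ^ n" using r by (simp add: field_simps power_divide)
  finally show ?thesis .
qed

lemma smooth_on_UNIV_germ: "smooth_on UNIV f \<Longrightarrow> smooth_germ f"
  by (rule smooth_germI[of UNIV]) auto

lemma borel_term_jet:
  "m < n \<Longrightarrow> jet (borel_term n c) $$ m = 0" "jet (borel_term n c) $$ n = c"
proof -
  define r where "r = borel_rate n c"
  have r: "r \<noteq> 0" using borel_rate_ge[of n c] by (simp add: r_def)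
  have sm: "smooth_germ (\<lambda>t. sin (r * t))" by (intro smooth_on_UNIV_germ sin_cos_smooth)
  have "jet (borel_term n c) = jet (\<lambda>t. (c / r ^ n) * sin (r * t) ^ n)"
    by (rule jet_cong) (simp add: borel_term_def r_def)
  then have j: "jet (borel_term n c) = fps_const (c / r ^ n) * jet (\<lambda>t. sin (r * t)) ^ n"
    by (simp only: jet_cmult[OF smooth_germ_power[OF sm]] jet_power[OF sm])
  have 0: "jet (\<lambda>t. sin (r * t)) $$ 0 = 0" by simp
  have "deriv (\<lambda>t. sin (r * t)) 0 = r" by (rule DERIV_imp_deriv) (auto intro!: derivative_eq_intros)
  then have 1: "jet (\<lambda>t. sin (r * t)) $$ 1 = r" by (simp add: jet_def)
  show "m < n \<Longrightarrow> jet (borel_term n c) $$ m = 0"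
    unfolding j using startsby_zero_power_prefix[OF 0] by simp
  show "jet (borel_term n c) $$ n = c"
    unfolding j using startsby_zero_power_nth_same[OF 0, of n] r unfolding 1 by simp
qed

theorem borel:
  obtains f where "smooth_on UNIV f" "jet f = A"
proof -
  define u where "u n = borel_term n (borel_coeff A n)" for n
  let ?f = "\<lambda>t. \<Sum>n. u n t"
  have ser: "smooth_on UNIV ?f" "(deriv ^^ j) ?f = (\<lambda>t. \<Sum>n. (deriv ^^ j) (u n) t)" for j
    using smooth_series[of u] borel_term_smooth borel_term_bound unfolding u_def by auto
  have "jet ?f $$ m = A $$ m" for m
  proof -
    have u: "(deriv ^^ m) (u n) 0 = fact m * jet (u n) $$ m" for n by (simp add: jet_def)
    have "(deriv ^^ m) ?f 0 = (\<Sum>n. fact m * jet (u n) $$ m)" unfolding ser(2) u ..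
    also have "\<dots> = (\<Sum>n\<in>{..m}. fact m * jet (u n) $$ m)"
      by (rule suminf_finite) (auto simp: u_def borel_term_jet(1))
    finally have "jet ?f $$ m = (\<Sum>n\<in>{..m}. jet (u n) $$ m)"
      by (simp add: jet_def flip: sum_distrib_left sum_divide_distrib)
    also have "\<dots> = (\<Sum>n\<in>{..<m}. jet (u n) $$ m) + borel_coeff A m"
      by (simp add: lessThan_Suc_atMost[symmetric] u_def borel_term_jet(2))
    also have "\<dots> = A $$ m" by (simp add: borel_coeff.simps[of A m] u_def)
    finally show ?thesis .
  qed
  then show thesis using that[OF ser(1)] by (simp add: fps_eq_iff)
qed

text \<open>A function whose Taylor series has only exponents divisible by 3 is
  \<open>h 0 + t ^ 3 * q t\<close>, where \<open>q\<close> is of the same kind. The derivative of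
  \<open>h (root 3 u)\<close> is again such a function of the cube root, so the induction closes
  although the root itself is not differentiable at 0.\<close>

lemma Ck_on_cube_root:
  assumes "r > 0"
  shows "smooth_on (ball 0 r) h \<Longrightarrow> (\<And>j. \<not> 3 dvd j \<Longrightarrow> jet h $$ j = 0) \<Longrightarrow>
    Ck_on k (ball 0 (r ^ 3)) (\<lambda>u. h (root 3 u))"
proof (induction k arbitrary: h)
  have root: "root 3 u \<in> ball 0 r" if "u \<in> ball 0 (r ^ 3)" for u
  proof -
    have "root 3 \<bar>u\<bar> < root 3 (r ^ 3)" using that by simp
    then show ?thesis using assms by (simp add: real_root_abs real_root_pos2)
  qed
  have croot: "continuous_on X (root 3)" for X
    by (intro continuous_on_real_root continuous_on_id)
  {
    case 0 then show ?case
      using root by (auto intro!: continuous_on_compose2[OF smooth_on_continuous_on croot])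
  next
    case (Suc k)
    have germ: "smooth_germ f" if "smooth_on (ball 0 r) f" for f :: "real \<Rightarrow> real"
      using smooth_germI[OF _ _ that] assms by simp
    have div: "\<exists>g. smooth_on (ball 0 r) g \<and> (\<forall>t\<in>ball 0 r. f t = t * g t) \<and> (\<forall>j. jet g $$ j = jet f $$ Suc j)"
      if f: "smooth_on (ball 0 r) f" "f 0 = 0" for f
    proof -
      obtain g where g: "smooth_on (ball 0 r) g" "\<And>t. t \<in> ball 0 r \<Longrightarrow> f t = t * g t"
        using smooth_on_divide[OF f] by blast
      have "jet f = fps_X * jet g"
        using jet_cong[OF eventually_ball[OF assms g(2)]] germ[OF g(1)] by (simp add: sg)
      then show ?thesis using g by auto
    qed
    have h1: "smooth_on (ball 0 r) (\<lambda>t. h t + - h 0)"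
      by (intro smooth_on_add smooth_on_const Suc.prems open_ball)
    have j1: "jet (\<lambda>t. h t + - h 0) = jet h + fps_const (- h 0)"
      using germ[OF Suc.prems(1)] by (simp only: jet_add jet_const sg)
    obtain a where a: "smooth_on (ball 0 r) a" "\<And>t. t \<in> ball 0 r \<Longrightarrow> h t + - h 0 = t * a t"
        "\<And>j. jet a $$ j = jet h $$ Suc j"
      using div[OF h1] unfolding j1 by auto
    have "a 0 = 0" using a(3)[of 0] Suc.prems(2)[of 1] by simp
    then obtain b where b: "smooth_on (ball 0 r) b" "\<And>t. t \<in> ball 0 r \<Longrightarrow> a t = t * b t"
        "\<And>j. jet b $$ j = jet a $$ Suc j"
      using div[OF a(1)] by auto
    have "jet h $$ 2 = 0" using Suc.prems(2)[of 2] by simp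
    then have "b 0 = 0" using b(3)[of 0] a(3)[of 1] by (simp add: numeral_2_eq_2)
    then obtain q where q: "smooth_on (ball 0 r) q" "\<And>t. t \<in> ball 0 r \<Longrightarrow> b t = t * q t"
        "\<And>j. jet q $$ j = jet b $$ Suc j"
      using div[OF b(1)] by auto
    have hq: "h t = h 0 + t ^ 3 * q t" if "t \<in> ball 0 r" for t
      using a(2)[OF that] b(2)[OF that] q(2)[OF that] by (simp add: power3_eq_cube algebra_simps)
    have jq: "jet q $$ j = jet h $$ (j + 3)" for j
      using a(3)[of "Suc (Suc j)"] b(3)[of "Suc j"] q(3)[of j] by (simp add: numeral_3_eq_3)
    \<comment> \<open>The quotient of \<open>deriv h t = 3 * t ^ 2 * q t + t ^ 3 * deriv q t\<close>
      by the derivative \<open>3 * t ^ 2\<close> of \<open>t ^ 3\<close>, in a form that is smooth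
      at 0.\<close>
    define h2 where "h2 t = q t + (t * (1/3)) * deriv q t" for t
    have sq': "smooth_on (ball 0 r) (deriv q)" by (rule smooth_on_deriv[OF open_ball q(1)])
    have sh2: "smooth_on (ball 0 r) h2"
      unfolding h2_def
      by (intro smooth_on_add smooth_on_bilinear[OF _ bounded_bilinear_mult] smooth_on_id smooth_on_const q(1) sq' open_ball)
    have jh2: "jet h2 $$ j = 0" if "\<not> 3 dvd j" for j
    proof -
      have "jet h2 = jet q + fps_const (1/3) * (fps_X * jet (deriv q))"
        using germ[OF q(1)] germ[OF sq'] by (simp add: h2_def[abs_def] sg)
      moreover have "jet q $$ j = 0" using that jq[of j] Suc.prems(2)[of "j + 3"] by simp
      ultimately show ?thesis by (cases j) (auto simp: fps_deriv_jet[symmetric])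
    qed
    have der: "((\<lambda>u. h (root 3 u)) has_real_derivative h2 (root 3 u)) (at u)" if u: "u \<in> ball 0 (r ^ 3)" for u
    proof (cases "u = 0")
      case False
      define t where "t = root 3 u"
      have t: "t \<noteq> 0" "t \<in> ball 0 r" using False root[OF u] by (auto simp: t_def)
      have "(q has_real_derivative deriv q t) (at t)"
        by (rule has_real_derivative_deriv[OF smooth_on_differentiable[OF q(1) t(2)]])
      then have "((\<lambda>t. h 0 + t ^ 3 * q t) has_real_derivative (3 * t ^ 2 * q t + t ^ 3 * deriv q t)) (at t)"
        by (auto intro!: derivative_eq_intros)
      then have "(h has_real_derivative (3 * t ^ 2 * q t + t ^ 3 * deriv q t)) (at t)"
        by (rule has_field_derivative_transform_within_open[OF _ open_ball t(2)]) (rule hq[symmetric])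
      moreover have "(root 3 has_real_derivative inverse (3 * t ^ 2)) (at u)"
        using DERIV_odd_real_root[of 3 u] False by (simp add: t_def)
      ultimately have "((\<lambda>u. h (root 3 u)) has_real_derivative (3 * t ^ 2 * q t + t ^ 3 * deriv q t) * inverse (3 * t ^ 2)) (at u)"
        unfolding t_def by (rule DERIV_chain2)
      moreover have "(3 * t ^ 2 * q t + t ^ 3 * deriv q t) * inverse (3 * t ^ 2) = h2 t"
        using t(1) by (simp add: h2_def field_simps power3_eq_cube power2_eq_square)
      ultimately show ?thesis by (simp add: t_def)
    next
      case True
      have "isCont q 0"
        using smooth_on_continuous_on[OF q(1)] assms by (simp add: continuous_on_eq_continuous_at)
      then have "isCont (\<lambda>u. q (root 3 u)) 0"
        using isCont_o2[of 0 "root 3" q] isCont_real_root[of 0 3] by simp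
      then have l: "((\<lambda>u. q (root 3 u)) \<longlongrightarrow> q 0) (at 0)" by (simp add: isCont_def)
      have "\<forall>\<^sub>F u in at 0. q (root 3 u) = (h (root 3 u) - h (root 3 0)) / (u - 0)"
      proof -
        have "\<forall>\<^sub>F u in at 0. u \<in> ball 0 (r ^ 3)" 
          using assms by (intro eventually_at_in_open') auto
        moreover have "\<forall>\<^sub>F u in at 0. u \<noteq> (0::real)" by (rule eventually_neq_at_within)
        ultimately show ?thesis
        proof eventually_elim
          case (elim u)
          have "h (root 3 u) = h 0 + u * q (root 3 u)" using hq[OF root[OF elim(1)]] by (simp add: odd_real_root_pow)
          then show ?case using elim(2) by simp
        qed
      qed
      then have "((\<lambda>u. (h (root 3 u) - h (root 3 0)) / (u - 0)) \<longlongrightarrow> q 0) (at 0)"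
        using l by (rule tendsto_cong[THEN iffD1])
      then show ?thesis unfolding True has_field_derivative_iff by (simp add: h2_def)
    qed
    show ?case
    proof (rule Ck_SucI[OF open_ball, where f'="\<lambda>u v. h2 (root 3 u) * v"])
      show "((\<lambda>u. h (root 3 u)) has_derivative (*) (h2 (root 3 u))) (at u)" if "u \<in> ball 0 (r ^ 3)" for u
        using der[OF that] by (simp add: has_field_derivative_def)
      show "Ck_on k (ball 0 (r ^ 3)) (\<lambda>u. h2 (root 3 u) * v)" for v
        by (rule Ck_on_bilinear[OF open_ball bounded_bilinear_mult Suc.IH[OF sh2 jh2] Ck_on_const[OF open_ball]])
    qed
  }
qed

lemma smooth_function_of_cube:
  assumes "smooth_germ h" "\<And>j. \<not> 3 dvd j \<Longrightarrow> jet h $$ j = 0"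
  obtains g where "smooth_germ g" "\<forall>\<^sub>F t in nhds 0. h t = g (t ^ 3)"
proof -
  obtain r where r: "r > 0" "smooth_on (ball 0 r) h" by (rule smooth_germ_ball[OF assms(1)])
  have "smooth_on (ball 0 (r ^ 3)) (\<lambda>u. h (root 3 u))"
    unfolding smooth_on_def using Ck_on_cube_root[OF r assms(2)] by blast
  then have "smooth_germ (\<lambda>u. h (root 3 u))" using r(1) by (intro smooth_germI[of "ball 0 (r ^ 3)"]) auto
  moreover have "h t = h (root 3 (t ^ 3))" for t by (simp add: odd_real_root_power_cancel)
  ultimately show thesis using that by (simp add: eventuallyI)
qed

text \<open>Borel's theorem realizes the exponents congruent to 1 and 2 modulo 3 by functions of
  \<open>t ^ 3\<close>. After subtracting them only multiples of 3 remain, and the rest, flat part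
  included, is a smooth function of \<open>t ^ 3\<close>. On the cusp \<open>t ^ 3\<close> is the
  coordinate \<open>z\<close>.\<close>

theorem cubic_decomposition:
  assumes "smooth_germ h" "\<And>j. j < k \<Longrightarrow> jet h $$ j = 0"
  obtains K0 K1 K2 where "smooth_germ K0" "smooth_germ K1" "smooth_germ K2"
    "\<forall>\<^sub>F t in nhds 0. h t = t ^ k * K0 (t ^ 3) + t ^ (k + 1) * K1 (t ^ 3) + t ^ (k + 2) * K2 (t ^ 3)"
proof -
  obtain g where g: "smooth_germ g" "\<forall>\<^sub>F t in nhds 0. h t = t ^ k * g t"
    using jet_zero_divide[OF assms] by blast
  obtain K1 where "smooth_on UNIV K1" and j1: "jet K1 = Abs_fps (\<lambda>n. jet g $$ (3 * n + 1))" by (rule borel)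
  then have K1: "smooth_germ K1" by (intro smooth_on_UNIV_germ)
  obtain K2 where "smooth_on UNIV K2" and j2: "jet K2 = Abs_fps (\<lambda>n. jet g $$ (3 * n + 2))" by (rule borel)
  then have K2: "smooth_germ K2" by (intro smooth_on_UNIV_germ)
  define h0 where "h0 t = g t - t * K1 (t ^ 3) - t ^ 2 * K2 (t ^ 3)" for t
  have t3: "smooth_germ (\<lambda>t::real. t ^ 3)" by (intro sg)
  have sK: "smooth_germ (\<lambda>t. K1 (t ^ 3))" "smooth_germ (\<lambda>t. K2 (t ^ 3))"
    by (rule smooth_germ_compose[OF K1 t3], simp) (rule smooth_germ_compose[OF K2 t3], simp)
  have jK: "jet (\<lambda>t. K1 (t ^ 3)) = jet K1 oo fps_X ^ 3" "jet (\<lambda>t. K2 (t ^ 3)) = jet K2 oo fps_X ^ 3"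
    using jet_compose[OF K1 t3] jet_compose[OF K2 t3] by (simp_all add: sg)
  have h0: "smooth_germ h0" unfolding h0_def by (intro sg sK g)
  have jh0: "jet h0 = jet g - fps_X * (jet K1 oo fps_X ^ 3) - fps_X ^ 2 * (jet K2 oo fps_X ^ 3)"
    unfolding h0_def using g sK by (simp add: sg jK)
  have "jet h0 $$ j = 0" if "\<not> 3 dvd j" for j
  proof -
    have "j mod 3 = 1 \<or> j mod 3 = 2" using that by (auto simp: dvd_eq_mod_eq_0)
    then show ?thesis
    proof
      assume j: "j mod 3 = 1"
      define n where "n = j div 3"
      have "j = 3 * n + 1" using j unfolding n_def by (metis mult_div_mod_eq)
      then show ?thesis
        by (cases n) (auto simp: jh0 fps_X_power_mult_nth fps_compose_X_power_nth j1 dvd_def; presburger)+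
    next
      assume j: "j mod 3 = 2"
      define n where "n = j div 3"
      have "j = 3 * n + 2" using j unfolding n_def by (metis mult_div_mod_eq)
      then show ?thesis
        by (cases n) (auto simp: jh0 fps_X_power_mult_nth fps_compose_X_power_nth j2 dvd_def; presburger)+
    qed
  qed
  then obtain K0 where K0: "smooth_germ K0" "\<forall>\<^sub>F t in nhds 0. h0 t = K0 (t ^ 3)"
    using smooth_function_of_cube[OF h0] by blast
  have "\<forall>\<^sub>F t in nhds 0. h t = t ^ k * K0 (t ^ 3) + t ^ (k + 1) * K1 (t ^ 3) + t ^ (k + 2) * K2 (t ^ 3)"
    using g(2) K0(2)
  proof eventually_elim
    case (elim t)
    have "g t = K0 (t ^ 3) + t * K1 (t ^ 3) + t ^ 2 * K2 (t ^ 3)" using elim(2) by (simp add: h0_def)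
    then show ?case using elim(1) by (simp add: algebra_simps power_add power2_eq_square)
  qed
  then show thesis using that K0(1) K1 K2 by blast
qed

section \<open>One-forms on the germ\<close>

lemma hadamard_sum:
  fixes f :: "'a::euclidean_space \<Rightarrow> real"
  assumes "smooth_germ f"
  obtains g where "\<And>b. smooth_germ (g b)" "\<forall>\<^sub>F x in nhds 0. f x = f 0 + (\<Sum>b\<in>Basis. (x \<bullet> b) * g b x)"
proof -
  obtain r where r: "r > 0" "smooth_on (ball 0 r) f" by (rule smooth_germ_ball[OF assms])
  define g where "g b x = integral {0..1} (\<lambda>s. D f (0 + s *\<^sub>R x) b)" for b x
  have dom: "0 + s *\<^sub>R x \<in> ball 0 r" if "x \<in> ball 0 r" "s \<in> {0..1}" for s and x :: 'a
  proof -
    have "\<bar>s\<bar> * norm x \<le> norm x" using that by (auto intro: mult_left_le_one_le)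
    then show ?thesis using that by auto
  qed
  have "f x = f 0 + (\<Sum>b\<in>Basis. (x \<bullet> b) * g b x)" if x: "x \<in> ball 0 r" for x
  proof -
    have "f x - f 0 = integral {0..1} (\<lambda>s. D f (0 + s *\<^sub>R x) x)"
      using integral_along_segment[OF r(2) dom[OF x]] by simp
    also have "\<dots> = integral {0..1} (\<lambda>s. \<Sum>b\<in>Basis. (x \<bullet> b) *\<^sub>R D f (0 + s *\<^sub>R x) b)"
      by (rule integral_cong)
        (rule linear_basis_sum[OF has_derivative_linear[OF smooth_on_has_derivative[OF r(2) dom[OF x]]]])
    also have "\<dots> = (\<Sum>b\<in>Basis. integral {0..1} (\<lambda>s. (x \<bullet> b) *\<^sub>R D f (0 + s *\<^sub>R x) b))"
    proof (intro integral_sum integrable_continuous_real continuous_on_scaleR continuous_on_const)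
      fix b
      have "continuous_on {0..1} (\<lambda>s. 0 + s *\<^sub>R x)" by (intro continuous_intros)
      then show "continuous_on {0..1} (\<lambda>s. D f (0 + s *\<^sub>R x) b)"
        by (rule continuous_on_compose2[OF smooth_on_continuous_on[OF smooth_on_D[OF r(2)]]]) (use dom[OF x] in blast)
    qed auto
    finally show ?thesis by (simp add: g_def)
  qed
  moreover have "smooth_germ (g b)" for b
    unfolding g_def by (intro smooth_germ_integral[where f="\<lambda>x. D f x b"] bounded_linear_zero bounded_linear_ident sg assms)
  ultimately show thesis by (intro that[of g] eventually_ball[OF r(1)])
qed

section \<open>The germ in three-space and its two branches\<close>

type_synonym R3 = "real \<times> real \<times> real"

abbreviation X :: "R3 \<Rightarrow> real" where "X p \<equiv> fst p"
abbreviation Y :: "R3 \<Rightarrow> real" where "Y p \<equiv> fst (snd p)"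
abbreviation Z :: "R3 \<Rightarrow> real" where "Z p \<equiv> snd (snd p)"

abbreviation e1 :: R3 where "e1 \<equiv> (1, 0, 0)"
abbreviation e2 :: R3 where "e2 \<equiv> (0, 1, 0)"
abbreviation e3 :: R3 where "e3 \<equiv> (0, 0, 1)"

lemma R3_sum_Basis: "(\<Sum>b\<in>Basis. f (b::R3)) = f e1 + f e2 + f e3"
  by (simp add: Basis_prod_def sum.union_disjoint sum.reindex inj_on_def image_Un image_image zero_prod_def add_ac)

lemma R3_linear: "linear L \<Longrightarrow> L (p::R3) = X p *\<^sub>R L e1 + Y p *\<^sub>R L e2 + Z p *\<^sub>R L e3"
  by (subst linear_basis_sum) (simp_all add: R3_sum_Basis inner_prod_def)

definition cusp :: "real \<Rightarrow> R3" where "cusp t = (t ^ 5, - (t ^ 7), t ^ 3)"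
definition line :: "real \<Rightarrow> R3" where "line t = (0, t, 0)"

definition N9 :: "R3 set" where "N9 = {(x, y, z). x\<^sup>2 + y * z = 0 \<and> x * y + z ^ 4 = 0}"

lemma cusp_simps [simp]: "X (cusp t) = t ^ 5" "Y (cusp t) = - (t ^ 7)" "Z (cusp t) = t ^ 3" "cusp 0 = 0"
  and line_simps [simp]: "X (line t) = 0" "Y (line t) = t" "Z (line t) = 0" "line 0 = 0"
  by (simp_all add: cusp_def line_def zero_prod_def)

lemma cusp_in_N9: "cusp t \<in> N9" and line_in_N9: "line t \<in> N9"
  by (simp_all add: N9_def cusp_def line_def flip: power_mult power_add)

lemma N9_cases:
  assumes "p \<in> N9" obtains t where "p = cusp t" | t where "p = line t"
proof -
  obtain x y z where p: "p = (x, y, z)" by (cases p)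
  have eq: "x\<^sup>2 + y * z = 0" "x * y + z ^ 4 = 0" using assms by (auto simp: N9_def p)
  show thesis
  proof (cases "x = 0")
    case True
    then have "z = 0" using eq by simp
    then show thesis using True that(2)[of y] by (simp add: p line_def)
  next
    case False
    have y: "y = - (z ^ 4) / x" using eq(2) False by (simp add: field_simps)
    have xz: "x ^ 3 = z ^ 5"
      using eq(1) False unfolding y by (simp add: field_simps power2_eq_square power3_eq_cube eval_nat_numeral)
    then have z: "z \<noteq> 0" using False by (metis power_eq_0_iff zero_neq_numeral zero_power2 power_zero_numeral)
    \<comment> \<open>On the cusp \<open>z\<^sup>2 / x\<close> is
      \<open>t ^ 6 / t ^ 5\<close>.\<close>
    define t where "t = z\<^sup>2 / x"
    have "t ^ 3 = z ^ 6 / x ^ 3" by (simp add: t_def power_divide flip: power_mult)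
    then have "t ^ 3 = z ^ 6 / z ^ 5" by (simp only: xz)
    then have t3: "t ^ 3 = z" using z by (simp add: eval_nat_numeral)
    have "t ^ 2 = z ^ 4 / x ^ 2" by (simp add: t_def power_divide flip: power_mult)
    then have t5: "t ^ 5 = x"
    proof -
      have "t ^ 5 = t ^ 3 * t ^ 2" by (simp flip: power_add)
      also have "\<dots> = z ^ 5 / x ^ 2" using t3 \<open>t ^ 2 = z ^ 4 / x ^ 2\<close> by (simp add: eval_nat_numeral)
      also have "\<dots> = x" using False by (simp flip: xz) (simp add: eval_nat_numeral)
      finally show ?thesis .
    qed
    have "t ^ 7 = t ^ 5 * t ^ 2" by (simp flip: power_add)
    also have "\<dots> = - y" using t5 \<open>t ^ 2 = z ^ 4 / x ^ 2\<close> False by (simp add: y power2_eq_square)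
    finally show thesis using that(1)[of t] t3 t5 by (simp add: p cusp_def)
  qed
qed

lemma smooth_cusp [sg]: "smooth_germ cusp" and smooth_line [sg]: "smooth_germ line"
  unfolding cusp_def[abs_def] line_def[abs_def] by (intro sg)+

text \<open>On the cusp \<open>\<bar>Z p\<bar>\<close> is the cube of the parameter, on the line
  \<open>\<bar>Y p\<bar>\<close> is the parameter; so points of \<open>N9\<close> near 0 have
  parameters near 0.\<close>

lemma eventually_N9:
  assumes "\<forall>\<^sub>F t in nhds 0. P (cusp t)" "\<forall>\<^sub>F t in nhds 0. P (line t)"
  shows "\<forall>\<^sub>F p in nhds 0. p \<in> N9 \<longrightarrow> P p"
proof -
  obtain d where d: "d > 0" "\<And>t. \<bar>t\<bar> < d \<Longrightarrow> P (cusp t)" "\<And>t. \<bar>t\<bar> < d \<Longrightarrow> P (line t)"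
  proof -
    have "\<forall>\<^sub>F t in nhds 0. P (cusp t) \<and> P (line t)" using assms by (rule eventually_conj)
    then show thesis using that by (auto simp: eventually_nhds_metric dist_norm)
  qed
  have n: "\<bar>Y p\<bar> \<le> norm p" "\<bar>Z p\<bar> \<le> norm p" for p :: R3
    by (metis norm_fst_le norm_snd_le order_trans prod.collapse real_norm_def)+
  have "p \<in> N9 \<longrightarrow> P p" if p: "p \<in> ball 0 (min d (d ^ 3))" for p
  proof
    assume "p \<in> N9"
    then show "P p"
    proof (cases rule: N9_cases)
      case (1 t)
      have "\<bar>t\<bar> ^ 3 < d ^ 3" using n(2)[of p] p by (simp add: 1 power_abs)
      then have "\<bar>t\<bar> < d" using d(1) power_less_imp_less_base[of "\<bar>t\<bar>" 3 d] by simp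
      then show ?thesis using d 1 by simp
    next
      case (2 t)
      then show ?thesis using n(1)[of p] p d by simp
    qed
  qed
  then show ?thesis using d(1) by (intro eventually_ball[of "min d (d ^ 3)"]) auto
qed

lemma eventually_cusp: "\<forall>\<^sub>F p in nhds 0. P p \<Longrightarrow> \<forall>\<^sub>F t in nhds 0. P (cusp t)"
  and eventually_line: "\<forall>\<^sub>F p in nhds 0. P p \<Longrightarrow> \<forall>\<^sub>F t in nhds 0. P (line t)"
  by (auto intro: smooth_germ_eventually[OF smooth_cusp] smooth_germ_eventually[OF smooth_line])

abbreviation jc :: "(R3 \<Rightarrow> real) \<Rightarrow> real fps" where "jc f \<equiv> jet (\<lambda>t. f (cusp t))"
abbreviation jl :: "(R3 \<Rightarrow> real) \<Rightarrow> real fps" where "jl f \<equiv> jet (\<lambda>t. f (line t))"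

lemma smooth_on_cusp [sg]: "smooth_germ f \<Longrightarrow> smooth_germ (\<lambda>t. f (cusp t))"
  and smooth_on_line [sg]: "smooth_germ f \<Longrightarrow> smooth_germ (\<lambda>t. f (line t))"
  for f :: "R3 \<Rightarrow> 'b::real_normed_vector"
  using smooth_germ_compose[OF _ smooth_cusp, of f] smooth_germ_compose[OF _ smooth_line, of f] by simp_all

text \<open>Nine functionals on 1-forms, one for each weight, which vanish exactly on the forms that are exact along the germ.
  \<open>H\<^sub>i\<close> and \<open>K\<^sub>i\<close> are the Taylor series of the coefficients of the form on the cusp and on the line.\<close>

definition ellj :: "real fps \<Rightarrow> real fps \<Rightarrow> real fps \<Rightarrow> real fps \<Rightarrow> real fps \<Rightarrow> nat \<Rightarrow> real" where
  "ellj H1 H2 H3 K1 K3 w =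
    (if w = 8 then (H1 $$ 3 - H3 $$ 5) / 8
     else if w = 10 then (H2 $$ 3 + H3 $$ 7) / 10
     else if w = 11 then (2 * H1 $$ 6 - H3 $$ 8) / 11
     else if w = 12 then (H1 $$ 7 + H2 $$ 5) / 12
     else if w = 13 then (H1 $$ 8 - 4 * H2 $$ 6 - 2 * H3 $$ 10) / 13
     else if w = 14 then (3 * H1 $$ 9 - H3 $$ 11) / 14
     else if w = 16 then (H1 $$ 11 - 3 * H2 $$ 9 - H3 $$ 13) / 8
     else if w = 17 then (4 * H1 $$ 12 + 8 * H2 $$ 10 - H3 $$ 14 + 17 * K3 $$ 2) / 17
     else if w = 19 then (3 * H1 $$ 14 - 8 * H2 $$ 12 - 2 * H3 $$ 16 - 19 * K1 $$ 2) / 19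
     else 0)"

definition ell :: "(R3 \<Rightarrow> R3 \<Rightarrow> real) \<Rightarrow> nat \<Rightarrow> real" where
  "ell \<alpha> = ellj (jc (\<lambda>p. \<alpha> p e1)) (jc (\<lambda>p. \<alpha> p e2)) (jc (\<lambda>p. \<alpha> p e3)) (jl (\<lambda>p. \<alpha> p e1)) (jl (\<lambda>p. \<alpha> p e3))"

lemma ell_cong:
  assumes "\<forall>\<^sub>F p in nhds 0. p \<in> N9 \<longrightarrow> (\<forall>v. \<alpha> p v = \<beta> p v)"
  shows "ell \<alpha> = ell \<beta>"
proof -
  have "jc (\<lambda>p. \<alpha> p v) = jc (\<lambda>p. \<beta> p v)" "jl (\<lambda>p. \<alpha> p v) = jl (\<lambda>p. \<beta> p v)" for v
    by (rule jet_cong[OF eventually_mono[OF eventually_cusp[OF assms]]], metis cusp_in_N9)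
      (rule jet_cong[OF eventually_mono[OF eventually_line[OF assms]]], metis line_in_N9)
  then show ?thesis by (simp add: ell_def)
qed

lemma ell_cong_germ: "\<forall>\<^sub>F p in nhds 0. \<forall>v. \<alpha> p v = \<beta> p v \<Longrightarrow> ell \<alpha> = ell \<beta>"
  by (rule ell_cong) (auto elim: eventually_mono)

lemma ellj_add: "ellj (P1 + Q1) (P2 + Q2) (P3 + Q3) (R1 + S1) (R3 + S3) w = ellj P1 P2 P3 R1 R3 w + ellj Q1 Q2 Q3 S1 S3 w"
  and ellj_diff: "ellj (P1 - Q1) (P2 - Q2) (P3 - Q3) (R1 - S1) (R3 - S3) w = ellj P1 P2 P3 R1 R3 w - ellj Q1 Q2 Q3 S1 S3 w"
  and ellj_cmult: "ellj (fps_const c * P1) (fps_const c * P2) (fps_const c * P3) (fps_const c * R1) (fps_const c * R3) w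
    = c * ellj P1 P2 P3 R1 R3 w"
  and ellj_zero: "ellj 0 0 0 0 0 w = 0"
  by (simp_all add: ellj_def field_simps)

lemma ell_add:
  assumes "\<And>v. smooth_germ (\<lambda>p. \<alpha> p v)" "\<And>v. smooth_germ (\<lambda>p. \<beta> p v)"
  shows "ell (\<lambda>p v. \<alpha> p v + \<beta> p v) w = ell \<alpha> w + ell \<beta> w"
  by (simp add: ell_def ellj_add smooth_on_cusp[OF assms(1)] smooth_on_cusp[OF assms(2)]
      smooth_on_line[OF assms(1)] smooth_on_line[OF assms(2)])

lemma ell_diff:
  assumes "\<And>v. smooth_germ (\<lambda>p. \<alpha> p v)" "\<And>v. smooth_germ (\<lambda>p. \<beta> p v)"
  shows "ell (\<lambda>p v. \<alpha> p v - \<beta> p v) w = ell \<alpha> w - ell \<beta> w"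
  by (simp add: ell_def ellj_diff smooth_on_cusp[OF assms(1)] smooth_on_cusp[OF assms(2)]
      smooth_on_line[OF assms(1)] smooth_on_line[OF assms(2)])

lemma ell_cmult:
  assumes "\<And>v. smooth_germ (\<lambda>p. \<alpha> p v)"
  shows "ell (\<lambda>p v. c * \<alpha> p v) w = c * ell \<alpha> w"
  by (simp only: ell_def ellj_cmult jet_cmult smooth_on_cusp[OF assms] smooth_on_line[OF assms])

lemma ell_zero [simp]: "ell (\<lambda>p v. 0) w = 0"
  by (simp add: ell_def ellj_zero)

text \<open>\<open>wt N\<close> are the smooth functions of weight at least \<open>N\<close>, \<open>pol N\<close> the polynomials of weight below \<open>N\<close>,
  for the weights \<open>5, 7, 3\<close> of the coordinates.\<close>

inductive wt :: "nat \<Rightarrow> (R3 \<Rightarrow> real) \<Rightarrow> bool" for N where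
  wt_mono: "N \<le> 5 * i + 7 * j + 3 * k \<Longrightarrow> smooth_germ R \<Longrightarrow> wt N (\<lambda>p. X p ^ i * (Y p ^ j * (Z p ^ k * R p)))"
| wt_add: "wt N f \<Longrightarrow> wt N g \<Longrightarrow> wt N (\<lambda>p. f p + g p)"

inductive pol :: "nat \<Rightarrow> (R3 \<Rightarrow> real) \<Rightarrow> bool" for N where
  pol_zero: "pol N (\<lambda>p. 0)"
| pol_mono: "5 * i + 7 * j + 3 * k < N \<Longrightarrow> pol N (\<lambda>p. c * (X p ^ i * (Y p ^ j * Z p ^ k)))"
| pol_add: "pol N f \<Longrightarrow> pol N g \<Longrightarrow> pol N (\<lambda>p. f p + g p)"

lemma wt_smooth: "wt N f \<Longrightarrow> smooth_germ f"
  by (induction rule: wt.induct) (auto intro!: sg)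

lemma pol_smooth: "pol N f \<Longrightarrow> smooth_germ f"
  by (induction rule: pol.induct) (auto intro!: sg)

lemma pol_Suc: "pol N f \<Longrightarrow> pol (Suc N) f"
  by (induction rule: pol.induct) (auto intro: pol.intros)

text \<open>In a term of weight exactly \<open>N\<close> the factor \<open>R\<close> is split by
  Hadamard into its value at 0, leaving a monomial, and multiples of the coordinates, each of which
  raises the weight.\<close>

lemma wt_Suc:
  "wt N f \<Longrightarrow> \<exists>P Q. pol (Suc N) P \<and> wt (Suc N) Q \<and> (\<forall>\<^sub>F p in nhds 0. f p = P p + Q p)"
proof (induction rule: wt.induct)
  case (wt_mono i j k R)
  show ?case
  proof (cases "Suc N \<le> 5 * i + 7 * j + 3 * k")
    case True
    then show ?thesis
      using wt.wt_mono[OF True wt_mono(2)] pol_zero by (intro exI[of _ "\<lambda>p. 0"] exI conjI) auto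
  next
    case False
    obtain g where g: "\<And>b. smooth_germ (g b)" "\<forall>\<^sub>F p in nhds 0. R p = R 0 + (\<Sum>b\<in>Basis. (p \<bullet> b) * g b p)"
      using hadamard_sum[OF wt_mono(2)] by blast
    let ?P = "\<lambda>p. R 0 * (X p ^ i * (Y p ^ j * Z p ^ k))"
    let ?Q = "\<lambda>p. X p ^ Suc i * (Y p ^ j * (Z p ^ k * g e1 p)) + (X p ^ i * (Y p ^ Suc j * (Z p ^ k * g e2 p))
       + X p ^ i * (Y p ^ j * (Z p ^ Suc k * g e3 p)))"
    have "pol (Suc N) ?P" using False by (intro pol_mono) simp
    moreover have "wt (Suc N) ?Q"
      using wt_mono(1) by (intro wt_add wt.wt_mono g) auto
    moreover have "\<forall>\<^sub>F p in nhds 0. X p ^ i * (Y p ^ j * (Z p ^ k * R p)) = ?P p + ?Q p"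
      using g(2)
    proof eventually_elim
      case (elim p)
      have "R p = R 0 + (X p * g e1 p + Y p * g e2 p + Z p * g e3 p)"
        using elim by (simp add: R3_sum_Basis inner_prod_def)
      then show ?case by (simp add: algebra_simps)
    qed
    ultimately show ?thesis by blast
  qed
next
  case (wt_add f g)
  then obtain P Q P' Q' where *: "pol (Suc N) P" "wt (Suc N) Q" "\<forall>\<^sub>F p in nhds 0. f p = P p + Q p"
     "pol (Suc N) P'" "wt (Suc N) Q'" "\<forall>\<^sub>F p in nhds 0. g p = P' p + Q' p" by blast
  have "\<forall>\<^sub>F p in nhds 0. f p + g p = (P p + P' p) + (Q p + Q' p)"
    using *(3,6) by eventually_elim simp
  then show ?case using pol_add[OF *(1,4)] wt.wt_add[OF *(2,5)] by blast
qed

lemma weighted_taylor: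
  assumes "smooth_germ f"
  shows "\<exists>P Q. pol N P \<and> wt N Q \<and> (\<forall>\<^sub>F p in nhds 0. f p = P p + Q p)"
proof (induction N)
  case 0
  have "wt 0 (\<lambda>p. X p ^ 0 * (Y p ^ 0 * (Z p ^ 0 * f p)))" by (rule wt_mono) (auto intro: assms)
  then show ?case using pol_zero by (intro exI[of _ "\<lambda>p. 0"] exI[of _ f]) simp
next
  case (Suc N)
  then obtain P Q where 1: "pol N P" "wt N Q" "\<forall>\<^sub>F p in nhds 0. f p = P p + Q p" by blast
  obtain P' Q' where 2: "pol (Suc N) P'" "wt (Suc N) Q'" "\<forall>\<^sub>F p in nhds 0. Q p = P' p + Q' p"
    using wt_Suc[OF 1(2)] by blast
  have "\<forall>\<^sub>F p in nhds 0. f p = (P p + P' p) + Q' p"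
    using 1(3) 2(3) by eventually_elim simp
  then show ?case using pol_add[OF pol_Suc[OF 1(1)] 2(1)] 2(2) by blast
qed

lemma D_add_germ:
  assumes "smooth_germ f" "smooth_germ g"
  shows "\<forall>\<^sub>F x in nhds 0. \<forall>v. D (\<lambda>x. f x + g x) x v = D f x v + D g x v"
  using smooth_germ_has_derivative[OF assms(1)] smooth_germ_has_derivative[OF assms(2)]
proof eventually_elim
  case (elim x)
  then show ?case using D_eq[OF has_derivative_add[OF elim]] by simp
qed

lemma ell_D_cong: "\<forall>\<^sub>F x in nhds 0. f x = g x \<Longrightarrow> ell (\<lambda>p. D f p) = ell (\<lambda>p. D g p)"
  by (rule ell_cong_germ, rule eventually_mono[OF D_cong_germ], assumption) metis

lemma ell_D_add:
  assumes "smooth_germ f" "smooth_germ g"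
  shows "ell (\<lambda>p. D (\<lambda>x. f x + g x) p) w = ell (\<lambda>p. D f p) w + ell (\<lambda>p. D g p) w"
  using ell_cong_germ[OF D_add_germ[OF assms]] ell_add[of "\<lambda>p. D f p" "\<lambda>p. D g p"] assms
  by (simp add: sg)

lemma jet_monom_nth: "jet (\<lambda>t. a * t ^ n) $$ m = (if m = n then a else 0)"
  by (simp add: sg fps_X_power_nth)

text \<open>The bounds 15, 13, 17 are 20 minus the weights of x, y, z. On the line a monomial of
  weight at least 20 that is at most linear in x and z contains at least the third power of
  y.\<close>

lemma ellj_low:
  assumes "\<And>m. m < 15 \<Longrightarrow> H1 $$ m = 0" "\<And>m. m < 13 \<Longrightarrow> H2 $$ m = 0" "\<And>m. m < 17 \<Longrightarrow> H3 $$ m = 0"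
    "\<And>m. m < 3 \<Longrightarrow> K1 $$ m = 0" "\<And>m. m < 3 \<Longrightarrow> K3 $$ m = 0"
  shows "ellj H1 H2 H3 K1 K3 w = 0"
  by (simp add: ellj_def assms)

text \<open>The functional of weight \<open>w\<close> sees only terms of that weight; on the line
  these are y^2 dx in weight 19 and y^2 dz in weight 17.\<close>

lemma ellj_weight:
  assumes "\<And>m. m + 5 = w \<Longrightarrow> H1 $$ m = 0" "\<And>m. m + 7 = w \<Longrightarrow> H2 $$ m = 0" "\<And>m. m + 3 = w \<Longrightarrow> H3 $$ m = 0"
    "w = 19 \<Longrightarrow> K1 $$ 2 = 0" "w = 17 \<Longrightarrow> K3 $$ 2 = 0"
  shows "ellj H1 H2 H3 K1 K3 w = 0"
  unfolding ellj_def using assms by simp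

lemma D_monom:
  "D (\<lambda>p. c * (X p ^ i * (Y p ^ j * Z p ^ k))) p v =
     c * (real i * X p ^ (i - 1) * X v * (Y p ^ j * Z p ^ k)
       + X p ^ i * (real j * Y p ^ (j - 1) * Y v * Z p ^ k + Y p ^ j * (real k * Z p ^ (k - 1) * Z v)))"
proof -
  have "((\<lambda>p. c * (X p ^ i * (Y p ^ j * Z p ^ k))) has_derivative (\<lambda>v.
     c * (real i * X p ^ (i - 1) * X v * (Y p ^ j * Z p ^ k)
       + X p ^ i * (real j * Y p ^ (j - 1) * Y v * Z p ^ k + Y p ^ j * (real k * Z p ^ (k - 1) * Z v))))) (at p)"
    by (rule derivative_eq_intros refl)+ (simp add: algebra_simps)
  then show ?thesis by (simp add: D_eq)
qed

lemma minus_power: "(- (x ^ 7)) ^ n = (-1) ^ n * (x ^ 7) ^ n" for x :: real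
  by (metis mult_minus1 power_mult_distrib)

text \<open>Only the functional whose weight is that of the monomial can react. The cases in the
  proof list all exponents below weight 20 whose weight occurs in \<open>ellj\<close>, and each is
  evaluated.\<close>

lemma ell_D_monom:
  assumes "5 * i + 7 * j + 3 * k < 20"
  shows "ell (\<lambda>p. D (\<lambda>p. c * (X p ^ i * (Y p ^ j * Z p ^ k))) p) w = 0"
proof -
  let ?F = "\<lambda>p. c * (X p ^ i * (Y p ^ j * Z p ^ k))"
  have 1: "jc (\<lambda>p. D ?F p e1) = jet (\<lambda>t. (c * real i * (-1) ^ j) * t ^ (5 * (i - 1) + 7 * j + 3 * k))"
    by (rule arg_cong[where f=jet]) (simp add: D_monom fun_eq_iff power_add power_mult minus_power)
  have 2: "jc (\<lambda>p. D ?F p e2) = jet (\<lambda>t. (c * real j * (-1) ^ (j - 1)) * t ^ (5 * i + 7 * (j - 1) + 3 * k))"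
    by (rule arg_cong[where f=jet]) (simp add: D_monom fun_eq_iff power_add power_mult minus_power)
  have 3: "jc (\<lambda>p. D ?F p e3) = jet (\<lambda>t. (c * real k * (-1) ^ j) * t ^ (5 * i + 7 * j + 3 * (k - 1)))"
    by (rule arg_cong[where f=jet]) (simp add: D_monom fun_eq_iff power_add power_mult minus_power)
  have 4: "jl (\<lambda>p. D ?F p e1) = jet (\<lambda>t. (c * real i * 0 ^ (i - 1) * 0 ^ k) * t ^ j)"
    by (rule arg_cong[where f=jet]) (simp add: D_monom fun_eq_iff)
  have 5: "jl (\<lambda>p. D ?F p e3) = jet (\<lambda>t. (c * real k * 0 ^ i * 0 ^ (k - 1)) * t ^ j)"
    by (rule arg_cong[where f=jet]) (simp add: D_monom fun_eq_iff)
  define n where "n = 5 * i + 7 * j + 3 * k"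
  have h1: "jc (\<lambda>p. D ?F p e1) $$ m = (if m + 5 = n then c * real i * (-1) ^ j else 0)" for m
    unfolding 1 jet_monom_nth n_def by (cases i) auto
  have h2: "jc (\<lambda>p. D ?F p e2) $$ m = (if m + 7 = n then c * real j * (-1) ^ (j - 1) else 0)" for m
    unfolding 2 jet_monom_nth n_def by (cases j) auto
  have h3: "jc (\<lambda>p. D ?F p e3) $$ m = (if m + 3 = n then c * real k * (-1) ^ j else 0)" for m
    unfolding 3 jet_monom_nth n_def by (cases k) auto
  have k1: "jl (\<lambda>p. D ?F p e1) $$ 2 = (if i = 1 \<and> j = 2 \<and> k = 0 then c else 0)"
    unfolding 4 jet_monom_nth by (auto simp: power_0_left)
  have k3: "jl (\<lambda>p. D ?F p e3) $$ 2 = (if i = 0 \<and> j = 2 \<and> k = 1 then c else 0)"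
    unfolding 5 jet_monom_nth by (auto simp: power_0_left)
  show ?thesis
  proof (cases "w = n")
    case False
    then show ?thesis unfolding ell_def
      by (intro ellj_weight) (simp_all only: h1 h2 h3 k1 k3, auto simp: n_def)
  next
    case True
    have "i = 0 \<or> i = 1 \<or> i = 2 \<or> i = 3" "j = 0 \<or> j = 1 \<or> j = 2"
      "k = 0 \<or> k = 1 \<or> k = 2 \<or> k = 3 \<or> k = 4 \<or> k = 5 \<or> k = 6"
      using assms by presburger+
    then consider "n \<notin> {8, 10, 11, 12, 13, 14, 16, 17, 19}"
      | "i = 1 \<and> j = 0 \<and> k = 1" | "i = 2 \<and> j = 0 \<and> k = 0" | "i = 0 \<and> j = 1 \<and> k = 1"
      | "i = 1 \<and> j = 0 \<and> k = 2" | "i = 1 \<and> j = 1 \<and> k = 0" | "i = 0 \<and> j = 0 \<and> k = 4"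
      | "i = 2 \<and> j = 0 \<and> k = 1" | "i = 0 \<and> j = 1 \<and> k = 2"
      | "i = 1 \<and> j = 0 \<and> k = 3" | "i = 0 \<and> j = 2 \<and> k = 0"
      | "i = 2 \<and> j = 0 \<and> k = 2" | "i = 0 \<and> j = 1 \<and> k = 3"
      | "i = 2 \<and> j = 1 \<and> k = 0" | "i = 0 \<and> j = 2 \<and> k = 1" | "i = 1 \<and> j = 0 \<and> k = 4"
      | "i = 1 \<and> j = 2 \<and> k = 0" | "i = 2 \<and> j = 0 \<and> k = 3" | "i = 0 \<and> j = 1 \<and> k = 4"
      unfolding n_def using assms by (elim disjE) simp_all
    then show ?thesis
    proof cases
      case 1 then show ?thesis unfolding ell_def ellj_def True by simp
    qed (unfold ell_def ellj_def h1 h2 h3 k1 k3, unfold True n_def, simp_all)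
  qed
qed

lemma D_wt:
  assumes "R differentiable (at p)"
  shows "D (\<lambda>p. X p ^ i * (Y p ^ j * (Z p ^ k * R p))) p v =
     real i * X p ^ (i - 1) * X v * (Y p ^ j * (Z p ^ k * R p))
       + X p ^ i * (real j * Y p ^ (j - 1) * Y v * (Z p ^ k * R p)
          + Y p ^ j * (real k * Z p ^ (k - 1) * Z v * R p + Z p ^ k * D R p v))"
proof -
  have "((\<lambda>p. X p ^ i * (Y p ^ j * (Z p ^ k * R p))) has_derivative (\<lambda>v.
     real i * X p ^ (i - 1) * X v * (Y p ^ j * (Z p ^ k * R p))
       + X p ^ i * (real j * Y p ^ (j - 1) * Y v * (Z p ^ k * R p)
          + Y p ^ j * (real k * Z p ^ (k - 1) * Z v * R p + Z p ^ k * D R p v)))) (at p)"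
    by (rule derivative_eq_intros refl D_works[OF assms])+ (simp add: algebra_simps)
  then show ?thesis by (simp add: D_eq)
qed

lemma jet_monom_mult_nth:
  assumes "smooth_germ R" "a = 0 \<or> m < n" shows "jet (\<lambda>t. a * (t ^ n * R t)) $$ m = 0"
  using assms by (auto simp: sg fps_X_power_mult_nth)

lemma ell_D_wt:
  assumes "wt 20 F" shows "ell (\<lambda>p. D F p) w = 0"
  using assms
proof (induction rule: wt.induct)
  case (wt_add f g)
  then show ?case using ell_D_add[OF wt_smooth wt_smooth, of 20 f 20 g w] by simp
next
  case (wt_mono i j k R)
  let ?F = "\<lambda>p. X p ^ i * (Y p ^ j * (Z p ^ k * R p))"
  have ev: "\<forall>\<^sub>F p in nhds 0. R differentiable (at p)"
    by (rule eventually_mono[OF smooth_germ_has_derivative[OF wt_mono(2)]]) (auto simp: differentiable_def)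
  have sR: "smooth_germ (\<lambda>t. R (cusp t))" "smooth_germ (\<lambda>t. D R (cusp t) v)"
    "smooth_germ (\<lambda>t. R (line t))" "smooth_germ (\<lambda>t. D R (line t) v)" for v
    using smooth_on_cusp[OF wt_mono(2)] smooth_on_line[OF wt_mono(2)]
      smooth_on_cusp[OF smooth_germ_D[OF wt_mono(2)]] smooth_on_line[OF smooth_germ_D[OF wt_mono(2)]] by auto
  have low: "jet (\<lambda>t. a * (t ^ n * f t) + b * (t ^ n' * g t)) $$ m = 0"
    if "smooth_germ f" "smooth_germ g" "a = 0 \<or> m < n" "b = 0 \<or> m < n'" for a b n n' f g m
  proof -
    have "jet (\<lambda>t. a * (t ^ n * f t) + b * (t ^ n' * g t)) = jet (\<lambda>t. a * (t ^ n * f t)) + jet (\<lambda>t. b * (t ^ n' * g t))"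
      by (intro jet_add sg that)
    then show ?thesis using jet_monom_mult_nth[OF that(1,3)] jet_monom_mult_nth[OF that(2,4)] by simp
  qed
  have 1: "jc (\<lambda>p. D ?F p e1) = jet (\<lambda>t. (real i * (-1) ^ j) * (t ^ (5 * (i - 1) + 7 * j + 3 * k) * R (cusp t))
      + (-1) ^ j * (t ^ (5 * i + 7 * j + 3 * k) * D R (cusp t) e1))"
    by (rule jet_cong, rule eventually_mono[OF eventually_cusp[OF ev]])
      (simp only: D_wt cusp_simps power_add power_mult minus_power, simp add: algebra_simps)
  have 2: "jc (\<lambda>p. D ?F p e2) = jet (\<lambda>t. (real j * (-1) ^ (j - 1)) * (t ^ (5 * i + 7 * (j - 1) + 3 * k) * R (cusp t))
      + (-1) ^ j * (t ^ (5 * i + 7 * j + 3 * k) * D R (cusp t) e2))"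
    by (rule jet_cong, rule eventually_mono[OF eventually_cusp[OF ev]])
      (simp only: D_wt cusp_simps power_add power_mult minus_power, simp add: algebra_simps)
  have 3: "jc (\<lambda>p. D ?F p e3) = jet (\<lambda>t. (real k * (-1) ^ j) * (t ^ (5 * i + 7 * j + 3 * (k - 1)) * R (cusp t))
      + (-1) ^ j * (t ^ (5 * i + 7 * j + 3 * k) * D R (cusp t) e3))"
    by (rule jet_cong, rule eventually_mono[OF eventually_cusp[OF ev]])
      (simp only: D_wt cusp_simps power_add power_mult minus_power, simp add: algebra_simps)
  have 4: "jl (\<lambda>p. D ?F p e1) = jet (\<lambda>t. (real i * 0 ^ (i - 1) * 0 ^ k) * (t ^ j * R (line t))
      + (0 ^ i * 0 ^ k) * (t ^ j * D R (line t) e1))"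
    by (rule jet_cong, rule eventually_mono[OF eventually_line[OF ev]]) (simp only: D_wt line_simps, simp add: algebra_simps)
  have 5: "jl (\<lambda>p. D ?F p e3) = jet (\<lambda>t. (real k * 0 ^ (k - 1) * 0 ^ i) * (t ^ j * R (line t))
      + (0 ^ i * 0 ^ k) * (t ^ j * D R (line t) e3))"
    by (rule jet_cong, rule eventually_mono[OF eventually_line[OF ev]]) (simp only: D_wt line_simps, simp add: algebra_simps)
  have z: "(0::real) ^ n = 0 \<or> n = 0" for n by auto
  show ?case
    unfolding ell_def 1 2 3 4 5
  proof (intro ellj_low low sR; (use wt_mono(1) in linarith)?)
  qed (use wt_mono(1) in \<open>auto simp: power_0_left\<close>)
qed

text \<open>Weight 20 is the point of division: above it all coefficients entering
  \<open>ellj\<close> vanish, below it finitely many monomials are checked.\<close>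

theorem ell_exact:
  assumes "smooth_germ F" shows "ell (\<lambda>p. D F p) w = 0"
proof -
  obtain P Q where PQ: "pol 20 P" "wt 20 Q" "\<forall>\<^sub>F p in nhds 0. F p = P p + Q p"
    using weighted_taylor[OF assms] by blast
  have "ell (\<lambda>p. D P p) w = 0"
    using PQ(1)
  proof (induction rule: pol.induct)
    case pol_zero
    then show ?case by simp
  next
    case (pol_mono i j k c) then show ?case by (rule ell_D_monom)
  next
    case (pol_add f g)
    then show ?case using ell_D_add[OF pol_smooth pol_smooth, of 20 f 20 g w] by simp
  qed
  then show ?thesis
    using ell_D_cong[OF PQ(3)] ell_D_add[OF pol_smooth[OF PQ(1)] wt_smooth[OF PQ(2)]] ell_D_wt[OF PQ(2)] by simp
qed

text \<open>Below weight 8 the monomials are 1, z, x, z^2, y. Thus t, t^2, t^4 never occur on the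
  cusp, t^3 and t^5 come only from z and x, and t^7 comes only from -y, which also gives the linear
  term on the line.\<close>

lemma jets_on_N9:
  assumes "smooth_germ f"
  shows "jc f $$ 1 = 0" "jc f $$ 2 = 0" "jc f $$ 4 = 0" "jc f $$ 3 = D f 0 e3" "jc f $$ 5 = D f 0 e1"
    "jc f $$ 7 = - D f 0 e2" "jl f $$ 0 = jc f $$ 0" "jl f $$ 1 = - jc f $$ 7"
proof -
  define good where "good f \<longleftrightarrow> jc f $$ 1 = 0 \<and> jc f $$ 2 = 0 \<and> jc f $$ 4 = 0 \<and> jc f $$ 3 = D f 0 e3 \<and> jc f $$ 5 = D f 0 e1 \<and>
    jc f $$ 7 = - D f 0 e2 \<and> jl f $$ 0 = jc f $$ 0 \<and> jl f $$ 1 = - jc f $$ 7" for f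
  have add: "good (\<lambda>p. f p + g p)" if "smooth_germ f" "smooth_germ g" "good f" "good g" for f g
    using that eventually_nhds_x_imp_x[OF D_add_germ[OF that(1,2)]]
      smooth_on_cusp[OF that(1)] smooth_on_cusp[OF that(2)] smooth_on_line[OF that(1)] smooth_on_line[OF that(2)]
    by (simp add: good_def)
  have cong: "good f" if "\<forall>\<^sub>F p in nhds 0. f p = g p" "good g" for f g
    using that(2) jet_cong[OF eventually_cusp[OF that(1)]] jet_cong[OF eventually_line[OF that(1)]] D_cong[OF that(1)]
    by (simp add: good_def)
  obtain P Q where PQ: "pol 8 P" "wt 8 Q" "\<forall>\<^sub>F p in nhds 0. f p = P p + Q p"
    using weighted_taylor[OF assms] by blast
  have "good P" using PQ(1)
  proof (induction rule: pol.induct)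
    case pol_zero then show ?case by (simp add: good_def)
  next
    case (pol_add f g) then show ?case by (intro add pol_smooth)
  next
    case (pol_mono i j k c)
    let ?F = "\<lambda>p. c * (X p ^ i * (Y p ^ j * Z p ^ k))"
    have 1: "jc ?F = jet (\<lambda>t. (c * (-1) ^ j) * t ^ (5 * i + 7 * j + 3 * k))"
      by (rule arg_cong[where f=jet]) (simp add: fun_eq_iff power_add power_mult minus_power)
    have 2: "jl ?F = jet (\<lambda>t. (c * 0 ^ i * 0 ^ k) * t ^ j)"
      by (rule arg_cong[where f=jet]) (simp add: fun_eq_iff)
    have "i = 0 \<or> i = 1" "j = 0 \<or> j = 1" "k = 0 \<or> k = 1 \<or> k = 2"
      using pol_mono by presburger+
    then consider "i = 0 \<and> j = 0 \<and> k = 0" | "i = 1 \<and> j = 0 \<and> k = 0" | "i = 0 \<and> j = 1 \<and> k = 0"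
      | "i = 0 \<and> j = 0 \<and> k = 1" | "i = 0 \<and> j = 0 \<and> k = 2"
      using pol_mono by (elim disjE) simp_all
    then show ?case
      by cases (unfold good_def 1 2 jet_monom_nth D_monom, simp_all add: jet_monom_nth jet_monom_nth[of "- c", simplified])
  qed
  moreover have "good Q" using PQ(2)
  proof (induction rule: wt.induct)
    case (wt_add f g) then show ?case by (intro add wt_smooth)
  next
    case (wt_mono i j k R)
    let ?F = "\<lambda>p. X p ^ i * (Y p ^ j * (Z p ^ k * R p))"
    have 1: "jc ?F = jet (\<lambda>t. (-1) ^ j * (t ^ (5 * i + 7 * j + 3 * k) * R (cusp t)))"
      by (rule arg_cong[where f=jet]) (simp add: fun_eq_iff power_add power_mult minus_power)
    have 2: "jl ?F = jet (\<lambda>t. (0 ^ i * 0 ^ k) * (t ^ j * R (line t)))"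
      by (rule arg_cong[where f=jet]) (simp add: fun_eq_iff)
    have d: "D ?F 0 v = 0" for v
      unfolding D_wt[OF differentiableI[OF smooth_germ_has_derivative0[OF wt_mono(2)]]] using wt_mono(1)
      by (auto simp: power_0_left)
    have c: "jc ?F $$ m = 0" if "m < 8" for m
      unfolding 1 using wt_mono that by (intro jet_monom_mult_nth smooth_on_cusp) auto
    have l: "jl ?F $$ m = 0" if "m < 2" for m
      unfolding 2 using wt_mono that by (intro jet_monom_mult_nth smooth_on_line) (auto simp: power_0_left)
    show ?case unfolding good_def using d c l by simp
  qed
  ultimately have "good f" by (intro cong[OF PQ(3)] add pol_smooth[OF PQ(1)] wt_smooth[OF PQ(2)])
  then show "jc f $$ 1 = 0" "jc f $$ 2 = 0" "jc f $$ 4 = 0" "jc f $$ 3 = D f 0 e3" "jc f $$ 5 = D f 0 e1"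
    "jc f $$ 7 = - D f 0 e2" "jl f $$ 0 = jc f $$ 0" "jl f $$ 1 = - jc f $$ 7"
    by (auto simp: good_def)
qed

section \<open>Exactness of forms without invariants\<close>

text \<open>All three components have to agree at each point of \<open>N9\<close>, so the normal
  part of the differential is prescribed too.\<close>

definition exact_on_N9 :: "(R3 \<Rightarrow> real) \<Rightarrow> (R3 \<Rightarrow> real) \<Rightarrow> (R3 \<Rightarrow> real) \<Rightarrow> bool" where
  "exact_on_N9 a1 a2 a3 \<longleftrightarrow> (\<exists>F. smooth_germ F \<and>
     (\<forall>\<^sub>F p in nhds 0. p \<in> N9 \<longrightarrow> D F p e1 = a1 p \<and> D F p e2 = a2 p \<and> D F p e3 = a3 p))"

lemma exact_on_N9_diff:
  assumes F: "smooth_germ F"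
    and "exact_on_N9 (\<lambda>p. a1 p - D F p e1) (\<lambda>p. a2 p - D F p e2) (\<lambda>p. a3 p - D F p e3)"
  shows "exact_on_N9 a1 a2 a3"
proof -
  obtain G where G: "smooth_germ G" "\<forall>\<^sub>F p in nhds 0. p \<in> N9 \<longrightarrow>
      D G p e1 = a1 p - D F p e1 \<and> D G p e2 = a2 p - D F p e2 \<and> D G p e3 = a3 p - D F p e3"
    using assms(2) by (auto simp: exact_on_N9_def)
  have "\<forall>\<^sub>F p in nhds 0. p \<in> N9 \<longrightarrow> D (\<lambda>p. F p + G p) p e1 = a1 p \<and> D (\<lambda>p. F p + G p) p e2 = a2 p
      \<and> D (\<lambda>p. F p + G p) p e3 = a3 p"
    using G(2) D_add_germ[OF F G(1)]
  proof eventually_elim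
    case (elim p)
    then show ?case by (simp del: split_paired_All)
  qed
  then show ?thesis using smooth_germ_add[OF F G(1)] unfolding exact_on_N9_def by blast
qed

lemma smooth_X [sg]: "smooth_germ X" and smooth_Y [sg]: "smooth_germ Y" and smooth_Z [sg]: "smooth_germ Z"
  by (intro sg)+

lemma has_derivative_Z:
  assumes "smooth_germ K"
  shows "\<forall>\<^sub>F p in nhds 0. ((\<lambda>p. K (Z p)) has_derivative (\<lambda>v. deriv K (Z p) * Z v)) (at p)"
proof -
  have "\<forall>\<^sub>F p in nhds (0::R3). K differentiable (at (Z p))"
    by (rule smooth_germ_eventually[OF smooth_Z _ smooth_germ_differentiable[OF assms]]) simp
  then show ?thesis
  proof eventually_elim
    case (elim p)
    have z: "(Z has_derivative Z) (at p)" by (auto intro!: derivative_eq_intros)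
    show ?case
      using has_derivative_compose[OF z has_real_derivative_deriv[OF elim, unfolded has_field_derivative_def]] by simp
  qed
qed

lemma has_derivative_Y:
  assumes "smooth_germ K"
  shows "\<forall>\<^sub>F p in nhds 0. ((\<lambda>p. K (Y p)) has_derivative (\<lambda>v. deriv K (Y p) * Y v)) (at p)"
proof -
  have "\<forall>\<^sub>F p in nhds (0::R3). K differentiable (at (Y p))"
    by (rule smooth_germ_eventually[OF smooth_Y _ smooth_germ_differentiable[OF assms]]) simp
  then show ?thesis
  proof eventually_elim
    case (elim p)
    have z: "(Y has_derivative Y) (at p)" by (auto intro!: derivative_eq_intros)
    show ?case
      using has_derivative_compose[OF z has_real_derivative_deriv[OF elim, unfolded has_field_derivative_def]] by simp
  qed
qed

lemma smooth_compose_Z: "smooth_germ K \<Longrightarrow> smooth_germ (\<lambda>p::R3. K (Z p))"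
  and smooth_compose_Y: "smooth_germ K \<Longrightarrow> smooth_germ (\<lambda>p::R3. K (Y p))" for K :: "real \<Rightarrow> real"
  using smooth_germ_compose[OF _ smooth_Z, of K] smooth_germ_compose[OF _ smooth_Y, of K] by simp_all

text \<open>The three functions \<open>x z\<^sup>5 - x\<^sup>4/4\<close>, \<open>z\<^sup>7\<close>, \<open>3 x\<^sup>2 z\<^sup>4 - 2 y z\<^sup>5 + 2 x\<^sup>3 y\<close> restrict to multiples of
  \<open>t\<^sup>2\<^sup>0, t\<^sup>2\<^sup>1, t\<^sup>2\<^sup>2\<close> on the cusp while their derivatives by \<open>x\<close> and \<open>y\<close> vanish there.\<close>

lemma exact_only_z:
  assumes a: "smooth_germ a3" and low: "\<And>m. m < 17 \<Longrightarrow> jc a3 $$ m = 0"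
    and l: "\<forall>\<^sub>F t in nhds 0. a1 (line t) = 0 \<and> a2 (line t) = 0 \<and> a3 (line t) = 0"
    and c: "\<forall>\<^sub>F t in nhds 0. a1 (cusp t) = 0 \<and> a2 (cusp t) = 0"
  shows "exact_on_N9 a1 a2 a3"
proof -
  \<comment> \<open>The derivative along the cusp of the desired primitive: its dx and dy parts
    vanish there, and dz is \<open>3 * t ^ 2\<close> dt. Integrating order 17 + 2 gives order
    20.\<close>
  define h where "h t = 3 * t ^ 2 * a3 (cusp t)" for t
  have sh: "smooth_germ h" unfolding h_def by (intro sg a)
  obtain H where H: "smooth_germ H" "H 0 = 0" "\<forall>\<^sub>F t in nhds 0. (H has_real_derivative h t) (at t)"
    using smooth_germ_antiderivative[OF sh] by blast
  have "\<forall>\<^sub>F t in nhds 0. deriv H t = h t" using H(3) by eventually_elim (rule DERIV_imp_deriv)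
  then have "jet (deriv H) = jet h" by (rule jet_cong)
  also have "jet h = fps_const 3 * fps_X ^ 2 * jc a3"
    unfolding h_def using smooth_on_cusp[OF a] by (simp add: sg)
  finally have jH: "jet (deriv H) = fps_const 3 * (fps_X ^ 2 * jc a3)" by (simp add: mult.assoc)
  have "jet H $$ m = 0" if "m < 20" for m
    using that H(2) low by (cases m) (auto simp: jet_nth_Suc jH fps_X_power_mult_nth)
  then obtain K0 K1 K2 where K: "smooth_germ K0" "smooth_germ K1" "smooth_germ K2"
    and HK: "\<forall>\<^sub>F t in nhds 0. H t = t ^ 20 * K0 (t ^ 3) + t ^ (20 + 1) * K1 (t ^ 3) + t ^ (20 + 2) * K2 (t ^ 3)"
    using cubic_decomposition[OF H(1), of 20] by blast
  \<comment> \<open>The factors 4/3 and 1/3 normalize the restrictions to the cusp to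
    \<open>t ^ 20\<close> and \<open>t ^ 22\<close>.\<close>
  define F where "F p = 4/3 * (X p * Z p ^ 5 - 1/4 * X p ^ 4) * K0 (Z p) + Z p ^ 7 * K1 (Z p)
      + 1/3 * (3 * X p ^ 2 * Z p ^ 4 - 2 * Y p * Z p ^ 5 + 2 * X p ^ 3 * Y p) * K2 (Z p)" for p
  have sF: "smooth_germ F" unfolding F_def by (intro sg smooth_compose_Z K)
  define F' where "F' p v = 4/3 * (X p * Z p ^ 5 - 1/4 * X p ^ 4) * (deriv K0 (Z p) * Z v) + 4/3 * (X v * Z p ^ 5 + X p * (5 * Z p ^ 4 * Z v) - X p ^ 3 * X v) * K0 (Z p)
      + (Z p ^ 7 * (deriv K1 (Z p) * Z v) + 7 * Z p ^ 6 * Z v * K1 (Z p))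
      + (1/3 * (3 * X p ^ 2 * Z p ^ 4 - 2 * Y p * Z p ^ 5 + 2 * X p ^ 3 * Y p) * (deriv K2 (Z p) * Z v)
        + 1/3 * (6 * X p * X v * Z p ^ 4 + 12 * X p ^ 2 * Z p ^ 3 * Z v - 2 * Y v * Z p ^ 5 - 10 * Y p * Z p ^ 4 * Z v
           + 6 * X p ^ 2 * X v * Y p + 2 * X p ^ 3 * Y v) * K2 (Z p))" for p v
  have dF: "\<forall>\<^sub>F p in nhds 0. (F has_derivative F' p) (at p)"
    using has_derivative_Z[OF K(1)] has_derivative_Z[OF K(2)] has_derivative_Z[OF K(3)]
  proof eventually_elim
    case (elim p)
    show ?case unfolding F_def F'_def
      by (rule derivative_eq_intros refl elim)+ (simp add: fun_eq_iff algebra_simps)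
  qed
  have dF_eq: "\<forall>\<^sub>F p in nhds 0. D F p = F' p" using dF by eventually_elim (rule D_eq)
  have cz: "F' (cusp t) e1 = 0" "F' (cusp t) e2 = 0" for t
    by (simp_all add: F'_def algebra_simps flip: power_mult power_add)
  have Fc: "\<forall>\<^sub>F t in nhds 0. F (cusp t) = H t"
    using HK
  proof eventually_elim
    case (elim t)
    show ?case unfolding elim F_def by (simp add: algebra_simps flip: power_mult power_add)
  qed
  have "\<forall>\<^sub>F t in nhds 0. D F (cusp t) e3 = a3 (cusp t)"
    using eventually_cusp[OF dF] Fc[THEN eventually_eventually[THEN iffD2]] H(3)
  proof eventually_elim
    case (elim t)
    show ?case
    proof (cases "t = 0")
      case True
      have "a3 0 = 0" using low[of 0] by simp
      moreover have "D F (cusp 0) = F' (cusp 0)" using elim(1) True by (simp add: D_eq)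
      ultimately show ?thesis using True by (simp add: F'_def)
    next
      case False
      have dc: "(cusp has_derivative (\<lambda>s. s *\<^sub>R (5 * t ^ 4, - (7 * t ^ 6), 3 * t ^ 2))) (at t)"
        unfolding cusp_def by (rule derivative_eq_intros refl)+ (simp add: fun_eq_iff)
      have "((\<lambda>t. F (cusp t)) has_derivative (\<lambda>s. F' (cusp t) (s *\<^sub>R (5 * t ^ 4, - (7 * t ^ 6), 3 * t ^ 2)))) (at t)"
        by (rule has_derivative_compose[OF dc elim(1)])
      then have "(H has_derivative (\<lambda>s. F' (cusp t) (s *\<^sub>R (5 * t ^ 4, - (7 * t ^ 6), 3 * t ^ 2)))) (at t)"
        by (rule has_derivative_cong_nhds[OF elim(2)])
      then have "(\<lambda>s. F' (cusp t) (s *\<^sub>R (5 * t ^ 4, - (7 * t ^ 6), 3 * t ^ 2))) = (*) (h t)"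
        using elim(3) has_derivative_unique unfolding has_field_derivative_def by blast
      then have "F' (cusp t) (5 * t ^ 4, - (7 * t ^ 6), 3 * t ^ 2) = h t"
        by (metis (mono_tags, lifting) mult.right_neutral scaleR_one)
      moreover have "linear (F' (cusp t))" using elim(1) has_derivative_linear by blast
      then have "F' (cusp t) (5 * t ^ 4, - (7 * t ^ 6), 3 * t ^ 2) = 3 * t ^ 2 * F' (cusp t) e3"
        by (subst R3_linear) (simp_all add: cz)
      ultimately show ?thesis using False D_eq[OF elim(1)] by (simp add: h_def)
    qed
  qed
  then have 1: "\<forall>\<^sub>F t in nhds 0. D F (cusp t) e1 = a1 (cusp t) \<and> D F (cusp t) e2 = a2 (cusp t) \<and> D F (cusp t) e3 = a3 (cusp t)"
    using eventually_cusp[OF dF_eq] c by eventually_elim (simp add: cz)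
  have 2: "\<forall>\<^sub>F t in nhds 0. D F (line t) e1 = a1 (line t) \<and> D F (line t) e2 = a2 (line t) \<and> D F (line t) e3 = a3 (line t)"
    using eventually_line[OF dF_eq] l by eventually_elim (simp add: F'_def)
  show ?thesis unfolding exact_on_N9_def using sF eventually_N9[OF 1 2] by blast
qed

text \<open>The functions x z^5, x^3 z^2 / 3 and x^2 z^4 / 2 have x-derivatives t^15, t^16, t^17 on
  the cusp and no y-derivative. Multiplied by functions of z they remove the dx part; the error in
  dz has order at least 17, and nothing changes on the line.\<close>

lemma exact_xz:
  assumes a: "smooth_germ a1" "smooth_germ a3"
    and low: "\<And>m. m < 15 \<Longrightarrow> jc a1 $$ m = 0" "\<And>m. m < 17 \<Longrightarrow> jc a3 $$ m = 0"
    and l: "\<forall>\<^sub>F t in nhds 0. a1 (line t) = 0 \<and> a2 (line t) = 0 \<and> a3 (line t) = 0"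
    and c: "\<forall>\<^sub>F t in nhds 0. a2 (cusp t) = 0"
  shows "exact_on_N9 a1 a2 a3"
proof -
  obtain K0 K1 K2 where K: "smooth_germ K0" "smooth_germ K1" "smooth_germ K2"
    and HK: "\<forall>\<^sub>F t in nhds 0. a1 (cusp t) = t ^ 15 * K0 (t ^ 3) + t ^ (15 + 1) * K1 (t ^ 3) + t ^ (15 + 2) * K2 (t ^ 3)"
    using cubic_decomposition[OF smooth_on_cusp[OF a(1)] low(1)] by blast
  define F where "F p = X p * Z p ^ 5 * K0 (Z p) + 1/3 * X p ^ 3 * Z p ^ 2 * K1 (Z p) + 1/2 * X p ^ 2 * Z p ^ 4 * K2 (Z p)" for p
  have sF: "smooth_germ F" unfolding F_def by (intro sg smooth_compose_Z K)
  define F' where "F' p v = X p * Z p ^ 5 * (deriv K0 (Z p) * Z v) + (X v * Z p ^ 5 + 5 * X p * Z p ^ 4 * Z v) * K0 (Z p)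
     + (1/3 * X p ^ 3 * Z p ^ 2 * (deriv K1 (Z p) * Z v) + (X p ^ 2 * X v * Z p ^ 2 + 2 / 3 * X p ^ 3 * Z p * Z v) * K1 (Z p))
     + (1/2 * X p ^ 2 * Z p ^ 4 * (deriv K2 (Z p) * Z v) + (X p * X v * Z p ^ 4 + 2 * X p ^ 2 * Z p ^ 3 * Z v) * K2 (Z p))" for p v
  have dF: "\<forall>\<^sub>F p in nhds 0. D F p = F' p"
    using has_derivative_Z[OF K(1)] has_derivative_Z[OF K(2)] has_derivative_Z[OF K(3)]
  proof eventually_elim
    case (elim p)
    have "(F has_derivative F' p) (at p)" unfolding F_def F'_def
      by (rule derivative_eq_intros refl elim)+ (simp add: fun_eq_iff algebra_simps)
    then show ?case by (rule D_eq)
  qed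
  note dc = eventually_cusp[OF dF] and dl = eventually_line[OF dF]
  note sK = smooth_germ_compose[OF K(1) smooth_germ_power[OF smooth_germ_id, of 3]]
     smooth_germ_compose[OF K(2) smooth_germ_power[OF smooth_germ_id, of 3]]
     smooth_germ_compose[OF K(3) smooth_germ_power[OF smooth_germ_id, of 3]]
     smooth_germ_compose[OF smooth_germ_deriv[OF K(1)] smooth_germ_power[OF smooth_germ_id, of 3]]
     smooth_germ_compose[OF smooth_germ_deriv[OF K(2)] smooth_germ_power[OF smooth_germ_id, of 3]]
     smooth_germ_compose[OF smooth_germ_deriv[OF K(3)] smooth_germ_power[OF smooth_germ_id, of 3]]
  show ?thesis
  proof (rule exact_on_N9_diff[OF sF], rule exact_only_z)
    show "smooth_germ (\<lambda>p. a3 p - D F p e3)" by (intro sg a sF)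
    have 3: "jc (\<lambda>p. a3 p - D F p e3) = jet (\<lambda>t. a3 (cusp t) - t ^ 17 *
        (t ^ 3 * deriv K0 (t ^ 3) + 5 * K0 (t ^ 3) + 1/3 * t ^ 4 * deriv K1 (t ^ 3) + 2/3 * t * K1 (t ^ 3)
          + 1/2 * t ^ 5 * deriv K2 (t ^ 3) + 2 * t ^ 2 * K2 (t ^ 3)))"
      by (rule jet_cong, rule eventually_mono[OF dc]) (simp add: F'_def eval_nat_numeral algebra_simps)
    show "jc (\<lambda>p. a3 p - D F p e3) $$ m = 0" if "m < 17" for m
      unfolding 3 using that low(2) smooth_on_cusp[OF a(2)] sK
      by (simp add: sg fps_X_power_mult_nth)
    show "\<forall>\<^sub>F t in nhds 0. a1 (line t) - D F (line t) e1 = 0 \<and> a2 (line t) - D F (line t) e2 = 0 \<and> a3 (line t) - D F (line t) e3 = 0"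
      using dl l by eventually_elim (simp add: F'_def)
    show "\<forall>\<^sub>F t in nhds 0. a1 (cusp t) - D F (cusp t) e1 = 0 \<and> a2 (cusp t) - D F (cusp t) e2 = 0"
      using dc c HK by eventually_elim (simp add: F'_def algebra_simps flip: power_mult power_add)
  qed
qed

text \<open>Here x^2 y z, x y z^3 and y z^5 have y-derivatives t^13, t^14, t^15 on the cusp and
  vanish to first order on the line. Removing dy before dx and dz is possible because the errors
  keep the orders 15 and 17.\<close>

lemma exact_off_line:
  assumes a: "smooth_germ a1" "smooth_germ a2" "smooth_germ a3"
    and low: "\<And>m. m < 15 \<Longrightarrow> jc a1 $$ m = 0" "\<And>m. m < 13 \<Longrightarrow> jc a2 $$ m = 0" "\<And>m. m < 17 \<Longrightarrow> jc a3 $$ m = 0"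
    and l: "\<forall>\<^sub>F t in nhds 0. a1 (line t) = 0 \<and> a2 (line t) = 0 \<and> a3 (line t) = 0"
  shows "exact_on_N9 a1 a2 a3"
proof -
  obtain K0 K1 K2 where K: "smooth_germ K0" "smooth_germ K1" "smooth_germ K2"
    and HK: "\<forall>\<^sub>F t in nhds 0. a2 (cusp t) = t ^ 13 * K0 (t ^ 3) + t ^ (13 + 1) * K1 (t ^ 3) + t ^ (13 + 2) * K2 (t ^ 3)"
    using cubic_decomposition[OF smooth_on_cusp[OF a(2)] low(2)] by blast
  define F where "F p = X p ^ 2 * Y p * Z p * K0 (Z p) + X p * Y p * Z p ^ 3 * K1 (Z p) + Y p * Z p ^ 5 * K2 (Z p)" for p
  have sF: "smooth_germ F" unfolding F_def by (intro sg smooth_compose_Z K)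
  define F' where "F' p v = X p ^ 2 * Y p * Z p * (deriv K0 (Z p) * Z v) + (2 * X p * X v * Y p * Z p + X p ^ 2 * Y v * Z p + X p ^ 2 * Y p * Z v) * K0 (Z p)
     + (X p * Y p * Z p ^ 3 * (deriv K1 (Z p) * Z v) + (X v * Y p * Z p ^ 3 + X p * Y v * Z p ^ 3 + 3 * X p * Y p * Z p ^ 2 * Z v) * K1 (Z p))
     + (Y p * Z p ^ 5 * (deriv K2 (Z p) * Z v) + (Y v * Z p ^ 5 + 5 * Y p * Z p ^ 4 * Z v) * K2 (Z p))" for p v
  have dF: "\<forall>\<^sub>F p in nhds 0. D F p = F' p"
    using has_derivative_Z[OF K(1)] has_derivative_Z[OF K(2)] has_derivative_Z[OF K(3)]
  proof eventually_elim
    case (elim p)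
    have "(F has_derivative F' p) (at p)" unfolding F_def F'_def
      by (rule derivative_eq_intros refl elim)+ (simp add: fun_eq_iff algebra_simps)
    then show ?case by (rule D_eq)
  qed
  note dc = eventually_cusp[OF dF] and dl = eventually_line[OF dF]
  note sK = smooth_germ_compose[OF K(1) smooth_germ_power[OF smooth_germ_id, of 3]]
     smooth_germ_compose[OF K(2) smooth_germ_power[OF smooth_germ_id, of 3]]
     smooth_germ_compose[OF K(3) smooth_germ_power[OF smooth_germ_id, of 3]]
     smooth_germ_compose[OF smooth_germ_deriv[OF K(1)] smooth_germ_power[OF smooth_germ_id, of 3]]
     smooth_germ_compose[OF smooth_germ_deriv[OF K(2)] smooth_germ_power[OF smooth_germ_id, of 3]]
     smooth_germ_compose[OF smooth_germ_deriv[OF K(3)] smooth_germ_power[OF smooth_germ_id, of 3]]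
  show ?thesis
  proof (rule exact_on_N9_diff[OF sF], rule exact_xz)
    show "smooth_germ (\<lambda>p. a1 p - D F p e1)" "smooth_germ (\<lambda>p. a3 p - D F p e3)" by (intro sg a sF)+
    have 1: "jc (\<lambda>p. a1 p - D F p e1) = jet (\<lambda>t. a1 (cusp t) - t ^ 15 * (- 2 * K0 (t ^ 3) - t * K1 (t ^ 3)))"
      by (rule jet_cong, rule eventually_mono[OF dc]) (simp add: F'_def eval_nat_numeral algebra_simps)
    show "jc (\<lambda>p. a1 p - D F p e1) $$ m = 0" if "m < 15" for m
      unfolding 1 using that low(1) smooth_on_cusp[OF a(1)] sK
      by (simp add: sg fps_X_power_mult_nth)
    have 3: "jc (\<lambda>p. a3 p - D F p e3) = jet (\<lambda>t. a3 (cusp t) - t ^ 17 *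
        (- (t ^ 3 * deriv K0 (t ^ 3)) - K0 (t ^ 3) - t ^ 4 * deriv K1 (t ^ 3) - 3 * t * K1 (t ^ 3)
          - t ^ 5 * deriv K2 (t ^ 3) - 5 * t ^ 2 * K2 (t ^ 3)))"
      by (rule jet_cong, rule eventually_mono[OF dc]) (simp add: F'_def eval_nat_numeral algebra_simps)
    show "jc (\<lambda>p. a3 p - D F p e3) $$ m = 0" if "m < 17" for m
      unfolding 3 using that low(3) smooth_on_cusp[OF a(3)] sK
      by (simp add: sg fps_X_power_mult_nth)
    show "\<forall>\<^sub>F t in nhds 0. a1 (line t) - D F (line t) e1 = 0 \<and> a2 (line t) - D F (line t) e2 = 0 \<and> a3 (line t) - D F (line t) e3 = 0"
      using dl l by eventually_elim (simp add: F'_def)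
    show "\<forall>\<^sub>F t in nhds 0. a2 (cusp t) - D F (cusp t) e2 = 0"
      using dc HK by eventually_elim (simp add: F'_def algebra_simps flip: power_mult power_add)
  qed
qed

text \<open>The values on the line are matched by x y^3 r1(y) + R(y) + z y^3 r3(y). Since y^7-type
  terms are of order 21 for y^3 and 14 for y^2 on the cusp, the orders 3, 2, 3 on the line preserve
  the thresholds 15, 13, 17.\<close>

lemma exact_high_order:
  assumes a: "smooth_germ a1" "smooth_germ a2" "smooth_germ a3"
    and low: "\<And>m. m < 15 \<Longrightarrow> jc a1 $$ m = 0" "\<And>m. m < 13 \<Longrightarrow> jc a2 $$ m = 0" "\<And>m. m < 17 \<Longrightarrow> jc a3 $$ m = 0"
    and lowl: "\<And>m. m < 3 \<Longrightarrow> jl a1 $$ m = 0" "\<And>m. m < 2 \<Longrightarrow> jl a2 $$ m = 0" "\<And>m. m < 3 \<Longrightarrow> jl a3 $$ m = 0"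
  shows "exact_on_N9 a1 a2 a3"
proof -
  obtain r1 where r1: "smooth_germ r1" "\<forall>\<^sub>F t in nhds 0. a1 (line t) = t ^ 3 * r1 t"
    using jet_zero_divide[OF smooth_on_line[OF a(1)] lowl(1)] by blast
  obtain r3 where r3: "smooth_germ r3" "\<forall>\<^sub>F t in nhds 0. a3 (line t) = t ^ 3 * r3 t"
    using jet_zero_divide[OF smooth_on_line[OF a(3)] lowl(3)] by blast
  obtain r2 where r2: "smooth_germ r2" "\<forall>\<^sub>F t in nhds 0. a2 (line t) = t ^ 2 * r2 t"
    using jet_zero_divide[OF smooth_on_line[OF a(2)] lowl(2)] by blast
  obtain R where R: "smooth_germ R" "\<forall>\<^sub>F t in nhds 0. (R has_real_derivative a2 (line t)) (at t)"
    using smooth_germ_antiderivative[OF smooth_on_line[OF a(2)]] by blast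
  have dR: "\<forall>\<^sub>F t in nhds 0. deriv R t = t ^ 2 * r2 t"
    using R(2) r2(2) by eventually_elim (auto dest: DERIV_imp_deriv)
  define F where "F p = X p * Y p ^ 3 * r1 (Y p) + R (Y p) + Z p * Y p ^ 3 * r3 (Y p)" for p
  have sF: "smooth_germ F" unfolding F_def by (intro sg smooth_compose_Y R r1 r3)
  define F' where "F' p v = X p * Y p ^ 3 * (deriv r1 (Y p) * Y v) + (X v * Y p ^ 3 + 3 * X p * Y p ^ 2 * Y v) * r1 (Y p)
     + Y p ^ 2 * r2 (Y p) * Y v
     + (Z p * Y p ^ 3 * (deriv r3 (Y p) * Y v) + (Z v * Y p ^ 3 + 3 * Z p * Y p ^ 2 * Y v) * r3 (Y p))" for p v
  have dR': "\<forall>\<^sub>F p in nhds 0. deriv R (Y p) = Y p ^ 2 * r2 (Y p)"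
    by (rule smooth_germ_eventually[OF smooth_Y _ dR]) simp
  have dF: "\<forall>\<^sub>F p in nhds 0. D F p = F' p"
    using has_derivative_Y[OF r1(1)] has_derivative_Y[OF R(1)] has_derivative_Y[OF r3(1)] dR'
  proof eventually_elim
    case (elim p)
    have "(F has_derivative F' p) (at p)" unfolding F_def F'_def
      by (rule derivative_eq_intros refl elim(1-3))+ (simp add: fun_eq_iff algebra_simps elim(4))
    then show ?case by (rule D_eq)
  qed
  note dc = eventually_cusp[OF dF] and dl = eventually_line[OF dF]
  have s7: "smooth_germ (\<lambda>t::real. - (t ^ 7))" by (intro sg)
  have sK: "smooth_germ (\<lambda>t. f (- (t ^ 7)))" if "smooth_germ f" for f :: "real \<Rightarrow> real"
    using smooth_germ_compose[OF that s7] by simp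
  note sK' = sK[OF r1(1)] sK[OF r2(1)] sK[OF r3(1)] sK[OF smooth_germ_deriv[OF r1(1)]] sK[OF smooth_germ_deriv[OF r3(1)]]
  show ?thesis
  proof (rule exact_on_N9_diff[OF sF], rule exact_off_line)
    show "smooth_germ (\<lambda>p. a1 p - D F p e1)" "smooth_germ (\<lambda>p. a2 p - D F p e2)" "smooth_germ (\<lambda>p. a3 p - D F p e3)" by (intro sg a sF)+
    have 1: "jc (\<lambda>p. a1 p - D F p e1) = jet (\<lambda>t. a1 (cusp t) - t ^ 21 * (- r1 (- (t ^ 7))))"
      by (rule jet_cong, rule eventually_mono[OF dc]) (simp add: F'_def eval_nat_numeral algebra_simps)
    show "jc (\<lambda>p. a1 p - D F p e1) $$ m = 0" if "m < 15" for m
      unfolding 1 using that low(1) smooth_on_cusp[OF a(1)] sK'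
      by (simp add: sg fps_X_power_mult_nth)
    have 2: "jc (\<lambda>p. a2 p - D F p e2) = jet (\<lambda>t. a2 (cusp t) - t ^ 14 *
      (- (t ^ 12 * deriv r1 (- (t ^ 7))) + 3 * t ^ 5 * r1 (- (t ^ 7)) + r2 (- (t ^ 7)) - t ^ 10 * deriv r3 (- (t ^ 7)) + 3 * t ^ 3 * r3 (- (t ^ 7))))"
      by (rule jet_cong, rule eventually_mono[OF dc]) (simp add: F'_def eval_nat_numeral algebra_simps)
    show "jc (\<lambda>p. a2 p - D F p e2) $$ m = 0" if "m < 13" for m
      unfolding 2 using that low(2) smooth_on_cusp[OF a(2)] sK'
      by (simp add: sg fps_X_power_mult_nth)
    have 3: "jc (\<lambda>p. a3 p - D F p e3) = jet (\<lambda>t. a3 (cusp t) - t ^ 21 * (- r3 (- (t ^ 7))))"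
      by (rule jet_cong, rule eventually_mono[OF dc]) (simp add: F'_def eval_nat_numeral algebra_simps)
    show "jc (\<lambda>p. a3 p - D F p e3) $$ m = 0" if "m < 17" for m
      unfolding 3 using that low(3) smooth_on_cusp[OF a(3)] sK'
      by (simp add: sg fps_X_power_mult_nth)
    show "\<forall>\<^sub>F t in nhds 0. a1 (line t) - D F (line t) e1 = 0 \<and> a2 (line t) - D F (line t) e2 = 0 \<and> a3 (line t) - D F (line t) e3 = 0"
      using dl r1(2) r2(2) r3(2) by eventually_elim (simp add: F'_def)
  qed
qed

text \<open>A polynomial of weight below 20 is sought whose differential matches all low
  coefficients. The nine equations are the compatibility conditions of this linear system, and the
  remainder is of high order.\<close>

lemma exact_of_ellj_zero:
  assumes a: "smooth_germ a1" "smooth_germ a2" "smooth_germ a3"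
    and ell0: "\<And>w. ellj (jc a1) (jc a2) (jc a3) (jl a1) (jl a3) w = 0"
  shows "exact_on_N9 a1 a2 a3"
proof -
  define A where "A j = jc a1 $$ j" for j
  define B where "B j = jc a2 $$ j" for j
  define C where "C j = jc a3 $$ j" for j
  define k1 where "k1 = jl a1 $$ 2"
  define k3 where "k3 = jl a3 $$ 2"
  note jA = jets_on_N9[OF a(1), folded A_def] and jB = jets_on_N9[OF a(2), folded B_def]
    and jC = jets_on_N9[OF a(3), folded C_def]
  note l = ell0[of 8] ell0[of 10] ell0[of 11] ell0[of 12] ell0[of 13] ell0[of 14] ell0[of 16] ell0[of 17] ell0[of 19]
  have L: "A 3 = C 5" "B 3 + C 7 = 0" "2 * A 6 = C 8" "A 7 + B 5 = 0" "A 8 - 4 * B 6 - 2 * C 10 = 0" "3 * A 9 = C 11"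
      "A 11 - 3 * B 9 - C 13 = 0" "4 * A 12 + 8 * B 10 - C 14 + 17 * k3 = 0" "3 * A 14 - 8 * B 12 - 2 * C 16 - 19 * k1 = 0"
    using l by (simp_all add: ellj_def A_def B_def C_def k1_def k3_def)
  \<comment> \<open>In weights 15, 17, 18 and 19 several monomials of \<open>F\<close> contribute to
    the same power of t, so their coefficients have to be solved for: \<open>c6\<close>,
    \<open>c7\<close> in weight 15, \<open>c1\<close> in 17, \<open>c2\<close>, \<open>c3\<close> in
    18, \<open>c4\<close>, \<open>c5\<close> in 19.\<close>
  define c1 where "c1 = B 10 + 2 * k3"
  define c2 where "c2 = (A 13 + B 11) / 3"
  define c3 where "c3 = (C 15 - c2 + 2 * B 11) / 6"
  define c4 where "c4 = B 12 + 2 * k1"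
  define c5 where "c5 = (A 14 - k1) / 2"
  define c6 where "c6 = (A 10 + B 8) / 3"
  define c7 where "c7 = (C 12 + B 8) / 5"
  define F where "F p = C 0 * Z p + A 0 * X p + B 0 * Y p + (C 3 / 2) * Z p ^ 2 + A 3 * X p * Z p + (C 6 / 3) * Z p ^ 3
     + (A 5 / 2) * X p ^ 2 + B 3 * Y p * Z p + A 6 * X p * Z p ^ 2 + B 5 * X p * Y p + (C 9 / 4) * Z p ^ 4
     + (A 8 / 2) * X p ^ 2 * Z p + B 6 * Y p * Z p ^ 2 + A 9 * X p * Z p ^ 3 + (- B 7 / 2) * Y p ^ 2
     + c6 * X p ^ 3 + c7 * Z p ^ 5 + B 8 * X p * Y p * Z p + (A 11 / 2) * X p ^ 2 * Z p ^ 2 + B 9 * Y p * Z p ^ 3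
     + k3 * Y p ^ 2 * Z p + c1 * X p ^ 2 * Y p + (A 12 + 2 * c1) * X p * Z p ^ 4
     + B 11 * X p * Y p * Z p ^ 2 + c2 * X p ^ 3 * Z p + c3 * Z p ^ 6
     + k1 * X p * Y p ^ 2 + c4 * Y p * Z p ^ 4 + c5 * X p ^ 2 * Z p ^ 3" for p
  have sF: "smooth_germ F" unfolding F_def by (intro sg)
  define F1 where "F1 p = A 0 + A 3 * Z p + A 5 * X p + A 6 * Z p ^ 2 + B 5 * Y p + A 8 * X p * Z p + A 9 * Z p ^ 3
     + 3 * c6 * X p ^ 2 + B 8 * Y p * Z p + A 11 * X p * Z p ^ 2 + 2 * c1 * X p * Y p + (A 12 + 2 * c1) * Z p ^ 4
     + B 11 * Y p * Z p ^ 2 + 3 * c2 * X p ^ 2 * Z p + k1 * Y p ^ 2 + 2 * c5 * X p * Z p ^ 3" for p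
  define F2 where "F2 p = B 0 + B 3 * Z p + B 5 * X p + B 6 * Z p ^ 2 - B 7 * Y p + B 8 * X p * Z p + B 9 * Z p ^ 3
     + 2 * k3 * Y p * Z p + c1 * X p ^ 2 + B 11 * X p * Z p ^ 2 + 2 * k1 * X p * Y p + c4 * Z p ^ 4" for p
  define F3 where "F3 p = C 0 + C 3 * Z p + A 3 * X p + C 6 * Z p ^ 2 + B 3 * Y p + 2 * A 6 * X p * Z p + C 9 * Z p ^ 3
     + (A 8 / 2) * X p ^ 2 + 2 * B 6 * Y p * Z p + 3 * A 9 * X p * Z p ^ 2 + 5 * c7 * Z p ^ 4 + B 8 * X p * Y p
     + A 11 * X p ^ 2 * Z p + 3 * B 9 * Y p * Z p ^ 2 + k3 * Y p ^ 2 + 4 * (A 12 + 2 * c1) * X p * Z p ^ 3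
     + 2 * B 11 * X p * Y p * Z p + c2 * X p ^ 3 + 6 * c3 * Z p ^ 5 + 4 * c4 * Y p * Z p ^ 3 + 3 * c5 * X p ^ 2 * Z p ^ 2" for p
  have dF: "D F p = (\<lambda>v. F1 p * X v + F2 p * Y v + F3 p * Z v)" for p
  proof (rule D_eq)
    show "(F has_derivative (\<lambda>v. F1 p * X v + F2 p * Y v + F3 p * Z v)) (at p)"
      unfolding F_def F1_def F2_def F3_def
      by (rule derivative_eq_intros refl)+ (simp add: fun_eq_iff algebra_simps)
  qed
  have A7: "A 7 = - B 5" using L(4) by simp
  have f1: "F1 (cusp t) = A 0 + A 3 * t ^ 3 + A 5 * t ^ 5 + A 6 * t ^ 6 + A 7 * t ^ 7 + A 8 * t ^ 8 + A 9 * t ^ 9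
     + A 10 * t ^ 10 + A 11 * t ^ 11 + A 12 * t ^ 12 + A 13 * t ^ 13 + A 14 * t ^ 14" for t
    unfolding F1_def c6_def c2_def c5_def A7
    by (simp add: power_numeral_reduce) (simp add: field_simps)
  have f2: "F2 (cusp t) = B 0 + B 3 * t ^ 3 + B 5 * t ^ 5 + B 6 * t ^ 6 + B 7 * t ^ 7 + B 8 * t ^ 8 + B 9 * t ^ 9
     + B 10 * t ^ 10 + B 11 * t ^ 11 + B 12 * t ^ 12" for t
    unfolding F2_def c1_def c4_def
    by (simp add: power_numeral_reduce) (simp add: field_simps)
  \<comment> \<open>These dz-coefficients are determined by the dx- and dy-coefficients and by the
    line; that they take these values is the content of the nine equations.\<close>
  have C: "C 5 = A 3" "C 7 = - B 3" "C 8 = 2 * A 6" "C 10 = A 8 / 2 - 2 * B 6" "C 11 = 3 * A 9" "C 13 = A 11 - 3 * B 9"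
      "C 14 = k3 + 4 * (A 12 + 2 * c1)" "C 16 = 3 * c5 - 4 * c4"
    using L unfolding c1_def c4_def c5_def by (simp_all add: field_simps)
  have f3: "F3 (cusp t) = C 0 + C 3 * t ^ 3 + C 5 * t ^ 5 + C 6 * t ^ 6 + C 7 * t ^ 7 + C 8 * t ^ 8 + C 9 * t ^ 9
     + C 10 * t ^ 10 + C 11 * t ^ 11 + C 12 * t ^ 12 + C 13 * t ^ 13 + C 14 * t ^ 14 + C 15 * t ^ 15 + C 16 * t ^ 16" for t
    unfolding F3_def C c7_def c3_def
    by (simp add: power_numeral_reduce) (simp add: field_simps)
  have l1: "F1 (line t) = A 0 + B 5 * t + k1 * t ^ 2" and l2: "F2 (line t) = B 0 - B 7 * t"
    and l3: "F3 (line t) = C 0 + B 3 * t + k3 * t ^ 2" for t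
    by (simp_all add: F1_def F2_def F3_def)
  note sc = smooth_on_cusp[OF a(1)] smooth_on_cusp[OF a(2)] smooth_on_cusp[OF a(3)]
    smooth_on_line[OF a(1)] smooth_on_line[OF a(2)] smooth_on_line[OF a(3)]
  show ?thesis
  proof (rule exact_on_N9_diff[OF sF], rule exact_high_order)
    show "smooth_germ (\<lambda>p. a1 p - D F p e1)" "smooth_germ (\<lambda>p. a2 p - D F p e2)" "smooth_germ (\<lambda>p. a3 p - D F p e3)"
      by (intro sg a sF)+
    show "jc (\<lambda>p. a1 p - D F p e1) $$ m = 0" if "m < 15" for m
    proof -
      have "jc (\<lambda>p. a1 p - D F p e1) $$ m = A m - jet (\<lambda>t. F1 (cusp t)) $$ m"
        unfolding dF A_def using sc by (simp add: f1 sg)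
      moreover have "m \<in> {0, 1, 2, 3, 4, 5, 6, 7, 8, 9, 10, 11, 12, 13, 14}" using that by (simp, presburger)
      ultimately show ?thesis unfolding f1 by (elim insertE) (simp_all add: sg fps_X_power_nth jA(1-3)[simplified])
    qed
    show "jc (\<lambda>p. a2 p - D F p e2) $$ m = 0" if "m < 13" for m
    proof -
      have "jc (\<lambda>p. a2 p - D F p e2) $$ m = B m - jet (\<lambda>t. F2 (cusp t)) $$ m"
        unfolding dF B_def using sc by (simp add: f2 sg)
      moreover have "m \<in> {0, 1, 2, 3, 4, 5, 6, 7, 8, 9, 10, 11, 12}" using that by (simp, presburger)
      ultimately show ?thesis unfolding f2 by (elim insertE) (simp_all add: sg fps_X_power_nth jB(1-3)[simplified])
    qed
    show "jc (\<lambda>p. a3 p - D F p e3) $$ m = 0" if "m < 17" for m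
    proof -
      have "jc (\<lambda>p. a3 p - D F p e3) $$ m = C m - jet (\<lambda>t. F3 (cusp t)) $$ m"
        unfolding dF C_def using sc by (simp add: f3 sg)
      moreover have "m \<in> {0, 1, 2, 3, 4, 5, 6, 7, 8, 9, 10, 11, 12, 13, 14, 15, 16}" using that by (simp, presburger)
      ultimately show ?thesis unfolding f3 by (elim insertE) (simp_all add: sg fps_X_power_nth jC(1-3)[simplified])
    qed
    have jl: "jl (\<lambda>p. a1 p - D F p e1) = jl a1 - jet (\<lambda>t. A 0 + B 5 * t + k1 * t ^ 2)"
      "jl (\<lambda>p. a2 p - D F p e2) = jl a2 - jet (\<lambda>t. B 0 - B 7 * t)"
      "jl (\<lambda>p. a3 p - D F p e3) = jl a3 - jet (\<lambda>t. C 0 + B 3 * t + k3 * t ^ 2)"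
      unfolding dF using sc by (simp_all add: l1 l2 l3 sg)
    have jA': "a1 0 = A 0" "jl a1 $$ Suc 0 = B 5" and jB': "a2 0 = B 0" "jl a2 $$ Suc 0 = - B 7"
      and jC': "a3 0 = C 0" "jl a3 $$ Suc 0 = B 3"
      using jA(7,8) jB(7,8) jC(7,8) L(2,4) unfolding A_def B_def C_def by simp_all
    have m3: "m \<in> {0, 1, 2}" if "m < 3" for m :: nat using that by (simp, presburger)
    show "jl (\<lambda>p. a1 p - D F p e1) $$ m = 0" if "m < 3" for m
      using m3[OF that] unfolding jl
      by (elim insertE) (simp_all add: sg fps_X_power_nth jA' k1_def)
    show "jl (\<lambda>p. a3 p - D F p e3) $$ m = 0" if "m < 3" for m
      using m3[OF that] unfolding jl
      by (elim insertE) (simp_all add: sg fps_X_power_nth jC' k3_def)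
    have m2: "m \<in> {0, 1}" if "m < 2" for m :: nat using that by (simp, presburger)
    show "jl (\<lambda>p. a2 p - D F p e2) $$ m = 0" if "m < 2" for m
      using m2[OF that] unfolding jl
      by (elim insertE) (simp_all add: sg fps_X_power_nth jB')
  qed
qed

lemma exact_of_ell_zero:
  assumes \<alpha>: "smooth_form \<alpha>" and "\<And>w. ell \<alpha> w = 0"
  obtains F where "smooth_germ F" "\<forall>\<^sub>F p in nhds 0. p \<in> N9 \<longrightarrow> (\<forall>v. D F p v = \<alpha> p v)"
proof -
  have "exact_on_N9 (\<lambda>p. \<alpha> p e1) (\<lambda>p. \<alpha> p e2) (\<lambda>p. \<alpha> p e3)"
    using assms by (intro exact_of_ellj_zero) (auto simp: smooth_form_def ell_def)
  then obtain F where F: "smooth_germ F" "\<forall>\<^sub>F p in nhds 0. p \<in> N9 \<longrightarrow> D F p e1 = \<alpha> p e1 \<and> D F p e2 = \<alpha> p e2 \<and> D F p e3 = \<alpha> p e3"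
    by (auto simp: exact_on_N9_def)
  have "\<forall>\<^sub>F p in nhds 0. linear (\<alpha> p)" using \<alpha> by (simp add: smooth_form_def)
  then have "\<forall>\<^sub>F p in nhds 0. p \<in> N9 \<longrightarrow> (\<forall>v. D F p v = \<alpha> p v)"
    using F(2) smooth_germ_linear_D[OF F(1)]
  proof eventually_elim
    case (elim p)
    show ?case
    proof (intro impI allI)
      fix v assume "p \<in> N9"
      then show "D F p v = \<alpha> p v"
        using elim(2) R3_linear[OF elim(1), of v] R3_linear[OF elim(3), of v] by simp
    qed
  qed
  then show thesis using that F(1) by blast
qed

section \<open>Pullbacks and the Liouville form\<close>

definition pull :: "('a::real_normed_vector \<Rightarrow> 'b::real_normed_vector) \<Rightarrow> ('b \<Rightarrow> 'b \<Rightarrow> real) \<Rightarrow> 'a \<Rightarrow> 'a \<Rightarrow> real" where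
  "pull f \<alpha> x v = \<alpha> (f x) (D f x v)"

lemma smooth_form_smooth: "smooth_form \<alpha> \<Longrightarrow> smooth_germ (\<lambda>x. \<alpha> x v)"
  by (simp add: smooth_form_def)

lemma smooth_form_linear: "smooth_form \<alpha> \<Longrightarrow> \<forall>\<^sub>F x in nhds 0. linear (\<alpha> x)"
  by (simp add: smooth_form_def)

lemma smooth_form_pull:
  fixes f :: "'a::euclidean_space \<Rightarrow> 'b::euclidean_space"
  assumes \<alpha>: "smooth_form \<alpha>" and f: "smooth_germ f" "f 0 = 0"
  shows "smooth_form (pull f \<alpha>)"
proof -
  have lin: "\<forall>\<^sub>F x in nhds 0. linear (\<alpha> (f x))"
    by (rule smooth_germ_eventually[OF f smooth_form_linear[OF \<alpha>]])
  have 1: "smooth_germ (\<lambda>x. \<Sum>b\<in>Basis. (D f x v \<bullet> b) *\<^sub>R \<alpha> (f x) b)" for v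
    by (intro sg f smooth_germ_compose[OF smooth_form_smooth[OF \<alpha>] f])
  have 2: "\<forall>\<^sub>F x in nhds 0. (\<Sum>b\<in>Basis. (D f x v \<bullet> b) *\<^sub>R \<alpha> (f x) b) = pull f \<alpha> x v" for v
    using lin by eventually_elim (simp only: pull_def linear_basis_sum[symmetric])
  have "smooth_germ (\<lambda>x. pull f \<alpha> x v)" for v by (rule smooth_germ_cong[OF 2 1])
  moreover have "\<forall>\<^sub>F x in nhds 0. linear (pull f \<alpha> x)"
    using lin smooth_germ_linear_D[OF f(1)]
    by eventually_elim (simp add: pull_def[abs_def] linear_compose[unfolded comp_def])
  ultimately show ?thesis by (simp add: smooth_form_def)
qed

lemma D_compose_germ:
  fixes g :: "'a::euclidean_space \<Rightarrow> 'b::euclidean_space" and f :: "'b \<Rightarrow> 'c::euclidean_space"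
  assumes "smooth_germ f" "smooth_germ g" "g 0 = 0"
  shows "\<forall>\<^sub>F x in nhds 0. D (\<lambda>x. f (g x)) x = (\<lambda>v. D f (g x) (D g x v))"
  using smooth_germ_eventually[OF assms(2,3) smooth_germ_has_derivative[OF assms(1)]] smooth_germ_has_derivative[OF assms(2)]
proof eventually_elim
  case (elim x)
  show ?case by (rule D_eq[OF has_derivative_compose[OF elim(2,1)]])
qed

lemma pull_D:
  fixes g :: "'a::euclidean_space \<Rightarrow> 'b::euclidean_space"
  assumes "smooth_germ F" "smooth_germ g" "g 0 = 0"
  shows "\<forall>\<^sub>F x in nhds 0. \<forall>v. pull g (\<lambda>y. D F y) x v = D (\<lambda>x. F (g x)) x v"
  using D_compose_germ[OF assms] by eventually_elim (simp add: pull_def)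

text \<open>The two pullbacks differ on \<open>N9\<close> by the differential of \<open>\<alpha> (g p) (f p - g p)\<close>.\<close>

lemma ell_pull_agree:
  fixes f g :: "R3 \<Rightarrow> 'b::euclidean_space"
  assumes \<alpha>: "smooth_form \<alpha>" and f: "smooth_germ f" "f 0 = 0" and g: "smooth_germ g" "g 0 = 0"
    and eq: "\<forall>\<^sub>F p in nhds 0. p \<in> N9 \<longrightarrow> f p = g p"
  shows "ell (pull f \<alpha>) w = ell (pull g \<alpha>) w"
proof -
  define c where "c b p = \<alpha> (g p) b" for b p
  have c: "smooth_germ (c b)" for b
    unfolding c_def by (rule smooth_germ_compose[OF smooth_form_smooth[OF \<alpha>] g])
  define F where "F p = (\<Sum>b\<in>Basis. ((f p - g p) \<bullet> b) * c b p)" for p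
  have sF: "smooth_germ F" unfolding F_def by (intro sg f g c)
  have "\<forall>\<^sub>F p in nhds 0. \<forall>b\<in>Basis. (c b has_derivative D (c b) p) (at p)"
    by (intro eventually_ball_finite finite_Basis ballI smooth_germ_has_derivative c)
  then have "\<forall>\<^sub>F p in nhds 0. p \<in> N9 \<longrightarrow> (\<forall>v. pull f \<alpha> p v - pull g \<alpha> p v = D F p v)"
    using smooth_germ_has_derivative[OF f(1)] smooth_germ_has_derivative[OF g(1)]
      smooth_germ_eventually[OF g smooth_form_linear[OF \<alpha>]] eq
  proof eventually_elim
    case (elim p)
    show ?case
    proof (intro impI allI)
      fix v assume "p \<in> N9"
      then have fg: "f p = g p" using elim by blast
      have "(F has_derivative (\<lambda>v. \<Sum>b\<in>Basis. ((f p - g p) \<bullet> b) * D (c b) p v + ((D f p v - D g p v) \<bullet> b) * c b p)) (at p)"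
        unfolding F_def
        by (intro has_derivative_sum has_derivative_mult has_derivative_inner_left has_derivative_diff elim(2,3))
          (use elim(1) in blast)
      then have "D F p v = (\<Sum>b\<in>Basis. ((D f p v - D g p v) \<bullet> b) * \<alpha> (g p) b)"
        by (simp add: D_eq fg c_def)
      also have "\<dots> = \<alpha> (g p) (D f p v - D g p v)"
        by (rule linear_basis_sum[OF elim(4), symmetric, unfolded real_scaleR_def])
      also have "\<dots> = pull f \<alpha> p v - pull g \<alpha> p v"
        using linear_diff[OF elim(4)] fg by (simp add: pull_def)
      finally show "pull f \<alpha> p v - pull g \<alpha> p v = D F p v" by simp
    qed
  qed
  then have "ell (\<lambda>p v. pull f \<alpha> p v - pull g \<alpha> p v) = ell (\<lambda>p. D F p)" by (rule ell_cong)
  then have "ell (\<lambda>p v. pull f \<alpha> p v - pull g \<alpha> p v) w = 0" using ell_exact[OF sF] by simp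
  then show ?thesis
    using ell_diff[OF smooth_form_smooth[OF smooth_form_pull[OF \<alpha> f]] smooth_form_smooth[OF smooth_form_pull[OF \<alpha> g]]] by simp
qed

definition lam :: "'n::finite symp \<Rightarrow> 'n symp \<Rightarrow> real" where
  "lam z v = fst z \<bullet> snd v"

lemma omega0_eq: "omega0 u v = fst u \<bullet> snd v - snd u \<bullet> fst v"
  by (simp add: omega0_def inner_vec_def sum_subtractf)

lemma linear_lam: "linear (lam z)"
  by (auto simp: lam_def linear_iff inner_add_right)

lemma smooth_form_lam: "smooth_form lam"
  unfolding smooth_form_def lam_def[abs_def]
  by (auto intro!: sg simp: linear_iff inner_add_right)

lemma pull_lam: "pull f lam x v = fst (f x) \<bullet> snd (D f x v)"
  by (simp add: pull_def lam_def)

lemma smooth_form_pull_lam: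
  assumes "smooth_germ f" shows "smooth_form (pull f lam)"
  unfolding smooth_form_def
proof
  show "\<forall>v. smooth_germ (\<lambda>x. pull f lam x v)"
    unfolding pull_lam by (intro allI sg assms)
  show "\<forall>\<^sub>F x in nhds 0. linear (pull f lam x)"
    using smooth_germ_linear_D[OF assms]
    by eventually_elim (simp add: pull_def[abs_def] linear_compose[unfolded comp_def] linear_lam)
qed

text \<open>The second derivatives of \<open>f\<close> cancel by symmetry, so pulling back commutes
  with the exterior derivative, and that of \<open>lam\<close> is \<open>omega0\<close>.\<close>

lemma D_pull_lam:
  fixes f :: "'a::euclidean_space \<Rightarrow> 'n::finite symp"
  assumes "smooth_germ f"
  shows "\<forall>\<^sub>F x in nhds 0. \<forall>u v. D (\<lambda>x. pull f lam x v) x u - D (\<lambda>x. pull f lam x u) x v = omega0 (D f x u) (D f x v)"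
proof -
  obtain U where U: "open U" "0 \<in> U" "smooth_on U f" using assms by (auto simp: smooth_germ_def)
  have "D (\<lambda>x. pull f lam x v) x u - D (\<lambda>x. pull f lam x u) x v = omega0 (D f x u) (D f x v)" if x: "x \<in> U" for x u v
  proof -
    have 1: "D (\<lambda>x. pull f lam x v) x u = fst (f x) \<bullet> snd (D (\<lambda>y. D f y v) x u) + fst (D f x u) \<bullet> snd (D f x v)" for u v
    proof -
      have "((\<lambda>x. pull f lam x v) has_derivative (\<lambda>u. fst (f x) \<bullet> snd (D (\<lambda>y. D f y v) x u) + fst (D f x u) \<bullet> snd (D f x v))) (at x)"
        unfolding pull_lam
        by (intro has_derivative_inner has_derivative_fst has_derivative_snd smooth_on_has_derivative[OF U(3) x]
            smooth_on_has_derivative[OF smooth_on_D[OF U(3)] x])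
      then show ?thesis by (simp add: D_eq)
    qed
    show ?thesis
      unfolding 1 using symmetric_second_derivative[OF U(1) x U(3), of u v]
      by (simp add: omega0_eq inner_commute)
  qed
  then show ?thesis using U(1,2) by (auto simp: eventually_nhds)
qed

text \<open>The difference is closed by \<open>D_pull_lam\<close>, so the Poincare lemma applies. It
  is used for a symplectic change of the target and for a map into a Lagrangian germ compared with a
  constant map.\<close>

lemma liouville_difference_exact:
  fixes f g :: "'a::euclidean_space \<Rightarrow> 'n::finite symp"
  assumes f: "smooth_germ f" and g: "smooth_germ g"
    and eq: "\<forall>\<^sub>F x in nhds 0. \<forall>u v. omega0 (D f x u) (D f x v) = omega0 (D g x u) (D g x v)"
  obtains F where "smooth_germ F" "F 0 = 0" "\<forall>\<^sub>F x in nhds 0. \<forall>v. D F x v = pull f lam x v - pull g lam x v"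
proof -
  let ?\<alpha> = "\<lambda>x v. pull f lam x v - pull g lam x v"
  note sf = smooth_form_pull_lam[OF f] and sgm = smooth_form_pull_lam[OF g]
  have sm: "smooth_form ?\<alpha>"
    unfolding smooth_form_def
  proof
    show "\<forall>v. smooth_germ (\<lambda>x. ?\<alpha> x v)" by (intro allI sg smooth_form_smooth sf sgm)
    show "\<forall>\<^sub>F x in nhds 0. linear (?\<alpha> x)"
      using smooth_form_linear[OF sf] smooth_form_linear[OF sgm]
      by eventually_elim (rule linear_compose_sub)
  qed
  have d: "\<forall>\<^sub>F x in nhds 0. \<forall>v. D (\<lambda>x. ?\<alpha> x v) x = (\<lambda>u. D (\<lambda>x. pull f lam x v) x u - D (\<lambda>x. pull g lam x v) x u)"
  proof -
    obtain U where U: "open U" "0 \<in> U" "smooth_on U f" "smooth_on U g" by (rule smooth_germ2[OF f g])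
    have s: "smooth_on U (\<lambda>x. pull h lam x v)" if "smooth_on U h" for h :: "'a \<Rightarrow> 'n symp" and v
      unfolding pull_lam
      by (intro smooth_on_bilinear[OF U(1) bounded_bilinear_inner] smooth_on_bounded_linear[OF U(1) bounded_linear_fst]
         smooth_on_bounded_linear[OF U(1) bounded_linear_snd] smooth_on_D that)
    have "D (\<lambda>x. ?\<alpha> x v) x = (\<lambda>u. D (\<lambda>x. pull f lam x v) x u - D (\<lambda>x. pull g lam x v) x u)" if "x \<in> U" for x v
      by (rule D_eq[OF has_derivative_diff[OF smooth_on_has_derivative[OF s[OF U(3)] that] smooth_on_has_derivative[OF s[OF U(4)] that]]])
    then show ?thesis using U(1,2) by (auto simp: eventually_nhds)
  qed
  have "\<forall>\<^sub>F x in nhds 0. \<forall>u v. D (\<lambda>x. ?\<alpha> x v) x u = D (\<lambda>x. ?\<alpha> x u) x v"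
    using d D_pull_lam[OF f] D_pull_lam[OF g] eq
  proof eventually_elim
    case (elim x)
    show ?case
    proof (intro allI)
      fix u v
      show "D (\<lambda>x. ?\<alpha> x v) x u = D (\<lambda>x. ?\<alpha> x u) x v"
        using elim(1) elim(2)[rule_format, of v u] elim(3)[rule_format, of v u] elim(4)[rule_format, of u v] by simp
    qed
  qed
  then obtain F where F: "smooth_germ F" "F 0 = 0" "\<forall>\<^sub>F x in nhds 0. (F has_derivative ?\<alpha> x) (at x)"
    using poincare[OF sm] by blast
  have "\<forall>\<^sub>F x in nhds 0. \<forall>v. D F x v = ?\<alpha> x v" using F(3) by eventually_elim (simp add: D_eq)
  then show thesis using that F by blast
qed

section \<open>Substitutions preserving the branches\<close>

text \<open>These are the contractions of dz dx, dz dy, dx dy with the Euler field of weights 5, 7,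
  3. When (x, y, z) is replaced by (x U^5, y U^7, z U^3), the terms with dU cancel and the three
  forms are just multiplied by U^8, U^10, U^12.\<close>

definition tau8 :: "R3 \<Rightarrow> R3 \<Rightarrow> real" where "tau8 p v = 3 * Z p * X v - 5 * X p * Z v"
definition tau10 :: "R3 \<Rightarrow> R3 \<Rightarrow> real" where "tau10 p v = 3 * Z p * Y v - 7 * Y p * Z v"
definition tau12 :: "R3 \<Rightarrow> R3 \<Rightarrow> real" where "tau12 p v = 5 * X p * Y v - 7 * Y p * X v"

text \<open>The weights of \<open>tau8\<close> multiplied by 1, z, x, z^2, x z, z^3, x z^2.\<close>

abbreviation wts8 :: "nat set" where "wts8 \<equiv> {8, 11, 13, 14, 16, 17, 19}"
abbreviation wts :: "nat set" where "wts \<equiv> {8, 10, 11, 12, 13, 14, 16, 17, 19}"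

lemma ell_outside: "w \<notin> wts \<Longrightarrow> ell \<alpha> w = 0"
  by (simp add: ell_def ellj_def)

lemma ell_tau8:
  assumes "smooth_germ R"
  shows "ell (\<lambda>p v. R p * tau8 p v) w = (if w \<in> wts8 then jc R $$ (w - 8) else 0)"
proof -
  note s = smooth_on_cusp[OF assms] smooth_on_line[OF assms]
  have j: "jc (\<lambda>p. R p * tau8 p e1) = fps_const 3 * (fps_X ^ 3 * jc R)" "jc (\<lambda>p. R p * tau8 p e2) = 0"
    "jc (\<lambda>p. R p * tau8 p e3) = - (fps_const 5 * (fps_X ^ 5 * jc R))"
    "jl (\<lambda>p. R p * tau8 p e1) = 0" "jl (\<lambda>p. R p * tau8 p e3) = 0"
    using s by (simp_all add: tau8_def sg mult_ac)
  show ?thesis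
    unfolding ell_def j using jets_on_N9(1-3)[OF assms]
    by (simp add: ellj_def fps_X_power_mult_nth)
qed

text \<open>Beyond weight 10, multiples of \<open>tau10\<close> are multiples of \<open>tau8\<close>
  modulo exact forms; for instance z \<open>tau10\<close> and -2 x \<open>tau8\<close> have the same
  invariants. In weight 17 the coefficient of t^7 on the cusp also stands for the linear term on the
  line.\<close>

lemma ell_tau10:
  assumes "smooth_germ R"
  shows "ell (\<lambda>p v. R p * tau10 p v) w = (if w = 10 then jc R $$ 0 else if w = 13 then - 2 * jc R $$ 3
    else if w = 16 then - 2 * jc R $$ 6 else if w = 17 then 8 * jc R $$ 7 else if w = 19 then - 2 * jc R $$ 9 else 0)"
proof -
  note s = smooth_on_cusp[OF assms] smooth_on_line[OF assms]
  have j: "jc (\<lambda>p. R p * tau10 p e1) = 0" "jc (\<lambda>p. R p * tau10 p e2) = fps_const 3 * (fps_X ^ 3 * jc R)"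
    "jc (\<lambda>p. R p * tau10 p e3) = fps_const 7 * (fps_X ^ 7 * jc R)"
    "jl (\<lambda>p. R p * tau10 p e1) = 0" "jl (\<lambda>p. R p * tau10 p e3) = - (fps_const 7 * (fps_X * jl R))"
    using s by (simp_all add: tau10_def sg mult_ac)
  show ?thesis
    unfolding ell_def j using jets_on_N9(1-3,8)[OF assms]
    by (simp add: ellj_def fps_X_power_mult_nth numeral_2_eq_2)
qed

lemma ell_tau12:
  assumes "smooth_germ R"
  shows "ell (\<lambda>p v. R p * tau12 p v) w = (if w = 12 then jc R $$ 0 else if w = 17 then 4 * jc R $$ 5
    else if w = 19 then - 8 * jc R $$ 7 else 0)"
proof -
  note s = smooth_on_cusp[OF assms] smooth_on_line[OF assms]
  have j: "jc (\<lambda>p. R p * tau12 p e1) = fps_const 7 * (fps_X ^ 7 * jc R)" "jc (\<lambda>p. R p * tau12 p e2) = fps_const 5 * (fps_X ^ 5 * jc R)"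
    "jc (\<lambda>p. R p * tau12 p e3) = 0"
    "jl (\<lambda>p. R p * tau12 p e1) = - (fps_const 7 * (fps_X * jl R))" "jl (\<lambda>p. R p * tau12 p e3) = 0"
    using s by (simp_all add: tau12_def sg mult_ac)
  show ?thesis
    unfolding ell_def j using jets_on_N9(1-3,8)[OF assms]
    by (simp add: ellj_def fps_X_power_mult_nth numeral_2_eq_2)
qed

definition pcoef :: "(nat \<Rightarrow> real) \<Rightarrow> R3 \<Rightarrow> real" where
  "pcoef v p = v 8 + v 11 * Z p + v 13 * X p + v 14 * Z p ^ 2 + v 16 * X p * Z p + v 17 * Z p ^ 3 + v 19 * X p * Z p ^ 2"

definition model :: "(nat \<Rightarrow> real) \<Rightarrow> R3 \<Rightarrow> R3 \<Rightarrow> real" where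
  "model v p w = pcoef v p * tau8 p w + v 10 * tau10 p w + v 12 * tau12 p w"

lemma smooth_taus [sg]: "smooth_germ (\<lambda>p. tau8 p w)" "smooth_germ (\<lambda>p. tau10 p w)" "smooth_germ (\<lambda>p. tau12 p w)"
  "smooth_germ (\<lambda>p. pcoef v p)"
  unfolding tau8_def tau10_def tau12_def pcoef_def by (intro sg)+

lemma smooth_form_model: "smooth_form (model v)"
  unfolding smooth_form_def model_def[abs_def]
proof (intro conjI allI always_eventually)
  show "smooth_germ (\<lambda>p. pcoef v p * tau8 p w + v 10 * tau10 p w + v 12 * tau12 p w)" for w by (intro sg)
  show "linear (\<lambda>w. pcoef v p * tau8 p w + v 10 * tau10 p w + v 12 * tau12 p w)" for p
    by (auto simp: linear_iff tau8_def tau10_def tau12_def algebra_simps)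
qed

text \<open>The denominators in \<open>ellj\<close> are chosen to make the functionals dual to the
  nine forms that span \<open>model\<close>.\<close>

lemma ell_model:
  assumes "w \<in> wts" shows "ell (model v) w = v w"
proof -
  have "ell (model v) w = ell (\<lambda>p w. pcoef v p * tau8 p w) w + ell (\<lambda>p w. v 10 * tau10 p w) w + ell (\<lambda>p w. v 12 * tau12 p w) w"
    unfolding model_def[abs_def] by (subst ell_add; (intro sg)?)+ simp
  also have "ell (\<lambda>p w. pcoef v p * tau8 p w) w = (if w \<in> wts8 then jc (pcoef v) $$ (w - 8) else 0)"
    by (rule ell_tau8) (intro sg)
  also have "jc (pcoef v) = fps_const (v 8) + fps_const (v 11) * fps_X ^ 3 + fps_const (v 13) * fps_X ^ 5 + fps_const (v 14) * fps_X ^ 6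
     + fps_const (v 16) * fps_X ^ 8 + fps_const (v 17) * fps_X ^ 9 + fps_const (v 19) * fps_X ^ 11"
    by (simp add: pcoef_def sg mult.assoc flip: power_mult power_add)
  finally show ?thesis
    using assms ell_tau10[OF smooth_germ_const, of "v 10" w] ell_tau12[OF smooth_germ_const, of "v 12" w]
    by (elim insertE) (simp_all add: fps_X_power_nth)
qed

text \<open>\<open>kappa\<close> vanishes on the cusp and is \<open>y\<^sup>2\<close> on the line, so that \<open>M\<close> reparametrizes the line alone.\<close>

definition kappa :: "R3 \<Rightarrow> real" where "kappa p = Y p ^ 2 - X p * Z p ^ 3"

definition Phi :: "(R3 \<Rightarrow> real) \<Rightarrow> (R3 \<Rightarrow> real) \<Rightarrow> R3 \<Rightarrow> R3" where
  "Phi U M p = (X p * U p ^ 5, Y p * U p ^ 7 + kappa p * M p, Z p * U p ^ 3)"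

lemma kappa_cusp [simp]: "kappa (cusp t) = 0" and kappa_line [simp]: "kappa (line t) = t ^ 2"
  by (simp_all add: kappa_def flip: power_mult power_add)

lemma smooth_kappa [sg]: "smooth_germ kappa"
  unfolding kappa_def[abs_def] by (intro sg)

lemma smooth_Phi: "smooth_germ U \<Longrightarrow> smooth_germ M \<Longrightarrow> smooth_germ (Phi U M)"
  unfolding Phi_def[abs_def] by (intro sg)

lemma Phi_0 [simp]: "Phi U M 0 = 0" by (simp add: Phi_def kappa_def zero_prod_def)

lemma Phi_cusp: "Phi U M (cusp t) = cusp (t * U (cusp t))"
  by (simp add: Phi_def) (simp add: cusp_def power_mult_distrib)

lemma Phi_line: "Phi U M (line t) = line (t * U (line t) ^ 7 + t ^ 2 * M (line t))"
  by (simp add: Phi_def) (simp add: line_def)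

lemma Phi_N9: "p \<in> N9 \<Longrightarrow> Phi U M p \<in> N9"
  by (metis N9_cases Phi_cusp Phi_line cusp_in_N9 line_in_N9)

lemma D_Phi:
  assumes "U differentiable (at p)" "M differentiable (at p)"
  shows "D (Phi U M) p v = (X v * U p ^ 5 + 5 * X p * U p ^ 4 * D U p v,
      Y v * U p ^ 7 + 7 * Y p * U p ^ 6 * D U p v + D (\<lambda>p. kappa p * M p) p v, Z v * U p ^ 3 + 3 * Z p * U p ^ 2 * D U p v)"
proof -
  have k: "(kappa has_derivative (\<lambda>v. 2 * Y p * Y v - X v * Z p ^ 3 - 3 * X p * Z p ^ 2 * Z v)) (at p)"
    unfolding kappa_def by (rule derivative_eq_intros refl)+ (simp add: fun_eq_iff algebra_simps)
  have "(\<lambda>p. kappa p * M p) differentiable (at p)"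
    by (rule differentiableI[OF has_derivative_mult[OF k D_works[OF assms(2)]]])
  note 2 = D_works[OF this] and 1 = D_works[OF assms(1)]
  have "(Phi U M has_derivative (\<lambda>v. (X v * U p ^ 5 + 5 * X p * U p ^ 4 * D U p v,
      Y v * U p ^ 7 + 7 * Y p * U p ^ 6 * D U p v + D (\<lambda>p. kappa p * M p) p v, Z v * U p ^ 3 + 3 * Z p * U p ^ 2 * D U p v))) (at p)"
    unfolding Phi_def by (rule derivative_eq_intros refl 1 2)+ (simp add: fun_eq_iff algebra_simps)
  then show ?thesis by (simp add: D_eq)
qed

text \<open>The effect on the invariants of the substitution \<open>Phi U M\<close>; \<open>u\<close> is the Taylor series of \<open>U\<close> on the cusp and \<open>m = M 0\<close>.\<close>

definition act :: "(nat \<Rightarrow> real) \<Rightarrow> real fps \<Rightarrow> real \<Rightarrow> nat \<Rightarrow> real" where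
  "act v u m w = (if w \<in> wts8 then \<Sum>i\<in>wts8. v i * (fps_X ^ (i - 8) * u ^ i) $$ (w - 8) else 0)
    + v 10 * (if w = 10 then (u ^ 10) $$ 0 else if w = 13 then - 2 * (u ^ 10) $$ 3
       else if w = 16 then - 2 * (u ^ 10) $$ 6 else if w = 17 then 8 * (u ^ 10) $$ 7 else if w = 19 then - 2 * (u ^ 10) $$ 9 else 0)
    + v 12 * (if w = 12 then (u ^ 12) $$ 0 else if w = 17 then 4 * (u ^ 12) $$ 5
       else if w = 19 then - 8 * (u ^ 12) $$ 7 else 0)
    + (if w = 17 then - 10 * v 10 * m * (u $$ 0) ^ 3 else if w = 19 then 12 * v 12 * m * (u $$ 0) ^ 5 else 0)"

lemma ell_add6:
  assumes "\<And>v. smooth_germ (\<lambda>p. T1 p v)" "\<And>v. smooth_germ (\<lambda>p. T2 p v)" "\<And>v. smooth_germ (\<lambda>p. T3 p v)"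
    "\<And>v. smooth_germ (\<lambda>p. T4 p v)" "\<And>v. smooth_germ (\<lambda>p. T5 p v)" "\<And>v. smooth_germ (\<lambda>p. T6 p v)"
  shows "ell (\<lambda>p v. T1 p v + T2 p v + T3 p v + T4 p v + T5 p v + T6 p v) w
    = ell T1 w + ell T2 w + ell T3 w + ell T4 w + ell T5 w + ell T6 w"
  by (simp add: ell_add smooth_germ_add assms)

text \<open>The form vanishes on the cusp and starts with \<open>t ^ 2\<close> on the line, where
  only the terms in weights 17 and 19 look.\<close>

lemma ell_kappa_form:
  assumes M: "smooth_germ M" and F: "smooth_germ F"
  shows "ell (\<lambda>p v. kappa p * M p * D F p v) w
    = (if w = 17 then M 0 * D F 0 e3 else if w = 19 then - M 0 * D F 0 e1 else 0)"
proof -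
  have s: "smooth_germ (\<lambda>t. D F (line t) v)" for v by (rule smooth_on_line[OF smooth_germ_D[OF F]])
  have c: "jc (\<lambda>p. kappa p * M p * D F p v) = 0" for v by simp
  have l: "jl (\<lambda>p. kappa p * M p * D F p v) $$ 2 = M 0 * D F 0 v" for v
    using s smooth_on_line[OF M] by (simp add: sg fps_X_power_mult_nth mult.assoc)
  show ?thesis unfolding ell_def ellj_def c l by simp
qed

theorem ell_pull_Phi_model:
  assumes U: "smooth_germ U" and M: "smooth_germ M"
  shows "ell (pull (Phi U M) (model v)) w = act v (jc U) (M 0) w"
proof -
  let ?u = "jc U"
  let ?Q8 = "\<lambda>p. pcoef v (Phi U M p) * U p ^ 8"
  \<comment> \<open>Integration by parts: with Z for the new third coordinate, 3 Z d(kappa M) - 7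
    kappa M dZ is d(3 Z kappa M) - 10 kappa M dZ; for \<open>tau12\<close> the number is 5 + 7 = 12.
    Hence the factors 10 and 12 in the last line of \<open>act\<close>.\<close>
  let ?E = "\<lambda>p. v 10 * (3 * (Z p * U p ^ 3) * (kappa p * M p)) + v 12 * (5 * (X p * U p ^ 5) * (kappa p * M p))"
  let ?Z = "\<lambda>p. Z p * U p ^ 3" and ?X = "\<lambda>p. X p * U p ^ 5"
  have sE: "smooth_germ ?E" and sZ: "smooth_germ ?Z" and sX: "smooth_germ ?X" by (intro sg U M)+
  have sQ: "smooth_germ ?Q8"
    using smooth_germ_compose[OF smooth_taus(4) smooth_Phi[OF U M]] by (intro sg U) simp_all
  have dU: "\<forall>\<^sub>F p in nhds 0. U differentiable (at p)" and dM: "\<forall>\<^sub>F p in nhds 0. M differentiable (at p)"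
    using smooth_germ_differentiable U M by blast+
  have sKM: "smooth_germ (\<lambda>p. kappa p * M p)" by (intro sg M)
  have "\<forall>\<^sub>F p in nhds 0. \<forall>w. pull (Phi U M) (model v) p w
     = ?Q8 p * tau8 p w + v 10 * U p ^ 10 * tau10 p w + v 12 * U p ^ 12 * tau12 p w + D ?E p w
       + (- 10 * v 10) * (kappa p * M p * D ?Z p w) + (- 12 * v 12) * (kappa p * M p * D ?X p w)"
    using dU dM smooth_germ_has_derivative[OF sKM]
  proof eventually_elim
    case (elim p)
    note 1 = D_works[OF elim(1)]
    have z: "D ?Z p = (\<lambda>w. Z w * U p ^ 3 + 3 * Z p * U p ^ 2 * D U p w)"
      by (rule D_eq, (rule derivative_eq_intros refl 1)+) (simp add: fun_eq_iff algebra_simps)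
    have x: "D ?X p = (\<lambda>w. X w * U p ^ 5 + 5 * X p * U p ^ 4 * D U p w)"
      by (rule D_eq, (rule derivative_eq_intros refl 1)+) (simp add: fun_eq_iff algebra_simps)
    have e: "D ?E p = (\<lambda>w. v 10 * (3 * D ?Z p w * (kappa p * M p) + 3 * ?Z p * D (\<lambda>p. kappa p * M p) p w)
        + v 12 * (5 * D ?X p w * (kappa p * M p) + 5 * ?X p * D (\<lambda>p. kappa p * M p) p w))"
      unfolding z x
      by (rule D_eq, (rule derivative_eq_intros refl 1 elim(3))+) (simp add: fun_eq_iff algebra_simps)
    show ?case
      unfolding pull_def model_def D_Phi[OF elim(1,2)] e z x
      by (simp add: tau8_def tau10_def tau12_def Phi_def power_numeral_reduce algebra_simps)
  qed
  note * = ell_cong_germ[OF this]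
  have "ell (pull (Phi U M) (model v)) w = ell (\<lambda>p w. ?Q8 p * tau8 p w) w + ell (\<lambda>p w. v 10 * U p ^ 10 * tau10 p w) w
     + ell (\<lambda>p w. v 12 * U p ^ 12 * tau12 p w) w + ell (\<lambda>p. D ?E p) w
     + ell (\<lambda>p w. (- 10 * v 10) * (kappa p * M p * D ?Z p w)) w + ell (\<lambda>p w. (- 12 * v 12) * (kappa p * M p * D ?X p w)) w"
    unfolding * by (rule ell_add6) (intro sg sQ U M sE sZ sX)+
  moreover have "ell (\<lambda>p w. ?Q8 p * tau8 p w) w = (if w \<in> wts8 then \<Sum>i\<in>wts8. v i * (fps_X ^ (i - 8) * ?u ^ i) $$ (w - 8) else 0)"
  proof -
    have sU: "smooth_germ (\<lambda>t. U (cusp t))" by (rule smooth_on_cusp[OF U])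
    have q: "?Q8 (cusp t) = v 8 * U (cusp t) ^ 8 + v 11 * (t ^ 3 * U (cusp t) ^ 11) + v 13 * (t ^ 5 * U (cusp t) ^ 13)
        + v 14 * (t ^ 6 * U (cusp t) ^ 14) + v 16 * (t ^ 8 * U (cusp t) ^ 16) + v 17 * (t ^ 9 * U (cusp t) ^ 17)
        + v 19 * (t ^ 11 * U (cusp t) ^ 19)" for t
      by (simp add: pcoef_def Phi_def power_numeral_reduce algebra_simps)
    have "jc ?Q8 = fps_const (v 8) * ?u ^ 8 + fps_const (v 11) * (fps_X ^ 3 * ?u ^ 11) + fps_const (v 13) * (fps_X ^ 5 * ?u ^ 13)
        + fps_const (v 14) * (fps_X ^ 6 * ?u ^ 14) + fps_const (v 16) * (fps_X ^ 8 * ?u ^ 16) + fps_const (v 17) * (fps_X ^ 9 * ?u ^ 17)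
        + fps_const (v 19) * (fps_X ^ 11 * ?u ^ 19)"
      unfolding q using sU by (simp add: sg)
    then show ?thesis by (simp only: ell_tau8[OF sQ]) (simp del: fps_X_power_mult_nth)
  qed
  moreover have "ell (\<lambda>p w. v 10 * U p ^ 10 * tau10 p w) w = v 10 * (if w = 10 then (?u ^ 10) $$ 0 else if w = 13 then - 2 * (?u ^ 10) $$ 3
       else if w = 16 then - 2 * (?u ^ 10) $$ 6 else if w = 17 then 8 * (?u ^ 10) $$ 7 else if w = 19 then - 2 * (?u ^ 10) $$ 9 else 0)"
  proof -
    have sR: "smooth_germ (\<lambda>p. v 10 * U p ^ 10)" by (intro sg U)
    have "jc (\<lambda>p. v 10 * U p ^ 10) = fps_const (v 10) * ?u ^ 10" using smooth_on_cusp[OF U] by (simp add: sg)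
    then show ?thesis by (simp add: ell_tau10[OF sR])
  qed
  moreover have "ell (\<lambda>p w. v 12 * U p ^ 12 * tau12 p w) w = v 12 * (if w = 12 then (?u ^ 12) $$ 0 else if w = 17 then 4 * (?u ^ 12) $$ 5
       else if w = 19 then - 8 * (?u ^ 12) $$ 7 else 0)"
  proof -
    have sR: "smooth_germ (\<lambda>p. v 12 * U p ^ 12)" by (intro sg U)
    have "jc (\<lambda>p. v 12 * U p ^ 12) = fps_const (v 12) * ?u ^ 12" using smooth_on_cusp[OF U] by (simp add: sg)
    then show ?thesis by (simp add: ell_tau12[OF sR])
  qed
  moreover have "ell (\<lambda>p w. (- 10 * v 10) * (kappa p * M p * D ?Z p w)) w
      + ell (\<lambda>p w. (- 12 * v 12) * (kappa p * M p * D ?X p w)) w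
      = (if w = 17 then - 10 * v 10 * M 0 * (?u $$ 0) ^ 3 else if w = 19 then 12 * v 12 * M 0 * (?u $$ 0) ^ 5 else 0)"
  proof -
    note 1 = D_works[OF eventually_nhds_x_imp_x[OF dU]]
    have z: "D ?Z 0 = (\<lambda>w. Z w * U 0 ^ 3)"
      by (rule D_eq, (rule derivative_eq_intros refl 1)+) (simp add: fun_eq_iff algebra_simps)
    have x: "D ?X 0 = (\<lambda>w. X w * U 0 ^ 5)"
      by (rule D_eq, (rule derivative_eq_intros refl 1)+) (simp add: fun_eq_iff algebra_simps)
    have s: "smooth_germ (\<lambda>p. kappa p * M p * D F p w)" if "smooth_germ F" for F w
      by (intro sg M that)
    show ?thesis
      by (simp only: ell_cmult[OF s[OF sZ]] ell_cmult[OF s[OF sX]] ell_kappa_form[OF M sZ] ell_kappa_form[OF M sX] z x) simp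
  qed
  ultimately show ?thesis using ell_exact[OF sE, of w] by (simp only: act_def)
qed

text \<open>By exactness it is enough to treat the model with the same invariants; the pullback of the exact
  remainder is exact again.\<close>

theorem ell_pull:
  assumes \<alpha>: "smooth_form \<alpha>" and s: "smooth_germ s" "s 0 = 0" and U: "smooth_germ U" and M: "smooth_germ M"
    and eq: "\<forall>\<^sub>F p in nhds 0. p \<in> N9 \<longrightarrow> s p = Phi U M p"
  shows "ell (pull s \<alpha>) w = act (ell \<alpha>) (jc U) (M 0) w"
proof -
  let ?P = "Phi U M" and ?v = "ell \<alpha>"
  note sP = smooth_Phi[OF U M]
  note sm\<alpha> = smooth_form_smooth[OF \<alpha>] and smm = smooth_form_smooth[OF smooth_form_model[of ?v]]
  have sd: "smooth_form (\<lambda>p w. \<alpha> p w - model ?v p w)"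
    unfolding smooth_form_def
  proof
    show "\<forall>w. smooth_germ (\<lambda>p. \<alpha> p w - model ?v p w)" by (intro allI smooth_germ_diff sm\<alpha> smm)
    show "\<forall>\<^sub>F p in nhds 0. linear (\<lambda>w. \<alpha> p w - model ?v p w)"
      using smooth_form_linear[OF \<alpha>] smooth_form_linear[OF smooth_form_model[of ?v]]
      by eventually_elim (rule linear_compose_sub)
  qed
  have "ell (\<lambda>p w. \<alpha> p w - model ?v p w) w = 0" for w
    using ell_diff[OF sm\<alpha> smm, where w=w] ell_model[of w ?v] ell_outside[of w] by (cases "w \<in> wts") auto
  then obtain F where F: "smooth_germ F" "\<forall>\<^sub>F p in nhds 0. p \<in> N9 \<longrightarrow> (\<forall>w. D F p w = \<alpha> p w - model ?v p w)"
    using exact_of_ell_zero[OF sd] by blast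
  have "ell (pull s \<alpha>) w = ell (pull ?P \<alpha>) w"
    by (rule ell_pull_agree[OF \<alpha> s sP Phi_0 eq])
  also have "ell (pull ?P \<alpha>) = ell (\<lambda>p w. pull ?P (model ?v) p w + D (\<lambda>p. F (?P p)) p w)"
  proof (rule ell_cong)
    show "\<forall>\<^sub>F p in nhds 0. p \<in> N9 \<longrightarrow> (\<forall>w. pull ?P \<alpha> p w = pull ?P (model ?v) p w + D (\<lambda>p. F (?P p)) p w)"
      using smooth_germ_eventually[OF sP Phi_0 F(2)] pull_D[OF F(1) sP Phi_0]
    proof eventually_elim
      case (elim p)
      show ?case
      proof (intro impI allI)
        fix w assume "p \<in> N9"
        then have "D F (?P p) (D ?P p w) = \<alpha> (?P p) (D ?P p w) - model ?v (?P p) (D ?P p w)"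
          using elim(1)[rule_format, OF Phi_N9] by simp
        moreover have "D (\<lambda>p. F (?P p)) p w = D F (?P p) (D ?P p w)" using elim(2) by (metis pull_def)
        ultimately show "pull ?P \<alpha> p w = pull ?P (model ?v) p w + D (\<lambda>p. F (?P p)) p w"
          by (simp add: pull_def)
      qed
    qed
  qed
  also have "\<dots> w = ell (pull ?P (model ?v)) w + ell (\<lambda>p. D (\<lambda>p. F (?P p)) p) w"
    by (rule ell_add[OF smooth_form_smooth[OF smooth_form_pull[OF smooth_form_model sP Phi_0]]])
       (intro sg smooth_germ_compose[OF F(1) sP Phi_0])
  also have "\<dots> = act ?v (jc U) (M 0) w"
    using ell_pull_Phi_model[OF U M] ell_exact[OF smooth_germ_compose[OF F(1) sP Phi_0]] by simp
  finally show ?thesis .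
qed

section \<open>Germs of diffeomorphisms and symplectomorphisms\<close>

declare split_paired_All [simp del] split_paired_Ex [simp del]

text \<open>No domain is part of the data; \<open>dgerm_diffeo\<close> supplies one inside any
  neighbourhood, by the inverse function theorem.\<close>

definition dgerm :: "('a::euclidean_space \<Rightarrow> 'a) \<Rightarrow> bool" where
  "dgerm g \<longleftrightarrow> smooth_germ g \<and> g 0 = 0 \<and> inj (D g 0)"

lemma dgermD: "dgerm g \<Longrightarrow> smooth_germ g" "dgerm g \<Longrightarrow> g 0 = 0" "dgerm g \<Longrightarrow> inj (D g 0)"
  by (simp_all add: dgerm_def)

lemma dgerm_diffeo:
  assumes "dgerm g" "open W" "0 \<in> W" obtains U where "diffeo_at0 g U" "U \<subseteq> W"
  using smooth_inverse_function[of g W] assms by (auto simp: dgerm_def)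

lemma diffeo_inverse:
  assumes "diffeo_at0 g U"
  shows "smooth_germ g" "smooth_germ (inv_into U g)" "g 0 = 0" "inv_into U g 0 = 0"
    "\<forall>\<^sub>F x in nhds 0. inv_into U g (g x) = x" "\<forall>\<^sub>F y in nhds 0. g (inv_into U g y) = y"
    "\<forall>\<^sub>F x in nhds 0. x \<in> U" "\<forall>\<^sub>F x in nhds 0. x \<in> g ` U"
proof -
  have U: "open U" "0 \<in> U" "g 0 = 0" "smooth_on U g" "inj_on g U" "open (g ` U)" "smooth_on (g ` U) (inv_into U g)"
    using assms by (auto simp: diffeo_at0_def)
  have 0: "0 \<in> g ` U" using U(2,3) by force
  show "smooth_germ g" "smooth_germ (inv_into U g)" using U 0 by (auto intro: smooth_germI)
  show "g 0 = 0" by fact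
  show "inv_into U g 0 = 0" using inv_into_f_f[OF U(5,2)] U(3) by simp
  show eU: "\<forall>\<^sub>F x in nhds 0. x \<in> U" and eg: "\<forall>\<^sub>F x in nhds 0. x \<in> g ` U"
    using U 0 by (auto intro: eventually_nhds_in_open)
  show "\<forall>\<^sub>F x in nhds 0. inv_into U g (g x) = x" using eU by eventually_elim (rule inv_into_f_f[OF U(5)])
  show "\<forall>\<^sub>F y in nhds 0. g (inv_into U g y) = y" using eg by eventually_elim (rule f_inv_into_f)
qed

lemma D_left_inverse:
  fixes g h :: "'a::euclidean_space \<Rightarrow> 'a"
  assumes "smooth_germ g" "g 0 = 0" "smooth_germ h" "\<forall>\<^sub>F x in nhds 0. h (g x) = x"
  shows "D h 0 (D g 0 v) = v"
proof -
  have "D (\<lambda>x. h (g x)) 0 = (\<lambda>v. D h (g 0) (D g 0 v))"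
    by (rule eventually_nhds_x_imp_x[OF D_compose_germ[OF assms(3,1,2)]])
  moreover have "D (\<lambda>x. h (g x)) 0 = D (\<lambda>x. x) 0" by (rule D_cong[OF assms(4)])
  moreover have "D (\<lambda>x::'a. x) 0 = (\<lambda>v. v)" by (rule D_eq) (rule has_derivative_ident)
  ultimately have "(\<lambda>v. D h 0 (D g 0 v)) = (\<lambda>v. v)" using assms(2) by simp
  then show ?thesis by metis
qed

lemma diffeo_dgerm:
  assumes "diffeo_at0 g U" shows "dgerm g" "dgerm (inv_into U g)"
proof -
  note inv = diffeo_inverse[OF assms]
  have 1: "D (inv_into U g) 0 (D g 0 v) = v" for v by (rule D_left_inverse[OF inv(1,3,2,5)])
  have 2: "D g 0 (D (inv_into U g) 0 v) = v" for v by (rule D_left_inverse[OF inv(2,4,1,6)])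
  show "dgerm g" unfolding dgerm_def using inv(1,3) 1 by (metis injI)
  show "dgerm (inv_into U g)" unfolding dgerm_def using inv(2,4) 2 by (metis injI)
qed

lemma dgerm_inverse:
  assumes "dgerm g"
  obtains h where "dgerm h" "\<forall>\<^sub>F x in nhds 0. h (g x) = x" "\<forall>\<^sub>F y in nhds 0. g (h y) = y"
proof -
  obtain U where U: "diffeo_at0 g U" using dgerm_diffeo[OF assms open_UNIV] by auto
  show thesis by (rule that[OF diffeo_dgerm(2)[OF U] diffeo_inverse(5)[OF U] diffeo_inverse(6)[OF U]])
qed

lemma dgerm_compose:
  assumes "dgerm f" "dgerm g" shows "dgerm (\<lambda>x. f (g x))"
proof -
  have "D (\<lambda>x. f (g x)) 0 = (\<lambda>v. D f 0 (D g 0 v))"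
    using eventually_nhds_x_imp_x[OF D_compose_germ[OF dgermD(1)[OF assms(1)] dgermD(1,2)[OF assms(2)]]]
    by (simp add: dgermD(2)[OF assms(2)])
  moreover have "inj (\<lambda>v. D f 0 (D g 0 v))"
    by (rule inj_compose[OF dgermD(3)[OF assms(1)] dgermD(3)[OF assms(2)], unfolded comp_def])
  ultimately show ?thesis
    unfolding dgerm_def using smooth_germ_compose[of f g] dgermD(1,2)[OF assms(1)] dgermD(1,2)[OF assms(2)] by simp
qed

text \<open>Equality of image germs becomes a condition on points near 0, which can be composed
  without tracking domains.\<close>

lemma germ_image_iff:
  assumes "diffeo_at0 g U"
  shows "germ_eq M (g ` (N \<inter> U)) \<longleftrightarrow> (\<forall>\<^sub>F x in nhds 0. x \<in> N \<longleftrightarrow> g x \<in> M)"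
proof
  note inv = diffeo_inverse[OF assms]
  have inj: "inj_on g U" using assms by (simp add: diffeo_at0_def)
  {
    assume "germ_eq M (g ` (N \<inter> U))"
    then have "\<forall>\<^sub>F y in nhds 0. y \<in> M \<longleftrightarrow> y \<in> g ` (N \<inter> U)" by (simp add: germ_eq_def)
    from smooth_germ_eventually[OF inv(1,3) this] inv(7)
    show "\<forall>\<^sub>F x in nhds 0. x \<in> N \<longleftrightarrow> g x \<in> M"
    proof eventually_elim
      case (elim x)
      then show ?case using inj by (auto simp: inj_on_def)
    qed
  }
  {
    assume "\<forall>\<^sub>F x in nhds 0. x \<in> N \<longleftrightarrow> g x \<in> M"
    from smooth_germ_eventually[OF inv(2,4) this] inv(6,8)
    have "\<forall>\<^sub>F y in nhds 0. y \<in> M \<longleftrightarrow> y \<in> g ` (N \<inter> U)"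
    proof eventually_elim
      case (elim y)
      then have h: "inv_into U g y \<in> U" by (meson inv_into_into)
      have "y \<in> g ` (N \<inter> U) \<longleftrightarrow> inv_into U g y \<in> N"
      proof
        assume "y \<in> g ` (N \<inter> U)"
        then obtain x where "y = g x" "x \<in> N" "x \<in> U" by blast
        then show "inv_into U g y \<in> N" using inv_into_f_f[OF inj] by simp
      next
        assume "inv_into U g y \<in> N"
        then show "y \<in> g ` (N \<inter> U)" using h elim(2) by (intro image_eqI[of _ _ "inv_into U g y"]) simp_all
      qed
      then show ?case using elim by simp
    qed
    then show "germ_eq M (g ` (N \<inter> U))" by (simp add: germ_eq_def)
  }
qed

definition sgerm :: "('n::finite symp \<Rightarrow> 'n symp) \<Rightarrow> bool" where
  "sgerm g \<longleftrightarrow> dgerm g \<and> (\<forall>\<^sub>F x in nhds 0. \<forall>u v. omega0 (D g x u) (D g x v) = omega0 u v)"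

lemma symp_equiv_iff:
  "symp_equiv N M \<longleftrightarrow> (\<exists>g. sgerm g \<and> (\<forall>\<^sub>F x in nhds 0. x \<in> N \<longleftrightarrow> g x \<in> M))"
proof
  assume "symp_equiv N M"
  then obtain g U where g: "diffeo_at0 g U" "symplectic_on U g" "germ_eq M (g ` (N \<inter> U))"
    by (auto simp: symp_equiv_def)
  have "\<forall>\<^sub>F x in nhds 0. \<forall>u v. omega0 (D g x u) (D g x v) = omega0 u v"
    using diffeo_inverse(7)[OF g(1)] by eventually_elim (use g(2) in \<open>simp add: symplectic_on_def\<close>)
  then show "\<exists>g. sgerm g \<and> (\<forall>\<^sub>F x in nhds 0. x \<in> N \<longleftrightarrow> g x \<in> M)"
    using diffeo_dgerm(1)[OF g(1)] g(3) germ_image_iff[OF g(1)] unfolding sgerm_def by blast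
next
  assume "\<exists>g. sgerm g \<and> (\<forall>\<^sub>F x in nhds 0. x \<in> N \<longleftrightarrow> g x \<in> M)"
  then obtain g where g: "dgerm g" "\<forall>\<^sub>F x in nhds 0. \<forall>u v. omega0 (D g x u) (D g x v) = omega0 u v"
    "\<forall>\<^sub>F x in nhds 0. x \<in> N \<longleftrightarrow> g x \<in> M" by (auto simp: sgerm_def)
  obtain W where W: "open W" "0 \<in> W" "\<And>x u v. x \<in> W \<Longrightarrow> omega0 (D g x u) (D g x v) = omega0 u v"
    using g(2) by (auto simp: eventually_nhds)
  obtain U where U: "diffeo_at0 g U" "U \<subseteq> W" using dgerm_diffeo[OF g(1) W(1,2)] .
  then have "symplectic_on U g" using W(3) by (auto simp: symplectic_on_def)
  then show "symp_equiv N M" unfolding symp_equiv_def using U(1) g(3) germ_image_iff[OF U(1)] by blast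
qed

lemma sgerm_inverse:
  assumes "sgerm g"
  obtains h where "sgerm h" "\<forall>\<^sub>F x in nhds 0. h (g x) = x" "\<forall>\<^sub>F y in nhds 0. g (h y) = y"
proof -
  have g: "dgerm g" "\<forall>\<^sub>F x in nhds 0. \<forall>u v. omega0 (D g x u) (D g x v) = omega0 u v" using assms by (auto simp: sgerm_def)
  obtain h where h: "dgerm h" "\<forall>\<^sub>F x in nhds 0. h (g x) = x" "\<forall>\<^sub>F y in nhds 0. g (h y) = y"
    using dgerm_inverse[OF g(1)] .
  have "\<forall>\<^sub>F y in nhds 0. D (\<lambda>y. g (h y)) y = D (\<lambda>y. y) y" by (rule D_cong_germ[OF h(3)])
  then have "\<forall>\<^sub>F y in nhds 0. \<forall>u v. omega0 (D h y u) (D h y v) = omega0 u v"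
    using D_compose_germ[OF dgermD(1)[OF g(1)] dgermD(1,2)[OF h(1)]] smooth_germ_eventually[OF dgermD(1,2)[OF h(1)] g(2)]
  proof eventually_elim
    case (elim y)
    have "D (\<lambda>y. y) y = (\<lambda>v. v)" by (rule D_eq) (rule has_derivative_ident)
    then have "D g (h y) (D h y v) = v" for v using elim(1,2) by metis
    then show ?case using elim(3) by metis
  qed
  then show thesis using that h by (auto simp: sgerm_def)
qed

lemma sgerm_compose:
  assumes "sgerm f" "sgerm g" shows "sgerm (\<lambda>x. f (g x))"
proof -
  have f: "dgerm f" "\<forall>\<^sub>F x in nhds 0. \<forall>u v. omega0 (D f x u) (D f x v) = omega0 u v"
    and g: "dgerm g" "\<forall>\<^sub>F x in nhds 0. \<forall>u v. omega0 (D g x u) (D g x v) = omega0 u v" using assms by (auto simp: sgerm_def)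
  have "\<forall>\<^sub>F y in nhds 0. \<forall>u v. omega0 (D (\<lambda>x. f (g x)) y u) (D (\<lambda>x. f (g x)) y v) = omega0 u v"
    using D_compose_germ[OF dgermD(1)[OF f(1)] dgermD(1,2)[OF g(1)]] smooth_germ_eventually[OF dgermD(1,2)[OF g(1)] f(2)] g(2)
    by eventually_elim simp
  then show ?thesis using dgerm_compose[OF f(1) g(1)] by (simp add: sgerm_def)
qed

lemma symp_equiv_sym: assumes "symp_equiv N M" shows "symp_equiv M N"
proof -
  obtain g where g: "sgerm g" "\<forall>\<^sub>F x in nhds 0. x \<in> N \<longleftrightarrow> g x \<in> M" using assms symp_equiv_iff by blast
  obtain h where h: "sgerm h" "\<forall>\<^sub>F x in nhds 0. h (g x) = x" "\<forall>\<^sub>F y in nhds 0. g (h y) = y"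
    using sgerm_inverse[OF g(1)] .
  have "smooth_germ h" "h 0 = 0" using h(1) by (auto simp: sgerm_def dgerm_def)
  from smooth_germ_eventually[OF this g(2)] h(3)
  have "\<forall>\<^sub>F y in nhds 0. y \<in> M \<longleftrightarrow> h y \<in> N" by eventually_elim simp
  then show ?thesis using h(1) symp_equiv_iff by blast
qed

section \<open>Linear symplectic algebra\<close>

lemma omega0_linear: "linear (omega0 u)" "linear (\<lambda>u. omega0 u v)"
  by (auto simp: linear_iff omega0_eq inner_add_left inner_add_right algebra_simps)

lemma omega0_skew: "omega0 u v = - omega0 v u" and omega0_self: "omega0 u u = 0"
  by (simp_all add: omega0_eq inner_commute)

lemma omega0_represent:
  fixes \<phi> :: "'n::finite symp \<Rightarrow> real"
  assumes "linear \<phi>" obtains w where "\<And>x. omega0 w x = \<phi> x"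
proof -
  define a where "a = (\<Sum>b\<in>Basis. \<phi> b *\<^sub>R b)"
  have a: "\<phi> x = a \<bullet> x" for x
    unfolding linear_basis_sum[OF assms, of x] a_def inner_sum_left
    by (simp add: inner_commute[of x] mult.commute)
  show thesis by (rule that[of "(snd a, - fst a)"]) (simp add: a omega0_eq inner_prod_def)
qed

definition symp_orth :: "'n::finite symp set \<Rightarrow> 'n symp set" where
  "symp_orth S = {x. \<forall>s\<in>S. omega0 x s = 0}"

lemma dim_symp_orth:
  assumes "subspace S" shows "dim (symp_orth S) + dim S = DIM('n::finite symp)" "subspace (symp_orth (S :: 'n symp set))"
proof -
  define J :: "'n symp \<Rightarrow> 'n symp" where "J u = (- snd u, fst u)" for u
  have J: "linear J" "inj J" by (auto simp: J_def linear_iff inj_def prod_eq_iff)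
  have oJ: "omega0 u v = J u \<bullet> v" for u v by (simp add: J_def omega0_eq inner_prod_def)
  show sub: "subspace (symp_orth S)"
    unfolding symp_orth_def subspace_def by (auto simp: omega0_eq inner_add_left algebra_simps)
  have "J ` symp_orth S = {y \<in> UNIV. \<forall>x\<in>S. orthogonal x y}"
  proof (intro equalityI subsetI)
    fix y assume "y \<in> {y \<in> UNIV. \<forall>x\<in>S. orthogonal x y}"
    then have "J (snd y, - fst y) = y" "(snd y, - fst y) \<in> symp_orth S"
      by (auto simp: J_def symp_orth_def oJ orthogonal_def inner_commute)
    then show "y \<in> J ` symp_orth S" by (metis imageI)
  qed (auto simp: symp_orth_def oJ orthogonal_def inner_commute)
  moreover have "dim (J ` symp_orth S) = dim (symp_orth S)"
    by (rule dim_image_eq[OF J(1)]) (rule inj_on_subset[OF J(2)], simp)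
  moreover have "dim {y \<in> UNIV. \<forall>x\<in>S. orthogonal x y} + dim S = dim (UNIV :: 'n symp set)"
    by (rule dim_subspace_orthogonal_to_vectors[OF assms subspace_UNIV]) simp
  ultimately show "dim (symp_orth S) + dim S = DIM('n symp)" by simp
qed

text \<open>Witt's theorem; the partial isometry is extended by one vector at a time.\<close>

lemma witt:
  fixes f :: "'n::finite symp \<Rightarrow> 'n symp"
  assumes "subspace S" "linear f" "inj_on f S" "\<And>s t. s \<in> S \<Longrightarrow> t \<in> S \<Longrightarrow> omega0 (f s) (f t) = omega0 s t"
  shows "\<exists>A. linear A \<and> (\<forall>u v. omega0 (A u) (A v) = omega0 u v) \<and> (\<forall>s\<in>S. A s = f s)"
  using assms
proof (induction "DIM('n symp) - dim S" arbitrary: S f rule: less_induct)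
  case less
  note S = less.prems
  show ?case
  proof (cases "S = UNIV")
    case True then show ?thesis using S by (intro exI[of _ f]) auto
  next
    case False
    then obtain v where v: "v \<notin> S" by blast
    have sfS: "subspace (f ` S)" by (rule linear_subspace_image[OF S(2,1)])
    have dfS: "dim (f ` S) = dim S"
      by (rule dim_image_eq[OF S(2)]) (simp add: S(1,3) span_eq_iff[THEN iffD2])
    have f0: "f s = 0 \<longleftrightarrow> s = 0" if "s \<in> S" for s
      using S(3) subspace_0[OF S(1)] linear_0[OF S(2)] that by (metis inj_onD)
    obtain g where g: "linear g" "\<And>s. s \<in> S \<Longrightarrow> g (f s) = s"
      using linear_exists_left_inverse_on[OF S(2,1,3)] by blast
    obtain v0 where v0: "\<And>x. omega0 v0 x = omega0 v (g x)"
      using omega0_represent[OF linear_compose[OF g(1) omega0_linear(1)], of v] by (auto simp: comp_def)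
    have v0S: "omega0 v0 (f s) = omega0 v s" if "s \<in> S" for s using v0 g(2)[OF that] by simp
    \<comment> \<open>The solutions of the pairing conditions form the coset of \<open>v0\<close>
      modulo the symplectic orthogonal of the image of \<open>S\<close>. If that coset lay in the
      image, so would the orthogonal; comparing dimensions, the orthogonal of \<open>S\<close> would
      lie in \<open>S\<close>, and with \<open>v0 = f s0\<close> so would \<open>v - s0\<close>,
      hence \<open>v\<close>.\<close>
    have "\<exists>v'. v' \<notin> f ` S \<and> (\<forall>s\<in>S. omega0 v' (f s) = omega0 v s)"
    proof (rule ccontr)
      assume "\<not> ?thesis"
      then have all: "v' \<in> f ` S" if "\<And>s. s \<in> S \<Longrightarrow> omega0 v' (f s) = omega0 v s" for v' using that by blast
      have v0f: "v0 \<in> f ` S" using all v0S by blast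
      have orth: "symp_orth (f ` S) \<subseteq> f ` S"
      proof
        fix k assume "k \<in> symp_orth (f ` S)"
        then have "v0 + k \<in> f ` S"
          by (intro all) (simp add: symp_orth_def linear_add[OF omega0_linear(2)] v0S)
        then have "v0 + k - v0 \<in> f ` S" using subspace_diff[OF sfS] v0f by blast
        then show "k \<in> f ` S" by simp
      qed
      have sub: "symp_orth (f ` S) \<subseteq> f ` (S \<inter> symp_orth S)"
      proof
        fix k assume k: "k \<in> symp_orth (f ` S)"
        then obtain s where s: "k = f s" "s \<in> S" using orth by blast
        then have "s \<in> symp_orth S" using k S(4) by (auto simp: symp_orth_def)
        then show "k \<in> f ` (S \<inter> symp_orth S)" using s by blast
      qed
      have "dim (symp_orth S) = dim (symp_orth (f ` S))"
        using dim_symp_orth(1)[OF S(1)] dim_symp_orth(1)[OF sfS] dfS by simp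
      also have "\<dots> \<le> dim (f ` (S \<inter> symp_orth S))" by (rule dim_subset[OF sub])
      also have "\<dots> \<le> dim (S \<inter> symp_orth S)" by (rule dim_image_le[OF S(2)])
      finally have "S \<inter> symp_orth S = symp_orth S"
        using subspace_dim_equal[OF subspace_inter[OF S(1) dim_symp_orth(2)[OF S(1)]] dim_symp_orth(2)[OF S(1)]] by blast
      moreover obtain s0 where s0: "v0 = f s0" "s0 \<in> S" using v0f by blast
      have "v - s0 \<in> symp_orth S"
        unfolding symp_orth_def using v0S S(4)[OF s0(2)] s0(1) by (simp add: linear_diff[OF omega0_linear(2)])
      ultimately have "v - s0 \<in> S" by blast
      then have "v - s0 + s0 \<in> S" using s0(2) subspace_add[OF S(1)] by blast
      then show False using v by simp
    qed
    then obtain v' where v': "v' \<notin> f ` S" "\<And>s. s \<in> S \<Longrightarrow> omega0 v' (f s) = omega0 v s" by blast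
    obtain y z where yz: "y \<in> span S" "\<And>w. w \<in> span S \<Longrightarrow> orthogonal z w" "v = y + z"
      using orthogonal_subspace_decomp_exists[of S v] by metis
    have spS: "span S = S" using S(1) by (simp add: span_eq_iff)
    have z0: "z \<bullet> z \<noteq> 0" using yz v spS by auto
    define c where "c x = (z \<bullet> x) / (z \<bullet> z)" for x
    have cS: "c s = 0" if "s \<in> S" for s using yz(2) that spS by (simp add: c_def orthogonal_def)
    have "z \<bullet> y = 0" using yz(1,2) by (simp add: orthogonal_def)
    then have cv: "c v = 1" using z0 yz(3) by (simp add: c_def inner_add_right)
    \<comment> \<open>\<open>c\<close> is a linear functional equal to 0 on \<open>S\<close> and to
      1 at \<open>v\<close>; so \<open>h\<close> keeps \<open>f\<close> on \<open>S\<close> and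
      sends \<open>v\<close> to \<open>v'\<close>.\<close>
    define h where "h x = f x + c x *\<^sub>R (v' - f v)" for x
    have linh: "linear h"
      using linear_add[OF S(2)] linear_scale[OF S(2)]
      by (auto simp: linear_iff h_def c_def inner_add_right add_divide_distrib algebra_simps)
    have hS: "h s = f s" if "s \<in> S" for s using cS[OF that] by (simp add: h_def)
    have hv: "h v = v'" by (simp add: h_def cv)
    let ?T = "span (insert v S)"
    have T: "\<exists>s k. s \<in> S \<and> x = s + k *\<^sub>R v" if "x \<in> ?T" for x
    proof -
      obtain k where "x - k *\<^sub>R v \<in> S" using \<open>x \<in> ?T\<close> span_breakdown_eq[of x v S] spS by auto
      then show ?thesis by (intro exI[of _ "x - k *\<^sub>R v"] exI[of _ k]) simp
    qed
    have hT: "h (s + k *\<^sub>R v) = f s + k *\<^sub>R v'" if "s \<in> S" for s k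
      using hS[OF that] hv by (simp add: linear_add[OF linh] linear_scale[OF linh])
    have h0: "x = 0" if x: "x \<in> ?T" "h x = 0" for x
    proof -
      obtain s k where sk: "s \<in> S" "x = s + k *\<^sub>R v" using T[OF x(1)] by blast
      have e: "f s + k *\<^sub>R v' = 0" using hT[OF sk(1)] x(2) sk(2) by simp
      have "k = 0"
      proof (rule ccontr)
        assume "k \<noteq> 0"
        have "k *\<^sub>R v' = - f s" using e by (simp add: eq_neg_iff_add_eq_0 add.commute)
        then have "k *\<^sub>R v' \<in> f ` S" using subspace_neg[OF sfS] sk(1) by simp
        then have "(1 / k) *\<^sub>R (k *\<^sub>R v') \<in> f ` S" by (rule subspace_scale[OF sfS])
        then show False using v'(1) \<open>k \<noteq> 0\<close> by simp
      qed
      then show ?thesis using e f0[OF sk(1)] sk(2) by simp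
    qed
    have injT: "inj_on h ?T"
    proof (rule inj_onI)
      fix x y assume "x \<in> ?T" "y \<in> ?T" "h x = h y"
      then have "x - y = 0" using h0[OF span_diff[of x _ y]] by (simp add: linear_diff[OF linh])
      then show "x = y" by simp
    qed
    have isoT: "omega0 (h x) (h y) = omega0 x y" if xy: "x \<in> ?T" "y \<in> ?T" for x y
    proof -
      obtain s k t m where sk: "s \<in> S" "x = s + k *\<^sub>R v" "t \<in> S" "y = t + m *\<^sub>R v"
        using T[OF xy(1)] T[OF xy(2)] by blast
      have "omega0 (f s) v' = omega0 s v" "omega0 v' (f t) = omega0 v t"
        using v'(2)[OF sk(1)] v'(2)[OF sk(3)] omega0_skew[of "f s" v'] omega0_skew[of s v] by simp_all
      then show ?thesis
        unfolding sk(2,4) hT[OF sk(1)] hT[OF sk(3)]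
        by (simp add: linear_add[OF omega0_linear(1)] linear_add[OF omega0_linear(2)] linear_scale[OF omega0_linear(1)]
           linear_scale[OF omega0_linear(2)] S(4)[OF sk(1,3)] omega0_self)
    qed
    have "v \<notin> span S" using v unfolding spS .
    then have "dim ?T = dim S + 1" by (simp add: dim_insert)
    moreover have "dim ?T \<le> DIM('n symp)" by (rule dim_subset_UNIV)
    ultimately have "DIM('n symp) - dim ?T < DIM('n symp) - dim S" by linarith
    from less.hyps[OF this subspace_span linh injT isoT]
    obtain A where "linear A" "\<forall>u v. omega0 (A u) (A v) = omega0 u v" "\<forall>s\<in>?T. A s = h s" by blast
    moreover have "s \<in> ?T" if "s \<in> S" for s using that by (simp add: span_base)
    ultimately show ?thesis using hS by (intro exI[of _ A]) auto
  qed
qed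

lemma witt_linear:
  fixes f g :: "'a::euclidean_space \<Rightarrow> 'n::finite symp"
  assumes "linear f" "linear g" "inj f" "inj g" "\<And>u v. omega0 (f u) (f v) = omega0 (g u) (g v)"
  obtains A where "linear A" "\<And>u v. omega0 (A u) (A v) = omega0 u v" "\<And>u. A (f u) = g u"
proof -
  obtain k where k: "linear k" "\<And>u. k (f u) = u"
    using linear_injective_left_inverse[OF assms(1,3)] by (metis comp_apply id_apply)
  have "\<exists>A. linear A \<and> (\<forall>u v. omega0 (A u) (A v) = omega0 u v) \<and> (\<forall>s\<in>range f. A s = (g \<circ> k) s)"
  proof (rule witt)
    show "subspace (range f)" by (rule linear_subspace_image[OF assms(1) subspace_UNIV])
    show "linear (g \<circ> k)" by (rule linear_compose[OF k(1) assms(2)])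
    show "inj_on (g \<circ> k) (range f)" using assms(4) k(2) by (auto simp: inj_on_def inj_def)
    show "omega0 ((g \<circ> k) s) ((g \<circ> k) t) = omega0 s t" if "s \<in> range f" "t \<in> range f" for s t
      using that assms(5) k(2) by auto
  qed
  then show thesis using that k(2) by auto
qed

section \<open>Interpolation by a symplectomorphism\<close>

text \<open>A generating function \<open>S(q, P)\<close> of two variables in mixed position; here the first component of the argument
  is \<open>P\<close> and the second one is \<open>q\<close>. The maps \<open>(P, q) \<mapsto> (P + S\<^sub>q, q)\<close> and \<open>(P, q) \<mapsto> (P, q + S\<^sub>P)\<close> pull the
  symplectic form back to the same form.\<close>

definition grad1 :: "('n::finite symp \<Rightarrow> real) \<Rightarrow> 'n symp \<Rightarrow> real ^ 'n" where
  "grad1 S x = (\<Sum>b\<in>Basis. D S x (b, 0) *\<^sub>R b)"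
definition grad2 :: "('n::finite symp \<Rightarrow> real) \<Rightarrow> 'n symp \<Rightarrow> real ^ 'n" where
  "grad2 S x = (\<Sum>b\<in>Basis. D S x (0, b) *\<^sub>R b)"

lemma smooth_grad: "smooth_germ S \<Longrightarrow> smooth_germ (grad1 S)" "smooth_germ S \<Longrightarrow> smooth_germ (grad2 S)"
  unfolding grad1_def[abs_def] grad2_def[abs_def] by (intro sg; assumption)+

lemma grad_inner:
  assumes "linear (D S x)"
  shows "grad1 S x \<bullet> u = D S x (u, 0)" "grad2 S x \<bullet> u = D S x (0, u)"
proof -
  have l: "linear (\<lambda>u. D S x (u, 0))" "linear (\<lambda>u. D S x (0, u))"
    using linear_compose[OF _ assms, of "\<lambda>u. (u, 0)"] linear_compose[OF _ assms, of "\<lambda>u. (0, u)"]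
    by (auto simp: comp_def linear_iff)
  show "grad1 S x \<bullet> u = D S x (u, 0)"
    unfolding grad1_def inner_sum_left linear_basis_sum[OF l(1), of u] by (simp add: inner_commute[of u] mult.commute)
  show "grad2 S x \<bullet> u = D S x (0, u)"
    unfolding grad2_def inner_sum_left linear_basis_sum[OF l(2), of u] by (simp add: inner_commute[of u] mult.commute)
qed

text \<open>The map sought is \<open>B\<close> after the inverse of \<open>A\<close>. The vanishing
  derivatives of \<open>S\<close> up to order two make both maps tangent to the identity, hence
  invertible.\<close>

theorem generating_function:
  fixes S :: "'n::finite symp \<Rightarrow> real"
  assumes S: "smooth_germ S" and S1: "\<And>v. D S 0 v = 0" and S2: "\<And>u v. D (\<lambda>x. D S x v) 0 u = 0"
  obtains g where "sgerm g" "\<forall>\<^sub>F x in nhds 0. g (fst x + grad2 S x, snd x) = (fst x, snd x + grad1 S x)"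
proof -
  define A where "A x = (fst x + grad2 S x, snd x)" for x
  define B where "B x = (fst x, snd x + grad1 S x)" for x
  have sA: "smooth_germ A" and sB: "smooth_germ B"
    unfolding A_def[abs_def] B_def[abs_def] by (intro sg smooth_grad S)+
  have g0: "grad1 S 0 = 0" "grad2 S 0 = 0" by (simp_all add: grad1_def grad2_def S1)
  have A0: "A 0 = 0" and B0: "B 0 = 0" by (simp_all add: A_def B_def g0 prod_eq_iff)
  have dA: "\<forall>\<^sub>F x in nhds 0. D A x = (\<lambda>u. (fst u + D (grad2 S) x u, snd u))"
    using smooth_germ_has_derivative[OF smooth_grad(2)[OF S]]
  proof eventually_elim
    case (elim x)
    show ?case unfolding A_def[abs_def] by (rule D_eq, (rule derivative_eq_intros refl elim)+)
  qed
  have dB: "\<forall>\<^sub>F x in nhds 0. D B x = (\<lambda>u. (fst u, snd u + D (grad1 S) x u))"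
    using smooth_germ_has_derivative[OF smooth_grad(1)[OF S]]
  proof eventually_elim
    case (elim x)
    show ?case unfolding B_def[abs_def] by (rule D_eq, (rule derivative_eq_intros refl elim)+)
  qed
  have dS: "((\<lambda>x. D S x v) has_derivative D (\<lambda>x. D S x v) 0) (at 0)" for v
    by (rule smooth_germ_has_derivative0[OF smooth_germ_D[OF S]])
  have "(grad1 S has_derivative (\<lambda>u. \<Sum>b\<in>Basis. D (\<lambda>x. D S x (b, 0)) 0 u *\<^sub>R b)) (at 0)"
    unfolding grad1_def[abs_def] by (intro has_derivative_sum has_derivative_scaleR_left dS)
  then have dg1: "D (grad1 S) 0 = (\<lambda>u. 0)" by (simp add: D_eq S2)
  have "(grad2 S has_derivative (\<lambda>u. \<Sum>b\<in>Basis. D (\<lambda>x. D S x (0, b)) 0 u *\<^sub>R b)) (at 0)"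
    unfolding grad2_def[abs_def] by (intro has_derivative_sum has_derivative_scaleR_left dS)
  then have dg2: "D (grad2 S) 0 = (\<lambda>u. 0)" by (simp add: D_eq S2)
  have "D A 0 = (\<lambda>u. u)" "D B 0 = (\<lambda>u. u)"
    using eventually_nhds_x_imp_x[OF dA] eventually_nhds_x_imp_x[OF dB] by (simp_all add: dg1 dg2)
  then have AB: "dgerm A" "dgerm B" unfolding dgerm_def using sA sB A0 B0 by simp_all
  obtain U where U: "open U" "0 \<in> U" "smooth_on U S" using S by (auto simp: smooth_germ_def)
  have same: "\<forall>\<^sub>F x in nhds 0. \<forall>u v. omega0 (D A x u) (D A x v) = omega0 (D B x u) (D B x v)"
  proof -
    \<comment> \<open>The left side is the Hessian of \<open>S\<close>; the two pullbacks of
      \<open>omega0\<close> differ by its antisymmetric part.\<close>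
    have sym: "D (grad2 S) x u \<bullet> snd v + D (grad1 S) x u \<bullet> fst v = D (\<lambda>x. D S x v) x u" if x: "x \<in> U" for x u v
    proof -
      have g1: "(grad1 S has_derivative (\<lambda>u. \<Sum>b\<in>Basis. D (\<lambda>x. D S x (b, 0)) x u *\<^sub>R b)) (at x)"
        unfolding grad1_def[abs_def]
        by (intro has_derivative_sum has_derivative_scaleR_left smooth_on_has_derivative[OF smooth_on_D[OF U(3)] x])
      have g2: "(grad2 S has_derivative (\<lambda>u. \<Sum>b\<in>Basis. D (\<lambda>x. D S x (0, b)) x u *\<^sub>R b)) (at x)"
        unfolding grad2_def[abs_def]
        by (intro has_derivative_sum has_derivative_scaleR_left smooth_on_has_derivative[OF smooth_on_D[OF U(3)] x])
      have "((\<lambda>x. grad2 S x \<bullet> snd v + grad1 S x \<bullet> fst v) has_derivative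
          (\<lambda>u. D (grad2 S) x u \<bullet> snd v + D (grad1 S) x u \<bullet> fst v)) (at x)"
        unfolding D_eq[OF g1] D_eq[OF g2] by (intro has_derivative_add has_derivative_inner_left g1 g2)
      then have "((\<lambda>x. D S x v) has_derivative (\<lambda>u. D (grad2 S) x u \<bullet> snd v + D (grad1 S) x u \<bullet> fst v)) (at x)"
      proof (rule has_derivative_transform_within_open[OF _ U(1) x])
        fix y assume "y \<in> U"
        then have l: "linear (D S y)" by (rule has_derivative_linear[OF smooth_on_has_derivative[OF U(3)]])
        have "D S y v = D S y ((0, snd v) + (fst v, 0))" by simp
        also have "\<dots> = grad2 S y \<bullet> snd v + grad1 S y \<bullet> fst v"
          unfolding linear_add[OF l] grad_inner[OF l] ..
        finally show "grad2 S y \<bullet> snd v + grad1 S y \<bullet> fst v = D S y v" by simp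
      qed
      then show ?thesis by (simp add: D_eq)
    qed
    have "\<forall>\<^sub>F x in nhds 0. x \<in> U" using U by (intro eventually_nhds_in_open)
    then show ?thesis using dA dB
    proof eventually_elim
      case (elim x)
      show ?case
      proof (intro allI)
        fix u v
        have "D (\<lambda>x. D S x v) x u = D (\<lambda>x. D S x u) x v" by (rule symmetric_second_derivative[OF U(1) elim(1) U(3)])
        then show "omega0 (D A x u) (D A x v) = omega0 (D B x u) (D B x v)"
          unfolding elim(2,3) sym[OF elim(1), symmetric]
          by (simp add: omega0_eq inner_add_left inner_add_right inner_commute algebra_simps)
      qed
    qed
  qed
  obtain h where h: "dgerm h" "\<forall>\<^sub>F x in nhds 0. h (A x) = x" "\<forall>\<^sub>F y in nhds 0. A (h y) = y" using dgerm_inverse[OF AB(1)] .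
  have "sgerm (\<lambda>y. B (h y))"
    unfolding sgerm_def
  proof
    show "dgerm (\<lambda>y. B (h y))" by (rule dgerm_compose[OF AB(2) h(1)])
    have id: "\<forall>\<^sub>F y in nhds 0. D (\<lambda>y. A (h y)) y = D (\<lambda>y. y) y" by (rule D_cong_germ[OF h(3)])
    show "\<forall>\<^sub>F y in nhds 0. \<forall>u v. omega0 (D (\<lambda>y. B (h y)) y u) (D (\<lambda>y. B (h y)) y v) = omega0 u v"
      using D_compose_germ[OF sB dgermD(1,2)[OF h(1)]] D_compose_germ[OF sA dgermD(1,2)[OF h(1)]] id
        smooth_germ_eventually[OF dgermD(1,2)[OF h(1)] same]
    proof eventually_elim
      case (elim y)
      have "D (\<lambda>y. y) y = (\<lambda>v::'n symp. v)" by (rule D_eq) (rule has_derivative_ident)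
      then have "D A (h y) (D h y v) = v" for v using elim(2,3) by metis
      then show ?case unfolding elim(1) using elim(4) by metis
    qed
  qed
  moreover have "\<forall>\<^sub>F x in nhds 0. B (h (A x)) = B x" using h(2) by eventually_elim simp
  ultimately show thesis using that[of "\<lambda>y. B (h y)"] by (simp add: A_def B_def)
qed

text \<open>Near the origin \<open>x \<mapsto> (P(G1 x), q(G0 x))\<close> is a coordinate change, and the required first derivatives of the
  generating function along the curve form the 1-form \<open>eta\<close>.\<close>

definition eta :: "('n::finite symp \<Rightarrow> 'n symp) \<Rightarrow> ('n symp \<Rightarrow> 'n symp) \<Rightarrow> 'n symp \<Rightarrow> 'n symp \<Rightarrow> real" where
  "eta G0 G1 x v = fst (G0 x - G1 x) \<bullet> snd (D G0 x v) + snd (G1 x - G0 x) \<bullet> fst (D G1 x v)"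

theorem symplectic_interpolation:
  fixes G0 G1 :: "'n::finite symp \<Rightarrow> 'n symp" and emb :: "R3 \<Rightarrow> 'n symp"
  assumes G0: "dgerm G0" and G1: "dgerm G1" and DG: "D G0 0 = D G1 0"
    and lin: "linear emb" "linear pr" and pr: "\<And>p. pr (emb p) = p"
    and F: "smooth_germ F" "\<forall>\<^sub>F p in nhds 0. p \<in> N9 \<longrightarrow> (\<forall>v. D F p v = eta G0 G1 (emb p) (emb v))"
  obtains g where "sgerm g" "\<forall>\<^sub>F p in nhds 0. p \<in> N9 \<longrightarrow> g (G0 (emb p)) = G1 (emb p)"
proof -
  note s0 = dgermD(1)[OF G0] and s1 = dgermD(1)[OF G1]
  have z: "G0 0 = 0" "G1 0 = 0" "emb 0 = 0" "pr 0 = 0" using G0 G1 lin by (auto simp: dgerm_def linear_0)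
  have bl: "bounded_linear emb" "bounded_linear pr" using lin linear_conv_bounded_linear by auto
  have se: "smooth_germ emb" and sp: "smooth_germ pr"
    using smooth_germ_linear[OF bl(1) smooth_germ_id] smooth_germ_linear[OF bl(2) smooth_germ_id] by simp_all
  define \<pi> where "\<pi> x = emb (pr x)" for x
  have bp: "bounded_linear \<pi>" unfolding \<pi>_def using bounded_linear_compose[OF bl] by (simp add: comp_def)
  have lp: "linear \<pi>" using bp bounded_linear.linear by blast
  have spi: "smooth_germ \<pi>" and pi0: "\<pi> 0 = 0" using smooth_germ_linear[OF bp smooth_germ_id] z by (simp_all add: \<pi>_def[abs_def])
  have pi_emb: "\<pi> (emb p) = emb p" for p by (simp add: \<pi>_def pr)
  define e where "e b x = eta G0 G1 x b" for b x
  have se: "smooth_germ (e b)" for b unfolding e_def eta_def by (intro sg s0 s1)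
  have e0: "e b 0 = 0" for b by (simp add: e_def eta_def z)
  have de0: "D (e b) 0 u = 0" for b u
  proof -
    note d0 = smooth_germ_has_derivative0[OF s0] and d1 = smooth_germ_has_derivative0[OF s1]
      and d2 = smooth_germ_has_derivative0[OF smooth_germ_D[OF s0]] and d3 = smooth_germ_has_derivative0[OF smooth_germ_D[OF s1]]
    have "(e b has_derivative (\<lambda>u. (fst (G0 0 - G1 0) \<bullet> snd (D (\<lambda>x. D G0 x b) 0 u) + fst (D G0 0 u - D G1 0 u) \<bullet> snd (D G0 0 b))
      + (snd (G1 0 - G0 0) \<bullet> fst (D (\<lambda>x. D G1 x b) 0 u) + snd (D G1 0 u - D G0 0 u) \<bullet> fst (D G1 0 b)))) (at 0)"
      unfolding e_def eta_def
      by (intro has_derivative_add has_derivative_inner has_derivative_fst has_derivative_snd has_derivative_diff d0 d1 d2 d3)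
    then show ?thesis by (simp add: D_eq z DG)
  qed
  \<comment> \<open>\<open>F\<close> takes care of the embedded directions only. The terms linear in
    \<open>x - \<pi> x\<close> prescribe the derivatives in the complementary directions, so that
    along the curve the whole differential of \<open>s\<close> is \<open>eta G0 G1\<close>.\<close>
  define s where "s x = F (pr x) + (\<Sum>b\<in>Basis. ((x - \<pi> x) \<bullet> b) * e b (\<pi> x))" for x
  have sF: "smooth_germ (\<lambda>x. F (pr x))" by (rule smooth_germ_compose[OF F(1) sp z(4)])
  have sep: "smooth_germ (\<lambda>x. e b (\<pi> x))" for b by (rule smooth_germ_compose[OF se spi pi0])
  have ss: "smooth_germ s" unfolding s_def by (intro sg sF sep spi)
  have dpr: "(pr has_derivative pr) (at x)" and dpi: "(\<pi> has_derivative \<pi>) (at x)" for x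
    using bl(2) bp bounded_linear_imp_has_derivative by blast+
  have ds: "\<forall>\<^sub>F x in nhds 0. D s x = (\<lambda>v. D F (pr x) (pr v)
      + (\<Sum>b\<in>Basis. ((x - \<pi> x) \<bullet> b) * D (e b) (\<pi> x) (\<pi> v) + ((v - \<pi> v) \<bullet> b) * e b (\<pi> x)))"
  proof -
    have "\<forall>\<^sub>F x in nhds 0. \<forall>b\<in>Basis. (e b has_derivative D (e b) (\<pi> x)) (at (\<pi> x))"
      by (intro eventually_ball_finite finite_Basis ballI smooth_germ_eventually[OF spi pi0] smooth_germ_has_derivative se)
    then show ?thesis using smooth_germ_eventually[OF sp z(4) smooth_germ_has_derivative[OF F(1)]]
    proof eventually_elim
      case (elim x)
      have c: "((\<lambda>x. e b (\<pi> x)) has_derivative (\<lambda>v. D (e b) (\<pi> x) (\<pi> v))) (at x)" if "b \<in> Basis" for b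
        by (rule has_derivative_compose[OF dpi]) (use elim(1) that in blast)
      show ?case
        unfolding s_def
        by (rule D_eq, intro has_derivative_add has_derivative_sum has_derivative_mult has_derivative_inner_left has_derivative_diff
            has_derivative_ident dpi c has_derivative_compose[OF dpr elim(2)])
    qed
  qed
  have s_eta: "\<forall>\<^sub>F p in nhds 0. p \<in> N9 \<longrightarrow> (\<forall>v. D s (emb p) v = eta G0 G1 (emb p) v)"
  proof -
    have el: "\<forall>\<^sub>F x in nhds 0. linear (eta G0 G1 x)"
      using smooth_germ_linear_D[OF s0] smooth_germ_linear_D[OF s1]
    proof eventually_elim
      case (elim x)
      then show ?case by (auto simp: linear_iff eta_def inner_add_right algebra_simps)
    qed
    have ee: "smooth_germ emb" using smooth_germ_linear[OF bl(1) smooth_germ_id] by simp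
    show ?thesis
      using smooth_germ_eventually[OF ee z(3) ds] smooth_germ_eventually[OF ee z(3) el] F(2)
    proof eventually_elim
      case (elim p)
      show ?case
      proof (intro impI allI)
        fix v assume p: "p \<in> N9"
        have "D s (emb p) v = D F p (pr v) + (\<Sum>b\<in>Basis. ((v - \<pi> v) \<bullet> b) * eta G0 G1 (emb p) b)"
          unfolding elim(1) by (simp add: pi_emb pr e_def)
        also have "\<dots> = eta G0 G1 (emb p) (\<pi> v) + eta G0 G1 (emb p) (v - \<pi> v)"
          using elim(3) p linear_basis_sum[OF elim(2), of "v - \<pi> v"] by (simp add: \<pi>_def)
        also have "\<dots> = eta G0 G1 (emb p) v" by (simp flip: linear_add[OF elim(2)])
        finally show "D s (emb p) v = eta G0 G1 (emb p) v" .
      qed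
    qed
  qed
  have N0: "0 \<in> N9" using cusp_in_N9[of 0] by simp
  have ee: "smooth_germ emb" using smooth_germ_linear[OF bl(1) smooth_germ_id] by simp
  \<comment> \<open>The differential of \<open>F\<close> is known only on \<open>N9\<close>, but by
    \<open>jets_on_N9\<close> the linear part of a function at 0 is determined by its restriction to
    the cusp. Since \<open>G0\<close> and \<open>G1\<close> have equal 1-jets, \<open>eta\<close>
    vanishes to second order at 0, and so does the differential of \<open>F\<close>.\<close>
  have F1: "D F 0 w = 0" and F2: "D (\<lambda>p. D F p w) 0 u = 0" for u w
  proof -
    define k where "k p = e (emb w) (emb p)" for p
    have sk: "smooth_germ k" unfolding k_def by (rule smooth_germ_compose[OF se ee z(3)])
    have "D k 0 = (\<lambda>u. D (e (emb w)) (emb 0) (D emb 0 u))"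
      unfolding k_def by (rule eventually_nhds_x_imp_x[OF D_compose_germ[OF se ee z(3)]])
    then have dk: "D k 0 u = 0" for u by (simp add: z de0)
    have eq: "\<forall>\<^sub>F p in nhds 0. p \<in> N9 \<longrightarrow> D F p w = k p"
      using F(2) by eventually_elim (simp add: k_def e_def)
    have "D F 0 w = k 0" using eventually_nhds_x_imp_x[OF eq] N0 by simp
    then show "D F 0 w = 0" by (simp add: k_def z e0)
    have "\<forall>\<^sub>F t in nhds 0. D F (cusp t) w = k (cusp t)"
      using eventually_cusp[OF eq] by eventually_elim (simp add: cusp_in_N9)
    then have j: "jc (\<lambda>p. D F p w) = jc k" by (rule jet_cong)
    have sF: "smooth_germ (\<lambda>p. D F p w)" by (rule smooth_germ_D[OF F(1)])
    have l: "linear (D (\<lambda>p. D F p w) 0)" using has_derivative_linear[OF smooth_germ_has_derivative0[OF sF]] .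
    have "D (\<lambda>p. D F p w) 0 e1 = 0" "D (\<lambda>p. D F p w) 0 e2 = 0" "D (\<lambda>p. D F p w) 0 e3 = 0"
      using jets_on_N9(4-6)[OF sF] jets_on_N9(4-6)[OF sk] by (simp_all add: j dk)
    then show "D (\<lambda>p. D F p w) 0 u = 0" using R3_linear[OF l, of u] by simp
  qed
  have s1': "D s 0 v = 0" for v
    using eventually_nhds_x_imp_x[OF ds] by (simp add: z pi0 F1 e0)
  have s2': "D (\<lambda>x. D s x v) 0 u = 0" for u v
  proof -
    let ?R = "\<lambda>x. D F (pr x) (pr v) + (\<Sum>b\<in>Basis. ((x - \<pi> x) \<bullet> b) * D (e b) (\<pi> x) (\<pi> v) + ((v - \<pi> v) \<bullet> b) * e b (\<pi> x))"
    have "D (\<lambda>x. D s x v) 0 = D ?R 0"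
      by (rule D_cong, rule eventually_mono[OF ds]) simp
    moreover have "(?R has_derivative (\<lambda>u. D (\<lambda>p. D F p (pr v)) 0 (pr u) + (\<Sum>b\<in>Basis. (((0 - \<pi> 0) \<bullet> b) * D (\<lambda>x. D (e b) x (\<pi> v)) 0 (\<pi> u)
        + ((u - \<pi> u) \<bullet> b) * D (e b) (\<pi> 0) (\<pi> v)) + ((v - \<pi> v) \<bullet> b) * D (e b) 0 (\<pi> u)))) (at 0)"
    proof (intro has_derivative_add has_derivative_sum has_derivative_mult has_derivative_mult_right has_derivative_inner_left has_derivative_diff
            has_derivative_ident dpi)
      show "((\<lambda>x. D F (pr x) (pr v)) has_derivative (\<lambda>u. D (\<lambda>p. D F p (pr v)) 0 (pr u))) (at 0)"
        using has_derivative_compose[OF dpr[of 0], of "\<lambda>p. D F p (pr v)"] smooth_germ_has_derivative0[OF smooth_germ_D[OF F(1)]] z(4) by simp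
      show "((\<lambda>x. D (e b) (\<pi> x) (\<pi> v)) has_derivative (\<lambda>u. D (\<lambda>x. D (e b) x (\<pi> v)) 0 (\<pi> u))) (at 0)" for b
        using has_derivative_compose[OF dpi[of 0], of "\<lambda>x. D (e b) x (\<pi> v)"] smooth_germ_has_derivative0[OF smooth_germ_D[OF se]] pi0 by simp
      show "((\<lambda>x. e b (\<pi> x)) has_derivative (\<lambda>u. D (e b) 0 (\<pi> u))) (at 0)" for b
        using has_derivative_compose[OF dpi[of 0], of "e b"] smooth_germ_has_derivative0[OF se] pi0 by simp
    qed
    ultimately show ?thesis by (simp add: D_eq F2 de0 pi0)
  qed
  define m where "m x = (fst (G1 x), snd (G0 x))" for x
  have sm: "smooth_germ m" unfolding m_def[abs_def] by (intro sg s0 s1)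
  have dm: "\<forall>\<^sub>F x in nhds 0. D m x = (\<lambda>v. (fst (D G1 x v), snd (D G0 x v)))"
    using smooth_germ_has_derivative[OF s0] smooth_germ_has_derivative[OF s1]
  proof eventually_elim
    case (elim x)
    show ?case unfolding m_def[abs_def]
      by (rule D_eq, intro has_derivative_Pair has_derivative_fst has_derivative_snd elim)
  qed
  have "D m 0 = D G0 0" using eventually_nhds_x_imp_x[OF dm] by (simp add: DG)
  then have m: "dgerm m" using sm dgermD(3)[OF G0] by (simp add: dgerm_def m_def z prod_eq_iff)
  obtain n where n: "dgerm n" "\<forall>\<^sub>F x in nhds 0. n (m x) = x" "\<forall>\<^sub>F y in nhds 0. m (n y) = y" using dgerm_inverse[OF m] .
  note sn = dgermD(1,2)[OF n(1)]
  define S where "S y = s (n y)" for y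
  have sS: "smooth_germ S" unfolding S_def by (rule smooth_germ_compose[OF ss sn])
  have dS: "\<forall>\<^sub>F y in nhds 0. D S y = (\<lambda>v. D s (n y) (D n y v))" unfolding S_def by (rule D_compose_germ[OF ss sn])
  have S1: "D S 0 v = 0" for v using eventually_nhds_x_imp_x[OF dS] by (simp add: sn(2) s1')
  have S2: "D (\<lambda>x. D S x v) 0 u = 0" for u v
  proof -
    let ?R = "\<lambda>y. \<Sum>b\<in>Basis. (D n y v \<bullet> b) * D s (n y) b"
    have "\<forall>\<^sub>F y in nhds 0. D S y v = ?R y"
      using dS smooth_germ_eventually[OF sn smooth_germ_linear_D[OF ss]]
    proof eventually_elim
      case (elim y)
      show ?case unfolding elim(1) by (rule linear_basis_sum[OF elim(2), unfolded real_scaleR_def])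
    qed
    then have "D (\<lambda>x. D S x v) 0 = D ?R 0" by (rule D_cong)
    moreover have "(?R has_derivative (\<lambda>u. \<Sum>b\<in>Basis. (D n 0 v \<bullet> b) * D (\<lambda>x. D s x b) 0 (D n 0 u) + (D (\<lambda>y. D n y v) 0 u \<bullet> b) * D s (n 0) b)) (at 0)"
    proof (intro has_derivative_sum has_derivative_mult has_derivative_inner_left smooth_germ_has_derivative0 smooth_germ_D sn)
      show "((\<lambda>y. D s (n y) b) has_derivative (\<lambda>u. D (\<lambda>x. D s x b) 0 (D n 0 u))) (at 0)" for b
        using has_derivative_compose[OF smooth_germ_has_derivative0[OF sn(1)], of "\<lambda>x. D s x b"]
          smooth_germ_has_derivative0[OF smooth_germ_D[OF ss]] sn(2) by simp
    qed
    ultimately show ?thesis by (simp add: D_eq s2' s1' sn(2))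
  qed
  obtain g where g: "sgerm g" "\<forall>\<^sub>F x in nhds 0. g (fst x + grad2 S x, snd x) = (fst x, snd x + grad1 S x)"
    using generating_function[OF sS S1 S2] .
  have inv: "\<forall>\<^sub>F y in nhds 0. \<forall>w. D m (n y) (D n y w) = w"
  proof -
    have "\<forall>\<^sub>F y in nhds 0. D (\<lambda>y. m (n y)) y = D (\<lambda>y. y) y" by (rule D_cong_germ[OF n(3)])
    then show ?thesis using D_compose_germ[OF sm sn]
    proof eventually_elim
      case (elim y)
      have "D (\<lambda>y. y) y = (\<lambda>v::'n symp. v)" by (rule D_eq) (rule has_derivative_ident)
      then show ?case using elim by metis
    qed
  qed
  have sme: "smooth_germ (\<lambda>p. m (emb p))" "m (emb 0) = 0"
    using smooth_germ_compose[OF sm ee z(3)] dgermD(2)[OF m] z(3) by simp_all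
  note ev = smooth_germ_eventually[OF sme]
  have "\<forall>\<^sub>F p in nhds 0. p \<in> N9 \<longrightarrow> g (G0 (emb p)) = G1 (emb p)"
    using ev[OF g(2)] ev[OF inv] ev[OF dS] smooth_germ_eventually[OF ee z(3) n(2)] smooth_germ_eventually[OF ee z(3) dm] s_eta
  proof eventually_elim
    case (elim p)
    show ?case
    proof
      assume p: "p \<in> N9"
      let ?z = "emb p" let ?x = "m ?z"
      have nx: "n ?x = ?z" by (rule elim(4))
      have DS: "D S ?x w = fst (G0 ?z - G1 ?z) \<bullet> snd w + snd (G1 ?z - G0 ?z) \<bullet> fst w" for w
      proof -
        let ?v = "D n ?x w"
        have w: "(fst (D G1 ?z ?v), snd (D G0 ?z ?v)) = w" using elim(2) unfolding nx elim(5) by blast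
        have "D S ?x w = eta G0 G1 ?z ?v" unfolding elim(3) nx using elim(6) p by blast
        also have "\<dots> = fst (G0 ?z - G1 ?z) \<bullet> snd w + snd (G1 ?z - G0 ?z) \<bullet> fst w"
          unfolding eta_def using w by (metis fst_conv snd_conv)
        finally show ?thesis .
      qed
      have "grad1 S ?x = snd (G1 ?z - G0 ?z)" "grad2 S ?x = fst (G0 ?z - G1 ?z)"
        by (simp_all add: grad1_def grad2_def DS euclidean_representation)
      then have "g (fst (G0 ?z), snd (G0 ?z)) = (fst (G1 ?z), snd (G1 ?z))"
        using elim(1) by (simp add: m_def)
      then show "g (G0 (emb p)) = G1 (emb p)" by simp
    qed
  qed
  then show thesis using that g(1) by blast
qed

section \<open>The invariants determine the germ\<close>

definition emb :: "(nat \<Rightarrow> 'n::finite) \<Rightarrow> R3 \<Rightarrow> 'n symp" where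
  "emb e p = pt e [X p, Y p, Z p]"
definition pr :: "(nat \<Rightarrow> 'n::finite) \<Rightarrow> 'n symp \<Rightarrow> R3" where
  "pr e v = (coord e 1 v, coord e 2 v, coord e 3 v)"

abbreviation enum :: "(nat \<Rightarrow> 'n::finite) \<Rightarrow> bool" where
  "enum e \<equiv> 2 * CARD('n) \<ge> 4 \<and> bij_betw e {1..CARD('n)} UNIV"

lemma coord_eqI:
  fixes e :: "nat \<Rightarrow> 'n::finite"
  assumes e: "bij_betw e {1..CARD('n)} UNIV" and c: "\<And>j. j \<in> {1..2 * CARD('n)} \<Longrightarrow> coord e j v = coord e j w"
  shows "v = w"
proof -
  have "fst v $ i = fst w $ i \<and> snd v $ i = snd w $ i" for i
  proof -
    obtain k where k: "k \<in> {1..CARD('n)}" "i = e k" using e by (metis UNIV_I bij_betw_imp_surj_on imageE)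
    then obtain m where m: "k = Suc m" by (cases k) auto
    have "coord e (2 * m + 1) v = coord e (2 * m + 1) w" "coord e (2 * m + 2) v = coord e (2 * m + 2) w"
      using k by (auto intro!: c simp: m)
    then show ?thesis by (simp add: coord_def k(2) m)
  qed
  then show ?thesis by (simp add: prod_eq_iff vec_eq_iff)
qed

lemma linear_coord: "linear (coord e j)"
  by (auto simp: linear_iff coord_def)

lemma emb_coord:
  fixes e :: "nat \<Rightarrow> 'n::finite"
  assumes "enum e" "1 \<le> j" "j \<le> 2 * CARD('n)"
  shows "coord e j (emb e p) = (if j = 1 then X p else if j = 2 then Y p else if j = 3 then Z p else 0)"
  unfolding emb_def coord_pt[OF conjunct2[OF assms(1)] assms(2,3)] using assms(2)
  by (auto simp: nth_Cons' numeral_eq_Suc)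

lemma linear_emb: assumes "enum e" shows "linear (emb (e :: nat \<Rightarrow> 'n::finite))"
  unfolding linear_iff
  by (auto intro!: coord_eqI[OF conjunct2[OF assms]] simp: linear_add[OF linear_coord] linear_scale[OF linear_coord] emb_coord[OF assms])

lemma linear_pr: "linear (pr e)"
  by (auto simp: linear_iff pr_def linear_add[OF linear_coord] linear_scale[OF linear_coord])

lemma pr_emb: assumes "enum (e :: nat \<Rightarrow> 'n::finite)" shows "pr e (emb e p) = p"
  using assms by (simp add: pr_def emb_coord[OF assms])

lemma inj_emb: assumes "enum (e :: nat \<Rightarrow> 'n::finite)" shows "inj (emb e)"
  by (metis injI pr_emb[OF assms])

lemma U9_eq: assumes "enum (e :: nat \<Rightarrow> 'n::finite)" shows "U9 e = emb e ` N9"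
proof (intro equalityI subsetI)
  fix v assume v: "v \<in> U9 e"
  have "v = emb e (pr e v)"
  proof (rule coord_eqI[OF conjunct2[OF assms]])
    fix j assume j: "j \<in> {1..2 * CARD('n)}"
    consider "j = 1" | "j = 2" | "j = 3" | "j \<in> {4..2 * CARD('n)}" using j by fastforce
    then show "coord e j v = coord e j (emb e (pr e v))"
      using v j by cases (auto simp: emb_coord[OF assms] pr_def U9_def)
  qed
  moreover have "pr e v \<in> N9" using v by (simp add: pr_def N9_def U9_def)
  ultimately show "v \<in> emb e ` N9" by blast
next
  fix v assume "v \<in> emb e ` N9"
  then show "v \<in> U9 e" using assms by (auto simp: U9_def N9_def emb_coord[OF assms])
qed

lemma bounded_linear_emb: "enum e \<Longrightarrow> bounded_linear (emb (e :: nat \<Rightarrow> 'n::finite))"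
  and bounded_linear_pr: "bounded_linear (pr e)"
  using linear_emb linear_pr linear_conv_bounded_linear by blast+

lemma smooth_emb: "enum e \<Longrightarrow> smooth_germ (emb (e :: nat \<Rightarrow> 'n::finite))"
  and smooth_pr: "smooth_germ (pr e)"
  using smooth_germ_linear[OF bounded_linear_emb smooth_germ_id] smooth_germ_linear[OF bounded_linear_pr smooth_germ_id] by auto

lemma emb_0 [simp]: "enum e \<Longrightarrow> emb (e :: nat \<Rightarrow> 'n::finite) 0 = 0" and pr_0 [simp]: "pr e 0 = 0"
  using linear_0[OF linear_emb] linear_0[OF linear_pr] by auto

lemma D_linear: "bounded_linear f \<Longrightarrow> D f x = f"
  by (intro D_eq bounded_linear_imp_has_derivative)

text \<open>Of the diffeomorphism germ only the restriction to the three-space containing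
  \<open>U9\<close> is kept; the branches and the invariants are read off from it.\<close>

definition par :: "(nat \<Rightarrow> 'n::finite) \<Rightarrow> 'n symp set \<Rightarrow> (R3 \<Rightarrow> 'n symp) \<Rightarrow> bool" where
  "par e N E \<longleftrightarrow> (\<exists>g. dgerm g \<and> (\<forall>\<^sub>F x in nhds 0. x \<in> U9 e \<longleftrightarrow> g x \<in> N) \<and> (\<forall>\<^sub>F p in nhds 0. E p = g (emb e p)))"

lemma in_U9_class_iff: "in_U9_class e N \<longleftrightarrow> (\<exists>g. dgerm g \<and> (\<forall>\<^sub>F x in nhds 0. x \<in> U9 e \<longleftrightarrow> g x \<in> N))"
proof
  assume "in_U9_class e N"
  then obtain g U where g: "diffeo_at0 g U" "germ_eq N (g ` (U9 e \<inter> U))" by (auto simp: in_U9_class_def)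
  show "\<exists>g. dgerm g \<and> (\<forall>\<^sub>F x in nhds 0. x \<in> U9 e \<longleftrightarrow> g x \<in> N)"
    by (rule exI, rule conjI[OF diffeo_dgerm(1)[OF g(1)] germ_image_iff[OF g(1), THEN iffD1, OF g(2)]])
next
  assume "\<exists>g. dgerm g \<and> (\<forall>\<^sub>F x in nhds 0. x \<in> U9 e \<longleftrightarrow> g x \<in> N)"
  then obtain g where g: "dgerm g" "\<forall>\<^sub>F x in nhds 0. x \<in> U9 e \<longleftrightarrow> g x \<in> N" by (elim exE conjE)
  obtain U where U: "diffeo_at0 g U" using dgerm_diffeo[OF g(1) open_UNIV UNIV_I] .
  show "in_U9_class e N" unfolding in_U9_class_def
    by (rule exI, rule exI, rule conjI[OF U germ_image_iff[OF U, THEN iffD2, OF g(2)]])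
qed

lemma in_U9_class_par: "in_U9_class e N \<longleftrightarrow> (\<exists>E. par e N E)"
proof
  assume "in_U9_class e N"
  then obtain g where "dgerm g" "\<forall>\<^sub>F x in nhds 0. x \<in> U9 e \<longleftrightarrow> g x \<in> N" by (auto simp: in_U9_class_iff)
  then have "par e N (\<lambda>p. g (emb e p))" by (auto simp: par_def)
  then show "\<exists>E. par e N E" by (rule exI[where x = "\<lambda>p. g (emb e p)"])
next
  assume "\<exists>E. par e N E"
  then obtain E where "par e N E" by (rule exE)
  then show "in_U9_class e N" unfolding par_def in_U9_class_iff by (elim exE conjE) (intro exI conjI)
qed

lemma par_smooth: "enum e \<Longrightarrow> par (e :: nat \<Rightarrow> 'n::finite) N E \<Longrightarrow> smooth_germ E" and par_0: "enum e \<Longrightarrow> par e N E \<Longrightarrow> E 0 = 0"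
proof -
  assume e: "enum e" and "par e N E"
  then obtain g where g: "dgerm g" "\<forall>\<^sub>F p in nhds 0. E p = g (emb e p)" by (auto simp: par_def)
  have "smooth_germ (\<lambda>p. g (emb e p))"
    by (rule smooth_germ_compose[OF dgermD(1)[OF g(1)] smooth_emb[OF e] emb_0[OF e]])
  then show "smooth_germ E" by (rule smooth_germ_cong[rotated]) (use g(2) in \<open>simp add: eq_commute\<close>)
  show "E 0 = 0" using eventually_nhds_x_imp_x[OF g(2)] e dgermD(2)[OF g(1)] by simp
qed

text \<open>The map \<open>k\<close>, the inverse of \<open>g\<close> after \<open>\<psi>\<close>
  and \<open>f\<close>, fixes the points of \<open>K\<close>. If conversely \<open>k x\<close> lies
  in \<open>K\<close>, then \<open>k (k x) = k x\<close> and injectivity gives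
  \<open>k x = x\<close>; so \<open>k\<close> preserves \<open>K\<close> in both directions.\<close>

lemma dgerm_images_agree:
  fixes f g \<psi> :: "'a::euclidean_space \<Rightarrow> 'a"
  assumes "dgerm f" "dgerm g" "dgerm \<psi>"
    and N: "\<forall>\<^sub>F x in nhds 0. x \<in> K \<longleftrightarrow> f x \<in> N" and M: "\<forall>\<^sub>F x in nhds 0. x \<in> K \<longleftrightarrow> g x \<in> M"
    and eq: "\<forall>\<^sub>F x in nhds 0. x \<in> K \<longrightarrow> \<psi> (f x) = g x"
  shows "\<forall>\<^sub>F x in nhds 0. x \<in> N \<longleftrightarrow> \<psi> x \<in> M"
proof -
  obtain f' where f': "dgerm f'" "\<forall>\<^sub>F x in nhds 0. f' (f x) = x" "\<forall>\<^sub>F x in nhds 0. f (f' x) = x" using dgerm_inverse[OF assms(1)] .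
  obtain g' where g': "dgerm g'" "\<forall>\<^sub>F x in nhds 0. g' (g x) = x" "\<forall>\<^sub>F x in nhds 0. g (g' x) = x" using dgerm_inverse[OF assms(2)] .
  define k where "k x = g' (\<psi> (f x))" for x
  have k: "dgerm k" unfolding k_def by (rule dgerm_compose[OF g'(1) dgerm_compose[OF assms(3,1)]])
  obtain k' where k': "dgerm k'" "\<forall>\<^sub>F x in nhds 0. k' (k x) = x" using dgerm_inverse[OF k] .
  note ev = smooth_germ_eventually[OF dgermD(1,2)]
  have kK: "\<forall>\<^sub>F x in nhds 0. x \<in> K \<longrightarrow> k x = x" using eq g'(2) by eventually_elim (simp add: k_def)
  have kiff: "\<forall>\<^sub>F x in nhds 0. x \<in> K \<longleftrightarrow> k x \<in> K"
    using kK ev[OF k k kK] k'(2) ev[OF k k k'(2)]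
  proof eventually_elim
    case (elim x) then show ?case by metis
  qed
  have \<psi>f: "dgerm (\<lambda>x. \<psi> (f x))" by (rule dgerm_compose[OF assms(3,1)])
  have "\<forall>\<^sub>F x in nhds 0. x \<in> K \<longleftrightarrow> \<psi> (f x) \<in> M"
    using kiff ev[OF k k M] ev[OF \<psi>f \<psi>f g'(3)]
    by eventually_elim (simp add: k_def)
  from ev[OF f'(1) f'(1) this] ev[OF f'(1) f'(1) N] f'(3)
  show ?thesis by eventually_elim simp
qed

lemma ell_pull_cong_germ:
  assumes "\<forall>\<^sub>F p in nhds 0. E p = E' p" shows "ell (pull E lam) = ell (pull E' lam)"
proof -
  have "\<forall>\<^sub>F p in nhds 0. \<forall>v. pull E lam p v = pull E' lam p v"
    using assms D_cong_germ[OF assms] by eventually_elim (simp add: pull_def)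
  then show ?thesis by (intro ext ell_cong_germ)
qed

lemma ell_symplectic:
  fixes E :: "R3 \<Rightarrow> 'n::finite symp"
  assumes "sgerm g" and E: "smooth_germ E" "E 0 = 0"
  shows "ell (pull (\<lambda>p. g (E p)) lam) w = ell (pull E lam) w"
proof -
  have g: "smooth_germ g" "g 0 = 0" and s: "\<forall>\<^sub>F x in nhds 0. \<forall>u v. omega0 (D g x u) (D g x v) = omega0 u v"
    using assms(1) by (auto simp: sgerm_def dgerm_def)
  have gE: "smooth_germ (\<lambda>p. g (E p))" by (rule smooth_germ_compose[OF g(1) E])
  have "\<forall>\<^sub>F p in nhds 0. \<forall>u v. omega0 (D (\<lambda>p. g (E p)) p u) (D (\<lambda>p. g (E p)) p v) = omega0 (D E p u) (D E p v)"
    using D_compose_germ[OF g(1) E] smooth_germ_eventually[OF E s] by eventually_elim simp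
  then obtain F where F: "smooth_germ F" "\<forall>\<^sub>F p in nhds 0. \<forall>v. D F p v = pull (\<lambda>p. g (E p)) lam p v - pull E lam p v"
    using liouville_difference_exact[OF gE E(1)] by blast
  have "ell (\<lambda>p. D F p) w = ell (pull (\<lambda>p. g (E p)) lam) w - ell (pull E lam) w"
    unfolding ell_cong_germ[OF F(2)]
    by (rule ell_diff[OF smooth_form_smooth[OF smooth_form_pull_lam[OF gE]] smooth_form_smooth[OF smooth_form_pull_lam[OF E(1)]]])
  then show ?thesis using ell_exact[OF F(1), of w] by simp
qed

text \<open>The exterior derivatives of \<open>tau8\<close>, \<open>tau10\<close>,
  \<open>tau12\<close> are 8 dz dx, 10 dz dy, 12 dx dy. So these three invariants record
  \<open>omega0\<close> on the tangent space of the embedded three-space, which is the input for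
  Witt's theorem.\<close>

lemma ell_omega:
  fixes E :: "R3 \<Rightarrow> 'n::finite symp"
  assumes E: "smooth_germ E"
  shows "ell (pull E lam) 8 = omega0 (D E 0 e3) (D E 0 e1) / 8"
    "ell (pull E lam) 10 = omega0 (D E 0 e3) (D E 0 e2) / 10"
    "ell (pull E lam) 12 = omega0 (D E 0 e1) (D E 0 e2) / 12"
proof -
  note s = smooth_form_smooth[OF smooth_form_pull_lam[OF E]]
  note d = eventually_nhds_x_imp_x[OF D_pull_lam[OF E], rule_format]
  note j = jets_on_N9(4-6)[OF s]
  show "ell (pull E lam) 8 = omega0 (D E 0 e3) (D E 0 e1) / 8"
    unfolding ell_def ellj_def j by (simp add: j d[symmetric])
  show "ell (pull E lam) 10 = omega0 (D E 0 e3) (D E 0 e2) / 10"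
    unfolding ell_def ellj_def j by (simp add: j d[symmetric])
  show "ell (pull E lam) 12 = omega0 (D E 0 e1) (D E 0 e2) / 12"
    unfolding ell_def ellj_def j by (simp add: j d[symmetric])
qed

lemma ell_omega_eq:
  fixes E0 E1 :: "R3 \<Rightarrow> 'n::finite symp"
  assumes E: "smooth_germ E0" "smooth_germ E1" and eq: "\<And>w. ell (pull E0 lam) w = ell (pull E1 lam) w"
  shows "omega0 (D E0 0 u) (D E0 0 v) = omega0 (D E1 0 u) (D E1 0 v)"
proof -
  have l: "linear (D E0 0)" "linear (D E1 0)"
    using E smooth_germ_has_derivative0 has_derivative_linear by blast+
  have o: "omega0 (D E0 0 e3) (D E0 0 e1) = omega0 (D E1 0 e3) (D E1 0 e1)"
    "omega0 (D E0 0 e3) (D E0 0 e2) = omega0 (D E1 0 e3) (D E1 0 e2)"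
    "omega0 (D E0 0 e1) (D E0 0 e2) = omega0 (D E1 0 e1) (D E1 0 e2)"
    using eq[of 8] eq[of 10] eq[of 12] unfolding ell_omega[OF E(1)] ell_omega[OF E(2)] by auto
  have o': "omega0 (D E0 0 e1) (D E0 0 e3) = omega0 (D E1 0 e1) (D E1 0 e3)"
    "omega0 (D E0 0 e2) (D E0 0 e3) = omega0 (D E1 0 e2) (D E1 0 e3)"
    "omega0 (D E0 0 e2) (D E0 0 e1) = omega0 (D E1 0 e2) (D E1 0 e1)"
    using o omega0_skew by metis+
  show ?thesis
    unfolding R3_linear[OF l(1), of u] R3_linear[OF l(1), of v] R3_linear[OF l(2), of u] R3_linear[OF l(2), of v]
    by (simp add: linear_add[OF omega0_linear(1)] linear_add[OF omega0_linear(2)] linear_scale[OF omega0_linear(1)]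
           linear_scale[OF omega0_linear(2)] omega0_self o o')
qed

lemma sgerm_linear:
  fixes A :: "'n::finite symp \<Rightarrow> 'n symp"
  assumes "linear A" "\<And>u v. omega0 (A u) (A v) = omega0 u v" shows "sgerm A"
proof -
  have b: "bounded_linear A" using assms(1) linear_conv_bounded_linear by blast
  have "inj A"
  proof (rule injI)
    fix x y assume "A x = A y"
    then have "A (x - y) = 0" using linear_diff[OF assms(1)] by simp
    then have z: "omega0 (x - y) v = 0" for v using assms(2)[of "x - y" v] by (simp add: omega0_eq)
    show "x = y" using z[of "(0, fst (x - y))"] z[of "(snd (x - y), 0)"] by (simp add: omega0_eq prod_eq_iff)
  qed
  then show ?thesis
    using smooth_germ_linear[OF b smooth_germ_id] linear_0[OF assms(1)] assms(2)
    by (simp add: sgerm_def dgerm_def D_linear[OF b])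
qed

theorem symp_equiv_of_ell_eq:
  fixes e :: "nat \<Rightarrow> 'n::finite"
  assumes e: "enum e" and N: "par e N E0" and M: "par e M E1" and eq: "\<And>w. ell (pull E0 lam) w = ell (pull E1 lam) w"
  shows "symp_equiv N M"
proof -
  let ?i = "emb e" and ?\<pi> = "\<lambda>x. emb e (pr e x)"
  note li = linear_emb[OF e] and si = smooth_emb[OF e] and i0 = emb_0[OF e]
  note sE = par_smooth[OF e N] par_0[OF e N] par_smooth[OF e M] par_0[OF e M]
  obtain g0 where g0: "dgerm g0" "\<forall>\<^sub>F x in nhds 0. x \<in> U9 e \<longleftrightarrow> g0 x \<in> N" "\<forall>\<^sub>F p in nhds 0. E0 p = g0 (?i p)"
    using N by (auto simp: par_def)
  obtain g1 where g1: "dgerm g1" "\<forall>\<^sub>F x in nhds 0. x \<in> U9 e \<longleftrightarrow> g1 x \<in> M" "\<forall>\<^sub>F p in nhds 0. E1 p = g1 (?i p)"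
    using M by (auto simp: par_def)
  have DE: "D E0 0 u = D g0 0 (?i u)" "D E1 0 u = D g1 0 (?i u)" for u
    using D_cong[OF g0(3)] D_cong[OF g1(3)] eventually_nhds_x_imp_x[OF D_compose_germ[OF dgermD(1)[OF g0(1)] si i0]]
      eventually_nhds_x_imp_x[OF D_compose_germ[OF dgermD(1)[OF g1(1)] si i0]] i0 D_linear[OF bounded_linear_emb[OF e]]
    by simp_all
  have lE: "linear (D E0 0)" "linear (D E1 0)"
    using sE smooth_germ_has_derivative0 has_derivative_linear by blast+
  have injE: "inj (D E0 0)" "inj (D E1 0)"
    using inj_compose[OF dgermD(3)[OF g0(1)] inj_emb[OF e]] inj_compose[OF dgermD(3)[OF g1(1)] inj_emb[OF e]]
    by (simp_all add: DE[abs_def] comp_def)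
  obtain A where A: "linear A" "\<And>u v. omega0 (A u) (A v) = omega0 u v" "\<And>u. A (D E0 0 u) = D E1 0 u"
    by (rule witt_linear[OF lE injE ell_omega_eq[OF sE(1,3) eq]]) (rule that)
  have sA: "sgerm A" by (rule sgerm_linear[OF A(1,2)])
  then have dA: "dgerm A" by (simp add: sgerm_def)
  have bA: "bounded_linear A" using A(1) linear_conv_bounded_linear by blast
  define G0 where "G0 x = A (g0 x)" for x
  have G0: "dgerm G0" unfolding G0_def by (rule dgerm_compose[OF dA g0(1)])
  define L where "L v = D G0 0 v - D g1 0 v" for v
  have lL: "linear L" unfolding L_def
    using dgermD(1)[OF G0] dgermD(1)[OF g1(1)] smooth_germ_has_derivative0 has_derivative_linear
    by (intro linear_compose_sub) blast+
  have bL: "bounded_linear L" using lL linear_conv_bounded_linear by blast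
  have DG0: "D G0 0 v = A (D g0 0 v)" for v
    using eventually_nhds_x_imp_x[OF D_compose_germ[OF dgermD(1)[OF dA] dgermD(1,2)[OF g0(1)]]]
    by (simp add: G0_def[abs_def] D_linear[OF bA] dgermD(2)[OF g0(1)])
  have Li: "L (?i u) = 0" for u using A(3)[of u] by (simp add: L_def DG0 DE)
  \<comment> \<open>After \<open>A\<close>, the derivatives at 0 of \<open>G0\<close> and
    \<open>g1\<close> agree on the embedded three-space. Adding \<open>L\<close> in the
    complementary directions makes them agree everywhere and does not move that space.\<close>
  define G1 where "G1 x = g1 x + (L x - L (?\<pi> x))" for x
  have b\<pi>: "bounded_linear ?\<pi>" using bounded_linear_compose[OF bounded_linear_emb[OF e] bounded_linear_pr[of e]] by (simp add: comp_def)
  have bLL: "bounded_linear (\<lambda>x. L x - L (?\<pi> x))"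
    using bounded_linear_sub[OF bL bounded_linear_compose[OF bL b\<pi>]] by simp
  have sG1: "smooth_germ G1" unfolding G1_def
    by (intro smooth_germ_add dgermD(1)[OF g1(1)] smooth_germ_linear[OF bLL smooth_germ_id])
  have "D G1 0 = (\<lambda>v. D g1 0 v + (L v - L (?\<pi> v)))"
    unfolding G1_def
    by (rule D_eq) (intro has_derivative_add bounded_linear_imp_has_derivative bLL smooth_germ_has_derivative0 dgermD(1)[OF g1(1)])
  then have DG: "D G0 0 = D G1 0" by (simp add: Li) (simp add: L_def)
  have G1_0: "G1 0 = 0" using dgermD(2)[OF g1(1)] i0 by (simp add: G1_def linear_0[OF lL])
  have G1: "dgerm G1" using sG1 G1_0 dgermD(3)[OF G0] DG by (simp add: dgerm_def)
  have G1i: "G1 (?i p) = g1 (?i p)" for p by (simp add: G1_def pr_emb[OF e])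
  define E0' where "E0' p = G0 (?i p)" for p
  define E1' where "E1' p = G1 (?i p)" for p
  have s0: "smooth_germ E0'" "smooth_germ E1'"
    unfolding E0'_def E1'_def by (intro smooth_germ_compose[OF dgermD(1)[OF G0] si i0] smooth_germ_compose[OF sG1 si i0])+
  have dE: "\<forall>\<^sub>F p in nhds 0. D E0' p = (\<lambda>v. D G0 (?i p) (?i v)) \<and> D E1' p = (\<lambda>v. D G1 (?i p) (?i v))"
    using D_compose_germ[OF dgermD(1)[OF G0] si i0] D_compose_germ[OF sG1 si i0]
    unfolding E0'_def[abs_def] E1'_def[abs_def] D_linear[OF bounded_linear_emb[OF e]] by (rule eventually_conj)
  \<comment> \<open>The boundary term of an integration by parts: along the embedding
    \<open>eta\<close> is the difference of the two Liouville forms plus the differential of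
    \<open>H\<close>.\<close>
  define H where "H p = fst (E1' p) \<bullet> snd (E1' p) - fst (E1' p) \<bullet> snd (E0' p)" for p
  have sH: "smooth_germ H" unfolding H_def by (intro sg s0)
  define \<beta> where "\<beta> p v = eta G0 G1 (?i p) (?i v)" for p v
  have \<beta>: "\<forall>\<^sub>F p in nhds 0. \<forall>v. \<beta> p v = pull E0' lam p v - pull E1' lam p v + D H p v"
    using dE smooth_germ_has_derivative[OF s0(1)] smooth_germ_has_derivative[OF s0(2)]
  proof eventually_elim
    case (elim p)
    have "(H has_derivative (\<lambda>v. (fst (E1' p) \<bullet> snd (D E1' p v) + fst (D E1' p v) \<bullet> snd (E1' p))
       - (fst (E1' p) \<bullet> snd (D E0' p v) + fst (D E1' p v) \<bullet> snd (E0' p)))) (at p)"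
      unfolding H_def by (intro has_derivative_diff has_derivative_inner has_derivative_fst has_derivative_snd elim)
    then have DH: "D H p = (\<lambda>v. (fst (E1' p) \<bullet> snd (D E1' p v) + fst (D E1' p v) \<bullet> snd (E1' p))
       - (fst (E1' p) \<bullet> snd (D E0' p v) + fst (D E1' p v) \<bullet> snd (E0' p)))" by (rule D_eq)
    show ?case
      using elim(1) unfolding DH \<beta>_def eta_def pull_lam
      by (simp add: E0'_def E1'_def inner_diff_left inner_commute)
  qed
  have sf: "smooth_form (\<lambda>p v. pull E0' lam p v - pull E1' lam p v + D H p v)"
    unfolding smooth_form_def
  proof
    show "\<forall>v. smooth_germ (\<lambda>p. pull E0' lam p v - pull E1' lam p v + D H p v)"
      by (intro allI smooth_germ_add smooth_germ_diff smooth_form_smooth[OF smooth_form_pull_lam] s0 smooth_germ_D sH)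
    show "\<forall>\<^sub>F p in nhds 0. linear (\<lambda>v. pull E0' lam p v - pull E1' lam p v + D H p v)"
      using smooth_form_linear[OF smooth_form_pull_lam[OF s0(1)]] smooth_form_linear[OF smooth_form_pull_lam[OF s0(2)]]
        smooth_germ_linear_D[OF sH]
      by eventually_elim (rule linear_compose_add[OF linear_compose_sub])
  qed
  have e0: "ell (pull E0' lam) w = ell (pull E0 lam) w" for w
  proof -
    have "\<forall>\<^sub>F p in nhds 0. E0' p = A (E0 p)" using g0(3) by eventually_elim (simp add: E0'_def G0_def)
    from ell_pull_cong_germ[OF this] show ?thesis using ell_symplectic[OF sA sE(1,2)] by simp
  qed
  have e1: "ell (pull E1' lam) = ell (pull E1 lam)"
  proof -
    have "\<forall>\<^sub>F p in nhds 0. E1' p = E1 p" using g1(3) by eventually_elim (simp add: E1'_def G1i)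
    then show ?thesis by (rule ell_pull_cong_germ)
  qed
  have "ell (\<lambda>p v. pull E0' lam p v - pull E1' lam p v + D H p v) w = 0" for w
  proof -
    have "ell (\<lambda>p v. pull E0' lam p v - pull E1' lam p v + D H p v) w
       = ell (\<lambda>p v. pull E0' lam p v - pull E1' lam p v) w + ell (\<lambda>p. D H p) w"
      by (rule ell_add) (intro smooth_germ_diff smooth_form_smooth[OF smooth_form_pull_lam] s0 smooth_germ_D sH)+
    also have "ell (\<lambda>p v. pull E0' lam p v - pull E1' lam p v) w = ell (pull E0' lam) w - ell (pull E1' lam) w"
      by (rule ell_diff) (intro smooth_form_smooth[OF smooth_form_pull_lam] s0)+
    finally show ?thesis using e0 e1 eq ell_exact[OF sH] by simp
  qed
  then obtain F where F: "smooth_germ F" "\<forall>\<^sub>F p in nhds 0. p \<in> N9 \<longrightarrow> (\<forall>v. D F p v = pull E0' lam p v - pull E1' lam p v + D H p v)"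
    using exact_of_ell_zero[OF sf] by blast
  have "\<forall>\<^sub>F p in nhds 0. p \<in> N9 \<longrightarrow> (\<forall>v. D F p v = eta G0 G1 (?i p) (?i v))"
    using F(2) \<beta> by eventually_elim (simp add: \<beta>_def)
  then obtain g where g: "sgerm g" "\<forall>\<^sub>F p in nhds 0. p \<in> N9 \<longrightarrow> g (G0 (?i p)) = G1 (?i p)"
    using symplectic_interpolation[OF G0 G1 DG li linear_pr pr_emb[OF e] F(1)] by blast
  let ?\<psi> = "\<lambda>x. g (A x)"
  have \<psi>: "sgerm ?\<psi>" by (rule sgerm_compose[OF g(1) sA])
  have "\<forall>\<^sub>F x in nhds 0. pr e x \<in> N9 \<longrightarrow> g (G0 (?\<pi> x)) = G1 (?\<pi> x)"
    by (rule smooth_germ_eventually[OF smooth_pr pr_0 g(2)])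
  then have "\<forall>\<^sub>F x in nhds 0. x \<in> U9 e \<longrightarrow> ?\<psi> (g0 x) = g1 x"
    by eventually_elim (auto simp: U9_eq[OF e] pr_emb[OF e] G0_def G1i)
  then have "\<forall>\<^sub>F x in nhds 0. x \<in> N \<longleftrightarrow> ?\<psi> x \<in> M"
    using dgerm_images_agree[OF g0(1) g1(1) _ g0(2) g1(2)] \<psi> by (simp add: sgerm_def)
  then show ?thesis using \<psi> symp_equiv_iff by blast
qed

section \<open>Constructing and changing parametrizations\<close>

lemma injective_extension:
  fixes e :: "nat \<Rightarrow> 'n::finite" and f :: "R3 \<Rightarrow> 'n symp"
  assumes e: "enum e" and f: "linear f" "inj f"
  obtains L where "linear L" "inj L" "\<And>p. L (emb e p) = f p"
proof -
  let ?K = "{v. pr e v = 0}" and ?T = "{y. \<forall>x\<in>range f. orthogonal x y}"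
  note li = linear_emb[OF e] and sr = linear_subspace_image[OF _ subspace_UNIV]
  have sK: "subspace ?K" by (rule linear_subspace_kernel[OF linear_pr])
  have sT: "subspace ?T" by (rule subspace_orthogonal_to_vectors)
  have dR: "dim (range (emb e)) = dim (range f)"
    using dim_image_eq[of "emb e" UNIV] dim_image_eq[of f UNIV] li f inj_emb[OF e]
    by (simp add: span_UNIV)
  have UN: "{x + y |x y. x \<in> ?K \<and> y \<in> range (emb e)} = UNIV"
  proof (intro set_eqI iffI UNIV_I CollectI)
    fix v
    have "v = (v - emb e (pr e v)) + emb e (pr e v) \<and> (v - emb e (pr e v)) \<in> ?K"
      by (simp add: linear_diff[OF linear_pr] pr_emb[OF e])
    then show "\<exists>x y. v = x + y \<and> x \<in> ?K \<and> y \<in> range (emb e)" by blast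
  qed
  have In: "?K \<inter> range (emb e) = {0}" using pr_emb[OF e] emb_0[OF e] by (auto simp: image_iff)
  have "dim ?K + dim (range (emb e)) = DIM('n symp)"
    using dim_sums_Int[OF sK sr[OF li]] unfolding UN In by (simp add: dim_UNIV)
  moreover have "dim ?T + dim (range f) = DIM('n symp)"
    using dim_subspace_orthogonal_to_vectors[OF sr[OF f(1)] subspace_UNIV] by (simp add: dim_UNIV)
  ultimately have "dim ?K = dim ?T" using dR by simp
  then obtain h where h: "linear h" "h ` ?K = ?T" "inj_on h ?K" using subspace_isomorphism[OF sK sT] by blast
  define L where "L v = f (pr e v) + h (v - emb e (pr e v))" for v
  have lL: "linear L"
    unfolding L_def linear_iff
    by (simp add: linear_add[OF linear_pr] linear_scale[OF linear_pr] linear_add[OF f(1)] linear_scale[OF f(1)]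
      linear_add[OF li] linear_scale[OF li] linear_add[OF h(1)] linear_scale[OF h(1)] linear_diff[OF h(1)] algebra_simps)
  have "v = 0" if "L v = 0" for v
  proof -
    have k: "v - emb e (pr e v) \<in> ?K" by (simp add: linear_diff[OF linear_pr] pr_emb[OF e])
    then have "orthogonal (f (pr e v)) (h (v - emb e (pr e v)))" using h(2) by blast
    moreover have *: "f (pr e v) = - h (v - emb e (pr e v))" using that by (simp add: L_def eq_neg_iff_add_eq_0)
    ultimately have 0: "h (v - emb e (pr e v)) = 0" by (simp add: orthogonal_def)
    then have "f (pr e v) = 0" using * by simp
    then have "pr e v = 0" using linear_injective_0[OF f(1)] f(2) by blast
    moreover have "v - emb e (pr e v) = 0"
      using 0 h(1,3) k linear_0[OF h(1)] sK subspace_0 by (metis (no_types, lifting) inj_onD)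
    ultimately show "v = 0" using emb_0[OF e] by simp
  qed
  then have "inj L" using linear_injective_0[OF lL] by blast
  moreover have "L (emb e p) = f p" for p by (simp add: L_def pr_emb[OF e] linear_0[OF h(1)])
  ultimately show thesis using that lL by blast
qed

text \<open>A linear injection on a complement extends \<open>E\<close> to a local diffeomorphism.
  As the image of all of \<open>N9\<close> is taken, \<open>proper\<close> is what prevents points
  far from 0 from being mapped near 0.\<close>

lemma par_immersion:
  fixes e :: "nat \<Rightarrow> 'n::finite" and E :: "R3 \<Rightarrow> 'n symp"
  assumes e: "enum e" and E: "smooth_germ E" "E 0 = 0" "inj (D E 0)"
    and proper: "\<And>\<delta>. \<delta> > 0 \<Longrightarrow> \<exists>\<epsilon>>0. \<forall>p\<in>N9. norm (E p) < \<epsilon> \<longrightarrow> norm p < \<delta>"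
  shows "par e (E ` N9) E"
proof -
  have lE: "linear (D E 0)" by (rule has_derivative_linear[OF smooth_germ_has_derivative0[OF E(1)]])
  obtain L where L: "linear L" "inj L" "\<And>p. L (emb e p) = D E 0 p"
    by (rule injective_extension[OF e lE E(3)]) (rule that)
  have bL: "bounded_linear (\<lambda>v. L (v - emb e (pr e v)))"
    using L(1) linear_compose[OF linear_compose_sub[OF linear_id linear_compose[OF linear_pr linear_emb[OF e]]] L(1)]
    by (simp add: comp_def linear_conv_bounded_linear[symmetric] id_def)
  define G where "G v = E (pr e v) + L (v - emb e (pr e v))" for v
  have Ei: "smooth_germ (\<lambda>v. E (pr e v))" by (rule smooth_germ_compose[OF E(1) smooth_pr pr_0])
  have sG: "smooth_germ G" unfolding G_def
    by (intro smooth_germ_add Ei smooth_germ_linear[OF bL smooth_germ_id])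
  have "D (\<lambda>v. E (pr e v)) 0 = (\<lambda>v. D E 0 (pr e v))"
    using eventually_nhds_x_imp_x[OF D_compose_germ[OF E(1) smooth_pr pr_0]]
    by (simp add: D_linear[OF bounded_linear_pr])
  then have "D G 0 = (\<lambda>v. D E 0 (pr e v) + L (v - emb e (pr e v)))"
    unfolding G_def
    by (intro D_eq has_derivative_add bounded_linear_imp_has_derivative[OF bL])
      (use smooth_germ_has_derivative0[OF Ei] in simp)
  then have "D G 0 = L" by (simp add: fun_eq_iff linear_diff[OF L(1)] L(3))
  then have G: "dgerm G" using sG E(2) L(2) by (simp add: dgerm_def G_def emb_0[OF e] linear_0[OF L(1)])
  have Gi: "G (emb e p) = E p" for p by (simp add: G_def pr_emb[OF e] linear_0[OF L(1)])
  obtain G' where G': "dgerm G'" "\<forall>\<^sub>F x in nhds 0. G' (G x) = x" using dgerm_inverse[OF G] .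
  have "\<forall>\<^sub>F p in nhds 0. G' (E p) = emb e p"
    using smooth_germ_eventually[OF smooth_emb[OF e] emb_0[OF e] G'(2)] by (simp add: Gi)
  then obtain \<delta> where \<delta>: "\<delta> > 0" "\<And>p. norm p < \<delta> \<Longrightarrow> G' (E p) = emb e p"
    by (auto simp: eventually_nhds_metric dist_norm)
  obtain \<epsilon> where \<epsilon>: "\<epsilon> > 0" "\<forall>p\<in>N9. norm (E p) < \<epsilon> \<longrightarrow> norm p < \<delta>" using proper[OF \<delta>(1)] by blast
  have "\<forall>\<^sub>F x in nhds 0. norm (G x) < \<epsilon>"
    by (rule smooth_germ_eventually[OF dgermD(1,2)[OF G]])
      (use \<epsilon>(1) in \<open>auto simp: eventually_nhds_metric dist_norm\<close>)
  from this G'(2) have "\<forall>\<^sub>F x in nhds 0. x \<in> U9 e \<longleftrightarrow> G x \<in> E ` N9"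
  proof eventually_elim
    case (elim x)
    show ?case
    proof
      assume "x \<in> U9 e" then show "G x \<in> E ` N9" by (auto simp: U9_eq[OF e] Gi)
    next
      assume "G x \<in> E ` N9"
      then obtain p where p: "p \<in> N9" "G x = E p" by blast
      then have "x = emb e p" using elim \<epsilon>(2) \<delta>(2) by metis
      then show "x \<in> U9 e" using p by (simp add: U9_eq[OF e])
    qed
  qed
  then show ?thesis unfolding par_def
    by (intro exI[where x = G] conjI G always_eventually[of "\<lambda>p. E p = G (emb e p)"] allI Gi[symmetric])
qed

text \<open>The two equations of \<open>N9\<close> are quasi-homogeneous of degrees 10 and
  12.\<close>

lemma Phi_N9_iff: assumes "U p \<noteq> 0" shows "Phi U (\<lambda>_. 0) p \<in> N9 \<longleftrightarrow> p \<in> N9"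
proof -
  have "(X p * U p ^ 5)\<^sup>2 + Y p * U p ^ 7 * (Z p * U p ^ 3) = U p ^ 10 * ((X p)\<^sup>2 + Y p * Z p)"
    "X p * U p ^ 5 * (Y p * U p ^ 7) + (Z p * U p ^ 3) ^ 4 = U p ^ 12 * (X p * Y p + Z p ^ 4)"
    by (simp_all add: power_mult_distrib algebra_simps flip: power_add power_mult)
  then show ?thesis using assms by (simp add: N9_def Phi_def case_prod_beta)
qed

text \<open>The substitution is extended by the identity in the complementary coordinates to a
  diffeomorphism germ, which preserves \<open>U9\<close> in both directions where \<open>U\<close>
  does not vanish.\<close>

lemma par_Phi:
  fixes e :: "nat \<Rightarrow> 'n::finite"
  assumes e: "enum e" and "par e N E" and U: "smooth_germ U" "U 0 \<noteq> 0"
  shows "par e N (\<lambda>p. E (Phi U (\<lambda>_. 0) p))"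
proof -
  obtain g where g: "dgerm g" "\<forall>\<^sub>F x in nhds 0. x \<in> U9 e \<longleftrightarrow> g x \<in> N" "\<forall>\<^sub>F p in nhds 0. E p = g (emb e p)"
    using assms(2) by (auto simp: par_def)
  let ?P = "Phi U (\<lambda>_. 0)"
  have sP: "smooth_germ ?P" by (intro smooth_Phi U sg)
  define h where "h v = emb e (?P (pr e v)) + (v - emb e (pr e v))" for v
  have b: "bounded_linear (\<lambda>v. v - emb e (pr e v))"
    using linear_compose_sub[OF linear_id linear_compose[OF linear_pr linear_emb[OF e]]]
    by (simp add: comp_def linear_conv_bounded_linear[symmetric] id_def)
  have Pp: "smooth_germ (\<lambda>v. ?P (pr e v))" by (rule smooth_germ_compose[OF sP smooth_pr pr_0])
  have sh: "smooth_germ h" unfolding h_def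
    by (intro smooth_germ_add smooth_germ_linear[OF bounded_linear_emb[OF e] Pp] smooth_germ_linear[OF b smooth_germ_id])
  have DP: "D ?P 0 v = (X v * U 0 ^ 5, Y v * U 0 ^ 7, Z v * U 0 ^ 3)" for v
    using eventually_nhds_x_imp_x[OF smooth_germ_differentiable[OF U(1)]]
    by (subst D_Phi) (auto simp: zero_prod_def intro: differentiable_const)
  have "D (\<lambda>v. ?P (pr e v)) 0 = (\<lambda>v. D ?P 0 (pr e v))"
    using eventually_nhds_x_imp_x[OF D_compose_germ[OF sP smooth_pr pr_0]]
    by (simp add: D_linear[OF bounded_linear_pr])
  then have "D h 0 = (\<lambda>v. emb e (D ?P 0 (pr e v)) + (v - emb e (pr e v)))"
    unfolding h_def
    by (intro D_eq has_derivative_add bounded_linear_imp_has_derivative[OF b]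
        bounded_linear.has_derivative[OF bounded_linear_emb[OF e]]) (use smooth_germ_has_derivative0[OF Pp] in simp)
  then have Dh: "D h 0 v = emb e (D ?P 0 (pr e v)) + (v - emb e (pr e v))" for v by simp
  have "v = 0" if "D h 0 v = 0" for v
  proof -
    have "pr e (D h 0 v) = D ?P 0 (pr e v)"
      by (simp add: Dh linear_add[OF linear_pr] linear_diff[OF linear_pr] pr_emb[OF e])
    then have "D ?P 0 (pr e v) = 0" using that by simp
    then have "pr e v = 0" using U(2) by (simp add: DP) (simp add: zero_prod_def prod_eq_iff)
    then show "v = 0" using that by (simp add: Dh DP emb_0[OF e] flip: zero_prod_def)
  qed
  then have "inj (D h 0)"
    using linear_injective_0 has_derivative_linear[OF smooth_germ_has_derivative0[OF sh]] by blast
  then have h: "dgerm h" using sh by (simp add: dgerm_def h_def emb_0[OF e])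
  have "\<forall>\<^sub>F v in nhds 0. U (pr e v) \<noteq> 0"
    by (rule smooth_germ_eventually[OF smooth_pr pr_0]) (rule tendsto_imp_eventually_ne[OF smooth_germ_tendsto[OF U(1)] U(2)])
  then have hU: "\<forall>\<^sub>F v in nhds 0. v \<in> U9 e \<longleftrightarrow> h v \<in> U9 e"
  proof eventually_elim
    case (elim v)
    have u: "w \<in> U9 e \<longleftrightarrow> w - emb e (pr e w) = 0 \<and> pr e w \<in> N9" for w
      unfolding U9_eq[OF e] by (auto simp: pr_emb[OF e])
    have "pr e (h v) = ?P (pr e v)" by (simp add: h_def linear_add[OF linear_pr] linear_diff[OF linear_pr] pr_emb[OF e])
    then show ?case unfolding u by (simp add: h_def Phi_N9_iff[of U, OF elim])
  qed
  have "\<forall>\<^sub>F v in nhds 0. v \<in> U9 e \<longleftrightarrow> g (h v) \<in> N"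
    using hU smooth_germ_eventually[OF dgermD(1,2)[OF h] g(2)] by eventually_elim simp
  moreover have "\<forall>\<^sub>F p in nhds 0. E (?P p) = g (h (emb e p))"
    using smooth_germ_eventually[OF sP Phi_0 g(3)] by (simp add: h_def pr_emb[OF e])
  ultimately show ?thesis unfolding par_def using dgerm_compose[OF g(1) h] by blast
qed

lemma branches_iff:
  fixes e :: "nat \<Rightarrow> 'n::finite"
  assumes e: "enum e"
  shows "branches e N f1 f2 \<longleftrightarrow>
    (\<exists>E. par e N E \<and> (\<forall>\<^sub>F t in nhds 0. f1 t = E (line t)) \<and> (\<forall>\<^sub>F t in nhds 0. f2 t = E (cusp t)))"
proof -
  have pt: "pt e [0, t, 0] = emb e (line t)" "pt e [t^5, - (t^7), t^3] = emb e (cusp t)" for t by (simp_all add: emb_def)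
  show ?thesis
  proof
    assume "branches e N f1 f2"
    then obtain g U where g: "diffeo_at0 g U" "germ_eq N (g ` (U9 e \<inter> U))"
      "\<forall>\<^sub>F t in nhds 0. f1 t = g (emb e (line t))" "\<forall>\<^sub>F t in nhds 0. f2 t = g (emb e (cusp t))"
      by (auto simp: branches_def pt)
    have "par e N (\<lambda>p. g (emb e p))" unfolding par_def
      by (intro exI[where x = g] conjI diffeo_dgerm(1)[OF g(1)] germ_image_iff[OF g(1), THEN iffD1, OF g(2)] always_eventually) simp
    then show "\<exists>E. par e N E \<and> (\<forall>\<^sub>F t in nhds 0. f1 t = E (line t)) \<and> (\<forall>\<^sub>F t in nhds 0. f2 t = E (cusp t))"
      using g(3,4) by (intro exI[where x = "\<lambda>p. g (emb e p)"] conjI)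
  next
    assume "\<exists>E. par e N E \<and> (\<forall>\<^sub>F t in nhds 0. f1 t = E (line t)) \<and> (\<forall>\<^sub>F t in nhds 0. f2 t = E (cusp t))"
    then obtain E where E: "par e N E" "\<forall>\<^sub>F t in nhds 0. f1 t = E (line t)" "\<forall>\<^sub>F t in nhds 0. f2 t = E (cusp t)"
      by (elim exE conjE)
    obtain g where g: "dgerm g" "\<forall>\<^sub>F x in nhds 0. x \<in> U9 e \<longleftrightarrow> g x \<in> N" "\<forall>\<^sub>F p in nhds 0. E p = g (emb e p)"
      using E(1) unfolding par_def by (elim exE conjE)
    obtain U where U: "diffeo_at0 g U" using dgerm_diffeo[OF g(1) open_UNIV UNIV_I] .
    have "\<forall>\<^sub>F t in nhds 0. f1 t = g (emb e (line t))" "\<forall>\<^sub>F t in nhds 0. f2 t = g (emb e (cusp t))"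
      using E(2) eventually_line[OF g(3)] E(3) eventually_cusp[OF g(3)] by (eventually_elim, simp)+
    then show "branches e N f1 f2" unfolding branches_def pt
      by (intro exI[where x = g] exI[where x = U] conjI U germ_image_iff[OF U, THEN iffD2, OF g(2)])
  qed
qed

section \<open>Symmetries of the germ\<close>

text \<open>The equations give 2 ord a = ord b + ord c and ord a + ord b = 4 ord c, hence 3 ord a =
  5 ord c. With ord c at least 3 and ord a at most 7 only 5 and 3 remain.\<close>

lemma fps_cusp_orders:
  fixes a b c :: "real fps"
  assumes eq: "a\<^sup>2 + b * c = 0" "a * b + c ^ 4 = 0" and a: "\<exists>i\<in>{3, 5, 7}. a $$ i \<noteq> 0" and c: "\<And>i. i < 3 \<Longrightarrow> c $$ i = 0"
  shows "subdegree a = 5 \<and> subdegree b = 7 \<and> subdegree c = 3"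
proof -
  have a0: "a \<noteq> 0" using a by auto
  then have b0: "b \<noteq> 0" and c0: "c \<noteq> 0" using eq(1) by auto
  have "a\<^sup>2 = - (b * c)" "a * b = - (c ^ 4)" using eq by (simp_all add: eq_neg_iff_add_eq_0)
  then have "subdegree (a\<^sup>2) = subdegree (b * c)" "subdegree (a * b) = subdegree (c ^ 4)" by (simp_all add: subdegree_uminus)
  then have e: "2 * subdegree a = subdegree b + subdegree c" "subdegree a + subdegree b = 4 * subdegree c"
    using a0 b0 c0 by (simp_all add: subdegree_mult subdegree_power)
  have "subdegree c \<ge> 3" using c c0 by (meson not_le nth_subdegree_nonzero)
  moreover have "subdegree a \<le> 7" using a by (auto dest!: subdegree_leI)
  moreover have "3 * subdegree a = 5 * subdegree c" using e by linarith
  ultimately have "subdegree a = 5 \<and> subdegree c = 3" by presburger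
  then show ?thesis using e by simp
qed

text \<open>Once the terms of order 0 and 3 are removed, the series starts at t^5, and t^5, t^6, t^7
  are the restrictions of x, z^2, -y; \<open>cubic_decomposition\<close> at 5 supplies their
  coefficients as functions of z.\<close>

lemma extend_from_cusp:
  assumes u: "smooth_germ u" and u1: "jet u $$ 1 = 0" and u2: "jet u $$ 2 = 0" and u4: "jet u $$ 4 = 0"
  obtains U where "smooth_germ U" "\<forall>\<^sub>F t in nhds 0. U (cusp t) = u t"
proof -
  define h where "h t = u t - u 0 - jet u $$ 3 * t ^ 3" for t
  have h: "smooth_germ h" unfolding h_def by (intro sg u)
  have h5: "jet h $$ j = 0" if "j < 5" for j
  proof -
    have "jet h = jet u - fps_const (u 0) - fps_const (jet u $$ 3) * fps_X ^ 3"
      unfolding h_def using u by (simp add: sg)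
    moreover have "j = 0 \<or> j = 1 \<or> j = 2 \<or> j = 3 \<or> j = 4" using that by linarith
    ultimately show ?thesis using u1 u2 u4 by (auto simp: fps_X_power_nth)
  qed
  obtain K0 K1 K2 where K: "smooth_germ K0" "smooth_germ K1" "smooth_germ K2"
    "\<forall>\<^sub>F t in nhds 0. h t = t ^ 5 * K0 (t ^ 3) + t ^ (5 + 1) * K1 (t ^ 3) + t ^ (5 + 2) * K2 (t ^ 3)"
    by (rule cubic_decomposition[OF h h5]) (assumption, rule that)
  define U where "U p = u 0 + jet u $$ 3 * Z p + X p * K0 (Z p) + Z p ^ 2 * K1 (Z p) - Y p * K2 (Z p)" for p :: R3
  have U: "smooth_germ U" unfolding U_def by (intro sg smooth_compose_Z K)
  have Uc: "\<forall>\<^sub>F t in nhds 0. U (cusp t) = u t"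
    using K(4) by eventually_elim (simp add: U_def h_def power_mult[symmetric])
  then show thesis using that[OF U] by simp
qed

text \<open>A symmetry of the germ of \<open>N9\<close> cannot exchange the branches; on the cusp its parameter is recovered
  without roots as \<open>z\<^sup>2/x\<close>.\<close>

theorem symmetry_form:
  fixes \<sigma> :: "R3 \<Rightarrow> R3"
  assumes \<sigma>: "smooth_germ \<sigma>" "\<sigma> 0 = 0" and inj: "inj (D \<sigma> 0)" and N: "\<forall>\<^sub>F p in nhds 0. p \<in> N9 \<longrightarrow> \<sigma> p \<in> N9"
  obtains U M where "smooth_germ U" "smooth_germ M" "\<forall>\<^sub>F p in nhds 0. p \<in> N9 \<longrightarrow> \<sigma> p = Phi U M p"
    "jc U $$ 0 \<noteq> 0" "jc U $$ 1 = 0" "jc U $$ 2 = 0" "jc U $$ 4 = 0"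
proof -
  define s1 where "s1 p = X (\<sigma> p)" for p
  define s2 where "s2 p = Y (\<sigma> p)" for p
  define s3 where "s3 p = Z (\<sigma> p)" for p
  have s: "smooth_germ s1" "smooth_germ s2" "smooth_germ s3"
    unfolding s1_def s2_def s3_def by (intro sg \<sigma>)+
  have s0: "s1 0 = 0" "s2 0 = 0" "s3 0 = 0" by (simp_all add: s1_def s2_def s3_def \<sigma>)
  have d: "(\<sigma> has_derivative D \<sigma> 0) (at 0)" by (rule smooth_germ_has_derivative0[OF \<sigma>(1)])
  have Ds: "D s1 0 v = X (D \<sigma> 0 v)" "D s2 0 v = Y (D \<sigma> 0 v)" "D s3 0 v = Z (D \<sigma> 0 v)" for v
    unfolding s1_def[abs_def] s2_def[abs_def] s3_def[abs_def]
    by (simp_all add: D_eq[OF has_derivative_fst[OF d]] D_eq[OF has_derivative_fst[OF has_derivative_snd[OF d]]]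
      D_eq[OF has_derivative_snd[OF has_derivative_snd[OF d]]])
  have lin: "linear (D \<sigma> 0)" by (rule has_derivative_linear[OF d])
  have surj: "surj (D \<sigma> 0)" by (rule linear_inj_imp_surj[OF lin inj])
  have Ns: "\<forall>\<^sub>F p in nhds 0. p \<in> N9 \<longrightarrow> (s1 p)\<^sup>2 + s2 p * s3 p = 0 \<and> s1 p * s2 p + s3 p ^ 4 = 0"
    using N by eventually_elim (auto simp: s1_def s2_def s3_def N9_def case_prod_beta)
  have c: "\<forall>\<^sub>F t in nhds 0. (s1 (cusp t))\<^sup>2 + s2 (cusp t) * s3 (cusp t) = 0 \<and> s1 (cusp t) * s2 (cusp t) + s3 (cusp t) ^ 4 = 0"
    using eventually_cusp[OF Ns] by eventually_elim (simp add: cusp_in_N9)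
  have l: "\<forall>\<^sub>F t in nhds 0. (s1 (line t))\<^sup>2 + s2 (line t) * s3 (line t) = 0 \<and> s1 (line t) * s2 (line t) + s3 (line t) ^ 4 = 0"
    using eventually_line[OF Ns] by eventually_elim (simp add: line_in_N9)
  note sc = smooth_on_cusp[OF s(1)] smooth_on_cusp[OF s(2)] smooth_on_cusp[OF s(3)]
  note sl = smooth_on_line[OF s(1)] smooth_on_line[OF s(2)] smooth_on_line[OF s(3)]
  have fc: "(jc s1)\<^sup>2 + jc s2 * jc s3 = 0" "jc s1 * jc s2 + jc s3 ^ 4 = 0"
  proof -
    have "jet (\<lambda>t. (s1 (cusp t))\<^sup>2 + s2 (cusp t) * s3 (cusp t)) = jet (\<lambda>t. 0)"
      "jet (\<lambda>t. s1 (cusp t) * s2 (cusp t) + s3 (cusp t) ^ 4) = jet (\<lambda>t. 0)"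
      by (rule jet_cong[OF eventually_mono[OF c]], simp)+
    then show "(jc s1)\<^sup>2 + jc s2 * jc s3 = 0" "jc s1 * jc s2 + jc s3 ^ 4 = 0" using sc by (simp_all add: sg)
  qed
  have fl: "(jl s1)\<^sup>2 + jl s2 * jl s3 = 0" "jl s1 * jl s2 + jl s3 ^ 4 = 0"
  proof -
    have "jet (\<lambda>t. (s1 (line t))\<^sup>2 + s2 (line t) * s3 (line t)) = jet (\<lambda>t. 0)"
      "jet (\<lambda>t. s1 (line t) * s2 (line t) + s3 (line t) ^ 4) = jet (\<lambda>t. 0)"
      by (rule jet_cong[OF eventually_mono[OF l]], simp)+
    then show "(jl s1)\<^sup>2 + jl s2 * jl s3 = 0" "jl s1 * jl s2 + jl s3 ^ 4 = 0" using sl by (simp_all add: sg)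
  qed
  note j1 = jets_on_N9[OF s(1)] and j2 = jets_on_N9[OF s(2)] and j3 = jets_on_N9[OF s(3)]
  have "\<exists>i\<in>{3, 5, 7}. jc s1 $$ i \<noteq> 0"
  proof (rule ccontr)
    assume "\<not> ?thesis"
    then have "D s1 0 e1 = 0" "D s1 0 e2 = 0" "D s1 0 e3 = 0" using j1 by auto
    then have "X (D \<sigma> 0 v) = 0" for v unfolding R3_linear[OF lin, of v] by (simp add: Ds)
    then show False using surj by (metis fst_conv surjD zero_neq_one)
  qed
  moreover have "jc s3 $$ i = 0" if "i < 3" for i
    using that j3(1,2) s0 by (auto simp: less_Suc_eq numeral_3_eq_3 numeral_2_eq_2)
  ultimately have ord: "subdegree (jc s1) = 5" "subdegree (jc s2) = 7" "subdegree (jc s3) = 3"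
    using fps_cusp_orders[OF fc] by blast+
  have nz: "jc s1 $$ 5 \<noteq> 0" "jc s3 $$ 3 \<noteq> 0" and z: "jc s1 $$ 3 = 0" "jc s2 $$ 3 = 0"
    using ord subdegree_0[where 'a = real] nth_subdegree_nonzero[of "jc s1"] nth_subdegree_nonzero[of "jc s3"]
      nth_less_subdegree_zero[of 3 "jc s1"] nth_less_subdegree_zero[of 3 "jc s2"]
    by (metis zero_neq_numeral, metis zero_neq_numeral, simp_all)
  \<comment> \<open>The coefficients of \<open>t ^ 2\<close> of both equations on the line constrain
    the image of \<open>e2\<close>. If its y-component vanished as well, \<open>e2\<close> and
    \<open>e3\<close> would both be mapped to the z-axis, against injectivity.\<close>
  have w: "D s1 0 e2 = 0" "D s3 0 e2 = 0" "D s2 0 e2 \<noteq> 0"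
  proof -
    have j: "jl f $$ 0 = 0" "jl f $$ 1 = D f 0 e2" if "smooth_germ f" "f 0 = 0" for f
      using jets_on_N9[OF that(1)] that(2) by auto
    note j = j[OF s(1) s0(1)] j[OF s(2) s0(2)] j[OF s(3) s0(3)]
    have e: "(D s1 0 e2)\<^sup>2 + D s2 0 e2 * D s3 0 e2 = 0" "D s1 0 e2 * D s2 0 e2 = 0"
      using arg_cong[OF fl(1), of "\<lambda>f. f $$ 2"] arg_cong[OF fl(2), of "\<lambda>f. f $$ 2"] j
      by (simp_all add: fps_mult_nth eval_nat_numeral fps_power_first)
    then show w1: "D s1 0 e2 = 0" by auto
    show w2: "D s2 0 e2 \<noteq> 0"
    proof
      assume "D s2 0 e2 = 0"
      then have "D \<sigma> 0 e2 = (0, 0, D s3 0 e2)" "D \<sigma> 0 e3 = (0, 0, D s3 0 e3)"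
        using w1 z j1 j2 by (simp_all add: prod_eq_iff Ds)
      then have "D \<sigma> 0 (D s3 0 e3 *\<^sub>R e2 - D s3 0 e2 *\<^sub>R e3) = 0"
        unfolding linear_diff[OF lin] linear_scale[OF lin] by (simp add: zero_prod_def mult.commute)
      then have "D s3 0 e3 *\<^sub>R e2 - D s3 0 e2 *\<^sub>R e3 = (0 :: R3)" using linear_injective_0[OF lin] inj by blast
      then have "D s3 0 e3 = 0" by (simp add: zero_prod_def)
      then show False using nz j3 by simp
    qed
    show "D s3 0 e2 = 0" using e w1 w2 by simp
  qed
  obtain g1 where g1: "smooth_germ g1" "\<forall>\<^sub>F t in nhds 0. s1 (cusp t) = t ^ 5 * g1 t"
    using jet_zero_divide[OF sc(1), of 5] ord nth_less_subdegree_zero[of _ "jc s1"] by auto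
  obtain g3 where g3: "smooth_germ g3" "\<forall>\<^sub>F t in nhds 0. s3 (cusp t) = t ^ 3 * g3 t"
    using jet_zero_divide[OF sc(3), of 3] ord nth_less_subdegree_zero[of _ "jc s3"] by auto
  have g0: "g1 0 \<noteq> 0" "g3 0 \<noteq> 0"
    using nz jet_cong[OF g1(2)] jet_cong[OF g3(2)] g1(1) g3(1) by (auto simp: sg fps_X_power_mult_nth)
  define u where "u t = (g3 t)\<^sup>2 / g1 t" for t
  have "smooth_germ (\<lambda>t. inverse (g1 t))"
    using smooth_germ_compose_on[OF smooth_on_inverse open_Compl[OF closed_singleton[of 0]] _ g1(1)] g0
    by auto
  then have u: "smooth_germ u" unfolding u_def divide_inverse by (intro sg g3)
  have u0: "u 0 \<noteq> 0" using g0 by (simp add: u_def)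
  have Nc: "\<forall>\<^sub>F t in nhds 0. \<sigma> (cusp t) \<in> N9" and Nl: "\<forall>\<^sub>F t in nhds 0. \<sigma> (line t) \<in> N9"
    using eventually_cusp[OF N] eventually_line[OF N] by (simp_all add: cusp_in_N9 line_in_N9)
  have \<sigma>c: "\<forall>\<^sub>F t in nhds 0. \<sigma> (cusp t) = cusp (t * u t)"
    using Nc g1(2) g3(2) tendsto_imp_eventually_ne[OF smooth_germ_tendsto[OF g1(1)] g0(1)]
      tendsto_imp_eventually_ne[OF smooth_germ_tendsto[OF g3(1)] g0(2)]
  proof eventually_elim
    case (elim t)
    show ?case
    proof (cases "t = 0")
      case True then show ?thesis using \<sigma>(2) by simp
    next
      case False
      show ?thesis using elim(1)
      proof (cases rule: N9_cases)
        case (1 r)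
        then have r: "r ^ 5 = t ^ 5 * g1 t" "r ^ 3 = t ^ 3 * g3 t" using elim(2,3) by (simp_all add: s1_def s3_def)
        have "r * (t ^ 5 * g1 t) = (t ^ 3 * g3 t)\<^sup>2" unfolding r[symmetric] by (simp add: eval_nat_numeral)
        then have "r = t * u t" using False elim(4) by (simp add: u_def field_simps eval_nat_numeral)
        then show ?thesis using 1 by simp
      next
        case (2 r)
        then show ?thesis using elim(3,5) False by (simp add: s3_def)
      qed
    qed
  qed
  have js: "jc s1 = fps_X ^ 5 * jet u ^ 5" "jc s2 = - (fps_X ^ 7 * jet u ^ 7)" "jc s3 = fps_X ^ 3 * jet u ^ 3"
  proof -
    have "jc s1 = jet (\<lambda>t. t ^ 5 * u t ^ 5)" "jc s2 = jet (\<lambda>t. - (t ^ 7 * u t ^ 7))" "jc s3 = jet (\<lambda>t. t ^ 3 * u t ^ 3)"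
      by (rule jet_cong[OF eventually_mono[OF \<sigma>c]], simp add: s1_def s2_def s3_def power_mult_distrib)+
    then show "jc s1 = fps_X ^ 5 * jet u ^ 5" "jc s2 = - (fps_X ^ 7 * jet u ^ 7)" "jc s3 = fps_X ^ 3 * jet u ^ 3"
      using u by (simp_all add: sg)
  qed
  \<comment> \<open>The coefficients \<open>u_1\<close>, \<open>u_2\<close>, \<open>u_4\<close> are
    read off from t^4 in the third component, a gap, and from t^7 in the first and third components,
    which vanish because the line stays tangent to the y-axis.\<close>
  have u1: "jet u $$ 1 = 0"
  proof -
    have "(jet u ^ 3) $$ 1 = 0" using j3(3) unfolding js by (simp add: fps_X_power_mult_nth)
    then show ?thesis using u0 by (simp add: fps_mult_nth eval_nat_numeral)
  qed
  have u2: "jet u $$ 2 = 0"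
  proof -
    have "(jet u ^ 5) $$ 2 = 0" using w(1) j1 unfolding js by (simp add: fps_X_power_mult_nth)
    then show ?thesis using u0 u1 by (simp add: fps_mult_nth eval_nat_numeral)
  qed
  have u4: "jet u $$ 4 = 0"
  proof -
    have "(jet u ^ 3) $$ 4 = 0" using w(2) j3 unfolding js by (simp add: fps_X_power_mult_nth)
    then show ?thesis using u0 u1 u2 by (simp add: fps_mult_nth eval_nat_numeral)
  qed
  obtain U where U: "smooth_germ U" and Uc: "\<forall>\<^sub>F t in nhds 0. U (cusp t) = u t"
    by (rule extend_from_cusp[OF u u1 u2 u4]) (rule that)
  note jU = jet_cong[OF Uc]
  have Ul: "jl (\<lambda>p. U p) $$ 0 = u 0" using eventually_nhds_x_imp_x[OF Uc] by simp
  define q where "q t = s2 (line t) - t * U (line t) ^ 7" for t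
  have q: "smooth_germ q" unfolding q_def by (intro sg sl smooth_on_line[OF U])
  have jq: "jet q = jl s2 - fps_X * jl U ^ 7" unfolding q_def using sl smooth_on_line[OF U] by (simp add: sg)
  have "D s2 0 e2 = u 0 ^ 7" using j2(6) unfolding js by (simp add: fps_X_power_mult_nth fps_nth_power_0)
  then have "jet q $$ j = 0" if "j < 2" for j
    using that j2 s0 Ul unfolding jq by (auto simp: less_2_cases_iff fps_nth_power_0)
  then obtain m where m: "smooth_germ m" "\<forall>\<^sub>F t in nhds 0. q t = t ^ 2 * m t"
    using jet_zero_divide[OF q, of 2] by blast
  define M where "M p = m (Y p)" for p :: R3
  have M: "smooth_germ M" unfolding M_def by (intro smooth_compose_Y m)
  obtain k2 where k2: "smooth_germ k2" "\<forall>\<^sub>F t in nhds 0. s2 (line t) = t ^ 1 * k2 t"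
    using jet_zero_divide[OF sl(2), of 1] s0 by auto
  obtain k3 where k3: "smooth_germ k3" "\<forall>\<^sub>F t in nhds 0. s3 (line t) = t ^ 1 * k3 t"
    using jet_zero_divide[OF sl(3), of 1] s0 by auto
  have k: "k2 0 = D s2 0 e2" "k3 0 = 0"
  proof -
    have "jl s2 $$ 1 = k2 0" "jl s3 $$ 1 = k3 0"
      using jet_cong[OF k2(2)] jet_cong[OF k3(2)] k2(1) k3(1) by (simp_all add: sg)
    then show "k2 0 = D s2 0 e2" "k3 0 = 0" using j2 j3 w by auto
  qed
  \<comment> \<open>This separates the branches: the image of the line has
    \<open>\<bar>z\<bar> < \<bar>y\<bar>\<close> off 0, while on the cusp near 0 one has
    \<open>\<bar>y\<bar> = \<bar>r\<bar> ^ 7 \<le> \<bar>r\<bar> ^ 3 =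
    \<bar>z\<bar>\<close>.\<close>
  have lt: "\<forall>\<^sub>F t in nhds 0. \<bar>k3 t\<bar> < \<bar>k2 t\<bar>"
  proof -
    have "((\<lambda>t. \<bar>k2 t\<bar> - \<bar>k3 t\<bar>) \<longlongrightarrow> \<bar>k2 0\<bar> - \<bar>k3 0\<bar>) (nhds 0)"
      by (intro tendsto_intros smooth_germ_tendsto k2 k3)
    from order_tendstoD(1)[OF this, of 0] show ?thesis using k w by simp
  qed
  have "\<forall>\<^sub>F t in nhds 0. \<bar>s3 (line t)\<bar> < 1"
    using order_tendstoD(2)[OF tendsto_rabs[OF smooth_germ_tendsto[OF sl(3)]], of 1] s0 by simp
  from Nl k2(2) k3(2) lt this have \<sigma>l: "\<forall>\<^sub>F t in nhds 0. \<sigma> (line t) = line (s2 (line t))"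
  proof eventually_elim
    case (elim t)
    show ?case using elim(1)
    proof (cases rule: N9_cases)
      case (1 r)
      show ?thesis
      proof (cases "t = 0")
        case True then show ?thesis using \<sigma>(2) s0 by simp
      next
        case False
        have r: "\<bar>s2 (line t)\<bar> = \<bar>r\<bar> ^ 7" "\<bar>s3 (line t)\<bar> = \<bar>r\<bar> ^ 3" using 1 by (simp_all add: s2_def s3_def power_abs)
        then have "\<bar>r\<bar> ^ 3 < 1 ^ 3" using elim(5) by simp
        then have "\<bar>r\<bar> < 1" by (rule power_less_imp_less_base) simp
        then have "\<bar>r\<bar> ^ 7 \<le> \<bar>r\<bar> ^ 3" by (intro power_decreasing) auto
        then have "\<bar>t\<bar> * \<bar>k2 t\<bar> \<le> \<bar>t\<bar> * \<bar>k3 t\<bar>" using elim(2,3) r by (simp add: abs_mult)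
        then show ?thesis using elim(4) False by simp
      qed
    next
      case (2 r) then show ?thesis by (simp add: s2_def)
    qed
  qed
  have "\<forall>\<^sub>F p in nhds 0. p \<in> N9 \<longrightarrow> \<sigma> p = Phi U M p"
  proof (rule eventually_N9)
    show "\<forall>\<^sub>F t in nhds 0. \<sigma> (cusp t) = Phi U M (cusp t)" using \<sigma>c Uc by eventually_elim (simp add: Phi_cusp)
    show "\<forall>\<^sub>F t in nhds 0. \<sigma> (line t) = Phi U M (line t)"
      using \<sigma>l m(2) by eventually_elim (simp add: Phi_line q_def M_def algebra_simps)
  qed
  then show thesis using that[OF U M] u0 u1 u2 u4 jU by simp
qed

text \<open>Transported to the model by the two parametrizations, the equivalence becomes a germ
  \<open>S\<close> preserving \<open>U9\<close>. Its three-dimensional part is a symmetry of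
  \<open>N9\<close>, so both branches are merely reparametrized and the invariants change by
  \<open>act\<close>.\<close>

theorem symp_equiv_form:
  fixes e :: "nat \<Rightarrow> 'n::finite"
  assumes e: "enum e" and N: "par e N E" and M: "par e M E'" and NM: "symp_equiv N M"
  obtains g U M where "sgerm g" "smooth_germ U" "smooth_germ M"
    "\<forall>\<^sub>F p in nhds 0. p \<in> N9 \<longrightarrow> g (E p) = E' (Phi U M p)"
    "jc U $$ 0 \<noteq> 0" "jc U $$ 1 = 0" "jc U $$ 2 = 0" "jc U $$ 4 = 0"
    "\<And>w. ell (pull E lam) w = act (ell (pull E' lam)) (jc U) (M 0) w"
proof -
  obtain g0 where g0: "dgerm g0" "\<forall>\<^sub>F x in nhds 0. x \<in> U9 e \<longleftrightarrow> g0 x \<in> N" "\<forall>\<^sub>F p in nhds 0. E p = g0 (emb e p)"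
    using N by (auto simp: par_def)
  obtain g1 where g1: "dgerm g1" "\<forall>\<^sub>F x in nhds 0. x \<in> U9 e \<longleftrightarrow> g1 x \<in> M" "\<forall>\<^sub>F p in nhds 0. E' p = g1 (emb e p)"
    using M by (auto simp: par_def)
  obtain g where g: "sgerm g" "\<forall>\<^sub>F x in nhds 0. x \<in> N \<longleftrightarrow> g x \<in> M" using NM symp_equiv_iff by blast
  then have dg: "dgerm g" by (simp add: sgerm_def)
  obtain h where h: "dgerm h" "\<forall>\<^sub>F x in nhds 0. h (g1 x) = x" "\<forall>\<^sub>F y in nhds 0. g1 (h y) = y" using dgerm_inverse[OF g1(1)] .
  define S where "S x = h (g (g0 x))" for x
  have gg0: "dgerm (\<lambda>x. g (g0 x))" by (rule dgerm_compose[OF dg g0(1)])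
  have S: "dgerm S" unfolding S_def by (rule dgerm_compose[OF h(1) gg0])
  note ev = smooth_germ_eventually[OF dgermD(1) dgermD(2)]
  have g1S: "\<forall>\<^sub>F x in nhds 0. g1 (S x) = g (g0 x)" using ev[OF gg0 gg0 h(3)] by (simp add: S_def)
  have SU: "\<forall>\<^sub>F x in nhds 0. x \<in> U9 e \<longrightarrow> S x \<in> U9 e"
    using g0(2) ev[OF g0(1) g0(1) g(2)] ev[OF S S g1(2)] g1S by eventually_elim simp
  define \<sigma> where "\<sigma> p = pr e (S (emb e p))" for p
  note si = smooth_emb[OF e] and i0 = emb_0[OF e]
  have Si: "smooth_germ (\<lambda>p. S (emb e p))" by (rule smooth_germ_compose[OF dgermD(1)[OF S] si i0])
  have S0: "S 0 = 0" by (rule dgermD(2)[OF S])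
  have s\<sigma>: "smooth_germ \<sigma>" unfolding \<sigma>_def by (rule smooth_germ_linear[OF bounded_linear_pr Si])
  have \<sigma>0: "\<sigma> 0 = 0" by (simp add: \<sigma>_def i0 S0)
  have \<sigma>N: "\<forall>\<^sub>F p in nhds 0. p \<in> N9 \<longrightarrow> \<sigma> p \<in> N9 \<and> S (emb e p) = emb e (\<sigma> p)"
    using smooth_germ_eventually[OF si i0 SU] by eventually_elim (auto simp: U9_eq[OF e] \<sigma>_def pr_emb[OF e] image_iff)
  define F where "F p = S (emb e p) - emb e (\<sigma> p)" for p
  have sF: "smooth_germ F" unfolding F_def by (intro smooth_germ_diff Si smooth_germ_linear[OF bounded_linear_emb[OF e] s\<sigma>])
  have DS: "D (\<lambda>p. S (emb e p)) 0 v = D S 0 (emb e v)" for v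
    using eventually_nhds_x_imp_x[OF D_compose_germ[OF dgermD(1)[OF S] si i0]] by (simp add: i0 D_linear[OF bounded_linear_emb[OF e]])
  have DF: "D F 0 = (\<lambda>v. D S 0 (emb e v) - emb e (D \<sigma> 0 v))"
    unfolding F_def DS[symmetric]
    by (intro D_eq has_derivative_diff bounded_linear.has_derivative[OF bounded_linear_emb[OF e]] smooth_germ_has_derivative0 Si s\<sigma>)
  \<comment> \<open>\<open>S\<close> need not preserve the embedded three-space, but
    \<open>F\<close> vanishes on the cusp, whose coefficients of t^3, t^5, t^7 determine the
    derivative at 0. So \<open>D S 0\<close> preserves the three-space and \<open>\<sigma>\<close>
    inherits injectivity.\<close>
  have "D F 0 v = 0" for v
  proof (rule euclidean_eqI)
    fix b :: "'n symp" assume "b \<in> Basis"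
    define f where "f p = F p \<bullet> b" for p
    have f: "smooth_germ f" unfolding f_def by (intro sg sF)
    have Df: "D f 0 = (\<lambda>v. D F 0 v \<bullet> b)"
      unfolding f_def by (intro D_eq has_derivative_inner_left smooth_germ_has_derivative0 sF)
    have "jc f = jet (\<lambda>t. 0)"
      by (rule jet_cong[OF eventually_mono[OF eventually_cusp[OF \<sigma>N]]]) (simp add: f_def F_def cusp_in_N9)
    then have "D f 0 e1 = 0" "D f 0 e2 = 0" "D f 0 e3 = 0" using jets_on_N9[OF f] by simp_all
    then have "D f 0 v = 0"
      using R3_linear[OF has_derivative_linear[OF smooth_germ_has_derivative0[OF f]], of v] by simp
    then show "D F 0 v \<bullet> b = 0 \<bullet> b" by (simp add: Df)
  qed
  then have "inj (\<lambda>v. emb e (D \<sigma> 0 v))"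
    using inj_compose[OF dgermD(3)[OF S] inj_emb[OF e]] by (simp add: DF comp_def)
  then have inj: "inj (D \<sigma> 0)" by (rule inj_on_imageI2[unfolded comp_def])
  have \<sigma>N9: "\<forall>\<^sub>F p in nhds 0. p \<in> N9 \<longrightarrow> \<sigma> p \<in> N9" using \<sigma>N by eventually_elim simp
  obtain U M where UM: "smooth_germ U" "smooth_germ M" "\<forall>\<^sub>F p in nhds 0. p \<in> N9 \<longrightarrow> \<sigma> p = Phi U M p"
    "jc U $$ 0 \<noteq> 0" "jc U $$ 1 = 0" "jc U $$ 2 = 0" "jc U $$ 4 = 0"
    by (rule symmetry_form[OF s\<sigma> \<sigma>0 inj \<sigma>N9]) (rule that)
  have gE: "\<forall>\<^sub>F p in nhds 0. p \<in> N9 \<longrightarrow> g (E p) = E' (\<sigma> p)"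
    using g0(3) smooth_germ_eventually[OF s\<sigma> \<sigma>0 g1(3)] smooth_germ_eventually[OF si i0 g1S] \<sigma>N
    by eventually_elim metis
  note sE = par_smooth[OF e N] par_0[OF e N] and sE' = par_smooth[OF e M] par_0[OF e M]
  have "ell (pull E lam) w = act (ell (pull E' lam)) (jc U) (M 0) w" for w
  proof -
    have "ell (pull E lam) w = ell (pull (\<lambda>p. g (E p)) lam) w" by (rule ell_symplectic[OF g(1) sE, symmetric])
    also have "\<dots> = ell (pull (\<lambda>p. E' (\<sigma> p)) lam) w"
      by (rule ell_pull_agree[OF smooth_form_lam smooth_germ_compose[OF dgermD(1)[OF dg] sE] _ smooth_germ_compose[OF sE'(1) s\<sigma> \<sigma>0] _ gE])
        (simp_all add: sE sE' \<sigma>0 dgermD(2)[OF dg])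
    also have "\<dots> = ell (pull \<sigma> (pull E' lam)) w"
    proof -
      have "\<forall>\<^sub>F p in nhds 0. \<forall>v. pull (\<lambda>p. E' (\<sigma> p)) lam p v = pull \<sigma> (pull E' lam) p v"
        using D_compose_germ[OF sE'(1) s\<sigma> \<sigma>0] by eventually_elim (simp add: pull_def)
      then show ?thesis by (simp only: ell_cong_germ)
    qed
    also have "\<dots> = act (ell (pull E' lam)) (jc U) (M 0) w"
      by (rule ell_pull[OF smooth_form_pull_lam[OF sE'(1)] s\<sigma> \<sigma>0 UM(1-3)])
    finally show ?thesis .
  qed
  moreover have "\<forall>\<^sub>F p in nhds 0. p \<in> N9 \<longrightarrow> g (E p) = E' (Phi U M p)"
    using gE UM(3) by eventually_elim simp
  ultimately show thesis using that[OF g(1) UM(1,2)] UM(4-7) by blast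
qed

section \<open>Normal forms of the invariants\<close>

text \<open>The numbers \<open>- w v\<^sub>w\<close> for the invariant vector \<open>v\<close> of a normal form.\<close>

fun co :: "U9_family \<Rightarrow> real \<Rightarrow> R3 \<Rightarrow> nat \<Rightarrow> real" where
  "co U9_0 s (c1, c2, c3) w = (if w = 8 then s else if w = 10 then c1 else if w = 12 then - c2 else 0)"
| "co U9_1 s (c1, c2, c3) w = (if w = 10 then s else if w = 12 then - c1 else if w = 11 then c2 else if w = 14 then s * c3 else 0)"
| "co U9_2 s (c1, c2, c3) w = (if w = 12 then - s else if w = 11 then c1 else if w = 13 then c2 else 0)"
| "co U9_30 s (c1, c2, c3) w = (if w = 12 then - s else if w = 13 then c1 else if w = 14 then c2 else 0)"
| "co U9_40 s (c1, c2, c3) w = (if w = 12 then - s else if w = 14 then c1 else if w = 16 then c2 else 0)"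
| "co U9_31 s (c1, c2, c3) w = (if w = 11 then s else if w = 13 then c1 else 0)"
| "co U9_41 s (c1, c2, c3) w = (if w = 13 then s else if w = 14 then c1 else if w = 17 then c2 else 0)"
| "co U9_5 s (c1, c2, c3) w = (if w = 14 then s else if w = 16 then c1 else 0)"
| "co U9_6 s (c1, c2, c3) w = (if w = 16 then s else if w = 17 then c1 else 0)"
| "co U9_7 s (c1, c2, c3) w = (if w = 17 then s else if w = 19 then c1 else 0)"
| "co U9_8 s (c1, c2, c3) w = (if w = 19 then s else 0)"
| "co U9_9 s (c1, c2, c3) w = 0"

definition vec :: "U9_family \<Rightarrow> real \<Rightarrow> R3 \<Rightarrow> nat \<Rightarrow> real" where
  "vec k s c w = - co k s c w / real w"

text \<open>The weights 8, 10, 12 are tested first, out of numerical order, since they are the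
  symplectic form on the tangent space; in each branch the invariants already known to vanish make
  the next test invariant.\<close>

definition cls :: "(nat \<Rightarrow> real) \<Rightarrow> U9_family" where
  "cls v = (if v 8 \<noteq> 0 then U9_0 else if v 10 \<noteq> 0 then U9_1
    else if v 12 \<noteq> 0 then (if v 11 \<noteq> 0 then U9_2 else if v 13 \<noteq> 0 then U9_30 else U9_40)
    else if v 11 \<noteq> 0 then U9_31 else if v 13 \<noteq> 0 then U9_41 else if v 14 \<noteq> 0 then U9_5
    else if v 16 \<noteq> 0 then U9_6 else if v 17 \<noteq> 0 then U9_7 else if v 19 \<noteq> 0 then U9_8 else U9_9)"

text \<open>By \<open>jets_on_N9\<close> and \<open>extend_from_cusp\<close> these are the Taylor
  series on the cusp of functions not vanishing at 0.\<close>

definition jet_ok :: "real fps \<Rightarrow> bool" where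
  "jet_ok u \<longleftrightarrow> u $$ 0 \<noteq> 0 \<and> u $$ 1 = 0 \<and> u $$ 2 = 0 \<and> u $$ 4 = 0"

lemma jet_ok_power:
  assumes "jet_ok u"
  shows "(u ^ n) $$ Suc 0 = 0" "(u ^ n) $$ 2 = 0" "(u ^ n) $$ 4 = 0" "(u ^ n) $$ 3 = real n * (u $$ 0) ^ (n - 1) * u $$ 3"
proof -
  have "(u ^ n) $$ 1 = 0 \<and> (u ^ n) $$ 2 = 0 \<and> (u ^ n) $$ 4 = 0 \<and> (u ^ n) $$ 3 = real n * (u $$ 0) ^ (n - 1) * u $$ 3"
  proof (induction n)
    case (Suc n)
    have "(u ^ n) $$ 0 = (u $$ 0) ^ n" by (simp add: fps_nth_power_0)
    moreover have "real n * (u $$ 0) ^ (n - 1) * u $$ 0 = real n * (u $$ 0) ^ n" by (cases n) auto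
    ultimately show ?case using Suc assms
      by (simp add: fps_mult_nth eval_nat_numeral jet_ok_def algebra_simps) blast
  qed (simp add: fps_mult_nth eval_nat_numeral)
  then show "(u ^ n) $$ Suc 0 = 0" "(u ^ n) $$ 2 = 0" "(u ^ n) $$ 4 = 0" "(u ^ n) $$ 3 = real n * (u $$ 0) ^ (n - 1) * u $$ 3"
    by simp_all
qed

lemma act_eqs:
  assumes "jet_ok u"
  shows "act v u m 8 = v 8 * (u $$ 0) ^ 8" "act v u m 10 = v 10 * (u $$ 0) ^ 10"
    "act v u m 11 = v 8 * (u ^ 8) $$ 3 + v 11 * (u $$ 0) ^ 11" "act v u m 12 = v 12 * (u $$ 0) ^ 12"
    "act v u m 13 = v 8 * (u ^ 8) $$ 5 + v 13 * (u $$ 0) ^ 13 - 2 * v 10 * (u ^ 10) $$ 3"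
    "act v u m 14 = v 8 * (u ^ 8) $$ 6 + v 11 * (u ^ 11) $$ 3 + v 14 * (u $$ 0) ^ 14"
    "act v u m 16 = v 8 * (u ^ 8) $$ 8 + v 11 * (u ^ 11) $$ 5 + v 13 * (u ^ 13) $$ 3 + v 16 * (u $$ 0) ^ 16 - 2 * v 10 * (u ^ 10) $$ 6"
    "act v u m 17 = v 8 * (u ^ 8) $$ 9 + v 11 * (u ^ 11) $$ 6 + v 14 * (u ^ 14) $$ 3 + v 17 * (u $$ 0) ^ 17
      + 8 * v 10 * (u ^ 10) $$ 7 + 4 * v 12 * (u ^ 12) $$ 5 - 10 * v 10 * m * (u $$ 0) ^ 3"
    "act v u m 19 = v 8 * (u ^ 8) $$ 11 + v 11 * (u ^ 11) $$ 8 + v 13 * (u ^ 13) $$ 6 + v 14 * (u ^ 14) $$ 5 + v 16 * (u ^ 16) $$ 3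
      + v 19 * (u $$ 0) ^ 19 - 2 * v 10 * (u ^ 10) $$ 9 - 8 * v 12 * (u ^ 12) $$ 7 + 12 * v 12 * m * (u $$ 0) ^ 5"
  using jet_ok_power[OF assms] by (simp_all add: act_def fps_X_power_mult_nth fps_nth_power_0)

text \<open>Each tested invariant is multiplied by a power of \<open>u $$ 0\<close>: of the earlier
  ones those that are nonzero could enter only through the coefficients of index 1, 2, 4 of powers
  of \<open>u\<close>, which vanish.\<close>

lemma cls_act: assumes "jet_ok u" shows "cls (act v u m) = cls v"
  using assms unfolding cls_def act_eqs[OF assms] jet_ok_def by (simp add: jet_ok_power[OF assms])

lemma cls_vec: "s \<in> signs k \<Longrightarrow> c \<in> params k \<Longrightarrow> cls (vec k s c) = k"
  by (cases c; cases k) (auto simp: cls_def vec_def)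

text \<open>Once \<open>u $$ 0\<close> is 1 or -1, the zero entries of the normal form force
  \<open>u $$ 3 = 0\<close> where that coefficient could mix with a parameter. What is left are the
  signs coming from odd weights.\<close>

lemma vec_rigid:
  assumes k: "s \<in> signs k" "c \<in> params k" "c' \<in> params k" and u: "jet_ok u"
    and eq: "\<And>w. w \<in> wts \<Longrightarrow> vec k s c' w = act (vec k s c) u m w"
  shows "c' \<in> {X c, - X c} \<times> {Y c, - Y c} \<times> {Z c, - Z c}"
proof -
  have e: "vec k s c' 8 = act (vec k s c) u m 8" "vec k s c' 10 = act (vec k s c) u m 10"
    "vec k s c' 11 = act (vec k s c) u m 11" "vec k s c' 12 = act (vec k s c) u m 12"
    "vec k s c' 13 = act (vec k s c) u m 13" "vec k s c' 14 = act (vec k s c) u m 14"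
    "vec k s c' 16 = act (vec k s c) u m 16" "vec k s c' 17 = act (vec k s c) u m 17"
    "vec k s c' 19 = act (vec k s c) u m 19"
    by (simp_all add: eq)
  note e = e[unfolded act_eqs[OF u] vec_def jet_ok_power[OF u]]
  have s: "s = 1 \<or> s = -1" using k(1) by (cases k) auto
  obtain c1 c2 c3 d1 d2 d3 where c: "c = (c1, c2, c3)" "c' = (d1, d2, d3)" by (metis prod_cases3)
  have u0: "u $$ 0 \<noteq> 0" using u by (simp add: jet_ok_def)
  \<comment> \<open>Each of these families has an entry that is nonzero and independent of the
    parameters; it is multiplied by a power of \<open>u $$ 0\<close>, which is therefore a real root
    of unity.\<close>
  have "\<exists>q>0. (u $$ 0) ^ q = 1" if "k \<noteq> U9_9"
  proof (cases k)
    case U9_0 then show ?thesis using e(1) s by (intro exI[of _ 8]) (auto simp: c)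
  next
    case U9_1 then show ?thesis using e(2) s by (intro exI[of _ 10]) (auto simp: c)
  next
    case U9_2 then show ?thesis using e(4) s by (intro exI[of _ 12]) (auto simp: c)
  next
    case U9_30 then show ?thesis using e(4) s by (intro exI[of _ 12]) (auto simp: c)
  next
    case U9_40 then show ?thesis using e(4) s by (intro exI[of _ 12]) (auto simp: c)
  next
    case U9_31 then show ?thesis using e(3) s by (intro exI[of _ 11]) (auto simp: c)
  next
    case U9_41 then show ?thesis using e(5) s by (intro exI[of _ 13]) (auto simp: c)
  next
    case U9_5 then show ?thesis using e(6) s by (intro exI[of _ 14]) (auto simp: c)
  next
    case U9_6 then show ?thesis using e(7) s by (intro exI[of _ 16]) (auto simp: c)
  next
    case U9_7 then show ?thesis using e(8) s by (intro exI[of _ 17]) (auto simp: c)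
  next
    case U9_8 then show ?thesis using e(9) s by (intro exI[of _ 19]) (auto simp: c)
  qed (use that in simp)
  then have r: "u $$ 0 = 1 \<or> u $$ 0 = -1" if "k \<noteq> U9_9"
    using that power_eq_1_iff[of "u $$ 0"] by fastforce
  show ?thesis
  proof (cases "k = U9_9")
    case True then show ?thesis using k by (simp add: c)
  next
    case False
    from r[OF this] show ?thesis using False s e k by (elim disjE; cases k) (simp_all add: c)
  qed
qed

section \<open>Elimination of invariants\<close>

lemma binomial_fps_nth:
  "((1 + fps_const a * fps_X ^ j) ^ n) $$ m = (if j dvd m then real (n choose (m div j)) * a ^ (m div j) else 0)"
  if "j > 0" for a :: real
proof -
  have "(1 + fps_const a * fps_X ^ j) ^ n = (1 + fps_const a * fps_X :: real fps) ^ n oo fps_X ^ j"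
    using that by (simp add: fps_compose_power[symmetric] fps_compose_add_distrib fps_compose_mult_distrib)
  moreover have "((1 + fps_const a * fps_X) ^ n) $$ i = real (n choose i) * a ^ i" for i
  proof -
    have "(1 + fps_const a * fps_X) ^ n = (\<Sum>k\<le>n. of_nat (n choose k) * (fps_const a * fps_X) ^ k :: real fps)"
      by (simp add: add.commute[of 1] binomial_ring)
    also have "\<dots> $$ i = (\<Sum>k\<le>n. if k = i then real (n choose k) * a ^ k else 0)"
      unfolding fps_sum_nth
      by (intro sum.cong refl) (simp add: power_mult_distrib fps_X_power_nth fps_const_power fps_of_nat[symmetric] mult.assoc[symmetric] del: fps_of_nat)
    finally show ?thesis by (auto simp: binomial_eq_0)
  qed
  ultimately show ?thesis using that by (simp add: fps_compose_X_power_nth)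
qed

text \<open>For these pairs \<open>(p, j)\<close> the substitution \<open>u = 1 + a t\<^sup>j\<close> adds a nonzero multiple of \<open>a v\<^sub>p\<close> to the invariant of
  weight \<open>p + j\<close>.\<close>

definition shifts :: "(nat \<times> nat) set" where
  "shifts = {(8, 3), (8, 5), (8, 6), (8, 8), (8, 9), (8, 11), (10, 3), (10, 6), (10, 7), (10, 9), (11, 3), (11, 5),
      (11, 6), (11, 8), (13, 3), (12, 5), (12, 7), (13, 6), (14, 3), (14, 5), (16, 3)}"

text \<open>The exception for weight 12 is harmless: it enters weights 17 and 19 through the
  coefficients of t^5 and t^7, which are zero for powers of 1 + a t^3.\<close>

definition killable :: "nat \<Rightarrow> nat \<Rightarrow> (nat \<Rightarrow> real) \<Rightarrow> bool" where
  "killable p j v \<longleftrightarrow> (p, j) \<in> shifts \<and> v p \<noteq> 0 \<and> (\<forall>i\<in>wts. i < p \<longrightarrow> v i = 0 \<or> i = 12 \<and> j = 3)"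

lemma shifts_wts: assumes "(p, j) \<in> shifts" shows "p \<in> wts" "p + j \<in> wts" "j > 2" "j \<noteq> 4"
  using assms unfolding shifts_def insert_iff empty_iff prod.inject simp_thms by (elim disjE conjE; simp)+

lemma kill:
  assumes "killable p j v"
  obtains u where "jet_ok u" "act v u 0 (p + j) = 0" "\<And>i. i \<in> wts \<Longrightarrow> i < p + j \<Longrightarrow> act v u 0 i = v i"
proof -
  \<comment> \<open>\<open>a\<close> solves the linear equation in weight \<open>p + j\<close>. Its
    coefficient is \<open>p\<close> for the multiples of \<open>tau8\<close>; it is -2 * 10 or 8 *
    10 for \<open>tau10\<close> and 4 * 12 or -8 * 12 for \<open>tau12\<close>.\<close>
  define a where "a = - v (p + j) / (v p * (if p = 10 then if j = 7 then 80 else -20 else if p = 12 then if j = 5 then 48 else -96 else real p))"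
  define u where "u = 1 + fps_const a * fps_X ^ j"
  have pj: "(p, j) \<in> shifts" and v: "v p \<noteq> 0" "\<forall>i\<in>wts. i < p \<longrightarrow> v i = 0 \<or> i = 12 \<and> j = 3"
    using assms by (auto simp only: killable_def)
  note j = shifts_wts(3,4)[OF pj]
  have ok: "jet_ok u" unfolding jet_ok_def using j binomial_fps_nth[of j a 1] by (auto simp: u_def)
  have un: "(u ^ n) $$ m = (if j dvd m then real (n choose (m div j)) * a ^ (m div j) else 0)" for n m
    unfolding u_def using j binomial_fps_nth[of j] by simp
  have u0: "u $$ 0 = 1" using j by (simp add: u_def)
  have "act v u 0 (p + j) = 0 \<and> (\<forall>i\<in>wts. i < p + j \<longrightarrow> act v u 0 i = v i)"
    using pj unfolding shifts_def insert_iff empty_iff prod.inject simp_thms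
    by (elim disjE conjE) (use v in \<open>simp_all add: act_eqs[OF ok] un u0 a_def\<close>)
  then show thesis using that[OF ok] by blast
qed

text \<open>Sources are at most \<open>b\<close>, targets exceed \<open>b\<close> and increase.
  Every substitution fixes the weights below its target, thus all sources and all weights cleared
  before.\<close>

lemma kills:
  assumes closed: "\<And>v u. R v \<Longrightarrow> jet_ok u \<Longrightarrow> R (act v u 0)" and "R v"
    and "\<forall>(p, j)\<in>set ps. killable p j v \<and> p \<le> b \<and> b < p + j" "sorted_wrt (<) (map (\<lambda>(p, j). p + j) ps)"
  shows "\<exists>v'. R v' \<and> (\<forall>i\<in>wts. i \<le> b \<longrightarrow> v' i = v i) \<and> (\<forall>(p, j)\<in>set ps. v' (p + j) = 0)"
  using assms(3,4)
proof (induction ps rule: rev_induct)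
  case Nil then show ?case using assms(2) by auto
next
  case (snoc x ps)
  obtain p j where x: "x = (p, j)" by (cases x)
  obtain v' where v': "R v'" "\<forall>i\<in>wts. i \<le> b \<longrightarrow> v' i = v i" "\<forall>(p, j)\<in>set ps. v' (p + j) = 0"
  proof -
    have "\<forall>(p, j)\<in>set ps. killable p j v \<and> p \<le> b \<and> b < p + j" "sorted_wrt (<) (map (\<lambda>(p, j). p + j) ps)"
      using snoc.prems by (simp_all add: sorted_wrt_append)
    from snoc.IH[OF this] show thesis using that by blast
  qed
  have pr: "killable p j v \<and> p \<le> b \<and> b < p + j" if "(p, j) \<in> set (ps @ [x])" for p j
    using snoc.prems(1)[THEN bspec, OF that] by simp
  have px: "killable p j v \<and> p \<le> b \<and> b < p + j" by (rule pr) (simp add: x)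
  have kw: "p \<in> wts" "p + j \<in> wts" if "killable p j v" for p j
    using that shifts_wts(1,2)[of p j] unfolding killable_def by blast+
  have "killable p j v'"
  proof -
    have "v' p = v p" using v'(2)[THEN bspec, OF kw(1)] px by blast
    moreover have "\<forall>i\<in>wts. i < p \<longrightarrow> v' i = v i"
    proof (intro ballI impI)
      fix i assume "i \<in> wts" "i < p" then show "v' i = v i" using v'(2)[THEN bspec, of i] px by linarith
    qed
    ultimately show ?thesis using px unfolding killable_def by metis
  qed
  then obtain u where u: "jet_ok u" "act v' u 0 (p + j) = 0" "\<And>i. i \<in> wts \<Longrightarrow> i < p + j \<Longrightarrow> act v' u 0 i = v' i"
    by (rule kill) (rule that)
  have 1: "act v' u 0 (p' + j') = 0" if m: "(p', j') \<in> set ps" for p' j'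
  proof -
    have a: "p' + j' < p + j" using snoc.prems(2) m unfolding x by (auto simp: sorted_wrt_append)
    have b: "p' + j' \<in> wts" using pr[of p' j'] m kw(2) by simp
    show ?thesis unfolding u(3)[OF b a] using v'(3)[THEN bspec, OF m] by simp
  qed
  have 2: "act v' u 0 i = v i" if i: "i \<in> wts" "i \<le> b" for i
    using u(3)[OF i(1)] v'(2)[THEN bspec, OF i(1)] i(2) px by linarith
  show ?case
  proof (rule exI, intro conjI)
    show "R (act v' u 0)" by (rule closed[OF v'(1) u(1)])
    show "\<forall>i\<in>wts. i \<le> b \<longrightarrow> act v' u 0 i = v i" using 2 by blast
    show "\<forall>(p, j)\<in>set (ps @ [x]). act v' u 0 (p + j) = 0"
    proof (rule ballI, rule prod.case_eq_if[THEN iffD2])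
      fix y assume "y \<in> set (ps @ [x])"
      then show "act v' u 0 (fst y + snd y) = 0" using 1[of "fst y" "snd y"] u(2) by (cases "y \<in> set ps") (simp_all add: x)
    qed
  qed
qed

text \<open>An even power leaves the sign of \<open>x\<close> as an invariant, an odd one absorbs
  it; this is the pattern of \<open>signs\<close>.\<close>

lemma scale:
  assumes "x \<noteq> 0" "p > 0"
  obtains l s :: real where "l \<noteq> 0" "s = 1 \<or> s = -1" "odd p \<Longrightarrow> s = 1" "l ^ p * x = - s / real p"
proof -
  define r where "r = root p (1 / (real p * \<bar>x\<bar>))"
  have r: "r ^ p = 1 / (real p * \<bar>x\<bar>)" "r > 0" using assms by (simp_all add: r_def)
  show thesis
  proof (cases "odd p")
    case True
    then have "(- sgn x * r) ^ p = - sgn x * r ^ p" using assms(1) by (cases "x > 0") (auto simp: power_minus_odd)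
    then show thesis using r assms by (intro that[of "- sgn x * r" 1]) (auto simp: sgn_if abs_if field_simps)
  next
    case False
    then show thesis using r assms by (intro that[of r "- sgn x"]) (auto simp: sgn_if abs_if field_simps)
  qed
qed

lemma cls_cases:
  "cls v = U9_0 \<Longrightarrow> v 8 \<noteq> 0" "cls v = U9_1 \<Longrightarrow> v 8 = 0 \<and> v 10 \<noteq> 0"
  "cls v = U9_2 \<Longrightarrow> v 8 = 0 \<and> v 10 = 0 \<and> v 12 \<noteq> 0 \<and> v 11 \<noteq> 0"
  "cls v = U9_30 \<Longrightarrow> v 8 = 0 \<and> v 10 = 0 \<and> v 12 \<noteq> 0 \<and> v 11 = 0 \<and> v 13 \<noteq> 0"
  "cls v = U9_40 \<Longrightarrow> v 8 = 0 \<and> v 10 = 0 \<and> v 12 \<noteq> 0 \<and> v 11 = 0 \<and> v 13 = 0"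
  "cls v = U9_31 \<Longrightarrow> v 8 = 0 \<and> v 10 = 0 \<and> v 12 = 0 \<and> v 11 \<noteq> 0"
  "cls v = U9_41 \<Longrightarrow> v 8 = 0 \<and> v 10 = 0 \<and> v 12 = 0 \<and> v 11 = 0 \<and> v 13 \<noteq> 0"
  "cls v = U9_5 \<Longrightarrow> v 8 = 0 \<and> v 10 = 0 \<and> v 12 = 0 \<and> v 11 = 0 \<and> v 13 = 0 \<and> v 14 \<noteq> 0"
  "cls v = U9_6 \<Longrightarrow> v 8 = 0 \<and> v 10 = 0 \<and> v 12 = 0 \<and> v 11 = 0 \<and> v 13 = 0 \<and> v 14 = 0 \<and> v 16 \<noteq> 0"
  "cls v = U9_7 \<Longrightarrow> v 8 = 0 \<and> v 10 = 0 \<and> v 12 = 0 \<and> v 11 = 0 \<and> v 13 = 0 \<and> v 14 = 0 \<and> v 16 = 0 \<and> v 17 \<noteq> 0"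
  "cls v = U9_8 \<Longrightarrow> v 8 = 0 \<and> v 10 = 0 \<and> v 12 = 0 \<and> v 11 = 0 \<and> v 13 = 0 \<and> v 14 = 0 \<and> v 16 = 0 \<and> v 17 = 0 \<and> v 19 \<noteq> 0"
  "cls v = U9_9 \<Longrightarrow> v 8 = 0 \<and> v 10 = 0 \<and> v 12 = 0 \<and> v 11 = 0 \<and> v 13 = 0 \<and> v 14 = 0 \<and> v 16 = 0 \<and> v 17 = 0 \<and> v 19 = 0"
  by (simp_all add: cls_def split: if_splits)

text \<open>\<open>R\<close> stands for the invariant vectors that one germ can attain. The
  elimination uses only the closure of this set under substitutions.\<close>

theorem normalize:
  assumes closed: "\<And>v u. R v \<Longrightarrow> jet_ok u \<Longrightarrow> R (act v u 0)" and v: "R v"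
  shows "\<exists>v' s c. R v' \<and> s \<in> signs (cls v) \<and> c \<in> params (cls v) \<and> (\<forall>w\<in>wts. v' w = vec (cls v) s c w)"
proof -
  \<comment> \<open>\<open>ps\<close> lists the eliminations, \<open>q\<close> is the weight that is
    scaled to \<open>- s / q\<close>, weights up to \<open>b\<close> are changed by the scaling
    alone, and \<open>C\<close> reads off the parameters. The factor \<open>g\<close> is -1 where
    \<open>co\<close> has \<open>- s\<close> in weight 12.\<close>
  have main: ?thesis if ps: "\<forall>(p, j)\<in>set ps. killable p j v \<and> p \<le> b \<and> b < p + j" "sorted_wrt (<) (map (\<lambda>(p, j). p + j) ps)"
    and q: "v q \<noteq> 0" "0 < q" "q \<in> wts" "q \<le> b"
    and C: "\<And>s x. s = 1 \<or> s = -1 \<Longrightarrow> (odd q \<Longrightarrow> s = 1) \<Longrightarrow> x q = - s / real q \<Longrightarrow> \<forall>(p, j)\<in>set ps. x (p + j) = 0 \<Longrightarrow>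
      \<forall>i\<in>wts. i \<le> b \<longrightarrow> (x i = 0) = (v i = 0) \<Longrightarrow>
      g * s \<in> signs (cls v) \<and> C s x \<in> params (cls v) \<and> (\<forall>w\<in>wts. x w = vec (cls v) (g * s) (C s x) w)" for ps b q C g
  proof -
    obtain v' where v': "R v'" "\<forall>i\<in>wts. i \<le> b \<longrightarrow> v' i = v i" "\<forall>(p, j)\<in>set ps. v' (p + j) = 0"
      using kills[OF closed v ps] by blast
    obtain l s where l: "l \<noteq> 0" "s = 1 \<or> s = -1" "odd q \<Longrightarrow> s = 1" "l ^ q * v q = - s / real q"
      by (rule scale[OF q(1,2)]) (rule that)
    have ok: "jet_ok (fps_const l)" using l(1) by (simp add: jet_ok_def)
    let ?x = "act v' (fps_const l) 0"
    have x: "?x w = l ^ w * v' w" if "w \<in> wts" for w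
      using that by (auto simp: act_eqs[OF ok] fps_const_power)
    have "p + j \<in> wts" if m: "(p, j) \<in> set ps" for p j
      using ps(1)[THEN bspec, OF m] shifts_wts(2)[of p j] unfolding killable_def by blast
    note x = x x[OF this]
    have 1: "?x q = - s / real q" using x(1)[OF q(3)] v'(2)[THEN bspec, OF q(3)] q(4) l(4) by simp
    have 2: "\<forall>(p, j)\<in>set ps. ?x (p + j) = 0" using x(2) v'(3) by fastforce
    have 3: "\<forall>i\<in>wts. i \<le> b \<longrightarrow> (?x i = 0) = (v i = 0)"
    proof (intro ballI impI)
      fix i assume i: "i \<in> wts" "i \<le> b"
      show "(?x i = 0) = (v i = 0)" using x(1)[OF i(1)] v'(2)[THEN bspec, OF i(1)] i(2) l(1) by simp
    qed
    have "g * s \<in> signs (cls v) \<and> C s ?x \<in> params (cls v) \<and> (\<forall>w\<in>wts. ?x w = vec (cls v) (g * s) (C s ?x) w)"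
      by (rule C[OF l(2,3) 1 2 3])
    then show ?thesis using closed[OF v'(1) ok] by blast
  qed
  note kd = killable_def
  show ?thesis
  proof (cases "cls v")
    case U9_0
    show ?thesis unfolding U9_0
      by (rule main[of "[(8, 3), (8, 5), (8, 6), (8, 8), (8, 9), (8, 11)]" 10 8 1 "\<lambda>s x. (-10 * x 10, 12 * x 12, 0)", unfolded U9_0])
        (use cls_cases(1)[OF U9_0] in \<open>simp_all add: kd shifts_def vec_def, (elim disjE; simp)?\<close>)
  next
    case U9_1
    show ?thesis unfolding U9_1
      by (rule main[of "[(10, 3), (10, 6), (10, 7), (10, 9)]" 12 10 1 "\<lambda>s x. (12 * x 12, -11 * x 11, -14 * s * x 14)", unfolded U9_1])
        (use cls_cases(2)[OF U9_1] in \<open>simp_all add: kd shifts_def vec_def, (elim disjE; simp)?\<close>)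
  next
    case U9_2
    show ?thesis unfolding U9_2
      by (rule main[of "[(11, 3), (11, 5), (11, 6), (11, 8)]" 13 12 "-1" "\<lambda>s x. (-11 * x 11, -13 * x 13, 0)", unfolded U9_2])
        (use cls_cases(3)[OF U9_2] in \<open>simp_all add: kd shifts_def vec_def, (elim disjE; simp)?\<close>)
  next
    case U9_30
    show ?thesis unfolding U9_30
      by (rule main[of "[(13, 3), (12, 5), (12, 7)]" 14 12 "-1" "\<lambda>s x. (-13 * x 13, -14 * x 14, 0)", unfolded U9_30])
        (use cls_cases(4)[OF U9_30] in \<open>simp_all add: kd shifts_def vec_def, (elim disjE; simp)?\<close>)
  next
    case U9_40
    show ?thesis unfolding U9_40
      by (rule main[of "[(12, 5), (12, 7)]" 16 12 "-1" "\<lambda>s x. (-14 * x 14, -16 * x 16, 0)", unfolded U9_40])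
        (use cls_cases(5)[OF U9_40] in \<open>simp_all add: kd shifts_def vec_def, (elim disjE; simp)?\<close>)
  next
    case U9_31
    show ?thesis unfolding U9_31
      by (rule main[of "[(11, 3), (11, 5), (11, 6), (11, 8)]" 13 11 1 "\<lambda>s x. (-13 * x 13, 0, 0)", unfolded U9_31])
        (use cls_cases(6)[OF U9_31] in \<open>simp_all add: kd shifts_def vec_def, (elim disjE; simp)?\<close>)
  next
    case U9_41
    show ?thesis unfolding U9_41
      by (rule main[of "[(13, 3), (13, 6)]" 14 13 1 "\<lambda>s x. (-14 * x 14, -17 * x 17, 0)", unfolded U9_41])
        (use cls_cases(7)[OF U9_41] in \<open>simp_all add: kd shifts_def vec_def, (elim disjE; simp)?\<close>)
  next
    case U9_5
    show ?thesis unfolding U9_5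
      by (rule main[of "[(14, 3), (14, 5)]" 16 14 1 "\<lambda>s x. (-16 * x 16, 0, 0)", unfolded U9_5])
        (use cls_cases(8)[OF U9_5] in \<open>simp_all add: kd shifts_def vec_def, (elim disjE; simp)?\<close>)
  next
    case U9_6
    show ?thesis unfolding U9_6
      by (rule main[of "[(16, 3)]" 17 16 1 "\<lambda>s x. (-17 * x 17, 0, 0)", unfolded U9_6])
        (use cls_cases(9)[OF U9_6] in \<open>simp_all add: kd shifts_def vec_def, (elim disjE; simp)?\<close>)
  next
    case U9_7
    show ?thesis unfolding U9_7
      by (rule main[of "[]" 19 17 1 "\<lambda>s x. (-19 * x 19, 0, 0)", unfolded U9_7])
        (use cls_cases(10)[OF U9_7] in \<open>simp_all add: kd shifts_def vec_def, (elim disjE; simp)?\<close>)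
  next
    case U9_8
    show ?thesis unfolding U9_8
      by (rule main[of "[]" 19 19 1 "\<lambda>s x. (0, 0, 0)", unfolded U9_8])
        (use cls_cases(11)[OF U9_8] in \<open>simp_all add: kd shifts_def vec_def, (elim disjE; simp)?\<close>)
  next
    case U9_9
    show ?thesis using v cls_cases(12)[OF U9_9]
      by (intro exI[where x = v] exI[where x = 1] exI[where x = "(0, 0, 0)"]) (simp add: vec_def U9_9)
  qed
qed

section \<open>Classification\<close>

text \<open>The two triples are \<open>(p1, q1, p2)\<close> and \<open>(q2, p3, q3)\<close>; in
  dimension four \<open>pt\<close> drops the last two entries.\<close>

definition emb6 :: "(nat \<Rightarrow> 'n::finite) \<Rightarrow> R3 \<times> R3 \<Rightarrow> 'n symp" where
  "emb6 e a = pt e [X (fst a), Y (fst a), Z (fst a), X (snd a), Y (snd a), Z (snd a)]"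

lemma emb6_coord:
  fixes e :: "nat \<Rightarrow> 'n::finite"
  assumes "enum e" "1 \<le> j" "j \<le> 2 * CARD('n)"
  shows "coord e j (emb6 e a) = (if j = 1 then X (fst a) else if j = 2 then Y (fst a) else if j = 3 then Z (fst a)
    else if j = 4 then X (snd a) else if j = 5 then Y (snd a) else if j = 6 then Z (snd a) else 0)"
  unfolding emb6_def coord_pt[OF conjunct2[OF assms(1)] assms(2,3)] using assms(2)
  by (auto simp: nth_Cons' numeral_eq_Suc)

lemma bounded_linear_emb6:
  fixes e :: "nat \<Rightarrow> 'n::finite" assumes "enum e" shows "bounded_linear (emb6 e)"
proof -
  have "linear (emb6 e)" unfolding linear_iff
    by (auto intro!: coord_eqI[OF conjunct2[OF assms]] simp: linear_add[OF linear_coord] linear_scale[OF linear_coord] emb6_coord[OF assms])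
  then show ?thesis by (simp add: linear_conv_bounded_linear)
qed

lemma lam_emb6:
  fixes e :: "nat \<Rightarrow> 'n::finite"
  assumes e: "enum e" and 6: "2 * CARD('n) \<ge> 6 \<or> Z (snd b) = 0"
  shows "fst (emb6 e a) \<bullet> snd (emb6 e b) = X (fst a) * Y (fst b) + Z (fst a) * X (snd b) + Y (snd a) * Z (snd b)"
proof -
  let ?h = "\<lambda>i. coord e (2 * i - 1) (emb6 e a) * coord e (2 * i) (emb6 e b)"
  have "fst (emb6 e a) \<bullet> snd (emb6 e b) = (\<Sum>i\<in>UNIV. fst (emb6 e a) $ i * snd (emb6 e b) $ i)"
    by (simp add: inner_vec_def)
  also have "\<dots> = (\<Sum>i\<in>{1..CARD('n)}. fst (emb6 e a) $ e i * snd (emb6 e b) $ e i)"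
    by (rule sum.reindex_bij_betw[symmetric]) (rule conjunct2[OF e])
  also have "\<dots> = (\<Sum>i\<in>{1..CARD('n)}. ?h i)"
    by (rule sum.cong) (auto simp: coord_def)
  also have "\<dots> = (\<Sum>i\<in>{1..CARD('n)} \<inter> {1, 2, 3}. ?h i)"
    by (rule sum.mono_neutral_right) (auto simp: emb6_coord[OF e])
  also have "\<dots> = X (fst a) * Y (fst b) + Z (fst a) * X (snd b) + Y (snd a) * Z (snd b)"
  proof (cases "2 * CARD('n) \<ge> 6")
    case True
    then have "{1..CARD('n)} \<inter> {1, 2, 3} = {1, 2, 3}" by auto
    then show ?thesis using True by (simp add: emb6_coord[OF e])
  next
    case False
    then have "{1..CARD('n)} \<inter> {1, 2, 3} = {1, 2}" using e by auto
    then show ?thesis using False 6 e by (simp add: emb6_coord[OF e])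
  qed
  finally show ?thesis .
qed

text \<open>The powers of t in the branches are rewritten as monomials in x, y, z, for instance t^8,
  t^10, t^11, t^13, t^14, t^16 as x z, x^2, x z^2, x^2 z, x z^3, x^2 z^2. These vanish on the line,
  so one map of three-space gives both branches.\<close>

fun nf :: "U9_family \<Rightarrow> real \<Rightarrow> R3 \<Rightarrow> R3 \<Rightarrow> R3 \<times> R3" where
  "nf U9_0 s (c1, c2, c3) = (\<lambda>p. ((s * X p, Z p, Y p), (c1 * Z p - c2 * X p, 0, 0)))"
| "nf U9_1 s (c1, c2, c3) = (\<lambda>p. ((Y p, s * Z p, X p), (c1 * Y p + c2 / 2 * Z p ^ 2 + s * (c3 / 3) * Z p ^ 3, 0, 0)))"
| "nf U9_2 s (c1, c2, c3) = (\<lambda>p. ((X p, s * Y p, c1 * (X p * Z p) + c2 / 2 * X p ^ 2), (Z p, 0, 0)))"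
| "nf U9_30 s (c1, c2, c3) = (\<lambda>p. ((X p, s * Y p, c1 / 2 * X p ^ 2 + c2 * (X p * Z p ^ 2)), (Z p, 0, 0)))"
| "nf U9_40 s (c1, c2, c3) = (\<lambda>p. ((X p, s * Y p, c1 * (X p * Z p ^ 2) + c2 / 2 * (X p ^ 2 * Z p)), (Z p, 0, 0)))"
| "nf U9_31 s (c1, c2, c3) = (\<lambda>p. ((X p, 0, Y p), (0, Z p, - (X p * Z p) - c1 / 2 * X p ^ 2)))"
| "nf U9_41 s (c1, c2, c3) = (\<lambda>p. ((X p, 0, Y p), (0, Z p, - (1 / 2) * X p ^ 2 - c1 * (X p * Z p ^ 2) - c2 * (X p * Z p ^ 3))))"
| "nf U9_5 s (c1, c2, c3) = (\<lambda>p. ((X p, 0, Y p), (0, Z p, - s * (X p * Z p ^ 2) - c1 / 2 * (X p ^ 2 * Z p))))"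
| "nf U9_6 s (c1, c2, c3) = (\<lambda>p. ((X p, 0, Y p), (0, Z p, - s * (1 / 2) * (X p ^ 2 * Z p) - c1 * (X p * Z p ^ 3))))"
| "nf U9_7 s (c1, c2, c3) = (\<lambda>p. ((X p, 0, Y p), (0, Z p, - (X p * Z p ^ 3) - c1 / 2 * (X p ^ 2 * Z p ^ 2))))"
| "nf U9_8 s (c1, c2, c3) = (\<lambda>p. ((X p, 0, Y p), (0, Z p, - (1 / 2) * (X p ^ 2 * Z p ^ 2))))"
| "nf U9_9 s (c1, c2, c3) = (\<lambda>p. ((X p, 0, Y p), (0, Z p, 0)))"

definition nfe :: "(nat \<Rightarrow> 'n::finite) \<Rightarrow> U9_family \<Rightarrow> real \<Rightarrow> R3 \<Rightarrow> R3 \<Rightarrow> 'n symp" where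
  "nfe e k s c p = emb6 e (nf k s c p)"

lemma pt_pad: "pt e [a, b, c, d] = pt e [a, b, c, d, 0, 0]"
proof -
  have "(if j < length [a, b, c, d] then [a, b, c, d] ! j else 0) = (if j < length [a, b, c, d, 0, 0] then [a, b, c, d, 0, 0] ! j else 0)" for j
    by (auto simp: nth_Cons')
  then show ?thesis unfolding pt_def Let_def by presburger
qed

lemma nfe_line: "nfe e k s c (line t) = B1 e k s c t"
  by (cases c; cases k; simp only: nfe_def emb6_def nf.simps B1.simps fst_conv snd_conv pt_pad line_simps) simp_all

lemma nfe_cusp: "nfe e k s c (cusp t) = B2 e k s c t"
  by (cases c; cases k; simp only: nfe_def emb6_def nf.simps B2.simps fst_conv snd_conv pt_pad cusp_simps) simp_all

lemma N9_eq: "N9 = range line \<union> range cusp"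
proof (intro equalityI subsetI)
  fix p assume "p \<in> N9" then show "p \<in> range line \<union> range cusp" by (rule N9_cases) simp_all
next
  fix p assume "p \<in> range line \<union> range cusp" then show "p \<in> N9" using line_in_N9 cusp_in_N9 by (elim UnE imageE) simp_all
qed

lemma curve_eq: "curve e k s c = nfe e k s c ` N9"
  unfolding curve_def N9_eq image_Un by (simp add: image_image nfe_line nfe_cusp)

text \<open>A linear left inverse of the embedding, from which both the injectivity of its
  derivative and the properness asked by \<open>par_immersion\<close> follow.\<close>

fun retr :: "(nat \<Rightarrow> 'n::finite) \<Rightarrow> U9_family \<Rightarrow> real \<Rightarrow> 'n symp \<Rightarrow> R3" where
  "retr e U9_0 s v = (s * coord e 1 v, coord e 3 v, coord e 2 v)"
| "retr e U9_1 s v = (coord e 3 v, coord e 1 v, s * coord e 2 v)"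
| "retr e U9_2 s v = (coord e 1 v, s * coord e 2 v, coord e 4 v)"
| "retr e U9_30 s v = (coord e 1 v, s * coord e 2 v, coord e 4 v)"
| "retr e U9_40 s v = (coord e 1 v, s * coord e 2 v, coord e 4 v)"
| "retr e _ s v = (coord e 1 v, coord e 3 v, coord e 5 v)"

lemma linear_retr: "linear (retr e k s)"
  by (cases k) (auto simp: linear_iff linear_add[OF linear_coord] linear_scale[OF linear_coord] algebra_simps)

lemma retr_nfe:
  fixes e :: "nat \<Rightarrow> 'n::finite"
  assumes e: "enum e" and k: "k \<in> families CARD('n)" "s \<in> signs k"
  shows "retr e k s (nfe e k s c p) = p"
  using e k by (cases c; cases k) (auto simp: nfe_def emb6_coord[OF e] families_def split: if_splits)

lemma smooth_nf: "smooth_germ (nf k s c)"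
  by (cases c; cases k; simp; intro sg)

lemma smooth_nfe: "enum e \<Longrightarrow> smooth_germ (nfe (e :: nat \<Rightarrow> 'n::finite) k s c)"
  unfolding nfe_def[abs_def] by (intro smooth_germ_linear[OF bounded_linear_emb6] smooth_nf)

lemma nfe_0: "enum e \<Longrightarrow> nfe (e :: nat \<Rightarrow> 'n::finite) k s c 0 = 0"
proof -
  assume e: "enum e"
  have "nf k s c 0 = 0" by (cases c; cases k) (simp_all add: zero_prod_def)
  then show "nfe e k s c 0 = 0" using bounded_linear.linear[OF bounded_linear_emb6[OF e]] by (simp add: nfe_def linear_0)
qed

lemma par_nfe:
  fixes e :: "nat \<Rightarrow> 'n::finite"
  assumes e: "enum e" and k: "k \<in> families CARD('n)" "s \<in> signs k"
  shows "par e (curve e k s c) (nfe e k s c)"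
  unfolding curve_eq
proof (rule par_immersion[OF e smooth_nfe[OF e] nfe_0[OF e]])
  have b: "bounded_linear (retr e k s)" using linear_retr linear_conv_bounded_linear by blast
  note r = retr_nfe[OF e k]
  have "((\<lambda>p. retr e k s (nfe e k s c p)) has_derivative (\<lambda>v. retr e k s (D (nfe e k s c) 0 v))) (at 0)"
    by (intro bounded_linear.has_derivative[OF b] smooth_germ_has_derivative0 smooth_nfe e)
  then have "(\<lambda>v. retr e k s (D (nfe e k s c) 0 v)) = (\<lambda>v. v)"
    unfolding r by (rule has_derivative_unique) (rule has_derivative_ident)
  then show "inj (D (nfe e k s c) 0)" by (metis injI)
  obtain C where C: "C > 0" "\<And>v. norm (retr e k s v) \<le> norm v * C" using bounded_linear.pos_bounded[OF b] by blast
  fix \<delta> :: real assume d: "\<delta> > 0"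
  have "norm p < \<delta>" if "norm (nfe e k s c p) < \<delta> / C" for p
  proof -
    have "norm p \<le> norm (nfe e k s c p) * C" using C(2)[of "nfe e k s c p"] by (simp add: r)
    then show ?thesis using that C(1) by (simp add: field_simps)
  qed
  then show "\<exists>\<epsilon>>0. \<forall>p\<in>N9. norm (nfe e k s c p) < \<epsilon> \<longrightarrow> norm p < \<delta>"
    using d C(1) by (intro exI[where x = "\<delta> / C"]) simp
qed

lemma ell_Z: "smooth_germ R \<Longrightarrow> ell (\<lambda>p v. R p * Z v) w = ellj 0 0 (jc R) 0 (jl R) w"
  by (simp add: ell_def)

lemma ell_YX: "ell (\<lambda>p v. Y p * X v) w = (if w = 12 then - 1 / 12 else 0)"
  and ell_XY: "ell (\<lambda>p v. X p * Y v) w = (if w = 12 then 1 / 12 else 0)"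
  by (simp_all add: ell_def ellj_def sg fps_X_power_nth)

lemma ell_ZdQ:
  assumes Q: "smooth_germ Q" shows "ell (\<lambda>p v. Z p * D Q p v) w = - ell (\<lambda>p v. Q p * Z v) w"
proof -
  have "\<forall>\<^sub>F p in nhds 0. \<forall>v. D (\<lambda>p. Z p * Q p) p v = Z p * D Q p v + Q p * Z v"
    using smooth_germ_has_derivative[OF Q]
  proof eventually_elim
    case (elim p)
    have "D (\<lambda>p. Z p * Q p) p = (\<lambda>v. Z p * D Q p v + Z v * Q p)"
      by (rule D_eq) (intro has_derivative_mult elim has_derivative_snd has_derivative_ident)
    then show ?case by (simp add: mult.commute)
  qed
  from ell_cong_germ[OF this] have "ell (\<lambda>p v. Z p * D Q p v + Q p * Z v) w = 0"
    using ell_exact[of "\<lambda>p. Z p * Q p" w] Q by (simp add: sg)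
  then show ?thesis by (subst (asm) ell_add) (auto intro!: sg Q)
qed

text \<open>The pulled-back form is p1 dq1 + p2 dq2 + p3 dq3 in the six coordinates. In dimension
  four it simplifies to R dz plus a multiple of x dy or y dx, whose invariants are
  immediate.\<close>

theorem ell_nfe:
  fixes e :: "nat \<Rightarrow> 'n::finite"
  assumes e: "enum e" and k: "k \<in> families CARD('n)" "s \<in> signs k"
  shows "ell (pull (nfe e k s c) lam) w = vec k s c w"
proof -
  define a where "a p = nf k s c p" for p
  have a: "smooth_germ a" unfolding a_def by (rule smooth_nf)
  have "\<forall>\<^sub>F p in nhds 0. \<forall>v. pull (nfe e k s c) lam p v
    = X (fst (a p)) * D (\<lambda>p. Y (fst (a p))) p v + Z (fst (a p)) * D (\<lambda>p. X (snd (a p))) p v + Y (snd (a p)) * D (\<lambda>p. Z (snd (a p))) p v"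
    using smooth_germ_has_derivative[OF a]
  proof eventually_elim
    case (elim p)
    have 1: "D (nfe e k s c) p = (\<lambda>v. emb6 e (D a p v))"
      unfolding nfe_def[abs_def] a_def[symmetric] by (intro D_eq bounded_linear.has_derivative[OF bounded_linear_emb6[OF e]] elim)
    have 2: "D (\<lambda>p. Y (fst (a p))) p = (\<lambda>v. Y (fst (D a p v)))" "D (\<lambda>p. X (snd (a p))) p = (\<lambda>v. X (snd (D a p v)))"
      "D (\<lambda>p. Z (snd (a p))) p = (\<lambda>v. Z (snd (D a p v)))"
      by (intro D_eq has_derivative_fst has_derivative_snd elim)+
    have "2 * CARD('n) \<ge> 6 \<or> Z (snd (D a p v)) = 0" for v
    proof -
      have "2 * CARD('n) \<ge> 6 \<or> (\<lambda>p. Z (snd (a p))) = (\<lambda>p. 0)"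
        using k(1) unfolding a_def by (cases c; cases k) (auto simp: families_def split: if_splits)
      moreover have "D (\<lambda>p. 0 :: real) p = (\<lambda>v. 0)" for p :: R3 by (rule D_eq) simp
      ultimately show ?thesis using 2(3) by metis
    qed
    then show ?case unfolding pull_lam 1 2 using lam_emb6[OF e] by (simp add: nfe_def a_def)
  qed
  note eq = ell_cong_germ[OF this]
  have D1: "D (\<lambda>p. s * Z p) p = (\<lambda>v. s * Z v)" "D (\<lambda>p. s * Y p) p = (\<lambda>v. s * Y v)" "D Z p = Z"
    "D (\<lambda>p. 0::real) p = (\<lambda>v. 0)" for s and p :: R3
    by (rule D_eq, (rule derivative_eq_intros refl)+, simp)+
  have D2: "D (\<lambda>p. c1 * Y p + c2 / 2 * Z p ^ 2 + s * (c3 / 3) * Z p ^ 3) p = (\<lambda>v. c1 * Y v + c2 * Z p * Z v + s * c3 * Z p ^ 2 * Z v)"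
    "D (\<lambda>p. c1 * Z p - c2 * X p) p = (\<lambda>v. c1 * Z v - c2 * X v)" for c1 c2 c3 and p :: R3
    by (rule D_eq, (rule derivative_eq_intros refl)+, simp add: fun_eq_iff)+
  obtain c1 c2 c3 where c: "c = (c1, c2, c3)" by (cases c)
  note simps = ell_Z ell_XY ell_YX c sg fps_X_power_nth ellj_def vec_def
  have A: "ell (\<lambda>p v. R p * Z v + b * L p v) w = ellj 0 0 (jc R) 0 (jl R) w + b * ell L w"
    if "smooth_germ R" "\<And>v. smooth_germ (\<lambda>p. L p v)" for R L b
    using that by (simp add: ell_add ell_cmult ell_Z sg)
  have Q: ?thesis
    \<comment> \<open>For the families starting in dimension six only the third pair contributes,
      with p3 = z.\<close>
    if q: "\<And>p v. X (fst (a p)) * D (\<lambda>p. Y (fst (a p))) p v + Z (fst (a p)) * D (\<lambda>p. X (snd (a p))) p v = 0"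
      "\<And>p. Y (snd (a p)) = Z p" and v: "- ellj 0 0 (jc (\<lambda>p. Z (snd (a p)))) 0 (jl (\<lambda>p. Z (snd (a p)))) w = vec k s c w"
  proof -
    have "smooth_germ (\<lambda>p. Z (snd (a p)))" by (intro sg a)
    then show ?thesis using v unfolding eq q add_0 by (simp only: ell_ZdQ ell_Z)
  qed
  show ?thesis
  proof (cases k)
    case U9_0
    have "ell (pull (nfe e k s c) lam) w = ell (\<lambda>p v. (s * X p + c1 * Y p) * Z v + - c2 * (Y p * X v)) w"
      unfolding eq a_def by (simp add: U9_0 c D1 D2 algebra_simps)
    also have "\<dots> = vec k s c w" by (subst A; (intro sg)?) (simp add: simps U9_0)
    finally show ?thesis .
  next
    case U9_1
    have "ell (pull (nfe e k s c) lam) w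
      = ell (\<lambda>p v. (s * Y p + c2 * (X p * Z p) + s * c3 * (X p * Z p ^ 2)) * Z v + c1 * (X p * Y v)) w"
      using D2(1) unfolding eq a_def by (simp add: U9_1 c D1 algebra_simps)
    also have "\<dots> = vec k s c w" by (subst A; (intro sg)?) (simp add: simps U9_1)
    finally show ?thesis .
  next
    case U9_2
    have "ell (pull (nfe e k s c) lam) w = ell (\<lambda>p v. (c1 * (X p * Z p) + c2 / 2 * X p ^ 2) * Z v + s * (X p * Y v)) w"
      unfolding eq a_def by (simp add: U9_2 c D1 algebra_simps)
    also have "\<dots> = vec k s c w" by (subst A; (intro sg)?) (simp add: simps U9_2)
    finally show ?thesis .
  next
    case U9_30
    have "ell (pull (nfe e k s c) lam) w = ell (\<lambda>p v. (c1 / 2 * X p ^ 2 + c2 * (X p * Z p ^ 2)) * Z v + s * (X p * Y v)) w"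
      unfolding eq a_def by (simp add: U9_30 c D1 algebra_simps)
    also have "\<dots> = vec k s c w" by (subst A; (intro sg)?) (simp add: simps U9_30)
    finally show ?thesis .
  next
    case U9_40
    have "ell (pull (nfe e k s c) lam) w = ell (\<lambda>p v. (c1 * (X p * Z p ^ 2) + c2 / 2 * (X p ^ 2 * Z p)) * Z v + s * (X p * Y v)) w"
      unfolding eq a_def by (simp add: U9_40 c D1 algebra_simps)
    also have "\<dots> = vec k s c w" by (subst A; (intro sg)?) (simp add: simps U9_40)
    finally show ?thesis .
  qed (rule Q; use k(2) in \<open>simp add: a_def D1 simps\<close>)+
qed

lemma par_inj:
  fixes e :: "nat \<Rightarrow> 'n::finite"
  assumes e: "enum e" and "par e N E" shows "inj (D E 0)"
proof -
  obtain g where g: "dgerm g" "\<forall>\<^sub>F p in nhds 0. E p = g (emb e p)"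
    using assms(2) unfolding par_def by (elim exE conjE)
  have "D E 0 = (\<lambda>u. D g 0 (emb e u))"
    using D_cong[OF g(2)] eventually_nhds_x_imp_x[OF D_compose_germ[OF dgermD(1)[OF g(1)] smooth_emb[OF e] emb_0[OF e]]]
      emb_0[OF e] D_linear[OF bounded_linear_emb[OF e]] by simp
  then show ?thesis using inj_compose[OF dgermD(3)[OF g(1)] inj_emb[OF e]] by (simp add: comp_def)
qed

text \<open>In dimension four the three-dimensional tangent space of the germ is not isotropic.\<close>

lemma cls_families:
  fixes e :: "nat \<Rightarrow> 'n::finite"
  assumes e: "enum e" and "par e N E" shows "cls (ell (pull E lam)) \<in> families CARD('n)"
proof (rule ccontr)
  assume c: "\<not> ?thesis"
  let ?v = "ell (pull E lam)"
  have z: "?v 8 = 0 \<and> ?v 10 = 0 \<and> ?v 12 = 0" and n: "2 * CARD('n) < 6"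
    using c unfolding families_def cls_def by (simp_all split: if_splits)
  have n2: "CARD('n) = 2" using n e by linarith
  note sE = par_smooth[OF assms]
  have l: "linear (D E 0)" by (rule has_derivative_linear[OF smooth_germ_has_derivative0[OF sE]])
  have o: "omega0 (D E 0 e3) (D E 0 e1) = 0" "omega0 (D E 0 e3) (D E 0 e2) = 0" "omega0 (D E 0 e1) (D E 0 e2) = 0"
    using z unfolding ell_omega[OF sE] by auto
  have o': "omega0 (D E 0 e1) (D E 0 e3) = 0" "omega0 (D E 0 e2) (D E 0 e3) = 0" "omega0 (D E 0 e2) (D E 0 e1) = 0"
    using o omega0_skew by (metis neg_0_equal_iff_equal)+
  have i: "omega0 (D E 0 u) (D E 0 v) = 0" for u v
    unfolding R3_linear[OF l, of u] R3_linear[OF l, of v]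
    by (simp add: linear_add[OF omega0_linear(1)] linear_add[OF omega0_linear(2)] linear_scale[OF omega0_linear(1)]
           linear_scale[OF omega0_linear(2)] omega0_self o o')
  have s: "subspace (range (D E 0))" by (rule linear_subspace_image[OF l subspace_UNIV])
  have "range (D E 0) \<subseteq> symp_orth (range (D E 0))" using i by (auto simp: symp_orth_def)
  then have "dim (range (D E 0)) \<le> dim (symp_orth (range (D E 0)))" by (rule dim_subset)
  moreover have "dim (range (D E 0)) = 3"
    using dim_image_eq[OF l, of UNIV] par_inj[OF assms] by (simp add: dim_UNIV)
  ultimately show False using dim_symp_orth(1)[OF s] n2 by simp
qed

text \<open>Every formal substitution is realized: Borel gives a function on the cusp,
  \<open>extend_from_cusp\<close> extends it to three-space, and \<open>par_Phi\<close> changes the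
  parametrization of the same germ. So the vector of invariants can be normalized without changing
  \<open>N\<close>.\<close>

theorem existence:
  fixes e :: "nat \<Rightarrow> 'n::finite"
  assumes e: "enum e" and N: "par e N E"
  defines "k \<equiv> cls (ell (pull E lam))"
  shows "\<exists>s\<in>signs k. \<exists>c\<in>params k. symp_equiv N (curve e k s c)"
proof -
  define R where "R v \<longleftrightarrow> (\<exists>E. par e N E \<and> v = ell (pull E lam))" for v
  have closed: "R (act v u 0)" if v: "R v" and u: "jet_ok u" for v u
  proof -
    obtain F where F: "par e N F" "v = ell (pull F lam)" using v unfolding R_def by (elim exE conjE)
    obtain f where f: "smooth_germ f" "jet f = u" using borel[of u] smooth_on_UNIV_germ by metis
    obtain U where U: "smooth_germ U" "\<forall>\<^sub>F t in nhds 0. U (cusp t) = f t"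
      by (rule extend_from_cusp[OF f(1)]) (use u f(2) that in \<open>auto simp: jet_ok_def\<close>)
    have jU: "jc U = u" using jet_cong[OF U(2)] f(2) by simp
    have U0: "U 0 \<noteq> 0" using u jU[symmetric] by (auto simp: jet_ok_def)
    let ?P = "Phi U (\<lambda>_. 0)"
    note sF = par_smooth[OF e F(1)] par_0[OF e F(1)]
    have sP: "smooth_germ ?P" by (intro smooth_Phi U sg)
    have "\<forall>\<^sub>F p in nhds 0. \<forall>v. pull (\<lambda>p. F (?P p)) lam p v = pull ?P (pull F lam) p v"
      using D_compose_germ[OF sF(1) sP Phi_0] by eventually_elim (simp add: pull_def)
    then have "ell (pull (\<lambda>p. F (?P p)) lam) = ell (pull ?P (pull F lam))" by (rule ell_cong_germ)
    also have "\<dots> = act v u 0"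
      unfolding F(2) using ell_pull[OF smooth_form_pull_lam[OF sF(1)] sP Phi_0 U(1) smooth_germ_const[of 0]] jU by (simp add: fun_eq_iff)
    finally have "act v u 0 = ell (pull (\<lambda>p. F (?P p)) lam)" by (rule sym)
    then show ?thesis unfolding R_def using par_Phi[OF e F(1) U(1) U0] by blast
  qed
  have "R (ell (pull E lam))" unfolding R_def using N by blast
  from normalize[of R, OF closed this] obtain v s c where v: "R v" "s \<in> signs k" "c \<in> params k" "\<forall>w\<in>wts. v w = vec k s c w"
    unfolding k_def by blast
  obtain F where F: "par e N F" "v = ell (pull F lam)" using v(1) unfolding R_def by (elim exE conjE)
  have kf: "k \<in> families CARD('n)" unfolding k_def by (rule cls_families[OF e N])
  have "ell (pull F lam) w = ell (pull (nfe e k s c) lam) w" for w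
  proof (cases "w \<in> wts")
    case True show ?thesis using v(4)[THEN bspec, OF True] unfolding F(2) ell_nfe[OF e kf v(2)] .
  next
    case False show ?thesis unfolding ell_outside[OF False] ..
  qed
  from symp_equiv_of_ell_eq[OF e F(1) par_nfe[OF e kf v(2)] this] v(2,3) show ?thesis by blast
qed

lemma symp_equiv_act:
  fixes e :: "nat \<Rightarrow> 'n::finite"
  assumes e: "enum e" and N: "par e N E" and k: "k \<in> families CARD('n)" "s \<in> signs k" and eq: "symp_equiv N (curve e k s c)"
  obtains u m where "jet_ok u" "\<And>w. ell (pull E lam) w = act (vec k s c) u m w"
proof -
  have "ell (pull (nfe e k s c) lam) = vec k s c" by (rule ext) (rule ell_nfe[OF e k])
  then show thesis
    using symp_equiv_form[OF e N par_nfe[OF e k] eq] that unfolding jet_ok_def by metis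
qed

theorem uniqueness:
  fixes e :: "nat \<Rightarrow> 'n::finite"
  assumes e: "enum e" and N: "par e N E" and k: "k \<in> families CARD('n)" "s \<in> signs k" "c \<in> params k" "symp_equiv N (curve e k s c)"
  shows "k = cls (ell (pull E lam))"
proof -
  obtain u m where u: "jet_ok u" "\<And>w. ell (pull E lam) w = act (vec k s c) u m w"
    by (rule symp_equiv_act[OF e N k(1,2,4)]) (rule that)
  have "ell (pull E lam) = act (vec k s c) u m" by (rule ext) (rule u(2))
  then show ?thesis using cls_act[OF u(1)] cls_vec[OF k(2,3)] by simp
qed

text \<open>By \<open>vec_rigid\<close> a path of mutually equivalent members takes at most eight
  values, and a continuous map with finite range on an interval is constant.\<close>

theorem moduli:
  fixes e :: "nat \<Rightarrow> 'n::finite"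
  assumes e: "enum e" and k: "k \<in> families CARD('n)" "s \<in> signs k"
  shows "params_are_moduli e k s"
  unfolding params_are_moduli_def
proof (rule notI, elim exE conjE)
  fix \<gamma> assume g: "smooth_on {0<..<1} \<gamma>" "\<gamma> ` {0<..<1::real} \<subseteq> params k" "\<not> \<gamma> constant_on {0<..<1}"
    and eq: "\<forall>a\<in>{0<..<1}. \<forall>b\<in>{0<..<1}. symp_equiv (curve e k s (\<gamma> a)) (curve e k s (\<gamma> b))"
  let ?a = "1 / 2 :: real" let ?c = "\<gamma> ?a"
  have "\<gamma> b \<in> {X ?c, - X ?c} \<times> {Y ?c, - Y ?c} \<times> {Z ?c, - Z ?c}" if b: "b \<in> {0<..<1}" for b
  proof -
    have "symp_equiv (curve e k s (\<gamma> b)) (curve e k s ?c)" using eq b by simp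
    from symp_equiv_act[OF e par_nfe[OF e k] k this] obtain u m where
      u: "jet_ok u" "\<And>w. ell (pull (nfe e k s (\<gamma> b)) lam) w = act (vec k s ?c) u m w" by blast
    have "?c \<in> params k" "\<gamma> b \<in> params k" using g(2) b by (auto simp: image_subset_iff)
    then show ?thesis by (rule vec_rigid[OF k(2) _ _ u(1)]) (use u(2) ell_nfe[OF e k] in simp)
  qed
  then have "\<gamma> ` {0<..<1} \<subseteq> {X ?c, - X ?c} \<times> {Y ?c, - Y ?c} \<times> {Z ?c, - Z ?c}" by blast
  then have "finite (\<gamma> ` {0<..<1})" by (rule finite_subset) simp
  moreover have "continuous_on {0<..<1} \<gamma>" by (rule smooth_on_continuous_on[OF g(1)])
  ultimately have "(\<lambda>b. f (\<gamma> b)) constant_on {0<..<1}" if "bounded_linear f" for f :: "R3 \<Rightarrow> real"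
    using finite_imageI[of "\<gamma> ` {0<..<1}" f] bounded_linear.continuous_on[OF that]
    by (intro continuous_finite_range_constant) (auto simp: image_image)
  from this[of X] this[of "\<lambda>p. Y p"] this[of "\<lambda>p. Z p"] have "\<gamma> constant_on {0<..<1}"
    unfolding constant_on_def
    by (simp add: bounded_linear_fst bounded_linear_snd bounded_linear_compose[OF bounded_linear_fst bounded_linear_snd]
      bounded_linear_compose[OF bounded_linear_snd bounded_linear_snd] prod_eq_iff) (metis prod.collapse fst_conv snd_conv)
  then show False using g(3) by simp
qed

section \<open>Tangency orders\<close>

lemma vanishing_order_iff: "enat K \<le> vanishing_order h \<longleftrightarrow> (\<forall>j<K. jet h $$ j = 0)"
proof -
  have "enat K \<le> vanishing_order h \<longleftrightarrow> (\<forall>j. (deriv ^^ j) h 0 \<noteq> 0 \<longrightarrow> K \<le> j)"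
    unfolding vanishing_order_def le_INF_iff by simp
  then show ?thesis by (auto simp: jet_def not_less[symmetric])
qed

lemma tangency_order_iff: "enat K \<le> tangency_order f H \<longleftrightarrow> (\<forall>i. \<forall>j<K. jet (\<lambda>t. H (f t) $ i) $$ j = 0)"
  by (auto simp: tangency_order_def vanishing_order_iff)

text \<open>Orders may be infinite; comparisons are reduced to finite lower bounds, the form in
  which \<open>tangency_order_iff\<close> is available.\<close>

lemma enat_le_iff: "x \<le> y \<longleftrightarrow> (\<forall>K. enat K \<le> x \<longrightarrow> enat K \<le> y)" for x y :: enat
proof (intro iffI allI impI)
  fix K assume "x \<le> y" "enat K \<le> x" then show "enat K \<le> y" by (rule order_trans[rotated])
next
  assume h: "\<forall>K. enat K \<le> x \<longrightarrow> enat K \<le> y"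
  show "x \<le> y"
  proof (rule ccontr)
    assume n: "\<not> x \<le> y"
    then obtain k where k: "y = enat k" by (cases y) auto
    then have "enat (Suc k) \<le> x" using n by (simp add: not_le Suc_ile_eq)
    then show False using h k by fastforce
  qed
qed

lemma lagrangian_iff:
  fixes H :: "'n::finite symp \<Rightarrow> real ^ 'n"
  shows "lagrangian_equations H \<longleftrightarrow> smooth_germ H \<and> H 0 = 0 \<and> (\<forall>\<^sub>F x in nhds 0. H x = 0 \<longrightarrow>
    surj (D H x) \<and> (\<forall>u v. D H x u = 0 \<longrightarrow> D H x v = 0 \<longrightarrow> omega0 u v = 0))" (is "_ \<longleftrightarrow> _ \<and> _ \<and> (\<forall>\<^sub>F x in nhds 0. ?P x)")
proof
  assume "lagrangian_equations H"
  then obtain U where U: "open U" "0 \<in> U" "smooth_on U H" "H 0 = 0" "\<forall>x\<in>U. ?P x"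
    unfolding lagrangian_equations_def by (elim exE conjE)
  have "smooth_germ H" using U(1-3) by (auto simp: smooth_germ_def)
  moreover have "\<forall>\<^sub>F x in nhds 0. ?P x" unfolding eventually_nhds using U(1,2,5) by blast
  ultimately show "smooth_germ H \<and> H 0 = 0 \<and> (\<forall>\<^sub>F x in nhds 0. ?P x)" using U(4) by blast
next
  assume h: "smooth_germ H \<and> H 0 = 0 \<and> (\<forall>\<^sub>F x in nhds 0. ?P x)"
  obtain U where U: "open U" "0 \<in> U" "smooth_on U H" using h by (auto simp: smooth_germ_def)
  obtain W where W: "open W" "0 \<in> W" "\<forall>x\<in>W. ?P x" using h unfolding eventually_nhds by blast
  have "open (U \<inter> W)" "0 \<in> U \<inter> W" "smooth_on (U \<inter> W) H" "\<forall>x\<in>U \<inter> W. ?P x"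
    using U W smooth_on_subset[OF U(3), of "U \<inter> W"] by auto
  then show "lagrangian_equations H" unfolding lagrangian_equations_def using h by blast
qed

lemma lagrangian_compose:
  assumes H: "lagrangian_equations H" and g: "sgerm g"
  shows "lagrangian_equations (\<lambda>x. H (g x))"
proof -
  note h = H[unfolded lagrangian_iff]
  have dg: "dgerm g" and s: "\<forall>\<^sub>F x in nhds 0. \<forall>u v. omega0 (D g x u) (D g x v) = omega0 u v"
    using g by (auto simp: sgerm_def)
  note g = dgermD(1,2)[OF dg]
  have "\<forall>\<^sub>F x in nhds 0. H (g x) = 0 \<longrightarrow> surj (D (\<lambda>x. H (g x)) x) \<and>
    (\<forall>u v. D (\<lambda>x. H (g x)) x u = 0 \<longrightarrow> D (\<lambda>x. H (g x)) x v = 0 \<longrightarrow> omega0 u v = 0)"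
    using s smooth_germ_eventually[OF g conjunct2[OF conjunct2[OF h]]] smooth_germ_linear_D[OF g(1)]
      D_compose_germ[OF conjunct1[OF h] g]
  proof eventually_elim
    case (elim x)
    have "inj (D g x)"
    proof (rule injI)
      fix a b assume ab: "D g x a = D g x b"
      have "omega0 (a - b) v = 0" for v
        using elim(1)[THEN spec, THEN spec, of "a - b" v] ab by (simp add: linear_diff[OF elim(3)] omega0_eq)
      from this[of "(0, fst (a - b))"] this[of "(snd (a - b), 0)"] show "a = b" by (simp add: omega0_eq prod_eq_iff)
    qed
    then have "surj (D g x)" by (rule linear_inj_imp_surj[OF elim(3)])
    show ?case
    proof (intro impI conjI allI)
      assume z: "H (g x) = 0"
      have "surj (D H (g x))" using elim(2) z by blast
      from comp_surj[OF \<open>surj (D g x)\<close> this] show "surj (D (\<lambda>x. H (g x)) x)" unfolding elim(4) by (simp add: comp_def)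
      fix u v assume "D (\<lambda>x. H (g x)) x u = 0" "D (\<lambda>x. H (g x)) x v = 0"
      then have "omega0 (D g x u) (D g x v) = 0" using elim(2) z unfolding elim(4) by blast
      then show "omega0 u v = 0" using elim(1) by simp
    qed
  qed
  then show ?thesis unfolding lagrangian_iff
    using smooth_germ_compose[OF conjunct1[OF h] g] h g(2) by simp
qed

lemma smooth_germ_lipschitz:
  fixes f :: "'a::euclidean_space \<Rightarrow> 'b::euclidean_space"
  assumes "smooth_germ f"
  obtains C r where "r > 0" "C \<ge> 0" "\<And>x y. x \<in> ball 0 r \<Longrightarrow> y \<in> ball 0 r \<Longrightarrow> norm (f x - f y) \<le> C * norm (x - y)"
proof -
  have "\<forall>\<^sub>F x in nhds 0. norm (D f x b) < norm (D f 0 b) + 1" for b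
    by (rule order_tendstoD(2)[OF tendsto_norm[OF smooth_germ_tendsto[OF smooth_germ_D[OF assms]]]]) simp
  then have "\<forall>\<^sub>F x in nhds 0. \<forall>b\<in>Basis. norm (D f x b) < norm (D f 0 b) + 1"
    by (simp add: eventually_ball_finite_distrib)
  then have "\<forall>\<^sub>F x in nhds 0. (f has_derivative D f x) (at x) \<and> (\<forall>b\<in>Basis. norm (D f x b) < norm (D f 0 b) + 1)"
    by (rule eventually_conj[OF smooth_germ_has_derivative[OF assms]])
  then obtain r where r: "r > 0" "\<And>x. norm x < r \<Longrightarrow> (f has_derivative D f x) (at x)"
    "\<And>x b. norm x < r \<Longrightarrow> b \<in> Basis \<Longrightarrow> norm (D f x b) < norm (D f 0 b) + 1"
    by (auto simp: eventually_nhds_metric dist_norm)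
  let ?C = "\<Sum>b\<in>Basis. norm (D f 0 b) + 1"
  have "norm (f x - f y) \<le> ?C * norm (x - y)" if "x \<in> ball 0 r" "y \<in> ball 0 r" for x y
  proof (rule differentiable_bound[where S = "ball 0 r"])
    fix x :: 'a assume x: "x \<in> ball 0 r"
    show "(f has_derivative D f x) (at x within ball 0 r)" using r(2) x by (auto intro: has_derivative_at_withinI)
    show "onorm (D f x) \<le> ?C"
    proof (rule onorm_bound)
      fix v
      have "D f x v = (\<Sum>b\<in>Basis. (v \<bullet> b) *\<^sub>R D f x b)"
        by (rule linear_basis_sum[OF has_derivative_linear[OF r(2)]]) (use x in simp)
      also have "norm \<dots> \<le> (\<Sum>b\<in>Basis. (norm (D f 0 b) + 1) * norm v)"
      proof (rule sum_norm_le)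
        fix b :: 'a assume b: "b \<in> Basis"
        have "\<bar>v \<bullet> b\<bar> * norm (D f x b) \<le> norm v * (norm (D f 0 b) + 1)"
          using r(3)[of x b] x b by (intro mult_mono Basis_le_norm) auto
        then show "norm ((v \<bullet> b) *\<^sub>R D f x b) \<le> (norm (D f 0 b) + 1) * norm v" by (simp add: mult.commute)
      qed
      finally show "norm (D f x v) \<le> ?C * norm v" by (simp add: sum_distrib_right)
    qed (simp add: sum_nonneg add_nonneg_nonneg)
  qed (use that in auto)
  then show thesis using that[OF r(1), of ?C] by (simp add: sum_nonneg add_nonneg_nonneg)
qed

text \<open>A Lagrangian germ \<open>H = 0\<close> has a retraction \<open>r\<close> with \<open>x - r x = O(H x)\<close>; pulling the Liouville form back
  along \<open>r\<close> makes it closed, hence the Liouville form is exact up to terms of order \<open>H\<close>. A complement to the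
  tangent space of a Lagrangian germ is its image under the complex structure.\<close>

theorem lagrangian_defect:
  fixes H :: "'n::finite symp \<Rightarrow> real ^ 'n"
  assumes "lagrangian_equations H"
  obtains r G C where "smooth_germ r" "r 0 = 0" "smooth_germ G" "C \<ge> 0" "\<forall>\<^sub>F x in nhds 0. norm (x - r x) \<le> C * norm (H x)"
    "\<forall>\<^sub>F x in nhds 0. \<forall>v. lam x v - D G x v = fst (x - r x) \<bullet> snd v - fst (D r x v) \<bullet> snd (x - r x)"
proof -
  have H: "smooth_germ H" "H 0 = 0" and L: "\<forall>\<^sub>F x in nhds 0. H x = 0 \<longrightarrow>
    surj (D H x) \<and> (\<forall>u v. D H x u = 0 \<longrightarrow> D H x v = 0 \<longrightarrow> omega0 u v = 0)"
    using assms unfolding lagrangian_iff by blast+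
  define J :: "'n symp \<Rightarrow> 'n symp" where "J u = (- snd u, fst u)" for u
  have DH: "bounded_linear (D H 0)" using smooth_germ_has_derivative0[OF H(1)] by (rule has_derivative_bounded_linear)
  have J: "bounded_linear J" unfolding J_def
    by (intro bounded_linear_Pair bounded_linear_minus bounded_linear_fst bounded_linear_snd)
  \<comment> \<open>\<open>P = (H, k)\<close> will be a chart: if \<open>v\<close> and
    \<open>J v\<close> are both tangent to the Lagrangian germ at 0, then
    \<open>omega0 v (J v)\<close>, the squared norm of \<open>v\<close>, vanishes. In this chart the
    retraction sets the \<open>H\<close>-part to zero.\<close>
  define k where "k v = D H 0 (J v)" for v
  have k: "bounded_linear k" unfolding k_def by (rule bounded_linear_compose[OF DH J])
  define P where "P v = (H v, k v)" for v
  have sk: "smooth_germ k" using smooth_germ_linear[OF k smooth_germ_id] .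
  have DP: "D P 0 = (\<lambda>v. (D H 0 v, k v))" unfolding P_def
    by (intro D_eq has_derivative_Pair smooth_germ_has_derivative0 H(1) bounded_linear_imp_has_derivative[OF k])
  have lP: "linear (D P 0)" unfolding DP
    using DH k by (intro bounded_linear.linear bounded_linear_Pair)
  have "v = 0" if "D P 0 v = 0" for v
  proof -
    have "D P 0 v = (D H 0 v, D H 0 (J v))" by (simp only: DP k_def)
    then have "D H 0 v = 0" "D H 0 (J v) = 0" using arg_cong[OF that, of fst] arg_cong[OF that, of snd] by simp_all
    then have "omega0 v (J v) = 0" using eventually_nhds_x_imp_x[OF L] H(2) by blast
    then have "fst v \<bullet> fst v + snd v \<bullet> snd v = 0" by (simp add: omega0_eq J_def)
    then show "v = 0" by (simp add: add_nonneg_eq_0_iff prod_eq_iff)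
  qed
  moreover have "smooth_germ P" unfolding P_def by (intro smooth_germ_Pair H sk)
  moreover have k0: "k 0 = 0" by (rule linear_0[OF bounded_linear.linear[OF k]])
  moreover have "P 0 = 0" unfolding P_def H(2) k0 by (rule zero_prod_def[symmetric])
  ultimately have P: "dgerm P" unfolding dgerm_def using linear_injective_0[OF lP] by blast
  obtain T where T: "dgerm T" "\<forall>\<^sub>F x in nhds 0. T (P x) = x" "\<forall>\<^sub>F y in nhds 0. P (T y) = y" using dgerm_inverse[OF P] .
  define q where "q v = (0 :: real ^ 'n, k v)" for v
  have q: "smooth_germ q" "q 0 = 0" unfolding q_def k0 by (intro sg sk, rule zero_prod_def[symmetric])
  define r where "r v = T (q v)" for v
  have r: "smooth_germ r" unfolding r_def by (rule smooth_germ_compose[OF dgermD(1)[OF T(1)] q])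
  have r0: "r 0 = 0" by (simp add: r_def q dgermD(2)[OF T(1)])
  have Hr: "\<forall>\<^sub>F x in nhds 0. H (r x) = 0"
    using smooth_germ_eventually[OF q T(3)] by eventually_elim (simp add: r_def P_def q_def)
  have "\<forall>\<^sub>F x in nhds 0. \<forall>u v. omega0 (D r x u) (D r x v) = omega0 (D (\<lambda>x. 0 :: 'n symp) x u) (D (\<lambda>x. 0 :: 'n symp) x v)"
    using Hr D_cong_germ[OF Hr] D_compose_germ[OF H(1) r r0] smooth_germ_eventually[OF r r0 L]
  proof eventually_elim
    case (elim x)
    have z: "D (\<lambda>x. 0 :: 'b::real_normed_vector) x = (\<lambda>v. 0)" for x :: "'n symp" by (rule D_eq) simp
    have "D H (r x) (D r x u) = 0" for u using elim(2,3) z by (metis (no_types))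
    then show ?case using elim(1,4) unfolding z by (simp add: omega0_eq[of 0])
  qed
  then obtain F where F: "smooth_germ F" "\<forall>\<^sub>F x in nhds 0. \<forall>v. D F x v = pull r lam x v - pull (\<lambda>x. 0 :: 'n symp) lam x v"
    by (rule liouville_difference_exact[OF r smooth_germ_const])
  \<comment> \<open>The term added to the primitive \<open>F\<close> of the pulled-back form makes
    every remaining term contain a factor \<open>x - r x\<close>.\<close>
  define G where "G x = F x + fst (r x) \<bullet> (snd x - snd (r x))" for x
  have G: "smooth_germ G" unfolding G_def by (intro sg F r)
  have "\<forall>\<^sub>F x in nhds 0. \<forall>v. lam x v - D G x v = fst (x - r x) \<bullet> snd v - fst (D r x v) \<bullet> snd (x - r x)"
    using F(2) smooth_germ_has_derivative[OF F(1)] smooth_germ_has_derivative[OF r]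
  proof eventually_elim
    case (elim x)
    have "D G x = (\<lambda>v. D F x v + (fst (r x) \<bullet> (snd v - snd (D r x v)) + fst (D r x v) \<bullet> (snd x - snd (r x))))"
      unfolding G_def by (intro D_eq has_derivative_add has_derivative_inner has_derivative_diff has_derivative_fst has_derivative_snd
        has_derivative_ident elim)
    then show ?case using elim(1) by (simp add: pull_lam lam_def inner_diff_left inner_diff_right)
  qed
  moreover obtain C d where C: "d > 0" "C \<ge> 0" "\<And>x y. x \<in> ball 0 d \<Longrightarrow> y \<in> ball 0 d \<Longrightarrow> norm (T x - T y) \<le> C * norm (x - y)"
    by (rule smooth_germ_lipschitz[OF dgermD(1)[OF T(1)]]) (rule that)

  have bd: "\<forall>\<^sub>F y in nhds 0. y \<in> ball (0 :: 'n symp) d" by (rule eventually_ball[OF C(1)])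
  have "\<forall>\<^sub>F x in nhds 0. norm (x - r x) \<le> C * norm (H x)"
    using T(2) smooth_germ_eventually[OF dgermD(1,2)[OF P] bd] smooth_germ_eventually[OF q bd]
  proof eventually_elim
    case (elim x)
    have "norm (T (P x) - T (q x)) \<le> C * norm (P x - q x)" by (rule C(3)) (use elim in auto)
    then show ?case using elim(1) by (simp add: r_def P_def q_def norm_prod_def)
  qed
  ultimately show thesis using that[OF r r0 G C(2)] by blast
qed

section \<open>Upper bounds for the tangency orders and their invariance\<close>

lemma smooth_germ_bounded:
  assumes "smooth_germ f" obtains B where "B \<ge> 0" "\<forall>\<^sub>F x in nhds 0. norm (f x) \<le> B"
proof -
  have "\<forall>\<^sub>F x in nhds 0. norm (f x) < norm (f 0) + 1"
    by (rule order_tendstoD(2)[OF tendsto_norm[OF smooth_germ_tendsto[OF assms]]]) simp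
  then have "\<forall>\<^sub>F x in nhds 0. norm (f x) \<le> norm (f 0) + 1" by eventually_elim simp
  then show thesis using that[of "norm (f 0) + 1"] by simp
qed

text \<open>\<open>\<alpha>\<close> is the pulled-back Liouville form without the exact part found
  in \<open>lagrangian_defect\<close>. It is bounded by the distance to the Lagrangian germ, hence
  by \<open>H\<close>, so its coefficients vanish to order \<open>K\<close> along the branch, while
  the invariants do not notice the exact part.\<close>

theorem tangency_bound:
  fixes E :: "R3 \<Rightarrow> 'n::finite symp"
  assumes H: "lagrangian_equations H" and E: "smooth_germ E" "E 0 = 0"
  obtains \<alpha> where "\<And>v. smooth_germ (\<lambda>p. \<alpha> p v)" "\<And>w. ell \<alpha> w = ell (pull E lam) w"
    "\<And>c K j v. smooth_germ c \<Longrightarrow> c 0 = 0 \<Longrightarrow> enat K \<le> tangency_order (\<lambda>t. E (c t)) H \<Longrightarrow> j < K \<Longrightarrow> jet (\<lambda>t. \<alpha> (c t) v) $$ j = 0"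
proof -
  obtain r G C where r: "smooth_germ r" "r 0 = 0" and G: "smooth_germ G" and C: "C \<ge> 0" "\<forall>\<^sub>F x in nhds 0. norm (x - r x) \<le> C * norm (H x)"
    and d: "\<forall>\<^sub>F x in nhds 0. \<forall>v. lam x v - D G x v = fst (x - r x) \<bullet> snd v - fst (D r x v) \<bullet> snd (x - r x)"
    by (rule lagrangian_defect[OF H]) (rule that)
  have sH: "smooth_germ H" "H 0 = 0" using H unfolding lagrangian_iff by blast+
  define \<alpha> where "\<alpha> p v = pull E lam p v - D (\<lambda>p. G (E p)) p v" for p v
  have GE: "smooth_germ (\<lambda>p. G (E p))" by (rule smooth_germ_compose[OF G E])
  note sp = smooth_form_smooth[OF smooth_form_pull_lam[OF E(1)]]
  have s\<alpha>: "smooth_germ (\<lambda>p. \<alpha> p v)" for v unfolding \<alpha>_def by (intro smooth_germ_diff sp smooth_germ_D GE)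
  have "ell \<alpha> w = ell (pull E lam) w" for w
    unfolding \<alpha>_def[abs_def] by (subst ell_diff) (simp_all add: sp smooth_germ_D GE ell_exact[OF GE])
  moreover have "jet (\<lambda>t. \<alpha> (c t) v) $$ j = 0"
    if c: "smooth_germ c" "c 0 = 0" and K: "enat K \<le> tangency_order (\<lambda>t. E (c t)) H" and j: "j < K" for c K j v
  proof -
    have Ec: "smooth_germ (\<lambda>t. E (c t))" "E (c 0) = 0" using smooth_germ_compose[OF E(1) c] c E by auto
    have HEc: "smooth_germ (\<lambda>t. H (E (c t)))" by (rule smooth_germ_compose[OF sH(1) Ec])
    have "\<exists>B\<ge>0. \<forall>\<^sub>F t in nhds 0. \<bar>H (E (c t)) $ i\<bar> \<le> B * \<bar>t\<bar> ^ K" for i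
    proof -
      have s: "smooth_germ (\<lambda>t. H (E (c t)) $ i)" by (rule smooth_germ_linear[OF bounded_linear_vec_nth HEc])
      obtain g where g: "smooth_germ g" "\<forall>\<^sub>F t in nhds 0. H (E (c t)) $ i = t ^ K * g t"
        using jet_zero_divide[OF s, of K] K unfolding tangency_order_iff by blast
      obtain B where B: "B \<ge> 0" "\<forall>\<^sub>F t in nhds 0. norm (g t) \<le> B" by (rule smooth_germ_bounded[OF g(1)])
      have "\<forall>\<^sub>F t in nhds 0. \<bar>H (E (c t)) $ i\<bar> \<le> B * \<bar>t\<bar> ^ K"
        using g(2) B(2) by eventually_elim (simp add: abs_mult power_abs mult.commute mult_right_mono)
      then show ?thesis using B(1) by blast
    qed
    then obtain B where B: "\<And>i. \<forall>\<^sub>F t in nhds 0. \<bar>H (E (c t)) $ i\<bar> \<le> B i * \<bar>t\<bar> ^ K" by metis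
    have hb: "\<forall>\<^sub>F t in nhds 0. norm (H (E (c t))) \<le> (\<Sum>i\<in>UNIV. B i) * \<bar>t\<bar> ^ K"
    proof -
      have "\<forall>\<^sub>F t in nhds 0. \<forall>i\<in>UNIV. \<bar>H (E (c t)) $ i\<bar> \<le> B i * \<bar>t\<bar> ^ K"
        by (intro eventually_ball_finite ballI B finite)
      then show ?thesis
      proof eventually_elim
        case (elim t)
        have "norm (H (E (c t))) \<le> (\<Sum>i\<in>UNIV. \<bar>H (E (c t)) $ i\<bar>)" by (rule norm_le_l1_cart)
        also have "\<dots> \<le> (\<Sum>i\<in>UNIV. B i * \<bar>t\<bar> ^ K)" by (rule sum_mono) (use elim in blast)
        finally show ?case by (simp add: sum_distrib_right)
      qed
    qed
    have rE: "smooth_germ (\<lambda>p. r (E p))" by (rule smooth_germ_compose[OF r(1) E])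
    obtain b1 where b1: "b1 \<ge> 0" "\<forall>\<^sub>F t in nhds 0. norm (D E (c t) v) \<le> b1"
      by (rule smooth_germ_bounded[OF smooth_germ_compose[OF smooth_germ_D[OF E(1)] c]])
    obtain b2 where b2: "b2 \<ge> 0" "\<forall>\<^sub>F t in nhds 0. norm (D (\<lambda>p. r (E p)) (c t) v) \<le> b2"
      by (rule smooth_germ_bounded[OF smooth_germ_compose[OF smooth_germ_D[OF rE] c]])
    note ec = smooth_germ_eventually[OF c] and eE = smooth_germ_eventually[OF Ec]
    have "\<forall>\<^sub>F t in nhds 0. \<bar>\<alpha> (c t) v\<bar> \<le> (C * (\<Sum>i\<in>UNIV. B i) * (b1 + b2)) * \<bar>t\<bar> ^ K"
      using hb b1(2) b2(2) ec[OF D_compose_germ[OF G E]] ec[OF D_compose_germ[OF r(1) E]] eE[OF C(2)] eE[OF d]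
    proof eventually_elim
      case (elim t)
      let ?x = "E (c t)" let ?R = "?x - r ?x"
      have "\<alpha> (c t) v = fst ?R \<bullet> snd (D E (c t) v) - fst (D (\<lambda>p. r (E p)) (c t) v) \<bullet> snd ?R"
        using elim(7)[THEN spec, of "D E (c t) v"] unfolding \<alpha>_def elim(4,5) by (simp add: pull_def)
      also have "\<bar>\<dots>\<bar> \<le> norm ?R * b1 + b2 * norm ?R"
      proof -
        have n: "\<bar>a \<bullet> b\<bar> \<le> x * y" if "norm a \<le> x" "norm b \<le> y" for a b :: "real ^ 'n" and x y
          using Cauchy_Schwarz_ineq2[of a b] mult_mono[OF that order_trans[OF norm_ge_zero that(1)] norm_ge_zero] by linarith
        have f: "norm (fst z) \<le> norm z" "norm (snd z) \<le> norm z" for z :: "'n symp"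
          by (metis norm_fst_le prod.collapse, metis norm_snd_le prod.collapse)
        have "\<bar>fst ?R \<bullet> snd (D E (c t) v)\<bar> \<le> norm ?R * b1"
          by (rule n[OF f(1) order_trans[OF f(2) elim(2)]])
        moreover have "\<bar>fst (D (\<lambda>p. r (E p)) (c t) v) \<bullet> snd ?R\<bar> \<le> b2 * norm ?R"
          by (rule n[OF order_trans[OF f(1) elim(3)] f(2)])
        ultimately show ?thesis by linarith
      qed
      also have "\<dots> = norm ?R * (b1 + b2)" by (simp add: algebra_simps)
      also have "\<dots> \<le> (C * ((\<Sum>i\<in>UNIV. B i) * \<bar>t\<bar> ^ K)) * (b1 + b2)"
        by (rule mult_right_mono[OF order_trans[OF elim(6) mult_left_mono[OF elim(1) C(1)]]]) (simp add: b1 b2)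
      finally show ?case by (simp add: mult_ac)
    qed
    then show ?thesis by (rule jet_zero_of_bound[OF smooth_germ_compose[OF s\<alpha> c] _ j])
  qed
  ultimately show thesis using that s\<alpha> by blast
qed

lemma jet_reparam:
  assumes h: "smooth_germ h" and \<phi>: "smooth_germ \<phi>" "\<phi> 0 = 0" and z: "\<And>j. j < K \<Longrightarrow> jet h $$ j = 0" and j: "j < K"
  shows "jet (\<lambda>t. h (\<phi> t)) $$ j = 0"
proof -
  obtain g where g: "smooth_germ g" "\<forall>\<^sub>F t in nhds 0. h t = t ^ K * g t" using jet_zero_divide[OF h z] by blast
  obtain b where b: "smooth_germ b" "\<forall>\<^sub>F t in nhds 0. \<phi> t = t * b t" by (rule smooth_germ_divide[OF \<phi>])
  have s: "smooth_germ (\<lambda>t. b t ^ K * g (\<phi> t))" by (intro sg b smooth_germ_compose[OF g(1) \<phi>])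
  have "\<forall>\<^sub>F t in nhds 0. h (\<phi> t) = t ^ K * (b t ^ K * g (\<phi> t))"
    using smooth_germ_eventually[OF \<phi> g(2)] b(2)
  proof eventually_elim
    case (elim t) show ?case unfolding elim(1) by (simp only: elim(2) power_mult_distrib mult.assoc)
  qed
  from jet_cong[OF this] s j show ?thesis by (simp add: sg fps_X_power_mult_nth)
qed

text \<open>By \<open>symp_equiv_form\<close> the equivalence carries each branch to the
  corresponding one up to a reparametrization fixing 0, and this cannot lower orders of
  vanishing.\<close>

lemma tangency_transfer:
  fixes e :: "nat \<Rightarrow> 'n::finite"
  assumes e: "enum e" and N: "par e N E" and M: "par e M E'" and NM: "symp_equiv N M" and H: "lagrangian_equations H"
  obtains H' where "lagrangian_equations H'"
    "tangency_order (\<lambda>t. E' (line t)) H \<le> tangency_order (\<lambda>t. E (line t)) H'"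
    "tangency_order (\<lambda>t. E' (cusp t)) H \<le> tangency_order (\<lambda>t. E (cusp t)) H'"
proof -
  obtain g U m where g: "sgerm g" and U: "smooth_germ U" and m: "smooth_germ m" and
    eq: "\<forall>\<^sub>F p in nhds 0. p \<in> N9 \<longrightarrow> g (E p) = E' (Phi U m p)"
    by (rule symp_equiv_form[OF e N M NM]) (rule that)
  note sE' = par_smooth[OF e M] par_0[OF e M]
  have sH: "smooth_germ H" using H by (simp add: lagrangian_iff)
  have le: "tangency_order (\<lambda>t. E' (c t)) H \<le> tangency_order (\<lambda>t. E (c t)) (\<lambda>x. H (g x))"
    if c: "smooth_germ c" "c 0 = 0" and \<phi>: "smooth_germ \<phi>" "\<phi> 0 = 0" and cN: "\<And>t. c t \<in> N9" and P: "\<And>t. Phi U m (c t) = c (\<phi> t)"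
    for c :: "real \<Rightarrow> R3" and \<phi>
  proof (subst enat_le_iff, intro allI impI)
    fix K assume K: "enat K \<le> tangency_order (\<lambda>t. E' (c t)) H"
    have "jet (\<lambda>t. H (g (E (c t))) $ i) $$ j = 0" if j: "j < K" for i j
    proof -
      have "\<forall>\<^sub>F t in nhds 0. H (g (E (c t))) $ i = H (E' (c (\<phi> t))) $ i"
        using smooth_germ_eventually[OF c eq] by eventually_elim (simp add: cN P)
      note jet_cong[OF this]
      moreover have "smooth_germ (\<lambda>t. H (E' (c t)) $ i)"
        using smooth_germ_compose[OF sH smooth_germ_compose[OF sE'(1) c]] c(2) sE'(2)
        by (intro smooth_germ_linear[OF bounded_linear_vec_nth]) simp
      moreover have "\<And>j. j < K \<Longrightarrow> jet (\<lambda>t. H (E' (c t)) $ i) $$ j = 0" using K unfolding tangency_order_iff by blast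
      ultimately show ?thesis using jet_reparam[of "\<lambda>t. H (E' (c t)) $ i", OF _ \<phi> _ j] by simp
    qed
    then show "enat K \<le> tangency_order (\<lambda>t. E (c t)) (\<lambda>x. H (g x))" unfolding tangency_order_iff by blast
  qed
  have s1: "smooth_germ (\<lambda>t. t * U (line t) ^ 7 + t ^ 2 * m (line t))" by (intro sg smooth_on_line[OF U] smooth_on_line[OF m])
  have s2: "smooth_germ (\<lambda>t. t * U (cusp t))" by (intro sg smooth_on_cusp[OF U])
  show thesis
  proof (rule that[OF lagrangian_compose[OF H g]])
    show "tangency_order (\<lambda>t. E' (line t)) H \<le> tangency_order (\<lambda>t. E (line t)) (\<lambda>x. H (g x))"
      by (rule le[where c = line, OF _ _ s1]) (simp_all only: sg line_simps line_in_N9 Phi_line mult_zero_left power_zero_numeral add_0)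
    show "tangency_order (\<lambda>t. E' (cusp t)) H \<le> tangency_order (\<lambda>t. E (cusp t)) (\<lambda>x. H (g x))"
      by (rule le[where c = cusp, OF _ _ s2]) (simp_all only: sg cusp_simps cusp_in_N9 Phi_cusp mult_zero_left)
  qed
qed

lemma is_maximum_iff:
  "is_maximum {\<phi> H |H. P H} m \<longleftrightarrow> (\<exists>H. P H \<and> m \<le> \<phi> H) \<and> (\<forall>H. P H \<longrightarrow> \<phi> H \<le> m)"
  unfolding is_maximum_def by (auto intro: antisym)

lemma tangency_cong:
  assumes "\<forall>\<^sub>F t in nhds 0. f t = f' t" shows "tangency_order f H = tangency_order f' H"
proof (rule antisym; subst enat_le_iff; unfold tangency_order_iff)
  have "jet (\<lambda>t. H (f t) $ i) = jet (\<lambda>t. H (f' t) $ i)" for i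
    by (rule jet_cong) (use assms in \<open>eventually_elim, simp\<close>)
  then show "\<forall>K. (\<forall>i. \<forall>j<K. jet (\<lambda>t. H (f t) $ i) $$ j = 0) \<longrightarrow> (\<forall>i. \<forall>j<K. jet (\<lambda>t. H (f' t) $ i) $$ j = 0)"
    "\<forall>K. (\<forall>i. \<forall>j<K. jet (\<lambda>t. H (f' t) $ i) $$ j = 0) \<longrightarrow> (\<forall>i. \<forall>j<K. jet (\<lambda>t. H (f t) $ i) $$ j = 0)"
    by simp_all
qed

lemma orders_transfer:
  fixes e :: "nat \<Rightarrow> 'n::finite"
  assumes e: "enum e" and N: "branches e N f1 f2" and k: "k \<in> families CARD('n)" "s \<in> signs k" and eq: "symp_equiv N (curve e k s c)"
  shows "is_Lt (B1 e k s c) (B2 e k s c) m \<Longrightarrow> is_Lt f1 f2 m" "is_L2 (B2 e k s c) m' \<Longrightarrow> is_L2 f2 m'"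
proof -
  obtain E where E: "par e N E" "\<forall>\<^sub>F t in nhds 0. f1 t = E (line t)" "\<forall>\<^sub>F t in nhds 0. f2 t = E (cusp t)"
    using N unfolding branches_iff[OF e] by (elim exE conjE)
  note M = par_nfe[OF e k]
  have 1: "\<exists>H'. lagrangian_equations H' \<and> tangency_order (B1 e k s c) H \<le> tangency_order f1 H' \<and>
      tangency_order (B2 e k s c) H \<le> tangency_order f2 H'" if H: "lagrangian_equations H" for H
    unfolding tangency_cong[OF E(2)] tangency_cong[OF E(3)]
    by (rule tangency_transfer[OF e E(1) M eq H], unfold nfe_line nfe_cusp) (intro exI conjI)
  have 2: "\<exists>H'. lagrangian_equations H' \<and> tangency_order f1 H \<le> tangency_order (B1 e k s c) H' \<and>
      tangency_order f2 H \<le> tangency_order (B2 e k s c) H'" if H: "lagrangian_equations H" for H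
    unfolding tangency_cong[OF E(2)] tangency_cong[OF E(3)]
    by (rule tangency_transfer[OF e M E(1) symp_equiv_sym[OF eq] H], unfold nfe_line nfe_cusp) (intro exI conjI)
  show "is_Lt (B1 e k s c) (B2 e k s c) m \<Longrightarrow> is_Lt f1 f2 m"
    unfolding is_Lt_def is_maximum_iff using 1 2 by (meson min.mono order_trans)
  show "is_L2 (B2 e k s c) m' \<Longrightarrow> is_L2 f2 m'"
    unfolding is_L2_def is_maximum_iff using 1 2 by (meson order_trans)
qed

text \<open>Each threshold is one more than the largest index used on the cusp by the functional in
  question. If the line is tangent too, \<open>jets_on_N9\<close> trades t^7 on the cusp for t on
  the line, which lowers the thresholds in weights 10 and 12 from 8 to 4 and 6.\<close>

lemma lead_tangency:
  fixes e :: "nat \<Rightarrow> 'n::finite"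
  assumes e: "enum e" and k: "k \<in> families CARD('n)" "s \<in> signs k" and H: "lagrangian_equations H" and K: "enat K \<le> tangency_order (B2 e k s c) H"
  shows "K \<ge> 6 \<Longrightarrow> vec k s c 8 = 0" "K \<ge> 8 \<Longrightarrow> vec k s c 10 = 0" "K \<ge> 8 \<Longrightarrow> vec k s c 12 = 0"
    "K \<ge> 9 \<Longrightarrow> vec k s c 11 = 0" "K \<ge> 11 \<Longrightarrow> vec k s c 13 = 0" "K \<ge> 12 \<Longrightarrow> vec k s c 14 = 0" "K \<ge> 14 \<Longrightarrow> vec k s c 16 = 0"
    "K \<ge> 4 \<Longrightarrow> enat K \<le> tangency_order (B1 e k s c) H \<Longrightarrow> vec k s c 10 = 0"
    "K \<ge> 6 \<Longrightarrow> enat K \<le> tangency_order (B1 e k s c) H \<Longrightarrow> vec k s c 12 = 0"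
    "K \<ge> 15 \<Longrightarrow> enat K \<le> tangency_order (B1 e k s c) H \<Longrightarrow> vec k s c 17 = 0"
    "K \<ge> 17 \<Longrightarrow> enat K \<le> tangency_order (B1 e k s c) H \<Longrightarrow> vec k s c 19 = 0"
proof -
  obtain \<alpha> where a: "\<And>v. smooth_germ (\<lambda>p. \<alpha> p v)" "\<And>w. ell \<alpha> w = ell (pull (nfe e k s c) lam) w"
    and z: "\<And>f K j v. smooth_germ f \<Longrightarrow> f 0 = 0 \<Longrightarrow> enat K \<le> tangency_order (\<lambda>t. nfe e k s c (f t)) H \<Longrightarrow> j < K \<Longrightarrow> jet (\<lambda>t. \<alpha> (f t) v) $$ j = 0"
    by (rule tangency_bound[OF H smooth_nfe[OF e] nfe_0[OF e]]) (rule that)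
  have v: "vec k s c w = ell \<alpha> w" for w by (simp only: a ell_nfe[OF e k])
  have c0: "jc (\<lambda>p. \<alpha> p v) $$ j = 0" if "j < K" for j v
    by (rule z[OF smooth_cusp _ _ that]) (simp_all add: nfe_cusp K)
  have l0: "jl (\<lambda>p. \<alpha> p v) $$ j = 0" if "j < K" "enat K \<le> tangency_order (B1 e k s c) H" for j v
    by (rule z[OF smooth_line _ _ that(1)]) (simp_all add: nfe_line that)
  have c7: "jc (\<lambda>p. \<alpha> p v) $$ 7 = 0" if "K \<ge> 4" "enat K \<le> tangency_order (B1 e k s c) H" for v
    using jets_on_N9(8)[OF a(1), of v] l0[of 1 v] that by simp
  show "K \<ge> 6 \<Longrightarrow> vec k s c 8 = 0" "K \<ge> 8 \<Longrightarrow> vec k s c 10 = 0" "K \<ge> 8 \<Longrightarrow> vec k s c 12 = 0"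
    "K \<ge> 9 \<Longrightarrow> vec k s c 11 = 0" "K \<ge> 11 \<Longrightarrow> vec k s c 13 = 0" "K \<ge> 12 \<Longrightarrow> vec k s c 14 = 0" "K \<ge> 14 \<Longrightarrow> vec k s c 16 = 0"
    unfolding v ell_def ellj_def by (simp_all add: c0)
  show "K \<ge> 4 \<Longrightarrow> enat K \<le> tangency_order (B1 e k s c) H \<Longrightarrow> vec k s c 10 = 0"
    "K \<ge> 6 \<Longrightarrow> enat K \<le> tangency_order (B1 e k s c) H \<Longrightarrow> vec k s c 12 = 0"
    "K \<ge> 15 \<Longrightarrow> enat K \<le> tangency_order (B1 e k s c) H \<Longrightarrow> vec k s c 17 = 0"
    "K \<ge> 17 \<Longrightarrow> enat K \<le> tangency_order (B1 e k s c) H \<Longrightarrow> vec k s c 19 = 0"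
    unfolding v ell_def ellj_def by (simp_all add: c0 c7 l0)
qed

lemma orders_upper:
  fixes e :: "nat \<Rightarrow> 'n::finite"
  assumes e: "enum e" and k: "k \<in> families CARD('n)" "s \<in> signs k" "c \<in> params k" and H: "lagrangian_equations H"
  shows "min (tangency_order (B1 e k s c) H) (tangency_order (B2 e k s c) H) \<le> Lt_value k c" (is "min ?x ?y \<le> _")
    and "tangency_order (B2 e k s c) H \<le> L2_value k"
proof -
  have le: "x \<le> numeral m" if "\<not> enat (Suc (numeral m)) \<le> x" for x m
    using that unfolding Suc_ile_eq not_less numeral_eq_enat .
  note L = lead_tangency[OF e k(1,2) H, of _ c]
  obtain c1 c2 c3 where c: "c = (c1, c2, c3)" by (cases c)
  show 2: "?y \<le> L2_value k"
  proof (cases k)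
    case U9_0
    show ?thesis unfolding U9_0 L2_value.simps by (rule le) (use L(1)[of 6] k in \<open>auto simp: vec_def c U9_0\<close>)
  next
    case U9_1
    show ?thesis unfolding U9_1 L2_value.simps by (rule le) (use L(2)[of 8] k in \<open>auto simp: vec_def c U9_1\<close>)
  next
    case U9_2
    show ?thesis unfolding U9_2 L2_value.simps by (rule le) (use L(3)[of 8] k in \<open>auto simp: vec_def c U9_2\<close>)
  next
    case U9_30
    show ?thesis unfolding U9_30 L2_value.simps by (rule le) (use L(3)[of 8] k in \<open>auto simp: vec_def c U9_30\<close>)
  next
    case U9_40
    show ?thesis unfolding U9_40 L2_value.simps by (rule le) (use L(3)[of 8] k in \<open>auto simp: vec_def c U9_40\<close>)
  next
    case U9_31
    show ?thesis unfolding U9_31 L2_value.simps by (rule le) (use L(4)[of 9] k in \<open>auto simp: vec_def c U9_31\<close>)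
  next
    case U9_41
    show ?thesis unfolding U9_41 L2_value.simps by (rule le) (use L(5)[of 11] k in \<open>auto simp: vec_def c U9_41\<close>)
  next
    case U9_5
    show ?thesis unfolding U9_5 L2_value.simps by (rule le) (use L(6)[of 12] k in \<open>auto simp: vec_def c U9_5\<close>)
  next
    case U9_6
    show ?thesis unfolding U9_6 L2_value.simps by (rule le) (use L(7)[of 14] k in \<open>auto simp: vec_def c U9_6\<close>)
  qed simp_all
  show "min ?x ?y \<le> Lt_value k c"
  proof (cases k)
    case U9_0
    have "min ?x ?y \<le> 3" if "c1 \<noteq> 0" by (rule le) (use L(8)[of 4] that in \<open>auto simp: vec_def c U9_0\<close>)
    then show ?thesis using 2 by (auto simp: c U9_0 min_def intro: order_trans)
  next
    case U9_1
    show ?thesis unfolding U9_1 c Lt_value.simps by (rule le) (use L(8)[of 4] k in \<open>auto simp: vec_def c U9_1\<close>)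
  next
    case U9_2
    show ?thesis unfolding U9_2 c Lt_value.simps by (rule le) (use L(9)[of 6] k in \<open>auto simp: vec_def c U9_2\<close>)
  next
    case U9_30
    show ?thesis unfolding U9_30 c Lt_value.simps by (rule le) (use L(9)[of 6] k in \<open>auto simp: vec_def c U9_30\<close>)
  next
    case U9_40
    show ?thesis unfolding U9_40 c Lt_value.simps by (rule le) (use L(9)[of 6] k in \<open>auto simp: vec_def c U9_40\<close>)
  next
    case U9_7
    show ?thesis unfolding U9_7 c Lt_value.simps by (rule le) (use L(10)[of 15] k in \<open>auto simp: vec_def c U9_7\<close>)
  next
    case U9_8
    show ?thesis unfolding U9_8 c Lt_value.simps by (rule le) (use L(11)[of 17] k in \<open>auto simp: vec_def c U9_8\<close>)
  qed (use 2 in \<open>auto simp: c min_def intro: order_trans\<close>)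
qed

text \<open>The gradient of k1 X Y + k2 X^2 Y + a (X^2 Y + 2 X Z^4 + Y^2 Z / 2) + b (X Y^2 + 2 Y Z^4
  - X^2 Z^3 / 2). At (t^5, -t^7, t^3) the parts with a and b have zero first and second components,
  and third components 17/2 t^14 and -19/2 t^16.\<close>

definition grd :: "real \<Rightarrow> real \<Rightarrow> real \<Rightarrow> real \<Rightarrow> R3 \<Rightarrow> R3" where
  "grd k1 k2 a b q =
    (k1 * Y q + 2 * k2 * (X q * Y q) + a * (2 * (X q * Y q) + 2 * Z q ^ 4) + b * (Y q ^ 2 - X q * Z q ^ 3),
     k1 * X q + k2 * X q ^ 2 + a * (X q ^ 2 + Y q * Z q) + b * (2 * (X q * Y q) + 2 * Z q ^ 4),
     a * (1 / 2 * Y q ^ 2 + 8 * (X q * Z q ^ 3)) + b * (8 * (Y q * Z q ^ 3) - 3 / 2 * (X q ^ 2 * Z q ^ 2)))"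

text \<open>\<open>grd\<close> is a gradient, so its derivative is symmetric.\<close>

lemma grd_derivative:
  "\<exists>g'. (grd k1 k2 a b has_derivative g') (at q) \<and> (\<forall>u v. g' u \<bullet> v = g' v \<bullet> u)"
proof (intro exI conjI allI)
  let ?g = "\<lambda>h. (k1 * Y h + 2 * k2 * (X h * Y q + X q * Y h) + a * (2 * (X h * Y q + X q * Y h) + 8 * Z q ^ 3 * Z h)
      + b * (2 * Y q * Y h - (X h * Z q ^ 3 + 3 * X q * Z q ^ 2 * Z h)),
    k1 * X h + 2 * k2 * X q * X h + a * (2 * X q * X h + Y h * Z q + Y q * Z h) + b * (2 * (X h * Y q + X q * Y h) + 8 * Z q ^ 3 * Z h),
    a * (Y q * Y h + 8 * (X h * Z q ^ 3 + 3 * X q * Z q ^ 2 * Z h))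
      + b * (8 * (Y h * Z q ^ 3 + 3 * Y q * Z q ^ 2 * Z h) - 3 * (X q * Z q ^ 2 * X h + X q ^ 2 * Z q * Z h)))"
  show "(grd k1 k2 a b has_derivative ?g) (at q)"
    unfolding grd_def[abs_def]
    by (intro has_derivative_Pair; (rule derivative_eq_intros refl)+; simp add: fun_eq_iff algebra_simps power2_eq_square power3_eq_cube)
  show "?g u \<bullet> v = ?g v \<bullet> u" for u v by (simp add: inner_prod_def algebra_simps)
qed

text \<open>The graphs below are graphs over the first component; exchanging (p, q) for (q, -p) in a
  pair lets a position serve as base coordinate.\<close>

definition swp :: "bool \<Rightarrow> bool \<Rightarrow> (nat \<Rightarrow> 'n::finite) \<Rightarrow> 'n symp \<Rightarrow> 'n symp" where
  "swp j1 j2 e v = (\<chi> i. if j1 \<and> i = e 1 \<or> j2 \<and> i = e 2 then snd v $ i else fst v $ i,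
    \<chi> i. if j1 \<and> i = e 1 \<or> j2 \<and> i = e 2 then - (fst v $ i) else snd v $ i)"

lemma sgerm_swp: "sgerm (swp j1 j2 e)"
proof (rule sgerm_linear)
  show "linear (swp j1 j2 e)" by (auto simp: linear_iff swp_def vec_eq_iff)
  show "omega0 (swp j1 j2 e u) (swp j1 j2 e v) = omega0 u v" for u v
    unfolding omega0_def by (rule sum.cong) (auto simp: swp_def)
qed

text \<open>The graph of the gradient of a function of three of the position coordinates. In dimension four \<open>e 3\<close> is an
  arbitrary index, and \<open>g\<close> must not involve the third variable.\<close>

definition graph :: "(R3 \<Rightarrow> R3) \<Rightarrow> (nat \<Rightarrow> 'n::finite) \<Rightarrow> 'n symp \<Rightarrow> real ^ 'n" where
  "graph g e x = (let q = g (fst x $ e 1, fst x $ e 2, fst x $ e 3) in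
     snd x - (X q *\<^sub>R axis (e 1) 1 + Y q *\<^sub>R axis (e 2) 1 + Z q *\<^sub>R axis (e 3) 1))"

lemma lagrangian_graph: "lagrangian_equations (graph (grd k1 k2 a b) (e :: nat \<Rightarrow> 'n::finite))"
proof -
  let ?H = "graph (grd k1 k2 a b) e"
  define T where "T p = (p $ e 1, p $ e 2, p $ e 3)" for p :: "real ^ 'n"
  have T: "bounded_linear (\<lambda>x :: 'n symp. T (fst x))" unfolding T_def
    by (intro bounded_linear_Pair bounded_linear_compose[OF bounded_linear_vec_nth bounded_linear_fst])
  have c: "smooth_germ (\<lambda>x :: 'n symp. fst x $ i)" for i
    by (rule smooth_germ_linear[OF bounded_linear_compose[OF bounded_linear_vec_nth bounded_linear_fst] smooth_germ_id])
  have s: "smooth_germ ?H" unfolding graph_def[abs_def] grd_def Let_def fst_conv snd_conv by (intro sg c)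
  have "surj (D ?H x) \<and> (\<forall>u v. D ?H x u = 0 \<longrightarrow> D ?H x v = 0 \<longrightarrow> omega0 u v = 0)" for x
  proof -
    obtain g' where g': "(grd k1 k2 a b has_derivative g') (at (T (fst x)))" "\<And>u v. g' u \<bullet> v = g' v \<bullet> u"
      using grd_derivative by blast
    have "((\<lambda>x. grd k1 k2 a b (T (fst x))) has_derivative (\<lambda>u. g' (T (fst u)))) (at x)"
      by (rule has_derivative_compose[OF bounded_linear_imp_has_derivative[OF T] g'(1)])
    then have "(?H has_derivative (\<lambda>u. snd u - (X (g' (T (fst u))) *\<^sub>R axis (e 1) 1 + Y (g' (T (fst u))) *\<^sub>R axis (e 2) 1 + Z (g' (T (fst u))) *\<^sub>R axis (e 3) 1))) (at x)"
      unfolding graph_def[abs_def] Let_def T_def[symmetric]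
      by (intro has_derivative_diff has_derivative_add has_derivative_scaleR_left has_derivative_fst has_derivative_snd has_derivative_ident)
    note DH = D_eq[OF this]
    have i: "(X q *\<^sub>R axis (e 1) 1 + Y q *\<^sub>R axis (e 2) 1 + Z q *\<^sub>R axis (e 3) 1) \<bullet> w = q \<bullet> T w" for q :: R3 and w :: "real ^ 'n"
      by (simp add: inner_add_left inner_axis' inner_prod_def T_def)
    have "linear g'" by (rule has_derivative_linear[OF g'(1)])
    then have "g' (T 0) = 0" by (simp add: T_def linear_0 flip: zero_prod_def)
    then have "D ?H x (0, w) = w" for w unfolding DH by simp
    then have "surj (D ?H x)" by (metis surjI)
    moreover have "omega0 u v = 0" if "D ?H x u = 0" "D ?H x v = 0" for u v
    proof -
      have "snd u \<bullet> fst v = g' (T (fst u)) \<bullet> T (fst v)" "snd v \<bullet> fst u = g' (T (fst v)) \<bullet> T (fst u)"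
        using that unfolding DH by (simp_all add: i flip: i)
      then show ?thesis using g'(2) by (simp add: omega0_eq inner_commute)
    qed
    ultimately show ?thesis by blast
  qed
  moreover have "?H 0 = 0" by (simp add: graph_def grd_def)
  ultimately show ?thesis unfolding lagrangian_iff using s by simp
qed

text \<open>The equations of the swapped graph evaluated at a point of \<open>emb6\<close>, with the
  base coordinates and the remaining ones selected by \<open>j1\<close> and
  \<open>j2\<close>.\<close>

definition hcomp :: "bool \<Rightarrow> bool \<Rightarrow> real \<Rightarrow> real \<Rightarrow> real \<Rightarrow> real \<Rightarrow> R3 \<times> R3 \<Rightarrow> R3" where
  "hcomp j1 j2 k1 k2 a b f = (if j1 then - X (fst f) else Y (fst f), if j2 then - Z (fst f) else X (snd f), Z (snd f))
    - grd k1 k2 a b (if j1 then Y (fst f) else X (fst f), if j2 then X (snd f) else Z (fst f), Y (snd f))"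

lemma attained:
  fixes e :: "nat \<Rightarrow> 'n::finite"
  assumes e: "enum e" and n: "2 * CARD('n) \<ge> 6 \<or> a = 0 \<and> b = 0"
    and z: "\<And>j. enat j < m \<Longrightarrow> jet (\<lambda>t. X (hcomp j1 j2 k1 k2 a b (F t))) $$ j = 0 \<and>
      jet (\<lambda>t. Y (hcomp j1 j2 k1 k2 a b (F t))) $$ j = 0 \<and> jet (\<lambda>t. Z (hcomp j1 j2 k1 k2 a b (F t))) $$ j = 0"
  shows "m \<le> tangency_order (\<lambda>t. emb6 e (F t)) (\<lambda>x. graph (grd k1 k2 a b) e (swp j1 j2 e x))"
proof (subst enat_le_iff, unfold tangency_order_iff, intro allI impI)
  fix K i j assume K: "enat K \<le> m" "j < K"
  note z = z[OF less_le_trans[OF _ K(1), of "enat j"]]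
  obtain l where l: "l \<in> {1..CARD('n)}" "i = e l" using e by (metis UNIV_I bij_betw_imp_surj_on imageE)
  have inj: "e p = e q \<longleftrightarrow> p = q" if "p \<in> {1..CARD('n)}" "q \<in> {1..CARD('n)}" for p q
    using e that by (auto simp: bij_betw_def inj_on_eq_iff)
  have co: "fst (emb6 e f) $ e p = coord e (2 * p - 1) (emb6 e f)" "snd (emb6 e f) $ e p = coord e (2 * p) (emb6 e f)" if "p \<ge> 1" for p f
    using that by (auto simp: coord_def)
  have fc: "fst (emb6 e f) $ e p = (if p = 1 then X (fst f) else if p = 2 then Z (fst f) else if p = 3 then Y (snd f) else 0)"
    "snd (emb6 e f) $ e p = (if p = 1 then Y (fst f) else if p = 2 then X (snd f) else if p = 3 then Z (snd f) else 0)"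
    if "p \<in> {1..CARD('n)}" for p f
    using that by (auto simp: co emb6_coord[OF e])
  have "graph (grd k1 k2 a b) e (swp j1 j2 e (emb6 e f)) $ e l
    = (let h = hcomp j1 j2 k1 k2 a b f in if l = 1 then X h else if l = 2 then Y h else if l = 3 then Z h else 0)" for f
  proof -
    have 12: "1 \<in> {1..CARD('n)}" "2 \<in> {1..CARD('n)}" using e by auto
    show ?thesis
    proof (cases "3 \<in> {1..CARD('n)}")
      case True
      then show ?thesis using l(1) 12
        by (simp add: graph_def hcomp_def swp_def fc inj axis_def Let_def del: One_nat_def atLeastAtMost_iff)
    next
      case False
      then have "a = 0" "b = 0" "l = 1 \<or> l = 2" using n l(1) by auto
      then show ?thesis using l(1) 12
        by (auto simp: graph_def hcomp_def swp_def fc inj axis_def Let_def grd_def simp del: One_nat_def atLeastAtMost_iff)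
    qed
  qed
  then show "jet (\<lambda>t. graph (grd k1 k2 a b) e (swp j1 j2 e (emb6 e (F t))) $ i) $$ j = 0"
    using z K(2) by (cases "l = 1"; cases "l = 2"; cases "l = 3") (simp_all add: l(2) Let_def)
qed

lemma orders_attained:
  fixes e :: "nat \<Rightarrow> 'n::finite"
  assumes e: "enum e" and k: "k \<in> families CARD('n)" "s \<in> signs k" "c \<in> params k"
  shows "\<exists>H. lagrangian_equations H \<and> Lt_value k c \<le> min (tangency_order (B1 e k s c) H) (tangency_order (B2 e k s c) H)"
    "\<exists>H. lagrangian_equations H \<and> L2_value k \<le> tangency_order (B2 e k s c) H"
proof -
  define ok where "ok j1 j2 k1 k2 a b m F \<longleftrightarrow> (\<forall>j. enat j < m \<longrightarrow> jet (\<lambda>t. X (hcomp j1 j2 k1 k2 a b (nf k s c (F t)))) $$ j = 0 \<and>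
      jet (\<lambda>t. Y (hcomp j1 j2 k1 k2 a b (nf k s c (F t)))) $$ j = 0 \<and> jet (\<lambda>t. Z (hcomp j1 j2 k1 k2 a b (nf k s c (F t)))) $$ j = 0)"
    for j1 j2 k1 k2 a b m and F :: "real \<Rightarrow> R3"
  have at: "m \<le> tangency_order (\<lambda>t. nfe e k s c (F t)) (\<lambda>x. graph (grd k1 k2 a b) e (swp j1 j2 e x))"
    if "ok j1 j2 k1 k2 a b m F" "2 * CARD('n) \<ge> 6 \<or> a = 0 \<and> b = 0" for j1 j2 k1 k2 a b m F
    unfolding nfe_def by (rule attained[OF e that(2)]) (use that(1) in \<open>simp add: ok_def\<close>)
  have 1: "\<exists>H. lagrangian_equations H \<and> Lt_value k c \<le> min (tangency_order (B1 e k s c) H) (tangency_order (B2 e k s c) H)"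
    if "ok j1 j2 k1 k2 0 0 (Lt_value k c) line" "ok j1 j2 k1 k2 0 0 (Lt_value k c) cusp" for j1 j2 k1 k2
    using at[OF that(1)] at[OF that(2)] lagrangian_compose[OF lagrangian_graph sgerm_swp, of k1 k2 0 0 e j1 j2 e]
    by (intro exI[where x = "\<lambda>x. graph (grd k1 k2 0 0) e (swp j1 j2 e x)"]) (simp add: nfe_line nfe_cusp)
  have 2: "\<exists>H. lagrangian_equations H \<and> L2_value k \<le> tangency_order (B2 e k s c) H"
    if "ok j1 j2 k1 k2 a b (L2_value k) cusp" "2 * CARD('n) \<ge> 6 \<or> a = 0 \<and> b = 0" for j1 j2 k1 k2 a b
    using at[OF that] lagrangian_compose[OF lagrangian_graph sgerm_swp, of k1 k2 a b e j1 j2 e]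
    by (intro exI[where x = "\<lambda>x. graph (grd k1 k2 a b) e (swp j1 j2 e x)"]) (simp add: nfe_cusp)
  obtain c1 c2 c3 where c: "c = (c1, c2, c3)" by (cases c)
  have less: "enat j < numeral m \<longleftrightarrow> j < numeral m" for j m by (simp add: numeral_eq_enat)
  note simps = ok_def hcomp_def grd_def families_def c sg fps_X_power_nth less power2_eq_square mult_ac
  show "\<exists>H. lagrangian_equations H \<and> Lt_value k c \<le> min (tangency_order (B1 e k s c) H) (tangency_order (B2 e k s c) H)"
  proof (cases k)
    case U9_0 show ?thesis by (rule 1[of True False 0 0]) (use k in \<open>auto simp: simps U9_0\<close>)
  next
    \<comment> \<open>With \<open>k1 = c1\<close> the graph contains the line, on which p1 = t and
      q2 = c1 t.\<close>
    case U9_1 show ?thesis by (rule 1[of False False c1 0]) (use k in \<open>auto simp: simps U9_1\<close>)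
  next
    case U9_2 show ?thesis by (rule 1[of True True 0 0]) (use k in \<open>auto simp: simps U9_2\<close>)
  next
    case U9_30 show ?thesis by (rule 1[of True True 0 0]) (use k in \<open>auto simp: simps U9_30\<close>)
  next
    case U9_40 show ?thesis by (rule 1[of True True 0 0]) (use k in \<open>auto simp: simps U9_40\<close>)
  qed (rule 1[of False False 0 0]; use k in \<open>auto simp: simps\<close>)+
  show "\<exists>H. lagrangian_equations H \<and> L2_value k \<le> tangency_order (B2 e k s c) H"
  proof (cases k)
    \<comment> \<open>After the exchange in the first pair q1 is a base coordinate, equal to t^3, so
      \<open>k1 = c1\<close> removes c1 t^3 from q2; in the next case \<open>k2 = c2 / 2\<close>
      removes c2/2 t^6, the square of q1 being t^6.\<close>
    case U9_0 show ?thesis by (rule 2[of True False c1 0 0 0]) (use k in \<open>auto simp: simps U9_0 split: if_splits\<close>)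
  next
    case U9_1 show ?thesis by (rule 2[of True False 0 "c2 / 2" 0 0]) (use k in \<open>auto simp: simps U9_1 split: if_splits\<close>)
  next
    case U9_2 show ?thesis by (rule 2[of False True 0 0 0 0]) (use k in \<open>auto simp: simps U9_2 split: if_splits\<close>)
  next
    case U9_30 show ?thesis by (rule 2[of False True 0 0 0 0]) (use k in \<open>auto simp: simps U9_30 split: if_splits\<close>)
  next
    case U9_40 show ?thesis by (rule 2[of False True 0 0 0 0]) (use k in \<open>auto simp: simps U9_40 split: if_splits\<close>)
  next
    \<comment> \<open>The factors -2/17 and c1/19 turn the third gradient component into -t^14 -
      c1/2 t^16, so the graph contains the whole branch; likewise 1/19 for the next family.\<close>
    case U9_7 show ?thesis by (rule 2[of False False 0 0 "-2 / 17" "c1 / 19"]) (use k in \<open>auto simp: simps U9_7 split: if_splits\<close>)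
  next
    case U9_8 show ?thesis by (rule 2[of False False 0 0 0 "1 / 19"]) (use k in \<open>auto simp: simps U9_8 split: if_splits\<close>)
  qed (rule 2[of False False 0 0 0 0]; use k in \<open>auto simp: simps\<close>)+
qed

theorem theorem5p2:
  fixes e :: "nat \<Rightarrow> 'n::finite"
  assumes "2 * CARD('n) \<ge> 4"
    and "bij_betw e {1..CARD('n)} UNIV"
  shows "(\<forall>N. in_U9_class e N \<longrightarrow>
            (\<exists>!k. k \<in> families CARD('n) \<and>
                  (\<exists>s\<in>signs k. \<exists>c\<in>params k. symp_equiv N (curve e k s c)))) \<and>
         (\<forall>k\<in>families CARD('n). \<forall>s\<in>signs k. params_are_moduli e k s) \<and>
         (\<forall>k\<in>families CARD('n). \<forall>s\<in>signs k. \<forall>c\<in>params k.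
            branches e (curve e k s c) (B1 e k s c) (B2 e k s c) \<and>
            (\<forall>N f1 f2. branches e N f1 f2 \<and> symp_equiv N (curve e k s c) \<longrightarrow>
               is_Lt f1 f2 (Lt_value k c) \<and> is_L2 f2 (L2_value k)))"
proof (intro conjI allI impI ballI)
  have e: "enum e" using assms by blast
  fix N assume "in_U9_class e N"
  then obtain E where E: "par e N E" unfolding in_U9_class_par by (rule exE)
  let ?k = "cls (ell (pull E lam))"
  show "\<exists>!k. k \<in> families CARD('n) \<and> (\<exists>s\<in>signs k. \<exists>c\<in>params k. symp_equiv N (curve e k s c))"
    using cls_families[OF e E] existence[OF e E] uniqueness[OF e E] by (intro ex1I[of _ ?k]) blast+
next
  have e: "enum e" using assms by blast
  fix k s assume k: "k \<in> families CARD('n)" "s \<in> signs k"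
  show "params_are_moduli e k s" by (rule moduli[OF e k])
  fix c assume c: "c \<in> params k"
  show "branches e (curve e k s c) (B1 e k s c) (B2 e k s c)"
    unfolding branches_iff[OF e] 
    by (intro exI[where x = "nfe e k s c"] conjI par_nfe[OF e k] always_eventually allI nfe_line[symmetric] nfe_cusp[symmetric])
  fix N f1 f2 assume N: "branches e N f1 f2 \<and> symp_equiv N (curve e k s c)"
  have "is_Lt (B1 e k s c) (B2 e k s c) (Lt_value k c)" "is_L2 (B2 e k s c) (L2_value k)"
    unfolding is_Lt_def is_L2_def is_maximum_iff using orders_attained[OF e k c] orders_upper[OF e k c] by blast+
  then show "is_Lt f1 f2 (Lt_value k c)" "is_L2 f2 (L2_value k)"
    using orders_transfer[OF e _ k] N by blast+
qed

end
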